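(* Let $(Q(\mathbb{G}),W(\mathbb{G}))$ be the quiver with potential associated to a plabic fence $\mathbb{G}$. Then $|\mathrm{Dil}[Q(\mathbb{G}),W(\mathbb{G})]|=1$, i.e. there exists a unique dilation class for $(Q(\mathbb{G}),W(\mathbb{G}))$.
   Context: Quivers with potential (QPs). Work over $\Bbbk=\mathbb{C}$; quivers are finite without loops; paths compose right-to-left. For a quiver $Q$ with vertex set $Q_0$, arrow set $Q_1$, source and target maps $s,t$, let $R_Q=\bigoplus_{i}\Bbbk e_i$, $A_Q=\bigoplus_{a\in Q_1}\Bbbk a$, let $\widehat{\Bbbk Q}=\prod_{n\ge0}A_Q^{\otimes_{R_Q} n}$ be the completed path algebra, $\mathfrak{m}_Q=\prod_{n\ge1}A_Q^{\otimes n}$, and $\widehat{\Bbbk Q}_{\mathrm{cyc}}=\widehat{\Bbbk Q}/\overline{[\widehat{\Bbbk Q},\widehat{\Bbbk Q}]}$. A potential $W$ is an element of the image of $\mathfrak{m}_Q^2$ in $\widehat{\Bbbk Q}_{\mathrm{cyc}}$. A right-equivalence $(Q,W)\to(Q',W')$ (same vertex set) is an algebra isomorphism $\varphi:\widehat{\Bbbk Q}\to\widehat{\Bbbk Q'}$ fixing the $e_i$ with $\varphi(W)=W'$ in the cyclic quotient. $(Q,W)$ is trivial if $W$ is purely quadratic and its Jacobian algebra is $R_Q$. The stable right-equivalence class $[Q,W]$ consists of the QPs obtained from $(Q,W)$ by right-equivalences and adjoining or deleting trivial direct summands (on the same vertex set). Graded QPs and dilations. A graded QP $(Q,W,d)$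 is a QP with a function $d:Q_1\to\mathbb{Z}$ (extended additively to paths) for which $W$ is homogeneous of degree one. Vertex gauge by $h:Q_0\to\mathbb{Z}$ replaces $d$ by $d^h(a)=d(a)+h(t(a))-h(s(a))$. A graded right-equivalence is a right-equivalence which is an isomorphism of graded algebras. A trivial graded QP is a graded QP whose underlying QP is trivial. The set of dilations $\mathrm{Dil}[Q,W]$ is the set of graded QPs $(Q',W',d')$ with $[Q',W']=[Q,W]$, modulo the equivalence relation generated by vertex gauge, graded right-equivalence, and adjoining or deleting trivial graded QP summands. Plabic fences. A plabic fence $\mathbb{G}$ consists of $n$ horizontal segments (lines numbered $1,\dots,n$ from bottom to top, with common left and right $x$-coordinates) and finitely many vertical edges at distinct $x$-coordinates, each joining, for some $k$ (its level), line $k$ (black trivalent vertex) to line $k+1$ (white trivalent vertex). Faces are the bounded faces, i.e. rectangles between two consecutive vertical edges of the same level. For a vertical edge $e$, $F_e$ denotes the face with right edge $e$ (if it exists). The quiver $Q(\mathbb{G})$ has the faces as vertices, and the following arrows, for each $e$ of level $k$ such that $F_e$ exists, with left edge $d$: (a) an arrow $F_d\to F_e$ if $F_d$ exists; (b) if $d^\uparrow$ is the first edge of level $k+1$ to the right of $d$, it lies to the left of $e$, and $F_{d^\uparrow}$ exists, an arrow $F_e\to F_{d^\uparrow}$; (c) likewise with level $k-1$: an arrow $F_e\to F_{d^\downarrow}$. A black (resp. white) pente-row is given by two consecutive edges $d_1<d_2$ (ordered left to right) of a level $q$ and all the edges $e_1<\dots<e_m$, $m\ge1$, of level $p=q+1$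 (resp. $p=q-1$) lying between them, provided $F_{e_1}$ exists and there is a next edge $e_{m+1}$ of level $p$ after $e_m$; on the horizontal line between the two levels one sees $m$ consecutive black (resp. white) vertices bounded by white (resp. black) ones. Its cycle is $F_{e_1}\to F_{e_2}\to\dots\to F_{e_{m+1}}\to F_{d_2}\to F_{e_1}$, with monomial $p_\rho$. The potential is $W(\mathbb{G})=\sum_{\rho\text{ black}}p_\rho-\sum_{\rho\text{ white}}p_\rho$. *)

theory Defs
  imports Complex_Main "HOL-Algebra.QuotRing" "HOL-Algebra.Generated_Groups" "Graph_Theory.Digraph"
begin

section \<open>Quivers and completed path algebras\<close>

text \<open>
  A quiver is a finite directed multigraph without loops; an arrow goes from its
  \<open>tail\<close> (source) to its \<open>head\<close> (target).
\<close>

type_synonym ('v, 'a) quiver = "('v, 'a) pre_digraph"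

definition is_quiver :: "('v, 'a) quiver \<Rightarrow> bool" where
  "is_quiver Q \<longleftrightarrow> fin_digraph Q \<and> loopfree_digraph Q"

text \<open>
  Paths compose right-to-left. The path \<open>a\<^sub>m \<dots> a\<^sub>1\<close> is the pair \<open>(i, [a\<^sub>m, \<dots>, a\<^sub>1])\<close>, where
  \<open>i\<close> is its target, i.e. the head of \<open>a\<^sub>m\<close>; the trivial path \<open>e\<^sub>i\<close> is \<open>(i, [])\<close>.
\<close>

type_synonym ('v, 'a) qpath = "'v \<times> 'a list"

fun is_qpath :: "('v, 'a) quiver \<Rightarrow> 'v \<Rightarrow> 'a list \<Rightarrow> bool" where
  "is_qpath Q i [] \<longleftrightarrow> i \<in> verts Q"
| "is_qpath Q i (a # w) \<longleftrightarrow> a \<in> arcs Q \<and> head Q a = i \<and> is_qpath Q (tail Q a) w"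

fun path_source :: "('v, 'a) quiver \<Rightarrow> 'v \<Rightarrow> 'a list \<Rightarrow> 'v" where
  "path_source Q i [] = i"
| "path_source Q i (a # w) = path_source Q (tail Q a) w"

text \<open>
  An element of the completed path algebra is a formal, possibly infinite, complex linear
  combination of paths, given by its coefficient function, which vanishes off the paths of the
  quiver. A quiver has finitely many paths of each length \<open>n\<close>, and these form a basis of the
  \<open>n\<close>-th tensor power of the arrow bimodule, so this is the product of all tensor powers.
\<close>

type_synonym ('v, 'a) series = "('v, 'a) qpath \<Rightarrow> complex"

definition conv :: "('v, 'a) quiver \<Rightarrow> ('v, 'a) series \<Rightarrow> ('v, 'a) series \<Rightarrow> ('v, 'a) series" where
  "conv Q x y = (\<lambda>(i, w). \<Sum>k\<le>length w.
     x (i, take k w) * y (path_source Q i (take k w), drop k w))"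

definition path_algebra :: "('v, 'a) quiver \<Rightarrow> ('v, 'a) series ring" where
  "path_algebra Q =
     \<lparr>carrier = {x. \<forall>i w. x (i, w) \<noteq> 0 \<longrightarrow> is_qpath Q i w},
      monoid.mult = conv Q,
      one = (\<lambda>(i, w). if i \<in> verts Q \<and> w = [] then 1 else 0),
      ring.zero = (\<lambda>p. 0),
      add = (\<lambda>x y p. x p + y p)\<rparr>"

definition path_elem :: "('v, 'a) qpath \<Rightarrow> ('v, 'a) series" where
  "path_elem p = (\<lambda>q. if q = p then 1 else 0)"

definition vertex_subalgebra :: "('v, 'a) quiver \<Rightarrow> ('v, 'a) series set" where
  "vertex_subalgebra Q = {x \<in> carrier (path_algebra Q). \<forall>i w. x (i, w) \<noteq> 0 \<longrightarrow> length w = 0}"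

text \<open>The \<open>n\<close>-th power of the arrow ideal: the series in paths of length at least \<open>n\<close>.\<close>

definition arrow_ideal_pow :: "('v, 'a) quiver \<Rightarrow> nat \<Rightarrow> ('v, 'a) series set" where
  "arrow_ideal_pow Q n = {x \<in> carrier (path_algebra Q). \<forall>i w. x (i, w) \<noteq> 0 \<longrightarrow> n \<le> length w}"

text \<open>Closure for the topology whose neighbourhoods of zero are the powers of the arrow ideal.\<close>

definition adic_closure :: "('v, 'a) quiver \<Rightarrow> ('v, 'a) series set \<Rightarrow> ('v, 'a) series set" where
  "adic_closure Q S = {x \<in> carrier (path_algebra Q).
     \<forall>n. \<exists>y\<in>S. (\<lambda>p. x p - y p) \<in> arrow_ideal_pow Q n}"

text \<open>
  The additive subgroup generated by the commutators is a complex subspace, because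
  \<open>c [x, y] = [c x, y]\<close>.
\<close>

definition commutator_space :: "('v, 'a) quiver \<Rightarrow> ('v, 'a) series set" where
  "commutator_space Q = generate (add_monoid (path_algebra Q))
     {x \<otimes>\<^bsub>path_algebra Q\<^esub> y \<ominus>\<^bsub>path_algebra Q\<^esub> y \<otimes>\<^bsub>path_algebra Q\<^esub> x | x y.
        x \<in> carrier (path_algebra Q) \<and> y \<in> carrier (path_algebra Q)}"

definition cyc_class :: "('v, 'a) quiver \<Rightarrow> ('v, 'a) series \<Rightarrow> ('v, 'a) series set" where
  "cyc_class Q x = adic_closure Q (commutator_space Q) +>\<^bsub>path_algebra Q\<^esub> x"


section \<open>Quivers with potential\<close>

text \<open>A potential is an element of the cyclic quotient, hence a coset of series.\<close>

type_synonym ('v, 'a) potential = "('v, 'a) series set"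

type_synonym ('v, 'a) qp = "('v, 'a) quiver \<times> ('v, 'a) potential"

definition is_qp :: "('v, 'a) qp \<Rightarrow> bool" where
  "is_qp = (\<lambda>(Q, W). is_quiver Q \<and> W \<in> cyc_class Q ` arrow_ideal_pow Q 2)"

definition right_equivalence ::
    "(('v, 'a) series \<Rightarrow> ('v, 'a) series) \<Rightarrow> ('v, 'a) qp \<Rightarrow> ('v, 'a) qp \<Rightarrow> bool" where
  "right_equivalence \<phi> = (\<lambda>(Q, W) (Q', W').
     verts Q' = verts Q \<and>
     \<phi> \<in> ring_iso (path_algebra Q) (path_algebra Q') \<and>
     (\<forall>c. \<forall>x\<in>carrier (path_algebra Q). \<phi> (\<lambda>p. c * x p) = (\<lambda>p. c * \<phi> x p)) \<and>
     (\<forall>i\<in>verts Q. \<phi> (path_elem (i, [])) = path_elem (i, [])) \<and>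
     \<phi> ` W = W')"

text \<open>
  The cyclic derivative sends a cycle \<open>c\<^sub>1 \<dots> c\<^sub>n\<close> to the sum, over all \<open>k\<close> with \<open>c\<^sub>k = a\<close>, of
  \<open>c\<^sub>k\<^sub>+\<^sub>1 \<dots> c\<^sub>n c\<^sub>1 \<dots> c\<^sub>k\<^sub>-\<^sub>1\<close>. Hence the coefficient of a path \<open>u\<close> in the derivative of a series
  is the sum of the coefficients of all rotations of the cycle \<open>a u\<close>.
\<close>

definition cyc_deriv :: "('v, 'a) quiver \<Rightarrow> 'a \<Rightarrow> ('v, 'a) series \<Rightarrow> ('v, 'a) series" where
  "cyc_deriv Q a x = (\<lambda>(i, u).
     if i = tail Q a \<and> is_qpath Q i u \<and> path_source Q i u = head Q a
     then \<Sum>k\<le>length u. (let c = rotate k (a # u) in x (head Q (hd c), c))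
     else 0)"

text \<open>
  All representatives \<open>x\<close> of \<open>W\<close> have the same cyclic derivatives.
\<close>

definition jacobian_ideal :: "('v, 'a) qp \<Rightarrow> ('v, 'a) series set" where
  "jacobian_ideal = (\<lambda>(Q, W).
     adic_closure Q (Idl\<^bsub>path_algebra Q\<^esub> {cyc_deriv Q a x | a x. a \<in> arcs Q \<and> x \<in> W}))"

definition jacobian_algebra :: "('v, 'a) qp \<Rightarrow> ('v, 'a) series set ring" where
  "jacobian_algebra X = path_algebra (fst X) Quot jacobian_ideal X"

text \<open>
  The last conjunct says that the natural map from the vertex subalgebra to the Jacobian algebra
  is bijective.
\<close>

definition is_trivial_qp :: "('v, 'a) qp \<Rightarrow> bool" where
  "is_trivial_qp = (\<lambda>(Q, W). is_qp (Q, W) \<and>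
     W \<in> cyc_class Q ` {x \<in> carrier (path_algebra Q). \<forall>i w. x (i, w) \<noteq> 0 \<longrightarrow> length w = 2} \<and>
     bij_betw (\<lambda>r. jacobian_ideal (Q, W) +>\<^bsub>path_algebra Q\<^esub> r)
       (vertex_subalgebra Q) (carrier (jacobian_algebra (Q, W))))"

text \<open>
  Direct sum of two QPs with the same vertices and disjoint arrow sets. Series of a summand are
  series of the sum, as coefficient functions are extended by zero.
\<close>

definition summable_qp :: "('v, 'a) qp \<Rightarrow> ('v, 'a) qp \<Rightarrow> bool" where
  "summable_qp = (\<lambda>(Q, W) (C, T). verts C = verts Q \<and> arcs Q \<inter> arcs C = {})"

definition quiver_sum :: "('v, 'a) quiver \<Rightarrow> ('v, 'a) quiver \<Rightarrow> ('v, 'a) quiver" where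
  "quiver_sum Q C =
     \<lparr>verts = verts Q,
      arcs = arcs Q \<union> arcs C,
      tail = (\<lambda>a. if a \<in> arcs Q then tail Q a else tail C a),
      head = (\<lambda>a. if a \<in> arcs Q then head Q a else head C a)\<rparr>"

definition qp_sum :: "('v, 'a) qp \<Rightarrow> ('v, 'a) qp \<Rightarrow> ('v, 'a) qp" where
  "qp_sum = (\<lambda>(Q, W) (C, T). (quiver_sum Q C,
     \<Union>x\<in>W. \<Union>y\<in>T. cyc_class (quiver_sum Q C) (\<lambda>p. x p + y p)))"

text \<open>
  The arrows of all QPs are drawn from one type \<open>'a\<close>. When \<open>'a\<close> is infinite this loses nothing:
  relabelling arrows is a right-equivalence, so every QP on the given vertices is represented,
  and trivial summands with fresh arrows can always be adjoined.
\<close>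

inductive stable_step :: "('v, 'a) qp \<Rightarrow> ('v, 'a) qp \<Rightarrow> bool" where
  right_equiv: "is_qp X \<Longrightarrow> is_qp Y \<Longrightarrow> right_equivalence \<phi> X Y \<Longrightarrow> stable_step X Y"
| adjoin_trivial: "is_qp X \<Longrightarrow> is_trivial_qp Z \<Longrightarrow> summable_qp X Z \<Longrightarrow> stable_step X (qp_sum X Z)"

definition stable_class :: "('v, 'a) qp \<Rightarrow> ('v, 'a) qp set" where
  "stable_class X = {Y. is_qp Y \<and> equivclp stable_step X Y}"


section \<open>Graded quivers with potential and dilations\<close>

type_synonym ('v, 'a) graded_qp = "('v, 'a) qp \<times> ('a \<Rightarrow> int)"

definition homogeneous :: "('v, 'a) quiver \<Rightarrow> ('a \<Rightarrow> int) \<Rightarrow> int \<Rightarrow> ('v, 'a) series set" where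
  "homogeneous Q d n = {x \<in> carrier (path_algebra Q).
     \<forall>i w. x (i, w) \<noteq> 0 \<longrightarrow> sum_list (map d w) = n}"

definition is_graded_qp :: "('v, 'a) graded_qp \<Rightarrow> bool" where
  "is_graded_qp = (\<lambda>((Q, W), d). is_qp (Q, W) \<and> W \<in> cyc_class Q ` homogeneous Q d 1)"

definition gauge :: "('v \<Rightarrow> int) \<Rightarrow> ('v, 'a) graded_qp \<Rightarrow> ('v, 'a) graded_qp" where
  "gauge h = (\<lambda>((Q, W), d). ((Q, W), \<lambda>a. d a + h (head Q a) - h (tail Q a)))"

definition graded_right_equivalence ::
    "(('v, 'a) series \<Rightarrow> ('v, 'a) series) \<Rightarrow> ('v, 'a) graded_qp \<Rightarrow> ('v, 'a) graded_qp \<Rightarrow> bool" where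
  "graded_right_equivalence \<phi> = (\<lambda>(X, d) (X', d'). right_equivalence \<phi> X X' \<and>
     (\<forall>n. \<phi> ` homogeneous (fst X) d n = homogeneous (fst X') d' n))"

definition graded_qp_sum :: "('v, 'a) graded_qp \<Rightarrow> ('v, 'a) graded_qp \<Rightarrow> ('v, 'a) graded_qp" where
  "graded_qp_sum = (\<lambda>(X, d) (Z, c).
     (qp_sum X Z, \<lambda>a. if a \<in> arcs (fst X) then d a else c a))"

inductive dilation_step :: "('v, 'a) graded_qp \<Rightarrow> ('v, 'a) graded_qp \<Rightarrow> bool" where
  vertex_gauge: "is_graded_qp X \<Longrightarrow> dilation_step X (gauge h X)"
| graded_right_equiv: "is_graded_qp X \<Longrightarrow> is_graded_qp Y \<Longrightarrow>
    graded_right_equivalence \<phi> X Y \<Longrightarrow> dilation_step X Y"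
| adjoin_graded_trivial: "is_graded_qp X \<Longrightarrow> is_graded_qp Z \<Longrightarrow> is_trivial_qp (fst Z) \<Longrightarrow>
    summable_qp (fst X) (fst Z) \<Longrightarrow> dilation_step X (graded_qp_sum X Z)"

definition Dil :: "('v, 'a) qp \<Rightarrow> ('v, 'a) graded_qp set set" where
  "Dil X = {Y. is_graded_qp Y \<and> stable_class (fst Y) = stable_class X}
     // {(Y, Z). equivclp dilation_step Y Z}"


section \<open>Plabic fences\<close>

text \<open>
  A vertical edge is identified with its \<open>x\<close>-coordinate; an edge of level \<open>k\<close> joins the horizontal
  lines \<open>k\<close> and \<open>k + 1\<close>.
\<close>

record plabic_fence =
  lines :: nat
  edges :: "real set"
  level :: "real \<Rightarrow> nat"

definition is_plabic_fence :: "plabic_fence \<Rightarrow> bool" where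
  "is_plabic_fence G \<longleftrightarrow> finite (edges G) \<and>
     (\<forall>e\<in>edges G. 1 \<le> level G e \<and> level G e + 1 \<le> lines G)"

text \<open>\<open>next_edge G k d e\<close>: \<open>e\<close> is the first edge of level \<open>k\<close> to the right of \<open>d\<close>.\<close>

definition next_edge :: "plabic_fence \<Rightarrow> nat \<Rightarrow> real \<Rightarrow> real \<Rightarrow> bool" where
  "next_edge G k d e \<longleftrightarrow> e \<in> edges G \<and> level G e = k \<and> d < e \<and>
     (\<forall>x\<in>edges G. level G x = k \<longrightarrow> \<not> (d < x \<and> x < e))"

text \<open>\<open>consecutive G d e\<close>: there is a face with left edge \<open>d\<close> and right edge \<open>e\<close>.\<close>

definition consecutive :: "plabic_fence \<Rightarrow> real \<Rightarrow> real \<Rightarrow> bool" where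
  "consecutive G d e \<longleftrightarrow> d \<in> edges G \<and> next_edge G (level G d) d e"

text \<open>The face \<open>F\<^sub>e\<close> is identified with its right edge \<open>e\<close>.\<close>

definition faces :: "plabic_fence \<Rightarrow> real set" where
  "faces G = {e. \<exists>d. consecutive G d e}"

text \<open>
  The arrow \<open>F\<^sub>x \<rightarrow> F\<^sub>y\<close> is the pair \<open>(x, y)\<close>. There are no parallel arrows: each face is the source
  of at most one arrow of each of the types (b), (c) and the source of at most one of type (a),
  and the three types change the level by \<open>1\<close>, \<open>-1\<close> and \<open>0\<close>.
\<close>

definition fence_quiver :: "plabic_fence \<Rightarrow> (real, real \<times> real) quiver" where
  "fence_quiver G =
     \<lparr>verts = faces G,
      arcs = {(d, e). consecutive G d e \<and> d \<in> faces G}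
        \<union> {(e, f). f \<in> faces G \<and> f < e \<and>
             (\<exists>d. consecutive G d e \<and> next_edge G (level G e + 1) d f)}
        \<union> {(e, f). f \<in> faces G \<and> f < e \<and>
             (\<exists>d. consecutive G d e \<and> next_edge G (level G e - 1) d f)},
      tail = fst,
      head = snd\<rparr>"

text \<open>
  A pente-row \<open>(d\<^sub>1, d\<^sub>2, [e\<^sub>1, \<dots>, e\<^sub>m], e\<^sub>m\<^sub>+\<^sub>1)\<close> with inner edges of level \<open>p\<close>.
\<close>

type_synonym pente_row = "real \<times> real \<times> real list \<times> real"

definition is_pente_row :: "plabic_fence \<Rightarrow> nat \<Rightarrow> pente_row \<Rightarrow> bool" where
  "is_pente_row G p = (\<lambda>(d1, d2, es, f). consecutive G d1 d2 \<and>
     es = sorted_list_of_set {e \<in> edges G. level G e = p \<and> d1 < e \<and> e < d2} \<and>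
     es \<noteq> [] \<and> hd es \<in> faces G \<and> next_edge G p (last es) f)"

definition black_rows :: "plabic_fence \<Rightarrow> pente_row set" where
  "black_rows G = {\<rho>. is_pente_row G (level G (fst \<rho>) + 1) \<rho>}"

text \<open>Levels start at \<open>1\<close>, so there is no white row with \<open>d\<^sub>1\<close> of level \<open>1\<close>.\<close>

definition white_rows :: "plabic_fence \<Rightarrow> pente_row set" where
  "white_rows G = {\<rho>. is_pente_row G (level G (fst \<rho>) - 1) \<rho>}"

text \<open>
  With \<open>vs = [e\<^sub>1, \<dots>, e\<^sub>m\<^sub>+\<^sub>1, d\<^sub>2]\<close>, the list \<open>zip vs (rotate1 vs)\<close> is the sequence of arrows of the
  cycle in the order in which they are traversed; right-to-left composition reverses it.
\<close>

definition row_monomial :: "pente_row \<Rightarrow> (real, real \<times> real) series" where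
  "row_monomial = (\<lambda>(d1, d2, es, f).
     let vs = es @ [f, d2] in path_elem (hd vs, rev (zip vs (rotate1 vs))))"

definition fence_potential :: "plabic_fence \<Rightarrow> (real, real \<times> real) potential" where
  "fence_potential G = cyc_class (fence_quiver G)
     (\<lambda>p. (\<Sum>\<rho>\<in>black_rows G. row_monomial \<rho> p) - (\<Sum>\<rho>\<in>white_rows G. row_monomial \<rho> p))"

end

theory Submission
  imports Defs "HOL-Library.Function_Algebras"
begin

text \<open>
  Call an arrow of the fence quiver \<open>Q\<close> an up arrow if it raises the level; every pente-row
  contains exactly one, so giving up arrows degree one and all others degree zero is a dilation.
  For uniqueness, a graded potential is first reduced, by splitting off graded trivial pairs of
  arrows, to one without quadratic part. By invariance under stable equivalence it then retracts
  onto the fence potential after adjoining a trivial summand, and the first-order data of this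
  retraction match its arrows bijectively with those of \<open>Q\<close>. Since a path parallel to an
  arrow \<open>a\<close> has at least as many up arrows as \<open>a\<close>, with equality only for \<open>a\<close> itself, everything of
  higher order is invisible in the part of degree one, which contains the whole fence potential.
  Transporting Euler derivations along the retraction shows that the given degrees sum to one on
  every pente-row; two such gradings differ by a coboundary, i.e. by a vertex gauge. After gauging,
  rescaling the arrows by the linear part of the retraction is a graded right-equivalence.
\<close>

text \<open>Stable equivalence is a zigzag in which trivial summands come and go, and cancelling one
  is the delicate move. Rather than uniqueness of reduced parts up to right-equivalence, the weaker
  data \<open>retract\<close> is carried along the zigzag, starting from the identity of
  \<open>(Q, w)\<close>. A summand to be deleted is renamed and kept among the auxiliary arrows, so
  deletion is no harder than adjunction. The identity \<open>p (E x) = p (E (s w))\<close> for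
  derivations \<open>E\<close>, up to cyclic equivalence, survives these moves and stands in for
  control of \<open>x - s w\<close>: the Euler derivation of weight 1/2 on auxiliary arrows and
  \<open>d\<close> on the others fixes the potential, and with 0 in place of \<open>d\<close> it
  isolates the trivial summand. The radical of the quadratic part is remembered because it is the
  column space of the linear part of \<open>p\<close>, which pairs the arrows. The terms of least
  \<open>up\<close>-degree in the image of a path are determined by linear parts, so the final
  isomorphism is a mere rescaling. Successive corrections are confined to the graded splitting of
  2-cycles, where the square is completed length by length.\<close>

abbreviation car :: "('v, 'a) quiver \<Rightarrow> ('v, 'a) series set" where
  "car Q \<equiv> carrier (path_algebra Q)"

definition scl :: "complex \<Rightarrow> ('p \<Rightarrow> complex) \<Rightarrow> 'p \<Rightarrow> complex" where
  "scl c x = (\<lambda>p. c * x p)"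

lemma scl_apply [simp]: "scl c x p = c * x p"
  by (simp add: scl_def)

definition fsum :: "('i \<Rightarrow> 'p \<Rightarrow> complex) \<Rightarrow> 'i set \<Rightarrow> 'p \<Rightarrow> complex" where
  "fsum f A = (\<lambda>p. \<Sum>a\<in>A. f a p)"

lemma fsum_apply: "fsum f A p = (\<Sum>a\<in>A. f a p)"
  by (simp add: fsum_def)

lemma fsum_empty [simp]: "fsum f {} = 0"
  and fsum_infinite [simp]: "infinite A \<Longrightarrow> fsum f A = 0"
  and fsum_insert [simp]: "finite A \<Longrightarrow> a \<notin> A \<Longrightarrow> fsum f (insert a A) = f a + fsum f A"
  by (simp_all add: fsum_def fun_eq_iff)

lemma scl_add: "scl c (x + y) = scl c x + scl c y"
  and scl_diff: "scl c (x - y) = scl c x - scl c y"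
  and scl_scl: "scl c (scl d x) = scl (c * d) x"
  and scl_one [simp]: "scl 1 x = x"
  and scl_zero [simp]: "scl 0 x = 0"
  and scl_zero_right [simp]: "scl c 0 = 0"
  and scl_minus_one: "scl (-1) x = - x"
  by (auto simp: fun_eq_iff algebra_simps)

subsection \<open>Paths\<close>

lemma quiver_tail: "is_quiver Q \<Longrightarrow> a \<in> arcs Q \<Longrightarrow> tail Q a \<in> verts Q"
  and quiver_head: "is_quiver Q \<Longrightarrow> a \<in> arcs Q \<Longrightarrow> head Q a \<in> verts Q"
  and quiver_loopfree: "is_quiver Q \<Longrightarrow> a \<in> arcs Q \<Longrightarrow> tail Q a \<noteq> head Q a"
  and quiver_finite_arcs: "is_quiver Q \<Longrightarrow> finite (arcs Q)"
  and quiver_finite_verts: "is_quiver Q \<Longrightarrow> finite (verts Q)"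
  unfolding is_quiver_def
  by (auto simp: fin_digraph_def wf_digraph_def fin_digraph_axioms_def loopfree_digraph_def
      loopfree_digraph_axioms_def)

lemma is_quiverI:
  assumes "finite (verts Q)" "finite (arcs Q)"
    "\<And>a. a \<in> arcs Q \<Longrightarrow> tail Q a \<in> verts Q \<and> head Q a \<in> verts Q \<and> tail Q a \<noteq> head Q a"
  shows "is_quiver Q"
  unfolding is_quiver_def using assms
  by (auto simp: fin_digraph_def wf_digraph_def fin_digraph_axioms_def loopfree_digraph_def
      loopfree_digraph_axioms_def)

lemma is_qpath_verts: "is_quiver Q \<Longrightarrow> is_qpath Q i w \<Longrightarrow> i \<in> verts Q"
  by (cases w) (auto dest: quiver_head)

lemma path_source_verts: "is_qpath Q i w \<Longrightarrow> path_source Q i w \<in> verts Q"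
  by (induction w arbitrary: i) auto

lemma path_source_append: "path_source Q i (u @ v) = path_source Q (path_source Q i u) v"
  by (induction u arbitrary: i) auto

lemma is_qpath_append:
  "is_quiver Q \<Longrightarrow> is_qpath Q i (u @ v) \<longleftrightarrow> is_qpath Q i u \<and> is_qpath Q (path_source Q i u) v"
  by (induction u arbitrary: i) (auto dest: is_qpath_verts)

lemma is_qpath_arcs: "is_qpath Q i w \<Longrightarrow> set w \<subseteq> arcs Q"
  by (induction w arbitrary: i) auto

lemma is_qpath_take_drop:
  assumes "is_quiver Q"
  shows "is_qpath Q i w \<longleftrightarrow> is_qpath Q i (take k w) \<and> is_qpath Q (path_source Q i (take k w)) (drop k w)"
  by (metis assms append_take_drop_id is_qpath_append)

text \<open>Finite index sets: a coefficient at a word of length \<open>n\<close> of a filtered map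
  is a sum over \<open>paths V n\<close>.\<close>

definition paths :: "('v, 'a) quiver \<Rightarrow> nat \<Rightarrow> ('v, 'a) qpath set" where
  "paths Q n = {(i, w). is_qpath Q i w \<and> length w \<le> n}"

lemma finite_paths: assumes "is_quiver Q" shows "finite (paths Q n)"
proof (rule finite_subset)
  show "paths Q n \<subseteq> verts Q \<times> {w. set w \<subseteq> arcs Q \<and> length w \<le> n}"
    by (auto simp: paths_def dest: is_qpath_verts[OF assms] is_qpath_arcs)
  show "finite (verts Q \<times> {w. set w \<subseteq> arcs Q \<and> length w \<le> n})"
    using assms by (auto intro!: finite_lists_length_le simp: quiver_finite_arcs quiver_finite_verts)
qed

subsection \<open>The path algebra\<close>

lemma car_iff: "x \<in> car Q \<longleftrightarrow> (\<forall>i w. x (i, w) \<noteq> 0 \<longrightarrow> is_qpath Q i w)"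
  by (simp add: path_algebra_def)

lemma pow_iff: "x \<in> arrow_ideal_pow Q n \<longleftrightarrow> x \<in> car Q \<and> (\<forall>i w. x (i, w) \<noteq> 0 \<longrightarrow> n \<le> length w)"
  by (simp add: arrow_ideal_pow_def)

lemma path_algebra_simps [simp]:
  "mult (path_algebra Q) = conv Q" "add (path_algebra Q) = (+)" "zero (path_algebra Q) = 0"
  "one (path_algebra Q) = (\<lambda>(i,w). if i \<in> verts Q \<and> w = [] then 1 else 0)"
  by (auto simp: path_algebra_def fun_eq_iff)

lemma pow_car: "x \<in> arrow_ideal_pow Q n \<Longrightarrow> x \<in> car Q"
  by (simp add: pow_iff)

lemma pow_0 [simp]: "arrow_ideal_pow Q 0 = car Q"
  by (auto simp: pow_iff)

lemma pow_mono: "x \<in> arrow_ideal_pow Q n \<Longrightarrow> m \<le> n \<Longrightarrow> x \<in> arrow_ideal_pow Q m"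
  by (fastforce simp: pow_iff)

lemma car_zero [simp, intro]: "0 \<in> car Q"
  and car_add [intro]: "x \<in> car Q \<Longrightarrow> y \<in> car Q \<Longrightarrow> x + y \<in> car Q"
  and car_diff [intro]: "x \<in> car Q \<Longrightarrow> y \<in> car Q \<Longrightarrow> x - y \<in> car Q"
  and car_uminus [intro]: "x \<in> car Q \<Longrightarrow> - x \<in> car Q"
  and car_scl [intro]: "x \<in> car Q \<Longrightarrow> scl c x \<in> car Q"
  unfolding car_iff by (auto, metis add.left_neutral, metis diff_zero)

lemma pow_zero [simp, intro]: "0 \<in> arrow_ideal_pow Q n"
  and pow_add [intro]: "x \<in> arrow_ideal_pow Q n \<Longrightarrow> y \<in> arrow_ideal_pow Q n \<Longrightarrow> x + y \<in> arrow_ideal_pow Q n"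
  and pow_diff [intro]: "x \<in> arrow_ideal_pow Q n \<Longrightarrow> y \<in> arrow_ideal_pow Q n \<Longrightarrow> x - y \<in> arrow_ideal_pow Q n"
  and pow_uminus [intro]: "x \<in> arrow_ideal_pow Q n \<Longrightarrow> - x \<in> arrow_ideal_pow Q n"
  and pow_scl [intro]: "x \<in> arrow_ideal_pow Q n \<Longrightarrow> scl c x \<in> arrow_ideal_pow Q n"
  unfolding pow_iff by (auto, metis add.left_neutral, metis diff_zero)

lemma car_fsum: "(\<And>a. a \<in> A \<Longrightarrow> f a \<in> car Q) \<Longrightarrow> fsum f A \<in> car Q"
  by (induction A rule: infinite_finite_induct) auto

lemma pow_fsum: "(\<And>a. a \<in> A \<Longrightarrow> f a \<in> arrow_ideal_pow Q n) \<Longrightarrow> fsum f A \<in> arrow_ideal_pow Q n"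
  by (induction A rule: infinite_finite_induct) auto

lemma path_elem_apply: "path_elem p q = (if q = p then 1 else 0)"
  by (simp add: path_elem_def)

lemma path_elem_car [intro]: "is_qpath Q i w \<Longrightarrow> path_elem (i, w) \<in> car Q"
  by (auto simp: car_iff path_elem_def)

lemma path_elem_pow [intro]: "is_qpath Q i w \<Longrightarrow> n \<le> length w \<Longrightarrow> path_elem (i, w) \<in> arrow_ideal_pow Q n"
  by (auto simp: pow_iff car_iff path_elem_def)

lemma conv_apply: "conv Q x y (i, w) = (\<Sum>k\<le>length w. x (i, take k w) * y (path_source Q i (take k w), drop k w))"
  by (simp add: conv_def)

lemma conv_add_left: "conv Q (x + y) z = conv Q x z + conv Q y z"
  and conv_add_right: "conv Q x (y + z) = conv Q x y + conv Q x z"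
  and conv_diff_left: "conv Q (x - y) z = conv Q x z - conv Q y z"
  and conv_diff_right: "conv Q x (y - z) = conv Q x y - conv Q x z"
  and conv_scl_left: "conv Q (scl c x) z = scl c (conv Q x z)"
  and conv_scl_right: "conv Q x (scl c z) = scl c (conv Q x z)"
  and conv_zero_left [simp]: "conv Q 0 z = 0"
  and conv_zero_right [simp]: "conv Q x 0 = 0"
  and conv_uminus_left: "conv Q (- x) z = - conv Q x z"
  and conv_uminus_right: "conv Q x (- z) = - conv Q x z"
  by (auto simp: fun_eq_iff conv_def algebra_simps sum.distrib sum_subtractf sum_distrib_left sum_negf)

lemma conv_nonzero:
  assumes "conv Q x y (i, w) \<noteq> 0"
  obtains u v where "w = u @ v" "x (i, u) \<noteq> 0" "y (path_source Q i u, v) \<noteq> 0"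
proof -
  from assms obtain k where "x (i, take k w) * y (path_source Q i (take k w), drop k w) \<noteq> 0"
    unfolding conv_apply by (meson sum.not_neutral_contains_not_neutral)
  then show thesis using that[of "take k w" "drop k w"] by simp
qed

lemma conv_car [intro]:
  assumes "is_quiver Q" "x \<in> car Q" "y \<in> car Q" shows "conv Q x y \<in> car Q"
  unfolding car_iff
proof (intro allI impI)
  fix i w assume "conv Q x y (i, w) \<noteq> 0"
  then show "is_qpath Q i w"
    by (rule conv_nonzero) (use assms in \<open>auto simp: is_qpath_append car_iff\<close>)
qed

lemma conv_pow:
  assumes "is_quiver Q" "x \<in> arrow_ideal_pow Q m" "y \<in> arrow_ideal_pow Q n" "k \<le> m + n"
  shows "conv Q x y \<in> arrow_ideal_pow Q k"
  unfolding pow_iff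
proof (intro conjI allI impI)
  show "conv Q x y \<in> car Q" using assms by (auto dest: pow_car)
  fix i w assume "conv Q x y (i, w) \<noteq> 0"
  then show "k \<le> length w"
  proof (rule conv_nonzero)
    fix u v assume "w = u @ v" "x (i, u) \<noteq> 0" "y (path_source Q i u, v) \<noteq> 0"
    with assms have "m \<le> length u" "n \<le> length v" by (auto simp: pow_iff)
    then show ?thesis using \<open>w = u @ v\<close> assms(4) by simp
  qed
qed

lemma conv_assoc: "conv Q (conv Q x y) z = conv Q x (conv Q y z)"
proof (rule ext, clarify)
  fix i w
  let ?s = "\<lambda>k. path_source Q i (take k w)"
  let ?n = "length w"
  have "conv Q (conv Q x y) z (i, w) = (\<Sum>k\<le>?n. \<Sum>j\<le>k. x (i, take j w) * y (?s j, drop j (take k w)) * z (?s k, drop k w))"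
    unfolding conv_apply sum_distrib_right
    by (intro sum.cong refl) (auto simp: min_def take_take)
  also have "\<dots> = (\<Sum>(k,j)\<in>(SIGMA k:{..?n}. {..k}). x (i, take j w) * y (?s j, drop j (take k w)) * z (?s k, drop k w))"
    by (simp add: sum.Sigma)
  \<comment> \<open>Two cuts at \<open>j\<close> and \<open>k\<close> are re-encoded by the first
    cut and the length \<open>l = k - j\<close> of the middle factor.\<close>
  also have "\<dots> = (\<Sum>(j,l)\<in>(SIGMA j:{..?n}. {..?n-j}). x (i, take j w) * (y (?s j, take l (drop j w)) * z (?s (j+l), drop (j+l) w)))"
    by (rule sum.reindex_bij_witness[of _ "\<lambda>(j,l). (j+l, j)" "\<lambda>(k,j). (j,k-j)"])
       (auto simp: drop_take)
  also have "\<dots> = (\<Sum>j\<le>?n. \<Sum>l\<le>?n-j. x (i, take j w) * (y (?s j, take l (drop j w)) * z (?s (j+l), drop (j+l) w)))"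
    by (simp add: sum.Sigma)
  also have "\<dots> = conv Q x (conv Q y z) (i, w)"
    unfolding conv_apply sum_distrib_left
    by (intro sum.cong refl) (auto simp: path_source_append take_add add.commute)
  finally show "conv Q (conv Q x y) z (i, w) = conv Q x (conv Q y z) (i, w)" .
qed

lemma conv_one_left: assumes "is_quiver Q" "x \<in> car Q"
  shows "conv Q (\<one>\<^bsub>path_algebra Q\<^esub>) x = x"
proof (rule ext, clarify)
  fix i w
  have "conv Q (\<one>\<^bsub>path_algebra Q\<^esub>) x (i, w) = (\<Sum>k\<in>{0}. \<one>\<^bsub>path_algebra Q\<^esub> (i, take k w) * x (path_source Q i (take k w), drop k w))"
    unfolding conv_apply by (rule sum.mono_neutral_right) auto
  also have "\<dots> = x (i, w)"
    using assms is_qpath_verts[OF assms(1)] by (auto simp: car_iff)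
  finally show "conv Q (\<one>\<^bsub>path_algebra Q\<^esub>) x (i, w) = x (i, w)" .
qed

lemma conv_one_right: assumes "is_quiver Q" "x \<in> car Q"
  shows "conv Q x (\<one>\<^bsub>path_algebra Q\<^esub>) = x"
proof (rule ext, clarify)
  fix i w
  have "conv Q x (\<one>\<^bsub>path_algebra Q\<^esub>) (i, w) = (\<Sum>k\<in>{length w}. x (i, take k w) * \<one>\<^bsub>path_algebra Q\<^esub> (path_source Q i (take k w), drop k w))"
    unfolding conv_apply by (rule sum.mono_neutral_right) auto
  also have "\<dots> = x (i, w)"
    using assms path_source_verts[of Q i w] by (auto simp: car_iff)
  finally show "conv Q x (\<one>\<^bsub>path_algebra Q\<^esub>) (i, w) = x (i, w)" .
qed

lemma one_car: "\<one>\<^bsub>path_algebra Q\<^esub> \<in> car Q"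
  by (auto simp: car_iff)

lemma ring_path_algebra: assumes "is_quiver Q" shows "ring (path_algebra Q)"
proof (rule ringI)
  show "abelian_group (path_algebra Q)"
    by (rule abelian_groupI) (auto simp: algebra_simps intro: exI[of _ "- _"] bexI[of _ "- _"])
  show "Group.monoid (path_algebra Q)"
    using assms by unfold_locales
      (auto simp del: path_algebra_simps(4) simp: conv_assoc conv_one_left conv_one_right one_car)
qed (auto simp: conv_add_left conv_add_right)

lemma a_inv_path_algebra:
  assumes "is_quiver Q" "x \<in> car Q" shows "\<ominus>\<^bsub>path_algebra Q\<^esub> x = - x"
proof -
  interpret ring "path_algebra Q" by (rule ring_path_algebra[OF assms(1)])
  show ?thesis by (rule minus_equality) (use assms in auto)
qed

lemma a_minus_path_algebra:
  assumes "is_quiver Q" "y \<in> car Q" shows "x \<ominus>\<^bsub>path_algebra Q\<^esub> y = x - y"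
  unfolding a_minus_def by (simp add: a_inv_path_algebra assms)

lemma conv_path_elem_left:
  "conv Q (path_elem (i, u)) y (j, w) =
    (if j = i \<and> take (length u) w = u then y (path_source Q i u, drop (length u) w) else 0)"
proof -
  have "conv Q (path_elem (i, u)) y (j, w) =
    (\<Sum>k\<le>length w. if k = length u then (if j = i \<and> take (length u) w = u then y (path_source Q i u, drop (length u) w) else 0) else 0)"
    unfolding conv_apply by (intro sum.cong refl) (auto simp: path_elem_apply)
  also have "\<dots> = (if j = i \<and> take (length u) w = u then y (path_source Q i u, drop (length u) w) else 0)"
    by (auto simp: sum.delta)
  finally show ?thesis .
qed

lemma conv_path_elem:
  "conv Q (path_elem (i, u)) (path_elem (j, v)) =
    (if path_source Q i u = j then path_elem (i, u @ v) else 0)"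
  by (rule ext, clarify)
     (auto simp: conv_path_elem_left path_elem_apply, (metis append_take_drop_id)+)

subsection \<open>Continuous linear maps\<close>

text \<open>Continuity is imposed in the strong form that every power of the arrow ideal is
  respected, so that coefficients in length \<open>n\<close> depend only on the input up to length
  \<open>n\<close>.\<close>

definition clin :: "('v, 'a) quiver \<Rightarrow> ('v, 'b) quiver \<Rightarrow> (('v, 'a) series \<Rightarrow> ('v, 'b) series) \<Rightarrow> bool" where
  "clin V V' T \<longleftrightarrow> (\<forall>x\<in>car V. \<forall>y\<in>car V. T (x + y) = T x + T y) \<and>
     (\<forall>c. \<forall>x\<in>car V. T (scl c x) = scl c (T x)) \<and>
     (\<forall>n. \<forall>x\<in>arrow_ideal_pow V n. T x \<in> arrow_ideal_pow V' n)"

lemma clin_add: "clin V V' T \<Longrightarrow> x \<in> car V \<Longrightarrow> y \<in> car V \<Longrightarrow> T (x + y) = T x + T y"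
  and clin_scl: "clin V V' T \<Longrightarrow> x \<in> car V \<Longrightarrow> T (scl c x) = scl c (T x)"
  and clin_pow: "clin V V' T \<Longrightarrow> x \<in> arrow_ideal_pow V n \<Longrightarrow> T x \<in> arrow_ideal_pow V' n"
  by (auto simp: clin_def)

lemma clin_car: "clin V V' T \<Longrightarrow> x \<in> car V \<Longrightarrow> T x \<in> car V'"
  using clin_pow[of V V' T x 0] by simp

lemma clin_zero: assumes "clin V V' T" shows "T 0 = 0"
  using clin_scl[OF assms, of 0 0] by simp

lemma clin_uminus: assumes "clin V V' T" "x \<in> car V" shows "T (- x) = - T x"
  using clin_scl[OF assms, of "-1"] by (simp add: scl_minus_one)

lemma clin_diff: assumes "clin V V' T" "x \<in> car V" "y \<in> car V" shows "T (x - y) = T x - T y"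
  using clin_add[OF assms(1,2), of "- y"] clin_uminus[OF assms(1,3)] assms(3) by auto

lemma clin_fsum: assumes "clin V V' T" "\<And>a. a \<in> A \<Longrightarrow> f a \<in> car V"
  shows "T (fsum f A) = fsum (\<lambda>a. T (f a)) A"
  using assms(2)
  by (induction A rule: infinite_finite_induct) (auto simp: clin_zero[OF assms(1)] clin_add[OF assms(1)] car_fsum)

lemma clin_comp: "clin V V' T \<Longrightarrow> clin V' V'' S \<Longrightarrow> clin V V'' (\<lambda>x. S (T x))"
  unfolding clin_def by (auto simp flip: pow_0)

definition trunc :: "nat \<Rightarrow> ('v, 'a) series \<Rightarrow> ('v, 'a) series" where
  "trunc n x = (\<lambda>(i, w). if length w \<le> n then x (i, w) else 0)"

lemma trunc_apply [simp]: "trunc n x (i, w) = (if length w \<le> n then x (i, w) else 0)"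
  by (simp add: trunc_def)

lemma trunc_car: "x \<in> car V \<Longrightarrow> trunc n x \<in> car V"
  by (auto simp: car_iff split: if_splits)

lemma trunc_rest: "x \<in> car V \<Longrightarrow> x - trunc n x \<in> arrow_ideal_pow V (Suc n)"
  by (auto simp: pow_iff car_iff split: if_splits)

lemma trunc_sum: assumes "is_quiver V" "x \<in> car V"
  shows "trunc n x = fsum (\<lambda>p. scl (x p) (path_elem p)) (paths V n)"
proof (rule ext, clarify)
  fix i w
  have "fsum (\<lambda>p. scl (x p) (path_elem p)) (paths V n) (i, w) = (\<Sum>p\<in>paths V n. if p = (i, w) then x p else 0)"
    unfolding fsum_apply by (intro sum.cong refl) (auto simp: path_elem_apply)
  also have "\<dots> = trunc n x (i, w)"
    using assms finite_paths[OF assms(1), of n] by (auto simp: sum.delta paths_def car_iff)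
  finally show "trunc n x (i, w) = fsum (\<lambda>p. scl (x p) (path_elem p)) (paths V n) (i, w)" by simp
qed

lemma clin_trunc:
  assumes "clin V V' T" "x \<in> car V" "length w \<le> n" shows "T x (i, w) = T (trunc n x) (i, w)"
proof -
  have "T (x - trunc n x) \<in> arrow_ideal_pow V' (Suc n)"
    by (rule clin_pow[OF assms(1) trunc_rest[OF assms(2)]])
  then have "T (x - trunc n x) (i, w) = 0"
    using assms(3) by (force simp: pow_iff)
  then show ?thesis
    using clin_diff[OF assms(1,2) trunc_car[OF assms(2)]] by simp
qed

text \<open>Paths longer than the word contribute nothing, since their images start beyond it. This
  turns infinite combinations into finite sums and is the device by which identities are checked on
  paths only.\<close>

lemma clin_expand:
  assumes "is_quiver V" "clin V V' T" "x \<in> car V" "length w \<le> n"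
  shows "T x (i, w) = (\<Sum>p\<in>paths V n. x p * T (path_elem p) (i, w))"
proof -
  have "path_elem p \<in> car V" if "p \<in> paths V n" for p
    using that by (auto simp: paths_def)
  then show ?thesis
    unfolding clin_trunc[OF assms(2-4)] trunc_sum[OF assms(1,3)]
    by (subst clin_fsum[OF assms(2)]) (auto simp: clin_scl[OF assms(2)] fsum_apply intro!: sum.cong)
qed

lemma clin_eqI:
  assumes "is_quiver V" "clin V V' T" "clin V V' S" "x \<in> car V"
    and "\<And>i w. is_qpath V i w \<Longrightarrow> T (path_elem (i, w)) = S (path_elem (i, w))"
  shows "T x = S x"
proof (rule ext, clarify)
  fix i w
  show "T x (i, w) = S x (i, w)"
    unfolding clin_expand[OF assms(1,2,4) order_refl] clin_expand[OF assms(1,3,4) order_refl]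
    by (intro sum.cong refl) (auto simp: paths_def assms(5))
qed

lemma clin_id: "clin V V (\<lambda>x. x)"
  by (auto simp: clin_def)

lemma clin_conv_left: "is_quiver V \<Longrightarrow> x \<in> car V \<Longrightarrow> clin V V (conv V x)"
  unfolding clin_def using conv_pow[of V x 0] by (auto simp: conv_add_right conv_scl_right)

lemma clin_conv_right: "is_quiver V \<Longrightarrow> y \<in> car V \<Longrightarrow> clin V V (\<lambda>x. conv V x y)"
  unfolding clin_def using conv_pow[of V _ _ y 0] by (auto simp: conv_add_left conv_scl_left)

lemma clin_add_fun: "clin V V' S \<Longrightarrow> clin V V' T \<Longrightarrow> clin V V' (\<lambda>x. S x + T x)"
  unfolding clin_def by (auto simp: scl_add)

lemma clin_diff_fun: "clin V V' S \<Longrightarrow> clin V V' T \<Longrightarrow> clin V V' (\<lambda>x. S x - T x)"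
  unfolding clin_def by (auto simp: scl_diff)

text \<open>Cutting the sum at \<open>length w\<close> is harmless when \<open>g p\<close> contains
  no path shorter than \<open>p\<close>, the hypothesis under which it is used; the sum is then the
  full linear extension.\<close>

definition lin_ext :: "('v, 'a) quiver \<Rightarrow> (('v, 'a) qpath \<Rightarrow> ('v, 'b) series) \<Rightarrow> ('v, 'a) series \<Rightarrow> ('v, 'b) series" where
  "lin_ext V g x = (\<lambda>(i, w). \<Sum>p\<in>paths V (length w). x p * g p (i, w))"

lemma lin_ext_path_elem:
  assumes "is_quiver V" "is_qpath V j u" "g (j, u) \<in> arrow_ideal_pow V' (length u)"
  shows "lin_ext V g (path_elem (j, u)) = g (j, u)"
proof (rule ext, clarify)
  fix i w
  have "lin_ext V g (path_elem (j, u)) (i, w) = (\<Sum>p\<in>paths V (length w). if p = (j, u) then g p (i, w) else 0)"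
    unfolding lin_ext_def by (auto intro!: sum.cong simp: path_elem_apply)
  also have "\<dots> = (if (j, u) \<in> paths V (length w) then g (j, u) (i, w) else 0)"
    by (simp add: finite_paths[OF assms(1)])
  also have "\<dots> = g (j, u) (i, w)"
    using assms(2,3) by (auto simp: paths_def pow_iff)
  finally show "lin_ext V g (path_elem (j, u)) (i, w) = g (j, u) (i, w)" .
qed

lemma clin_lin_ext:
  assumes "is_quiver V" "\<And>j u. is_qpath V j u \<Longrightarrow> g (j, u) \<in> arrow_ideal_pow V' (length u)"
  shows "clin V V' (lin_ext V g)"
  unfolding clin_def
proof (intro conjI ballI allI)
  show "lin_ext V g (x + y) = lin_ext V g x + lin_ext V g y" for x y
    by (auto simp: lin_ext_def fun_eq_iff algebra_simps sum.distrib)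
  show "lin_ext V g (scl c x) = scl c (lin_ext V g x)" for c x
    by (auto simp: lin_ext_def fun_eq_iff algebra_simps sum_distrib_left)
  fix n x assume x: "x \<in> arrow_ideal_pow V n"
  {
    fix i w assume "lin_ext V g x (i, w) \<noteq> 0"
    then obtain j u where p: "(j, u) \<in> paths V (length w)" "x (j, u) \<noteq> 0" "g (j, u) (i, w) \<noteq> 0"
      unfolding lin_ext_def by (auto elim!: sum.not_neutral_contains_not_neutral)
    from p(1) have "is_qpath V j u" "length u \<le> length w" by (auto simp: paths_def)
    with assms(2) p have "is_qpath V' i w" by (force simp: pow_iff car_iff)
    moreover have "n \<le> length w" using x p(2) \<open>length u \<le> length w\<close> by (force simp: pow_iff)
    ultimately have "is_qpath V' i w \<and> n \<le> length w" by simp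
  }
  then show "lin_ext V g x \<in> arrow_ideal_pow V' n"
    by (auto simp: pow_iff car_iff)
qed

section \<open>Vertex idempotents, arrows and Peirce components\<close>

abbreviation idem :: "'v \<Rightarrow> ('v, 'a) series" where
  "idem i \<equiv> path_elem (i, [])"

abbreviation arr :: "('v, 'a) quiver \<Rightarrow> 'a \<Rightarrow> ('v, 'a) series" where
  "arr V a \<equiv> path_elem (head V a, [a])"

lemma idem_car: "i \<in> verts V \<Longrightarrow> idem i \<in> car V"
  by auto

lemma arr_path: "is_quiver V \<Longrightarrow> a \<in> arcs V \<Longrightarrow> is_qpath V (head V a) [a]"
  by (auto simp: quiver_tail)

lemma arr_pow: "is_quiver V \<Longrightarrow> a \<in> arcs V \<Longrightarrow> arr V a \<in> arrow_ideal_pow V (Suc 0)"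
  by (rule path_elem_pow[OF arr_path]) auto

lemma arr_car: "is_quiver V \<Longrightarrow> a \<in> arcs V \<Longrightarrow> arr V a \<in> car V"
  by (rule pow_car[OF arr_pow])

text \<open>The Peirce component \<open>e_i A e_j\<close> of the completed path algebra; the target
  comes first because paths compose right to left.\<close>

definition between :: "('v, 'a) quiver \<Rightarrow> 'v \<Rightarrow> 'v \<Rightarrow> ('v, 'a) series set" where
  "between V i j = {x \<in> car V. \<forall>k w. x (k, w) \<noteq> 0 \<longrightarrow> k = i \<and> path_source V k w = j}"

lemma between_car: "x \<in> between V i j \<Longrightarrow> x \<in> car V"
  by (simp add: between_def)

lemma between_D: "x \<in> between V i j \<Longrightarrow> x (k, w) \<noteq> 0 \<Longrightarrow> k = i \<and> path_source V k w = j \<and> is_qpath V k w"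
  by (auto simp: between_def car_iff)

lemma conv_idem_left: "conv V (idem i) x (k, w) = (if k = i then x (k, w) else 0)"
  by (auto simp: conv_path_elem_left)

lemma conv_idem_right: "conv V x (idem j) (k, w) = (if path_source V k w = j then x (k, w) else 0)"
proof -
  have "conv V x (idem j) (k, w) =
    (\<Sum>l\<le>length w. if l = length w then (if path_source V k w = j then x (k, w) else 0) else 0)"
    unfolding conv_apply by (intro sum.cong refl) (auto simp: path_elem_apply)
  then show ?thesis by simp
qed

lemma conv_idem_between_left: assumes "x \<in> between V i j" shows "conv V (idem i) x = x"
proof (rule ext, clarify)
  fix k w show "conv V (idem i) x (k, w) = x (k, w)"
    unfolding conv_idem_left using between_D[OF assms, of k w] by auto
qed

lemma conv_idem_between_right: assumes "x \<in> between V i j" shows "conv V x (idem j) = x"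
proof (rule ext, clarify)
  fix k w show "conv V x (idem j) (k, w) = x (k, w)"
    unfolding conv_idem_right using between_D[OF assms, of k w] by auto
qed

lemmas conv_idem_between = conv_idem_between_left conv_idem_between_right

lemma between_I:
  assumes "x \<in> car V" shows "conv V (idem i) (conv V x (idem j)) \<in> between V i j"
  unfolding between_def
proof (intro CollectI conjI allI impI)
  have *: "conv V (idem i) (conv V x (idem j)) (k, w) =
      (if k = i \<and> path_source V k w = j then x (k, w) else 0)" for k w
    by (simp add: conv_idem_left conv_idem_right)
  show "conv V (idem i) (conv V x (idem j)) \<in> car V"
    unfolding car_iff * using assms by (simp add: car_iff)
  fix k w assume "conv V (idem i) (conv V x (idem j)) (k, w) \<noteq> 0"
  then show "k = i" "path_source V k w = j" unfolding * by (auto split: if_splits)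
qed

lemma conv_between:
  assumes "is_quiver V" "x \<in> between V i j" "y \<in> between V j k"
  shows "conv V x y \<in> between V i k"
  unfolding between_def
proof (intro CollectI conjI allI impI)
  show "conv V x y \<in> car V" using assms by (auto dest: between_car)
  fix l w assume "conv V x y (l, w) \<noteq> 0"
  then obtain u v where "w = u @ v" "x (l, u) \<noteq> 0" "y (path_source V l u, v) \<noteq> 0" by (rule conv_nonzero)
  then show "l = i" "path_source V l w = k"
    using between_D[OF assms(2), of l u] between_D[OF assms(3), of "path_source V l u" v]
    by (auto simp: path_source_append)
qed

lemma path_elem_between: assumes "is_qpath V i w" shows "path_elem (i, w) \<in> between V i (path_source V i w)"
  unfolding between_def using path_elem_car[OF assms] by (simp add: path_elem_apply)

lemma arr_between: "is_quiver V \<Longrightarrow> a \<in> arcs V \<Longrightarrow> arr V a \<in> between V (head V a) (tail V a)"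
  using path_elem_between[OF arr_path] by simp

lemma between_scl: assumes "x \<in> between V i j" shows "scl c x \<in> between V i j"
proof -
  have "k = i \<and> path_source V k w = j" if "scl c x (k, w) \<noteq> 0" for k w
    using between_D[OF assms, of k w] that by auto
  then show ?thesis using between_car[OF assms] by (auto simp: between_def)
qed

lemma between_add: assumes "x \<in> between V i j" "y \<in> between V i j" shows "x + y \<in> between V i j"
proof -
  have "k = i \<and> path_source V k w = j" if "(x + y) (k, w) \<noteq> 0" for k w
    using between_D[OF assms(1), of k w] between_D[OF assms(2), of k w] that by (cases "x (k, w) = 0") auto
  then show ?thesis using between_car[OF assms(1)] between_car[OF assms(2)] by (auto simp: between_def)
qed

lemma path_elem_Cons:
  "is_qpath V i (a # w) \<Longrightarrow> path_elem (i, a # w) = conv V (arr V a) (path_elem (tail V a, w))"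
  by (auto simp: conv_path_elem)

subsection \<open>Homomorphisms and derivations\<close>

definition chom :: "('v, 'a) quiver \<Rightarrow> ('v, 'b) quiver \<Rightarrow> (('v, 'a) series \<Rightarrow> ('v, 'b) series) \<Rightarrow> bool" where
  "chom V V' h \<longleftrightarrow> verts V' = verts V \<and> clin V V' h \<and>
     (\<forall>x\<in>car V. \<forall>y\<in>car V. h (conv V x y) = conv V' (h x) (h y)) \<and>
     (\<forall>i\<in>verts V. h (idem i) = idem i)"

definition cder :: "('v, 'a) quiver \<Rightarrow> (('v, 'a) series \<Rightarrow> ('v, 'a) series) \<Rightarrow> bool" where
  "cder V E \<longleftrightarrow> clin V V E \<and>
     (\<forall>x\<in>car V. \<forall>y\<in>car V. E (conv V x y) = conv V (E x) y + conv V x (E y)) \<and>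
     (\<forall>i\<in>verts V. E (idem i) = 0)"

lemma chom_clin: "chom V V' h \<Longrightarrow> clin V V' h"
  and chom_conv: "chom V V' h \<Longrightarrow> x \<in> car V \<Longrightarrow> y \<in> car V \<Longrightarrow> h (conv V x y) = conv V' (h x) (h y)"
  and chom_idem: "chom V V' h \<Longrightarrow> i \<in> verts V \<Longrightarrow> h (idem i) = idem i"
  and chom_verts: "chom V V' h \<Longrightarrow> verts V' = verts V"
  by (auto simp: chom_def)

lemma cder_clin: "cder V E \<Longrightarrow> clin V V E"
  and cder_conv: "cder V E \<Longrightarrow> x \<in> car V \<Longrightarrow> y \<in> car V \<Longrightarrow> E (conv V x y) = conv V (E x) y + conv V x (E y)"
  and cder_idem: "cder V E \<Longrightarrow> i \<in> verts V \<Longrightarrow> E (idem i) = 0"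
  by (auto simp: cder_def)

lemma chom_car: "chom V V' h \<Longrightarrow> x \<in> car V \<Longrightarrow> h x \<in> car V'"
  by (rule clin_car[OF chom_clin])

lemma cder_car: "cder V h \<Longrightarrow> x \<in> car V \<Longrightarrow> h x \<in> car V"
  by (rule clin_car[OF cder_clin])

lemma chom_id: "chom V V (\<lambda>x. x)"
  by (simp add: chom_def clin_id)

lemma chom_comp: "chom V V' g \<Longrightarrow> chom V' V'' h \<Longrightarrow> chom V V'' (\<lambda>x. h (g x))"
  unfolding chom_def by (auto intro: clin_comp simp: clin_car)

lemma chom_eqI:
  assumes V: "is_quiver V" and g: "chom V V' g" and h: "chom V V' h" and x: "x \<in> car V"
    and arrs: "\<And>a. a \<in> arcs V \<Longrightarrow> g (arr V a) = h (arr V a)"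
  shows "g x = h x"
proof (rule clin_eqI[OF V chom_clin[OF g] chom_clin[OF h] x])
  fix i w assume "is_qpath V i w"
  then show "g (path_elem (i, w)) = h (path_elem (i, w))"
  proof (induction w arbitrary: i)
    case Nil
    then show ?case by (simp add: chom_idem[OF g] chom_idem[OF h])
  next
    case (Cons a w)
    then have "arr V a \<in> car V" "path_elem (tail V a, w) \<in> car V" using V by (auto simp: arr_car)
    then show ?case
      using Cons by (simp only: path_elem_Cons chom_conv[OF g] chom_conv[OF h]) (auto simp: arrs)
  qed
qed

lemma chom_between:
  assumes "is_quiver V" "chom V V' h" "i \<in> verts V" "j \<in> verts V" "x \<in> between V i j"
  shows "h x \<in> between V' i j"
proof -
  have x: "x \<in> car V" using assms(5) by (rule between_car)
  have "h x = h (conv V (idem i) (conv V x (idem j)))"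
    using conv_idem_between[OF assms(5)] by simp
  also have "\<dots> = conv V' (idem i) (conv V' (h x) (idem j))"
    using assms x by (simp add: chom_conv[OF assms(2)] idem_car conv_car chom_idem[OF assms(2)])
  also have "\<dots> \<in> between V' i j" by (rule between_I[OF chom_car[OF assms(2) x]])
  finally show ?thesis .
qed

lemma cder_between:
  assumes "is_quiver V" "cder V h" "i \<in> verts V" "j \<in> verts V" "x \<in> between V i j"
  shows "h x \<in> between V i j"
proof -
  have x: "x \<in> car V" using assms(5) by (rule between_car)
  have "h x = h (conv V (idem i) (conv V x (idem j)))"
    using conv_idem_between[OF assms(5)] by simp
  also have "\<dots> = conv V (idem i) (conv V (h x) (idem j))"
    using assms x by (simp add: cder_conv[OF assms(2)] idem_car conv_car cder_idem[OF assms(2)])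
  also have "\<dots> \<in> between V i j" by (rule between_I[OF cder_car[OF assms(2) x]])
  finally show ?thesis .
qed

section \<open>Homomorphisms given by substitution for the arrows\<close>

fun ev :: "('v, 'a) quiver \<Rightarrow> ('v, 'b) quiver \<Rightarrow> ('a \<Rightarrow> ('v, 'b) series) \<Rightarrow> 'v \<Rightarrow> 'a list \<Rightarrow> ('v, 'b) series" where
  "ev V V' f i [] = idem i"
| "ev V V' f i (a # w) = conv V' (f a) (ev V V' f (tail V a) w)"

definition subst :: "('v, 'a) quiver \<Rightarrow> ('v, 'b) quiver \<Rightarrow> ('a \<Rightarrow> ('v, 'b) series) \<Rightarrow> ('v, 'a) series \<Rightarrow> ('v, 'b) series" where
  "subst V V' f = lin_ext V (\<lambda>(i, w). ev V V' f i w)"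

definition substitution :: "('v, 'a) quiver \<Rightarrow> ('v, 'b) quiver \<Rightarrow> ('a \<Rightarrow> ('v, 'b) series) \<Rightarrow> bool" where
  "substitution V V' f \<longleftrightarrow> is_quiver V \<and> is_quiver V' \<and> verts V' = verts V \<and>
     (\<forall>a\<in>arcs V. f a \<in> arrow_ideal_pow V' 1 \<and> f a \<in> between V' (head V a) (tail V a))"

lemma ev_between:
  assumes "substitution V V' f" "is_qpath V i w"
  shows "ev V V' f i w \<in> between V' i (path_source V i w) \<inter> arrow_ideal_pow V' (length w)"
  using assms(2)
proof (induction w arbitrary: i)
  case Nil
  then have "is_qpath V' i []" using assms(1) by (simp add: substitution_def)
  from path_elem_between[OF this] path_elem_pow[OF this, of 0] show ?case by simp
next
  case (Cons a w)
  then have IH: "ev V V' f (tail V a) w \<in> between V' (tail V a) (path_source V (tail V a) w) \<inter> arrow_ideal_pow V' (length w)"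
    and f: "f a \<in> arrow_ideal_pow V' 1 \<and> f a \<in> between V' (head V a) (tail V a)" and V': "is_quiver V'"
    using assms(1) by (auto simp: substitution_def)
  then show ?case using Cons.prems
    by (auto intro: conv_between conv_pow[OF V', of "f a" 1])
qed

lemma ev_append:
  assumes "substitution V V' f" "is_qpath V i (u @ v)"
  shows "ev V V' f i (u @ v) = conv V' (ev V V' f i u) (ev V V' f (path_source V i u) v)"
  using assms(2)
proof (induction u arbitrary: i)
  case Nil
  then show ?case using ev_between[OF assms(1), of i v] by (auto simp: conv_idem_between)
next
  case (Cons a u)
  then show ?case by (auto simp: conv_assoc)
qed

lemma subst_path_elem:
  assumes "substitution V V' f" "is_qpath V i w"
  shows "subst V V' f (path_elem (i, w)) = ev V V' f i w"
  unfolding subst_def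
  by (subst lin_ext_path_elem) (use assms ev_between[OF assms] in \<open>auto simp: substitution_def\<close>)

lemma clin_subst: assumes "substitution V V' f" shows "clin V V' (subst V V' f)"
  unfolding subst_def
  by (rule clin_lin_ext) (use assms ev_between[OF assms] in \<open>auto simp: substitution_def\<close>)

text \<open>Both sides are filtered and linear in each factor, so multiplicativity reduces to two
  paths: composable ones are covered by \<open>ev_append\<close>, and for the others the images have
  mismatched end vertices, so their product vanishes.\<close>

lemma chom_subst: assumes f: "substitution V V' f" shows "chom V V' (subst V V' f)"
  unfolding chom_def
proof (intro conjI ballI)
  have V: "is_quiver V" and V': "is_quiver V'" using f by (auto simp: substitution_def)
  show "verts V' = verts V" using f by (simp add: substitution_def)
  show clin: "clin V V' (subst V V' f)" by (rule clin_subst[OF f])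
  show "subst V V' f (idem i) = idem i" if "i \<in> verts V" for i
    using that by (simp add: subst_path_elem[OF f])
  fix x y assume x: "x \<in> car V" and y: "y \<in> car V"
  note car = clin_car[OF clin]
  show "subst V V' f (conv V x y) = conv V' (subst V V' f x) (subst V V' f y)"
  proof (rule clin_eqI[OF V _ _ x, where T = "\<lambda>x. subst V V' f (conv V x y)"])
    show "clin V V' (\<lambda>x. subst V V' f (conv V x y))"
      by (rule clin_comp[OF clin_conv_right[OF V y] clin])
    show "clin V V' (\<lambda>x. conv V' (subst V V' f x) (subst V V' f y))"
      by (rule clin_comp[OF clin clin_conv_right[OF V' car[OF y]]])
    fix i u assume u: "is_qpath V i u"
    then have u': "path_elem (i, u) \<in> car V" by auto
    show "subst V V' f (conv V (path_elem (i, u)) y) = conv V' (subst V V' f (path_elem (i, u))) (subst V V' f y)"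
    proof (rule clin_eqI[OF V _ _ y, where T = "\<lambda>y. subst V V' f (conv V (path_elem (i, u)) y)"])
      show "clin V V' (\<lambda>y. subst V V' f (conv V (path_elem (i, u)) y))"
        by (rule clin_comp[OF clin_conv_left[OF V u'] clin])
      show "clin V V' (\<lambda>y. conv V' (subst V V' f (path_elem (i, u))) (subst V V' f y))"
        by (rule clin_comp[OF clin clin_conv_left[OF V' car[OF u']]])
      fix j v assume v: "is_qpath V j v"
      show "subst V V' f (conv V (path_elem (i, u)) (path_elem (j, v))) =
        conv V' (subst V V' f (path_elem (i, u))) (subst V V' f (path_elem (j, v)))"
      proof (cases "path_source V i u = j")
        case True
        then have "is_qpath V i (u @ v)" using u v V by (simp add: is_qpath_append)
        then show ?thesis using True u v by (simp add: conv_path_elem subst_path_elem[OF f] ev_append[OF f])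
      next
        case False
        have "conv V' (ev V V' f i u) (ev V V' f j v) = 0"
        proof (rule ext, clarify, rule ccontr)
          fix k w assume "conv V' (ev V V' f i u) (ev V V' f j v) (k, w) \<noteq> 0 (k, w)"
          then obtain w1 w2 where "ev V V' f i u (k, w1) \<noteq> 0" "ev V V' f j v (path_source V' k w1, w2) \<noteq> 0"
            by (auto elim!: conv_nonzero)
          then show False using ev_between[OF f u] ev_between[OF f v] False by (auto simp: between_def)
        qed
        then show ?thesis using False u v by (simp add: conv_path_elem subst_path_elem[OF f] clin_zero[OF clin])
      qed
    qed
  qed
qed

lemma subst_arr: assumes f: "substitution V V' f" "a \<in> arcs V"
  shows "subst V V' f (arr V a) = f a"
proof -
  have "subst V V' f (arr V a) = ev V V' f (head V a) [a]"
    using f by (subst subst_path_elem[OF f(1)]) (auto simp: substitution_def quiver_tail)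
  also have "\<dots> = f a" using f by (auto simp: conv_idem_between substitution_def)
  finally show ?thesis .
qed

subsection \<open>Unipotent maps\<close>

text \<open>\<open>T = 1 - D\<close> with \<open>D\<close> raising length, so the Neumann series of
  \<open>D\<close> inverts \<open>T\<close>. It converges because each coefficient sees only
  finitely many powers.\<close>

lemma unipotent_inverse:
  fixes V :: "('v, 'a) quiver"
  assumes V: "is_quiver V" and T: "clin V V T"
    and uni: "\<And>n x. x \<in> arrow_ideal_pow V n \<Longrightarrow> T x - x \<in> arrow_ideal_pow V (Suc n)"
  obtains S where "clin V V S" "\<And>x. x \<in> car V \<Longrightarrow> S (T x) = x" "\<And>x. x \<in> car V \<Longrightarrow> T (S x) = x"
proof -
  define D where "D = (\<lambda>x. x - T x)"
  have D: "clin V V D" unfolding D_def by (rule clin_diff_fun[OF clin_id T])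
  have Dpow: "D x \<in> arrow_ideal_pow V (Suc n)" if "x \<in> arrow_ideal_pow V n" for x n
    using pow_uminus[OF uni[OF that]] by (simp add: D_def)
  have Dk: "clin V V (D ^^ k)" for k
  proof (induction k)
    case (Suc k)
    from clin_comp[OF Suc D] show ?case by (simp add: comp_def)
  qed (use clin_id[of V] in \<open>simp add: id_def\<close>)
  have Dkpow: "(D ^^ k) x \<in> arrow_ideal_pow V (n + k)" if "x \<in> arrow_ideal_pow V n" for x n k
    by (induction k) (auto simp: that Dpow)
  define P where "P = (\<lambda>n x. fsum (\<lambda>k. (D ^^ k) x) {..n})"
  have P: "clin V V (P n)" for n
  proof (induction n)
    case 0
    show ?case using clin_id[of V] by (simp add: P_def)
  next
    case (Suc n)
    have "P (Suc n) = (\<lambda>x. P n x + (D ^^ Suc n) x)"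
      by (rule ext) (simp add: P_def atMost_Suc add.commute)
    with clin_add_fun[OF Suc Dk[of "Suc n"]] show ?case by (simp only:)
  qed
  \<comment> \<open>\<open>D ^^ k\<close> has no terms on words shorter than \<open>k\<close>, so
    the partial sum up to \<open>length w\<close> already has its final coefficient at
    \<open>w\<close>.\<close>
  define S where "S = (\<lambda>x (i, w). P (length w) x (i, w))"
  have Dk0: "(D ^^ k) x (i, w) = 0" if "x \<in> car V" "length w < k" for k x i w
    using Dkpow[of x 0 k] that by (force simp: pow_iff)
  have S_P: "S x (i, w) = P n x (i, w)" if "x \<in> car V" "length w \<le> n" for x i w n
    unfolding S_def P_def fsum_apply case_prod_conv
    by (rule sum.mono_neutral_left) (use that Dk0 in auto)
  have TP: "T (P n x) = x - (D ^^ Suc n) x" if x: "x \<in> car V" for n x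
  proof -
    have "T y = y - D y" for y by (simp add: D_def)
    moreover have "P n x - D (P n x) = x - (D ^^ Suc n) x"
    proof (induction n)
      case 0
      show ?case by (simp add: P_def)
    next
      case (Suc n)
      have "P (Suc n) x = P n x + (D ^^ Suc n) x"
        by (simp add: P_def atMost_Suc add.commute)
      then have "P (Suc n) x - D (P (Suc n) x) = (P n x - D (P n x)) + (D ^^ Suc n) x - (D ^^ Suc (Suc n)) x"
        using clin_add[OF D clin_car[OF P x] clin_car[OF Dk x], of n "Suc n"] by (simp add: algebra_simps)
      also have "\<dots> = x - (D ^^ Suc (Suc n)) x"
        unfolding Suc by (simp add: algebra_simps)
      finally show ?case .
    qed
    ultimately show ?thesis by simp
  qed
  have PT: "P n (T x) = x - (D ^^ Suc n) x" if x: "x \<in> car V" for n x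
  proof -
    have "P n (T x) = P n x - P n (D x)"
      using clin_diff[OF P x clin_car[OF D x]] by (simp add: D_def)
    also have "\<dots> = x - (D ^^ Suc n) x"
    proof (induction n)
      case 0
      show ?case by (simp add: P_def)
    next
      case (Suc n)
      have "P (Suc n) y = P n y + (D ^^ Suc n) y" for y
        by (simp add: P_def atMost_Suc add.commute)
      then have "P (Suc n) x - P (Suc n) (D x) = (P n x - P n (D x)) + (D ^^ Suc n) x - (D ^^ Suc (Suc n)) x"
        by (simp add: algebra_simps funpow_swap1)
      also have "\<dots> = x - (D ^^ Suc (Suc n)) x"
        unfolding Suc by (simp add: algebra_simps)
      finally show ?case .
    qed
    finally show ?thesis .
  qed
  show thesis
  proof
    show S: "clin V V S" unfolding clin_def
    proof (intro conjI ballI allI)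
      show "S (x + y) = S x + S y" if "x \<in> car V" "y \<in> car V" for x y
        by (rule ext) (auto simp: S_def clin_add[OF P] that)
      show "S (scl c x) = scl c (S x)" if "x \<in> car V" for c x
        by (rule ext) (auto simp: S_def clin_scl[OF P] that)
      fix n x assume x: "x \<in> arrow_ideal_pow V n"
      show "S x \<in> arrow_ideal_pow V n"
        unfolding pow_iff car_iff S_def case_prod_conv
        using clin_pow[OF P x] by (simp add: pow_iff car_iff)
    qed
    fix x assume x: "x \<in> car V"
    show "S (T x) = x"
      by (rule ext) (auto simp: S_def PT[OF x] Dk0[OF x] simp del: funpow.simps)
    show "T (S x) = x"
    proof (rule ext, clarify)
      fix i :: 'v and w :: "'a list"
      let ?n = "length w"
      have "trunc ?n (S x) = trunc ?n (P ?n x)"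
        by (auto simp: fun_eq_iff S_P[OF x])
      then have "T (S x) (i, w) = T (P ?n x) (i, w)"
        using clin_trunc[OF T clin_car[OF S x] order_refl] clin_trunc[OF T clin_car[OF P x] order_refl] by metis
      then show "T (S x) (i, w) = x (i, w)"
        by (simp add: TP[OF x] Dk0[OF x] del: funpow.simps)
    qed
  qed
qed

subsection \<open>Algebra homomorphisms are continuous\<close>

lemma one_fsum: assumes "is_quiver V" shows "\<one>\<^bsub>path_algebra V\<^esub> = fsum idem (verts V)"
proof (rule ext, clarify)
  fix i :: 'a and w :: "'b list"
  have "fsum idem (verts V) (i, w) = (\<Sum>j\<in>verts V. if i = j then (if w = [] then 1 else 0) else 0)"
    unfolding fsum_apply by (intro sum.cong refl) (auto simp: path_elem_apply)
  then show "\<one>\<^bsub>path_algebra V\<^esub> (i, w) = fsum idem (verts V) (i, w)"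
    by (simp add: quiver_finite_verts[OF assms])
qed

lemma chom_one:
  assumes "is_quiver V" "is_quiver V'" "chom V V' h"
  shows "h (\<one>\<^bsub>path_algebra V\<^esub>) = \<one>\<^bsub>path_algebra V'\<^esub>"
  unfolding one_fsum[OF assms(1)] one_fsum[OF assms(2)] chom_verts[OF assms(3)]
  by (subst clin_fsum[OF chom_clin[OF assms(3)]])
     (auto simp: idem_car fun_eq_iff fsum_apply chom_idem[OF assms(3)] intro!: sum.cong)

lemma car_pow_one: "x \<in> car V \<Longrightarrow> (\<And>i. x (i, []) = 0) \<Longrightarrow> x \<in> arrow_ideal_pow V (Suc 0)"
  by (auto simp: pow_iff) (metis length_greater_0_conv less_eq_Suc_le)

text \<open>Left multiplication by \<open>1 - x\<close> is unipotent; its inverse is applied to the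
  unit.\<close>

lemma geometric_inverse:
  assumes V: "is_quiver V" and x: "x \<in> arrow_ideal_pow V 1"
  obtains y where "y \<in> car V" "conv V (\<one>\<^bsub>path_algebra V\<^esub> - x) y = \<one>\<^bsub>path_algebra V\<^esub>"
proof -
  have car: "\<one>\<^bsub>path_algebra V\<^esub> - x \<in> car V" using one_car pow_car[OF x] by blast
  obtain S where S: "clin V V S" "\<And>y. y \<in> car V \<Longrightarrow> conv V (\<one>\<^bsub>path_algebra V\<^esub> - x) (S y) = y"
  proof (rule unipotent_inverse[OF V clin_conv_left[OF V car]])
    fix n y assume y: "y \<in> arrow_ideal_pow V n"
    have "conv V (\<one>\<^bsub>path_algebra V\<^esub> - x) y - y = - conv V x y"
      unfolding conv_diff_left conv_one_left[OF V pow_car[OF y]] by simp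
    also have "\<dots> \<in> arrow_ideal_pow V (Suc n)"
      by (rule pow_uminus[OF conv_pow[OF V x y]]) simp
    finally show "conv V (\<one>\<^bsub>path_algebra V\<^esub> - x) y - y \<in> arrow_ideal_pow V (Suc n)" .
  qed (use that in blast)
  show thesis by (rule that[OF clin_car[OF S(1) one_car] S(2)[OF one_car]])
qed

text \<open>Sorted by first letter, a series is a finite sum over the arrows. Finiteness matters: it
  lets a bare algebra homomorphism, not yet known to be continuous, act term by term.\<close>

lemma pow_Suc_expand:
  assumes V: "is_quiver V" and x: "x \<in> arrow_ideal_pow V (Suc n)"
  obtains g where "\<And>a. a \<in> arcs V \<Longrightarrow> g a \<in> arrow_ideal_pow V n" "x = fsum (\<lambda>a. conv V (arr V a) (g a)) (arcs V)"
proof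
  let ?g = "\<lambda>a (j, w). if j = tail V a then x (head V a, a # w) else 0"
  show "?g a \<in> arrow_ideal_pow V n" if "a \<in> arcs V" for a
    using x that by (fastforce simp: pow_iff car_iff split: if_splits)
  show "x = fsum (\<lambda>a. conv V (arr V a) (?g a)) (arcs V)"
  proof (rule ext, clarify)
    fix i w
    show "x (i, w) = fsum (\<lambda>a. conv V (arr V a) (?g a)) (arcs V) (i, w)"
    proof (cases w)
      case Nil
      then show ?thesis using x by (force simp: fsum_apply conv_path_elem_left pow_iff intro!: sum.neutral[symmetric])
    next
      case (Cons b u)
      have "fsum (\<lambda>a. conv V (arr V a) (?g a)) (arcs V) (i, w)
        = (\<Sum>a\<in>arcs V. if a = b then (if i = head V a then x (head V a, b # u) else 0) else 0)"
        unfolding fsum_apply by (intro sum.cong refl) (auto simp: conv_path_elem_left Cons)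
      also have "\<dots> = (if b \<in> arcs V \<and> i = head V b then x (head V b, b # u) else 0)"
        by (simp add: quiver_finite_arcs[OF V])
      also have "\<dots> = x (i, w)"
      proof -
        have "x (i, b # u) = 0" if "\<not> (b \<in> arcs V \<and> head V b = i)"
          using pow_car[OF x] that unfolding car_iff by (meson is_qpath.simps(2))
        then show ?thesis using Cons by auto
      qed
      finally show ?thesis by simp
    qed
  qed
qed

text \<open>Automatic continuity. For \<open>x\<close> in the arrow ideal, a nonzero constant
  coefficient \<open>c\<close> of \<open>h x\<close> is impossible: \<open>1 - x / c\<close> is
  invertible, while its image has constant coefficient zero at that vertex. Higher powers follow by
  factoring off one arrow at a time.\<close>

lemma alg_hom_continuous:
  assumes V: "is_quiver V" and V': "is_quiver V'" "verts V' = verts V"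
    and car: "\<And>x. x \<in> car V \<Longrightarrow> h x \<in> car V'"
    and add: "\<And>x y. x \<in> car V \<Longrightarrow> y \<in> car V \<Longrightarrow> h (x + y) = h x + h y"
    and scl: "\<And>c x. x \<in> car V \<Longrightarrow> h (scl c x) = scl c (h x)"
    and mult: "\<And>x y. x \<in> car V \<Longrightarrow> y \<in> car V \<Longrightarrow> h (conv V x y) = conv V' (h x) (h y)"
    and idem: "\<And>i. i \<in> verts V \<Longrightarrow> h (idem i) = idem i"
  shows "chom V V' h"
proof -
  have zero: "h 0 = 0" using scl[of 0 0] by simp
  have fsum: "h (fsum f A) = fsum (\<lambda>a. h (f a)) A" if "\<And>a. a \<in> A \<Longrightarrow> f a \<in> car V" for f and A :: "'x set"
    using that by (induction A rule: infinite_finite_induct) (auto simp: zero add car_fsum)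
  have one: "h (\<one>\<^bsub>path_algebra V\<^esub>) = \<one>\<^bsub>path_algebra V'\<^esub>"
    unfolding one_fsum[OF V] one_fsum[OF V'(1)] V'(2)
    by (subst fsum) (auto simp: idem_car fun_eq_iff fsum_apply idem intro!: sum.cong)
  have rad: "h x \<in> arrow_ideal_pow V' 1" if x: "x \<in> arrow_ideal_pow V 1" for x
  proof -
    have hx: "h x \<in> car V'" by (rule car[OF pow_car[OF x]])
    have "h x (i, []) = 0" for i
    proof (rule ccontr)
      assume c: "h x (i, []) \<noteq> 0"
      then have i: "i \<in> verts V'" using hx by (force simp: car_iff)
      let ?c = "h x (i, [])"
      obtain y where y: "y \<in> car V" "conv V (\<one>\<^bsub>path_algebra V\<^esub> - scl (1 / ?c) x) y = \<one>\<^bsub>path_algebra V\<^esub>"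
        by (rule geometric_inverse[OF V pow_scl[OF x]])
      have 1: "scl (- 1 / ?c) x \<in> car V" using pow_car[OF x] by auto
      have "\<one>\<^bsub>path_algebra V\<^esub> - scl (1 / ?c) x = \<one>\<^bsub>path_algebra V\<^esub> + scl (- 1 / ?c) x"
        by (auto simp: fun_eq_iff)
      then have "conv V' (\<one>\<^bsub>path_algebra V'\<^esub> + scl (-1 / ?c) (h x)) (h y) = \<one>\<^bsub>path_algebra V'\<^esub>"
        using mult[OF car_add[OF one_car 1] y(1)] y(2) one
          add[OF one_car 1] scl[OF pow_car[OF x]] by metis
      then have "conv V' (\<one>\<^bsub>path_algebra V'\<^esub> + scl (-1 / ?c) (h x)) (h y) (i, []) = \<one>\<^bsub>path_algebra V'\<^esub> (i, [])"
        by metis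
      then show False using i c by (simp add: conv_apply)
    qed
    then show ?thesis using car_pow_one[OF hx] by simp
  qed
  have pow: "h x \<in> arrow_ideal_pow V' n" if "x \<in> arrow_ideal_pow V n" for x n
    using that
  proof (induction n arbitrary: x)
    case 0
    then show ?case by (simp add: car)
  next
    case (Suc n)
    obtain g where g: "\<And>a. a \<in> arcs V \<Longrightarrow> g a \<in> arrow_ideal_pow V n"
      "x = fsum (\<lambda>a. conv V (arr V a) (g a)) (arcs V)"
      by (rule pow_Suc_expand[OF V Suc.prems]) (use that in blast)
    have "h x = fsum (\<lambda>a. h (conv V (arr V a) (g a))) (arcs V)"
      unfolding g(2) by (rule fsum) (auto intro!: conv_car[OF V] simp: arr_car[OF V] pow_car[OF g(1)])
    also have "\<dots> \<in> arrow_ideal_pow V' (Suc n)"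
    proof (rule pow_fsum)
      fix a assume a: "a \<in> arcs V"
      have "h (conv V (arr V a) (g a)) = conv V' (h (arr V a)) (h (g a))"
        by (rule mult) (use a V in \<open>auto simp: arr_car pow_car[OF g(1)]\<close>)
      moreover have "h (arr V a) \<in> arrow_ideal_pow V' 1" using rad arr_pow[OF V a] by simp
      ultimately show "h (conv V (arr V a) (g a)) \<in> arrow_ideal_pow V' (Suc n)"
        using conv_pow[OF V'(1) _ Suc.IH[OF g(1)[OF a]]] by simp
    qed
    finally show ?case .
  qed
  show ?thesis unfolding chom_def clin_def using assms pow by auto
qed

text \<open>Induction leaves eta-expanded series behind, in which these rules would rewrite under the
  abstraction and destroy the algebraic structure.\<close>

lemmas pointwise = plus_fun_apply zero_fun_apply minus_apply uminus_apply scl_apply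

declare pointwise [simp del]

subsection \<open>Cyclic equivalence\<close>

abbreviation cycz :: "('v, 'a) quiver \<Rightarrow> ('v, 'a) series set" where
  "cycz V \<equiv> adic_closure V (commutator_space V)"

lemma comm_zero: "0 \<in> commutator_space V"
  using generate.one[of "add_monoid (path_algebra V)"] by (simp add: commutator_space_def)

lemma comm_add: "x \<in> commutator_space V \<Longrightarrow> y \<in> commutator_space V \<Longrightarrow> x + y \<in> commutator_space V"
  unfolding commutator_space_def using generate.eng[of x "add_monoid (path_algebra V)" _ y] by simp

lemma comm_gen:
  assumes "is_quiver V" "x \<in> car V" "y \<in> car V"
  shows "conv V x y - conv V y x \<in> commutator_space V"
  unfolding commutator_space_def
proof (rule generate.incl)
  have "conv V x y - conv V y x = x \<otimes>\<^bsub>path_algebra V\<^esub> y \<ominus>\<^bsub>path_algebra V\<^esub> y \<otimes>\<^bsub>path_algebra V\<^esub> x"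
    using assms by (simp add: a_minus_path_algebra conv_car)
  then show "conv V x y - conv V y x \<in> {x \<otimes>\<^bsub>path_algebra V\<^esub> y \<ominus>\<^bsub>path_algebra V\<^esub> y \<otimes>\<^bsub>path_algebra V\<^esub> x | x y.
        x \<in> car V \<and> y \<in> car V}" using assms by blast
qed

lemma comm_induct [consumes 2, case_names zero gen add]:
  assumes V: "is_quiver V" and z: "z \<in> commutator_space V"
    and zero: "P 0"
    and gen: "\<And>x y. x \<in> car V \<Longrightarrow> y \<in> car V \<Longrightarrow> P (conv V x y - conv V y x)"
    and add: "\<And>x y. x \<in> car V \<Longrightarrow> P x \<Longrightarrow> y \<in> car V \<Longrightarrow> P y \<Longrightarrow> P (x + y)"
  shows "P z"
proof -
  let ?H = "{x \<otimes>\<^bsub>path_algebra V\<^esub> y \<ominus>\<^bsub>path_algebra V\<^esub> y \<otimes>\<^bsub>path_algebra V\<^esub> x | x y. x \<in> car V \<and> y \<in> car V}"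
  have H: "\<exists>x\<in>car V. \<exists>y\<in>car V. h = conv V x y - conv V y x" if h: "h \<in> ?H" for h
  proof -
    from h obtain x y where xy: "x \<in> car V" "y \<in> car V"
      "h = x \<otimes>\<^bsub>path_algebra V\<^esub> y \<ominus>\<^bsub>path_algebra V\<^esub> y \<otimes>\<^bsub>path_algebra V\<^esub> x" by blast
    then have "h = conv V x y - conv V y x" using V by (simp add: a_minus_path_algebra conv_car)
    then show ?thesis using xy by blast
  qed
  have "z \<in> car V \<and> P z" using z unfolding commutator_space_def
  proof (induction rule: generate.induct)
    case one
    then show ?case using zero by simp
  next
    case (incl h)
    then obtain x y where "x \<in> car V" "y \<in> car V" "h = conv V x y - conv V y x" using H by blast
    then show ?case using gen conv_car[OF V] by auto
  next
    case (inv h)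
    then obtain x y where xy: "x \<in> car V" "y \<in> car V" "h = conv V x y - conv V y x" using H by blast
    then have h: "h \<in> car V" using conv_car[OF V] by auto
    have "inv\<^bsub>add_monoid (path_algebra V)\<^esub> h = - h"
      using a_inv_path_algebra[OF V h] by (simp add: a_inv_def)
    also have "- h = conv V y x - conv V x y" using xy by simp
    finally show ?case using gen[OF xy(2,1)] conv_car[OF V] xy(1,2) by auto
  next
    case (eng x y)
    then show ?case using add by auto
  qed
  then show ?thesis by simp
qed

lemma comm_car: assumes "is_quiver V" "x \<in> commutator_space V" shows "x \<in> car V"
  using assms by (induction rule: comm_induct) (auto intro!: conv_car[OF assms(1)] car_diff)

lemma comm_scl: assumes V: "is_quiver V" and x: "x \<in> commutator_space V" shows "scl c x \<in> commutator_space V"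
  using assms
proof (induction rule: comm_induct)
  case zero
  then show ?case by (simp add: comm_zero)
next
  case (gen x y)
  have "scl c (conv V x y - conv V y x) = conv V (scl c x) y - conv V y (scl c x)"
    by (simp add: scl_diff conv_scl_left conv_scl_right)
  then show ?case using comm_gen[OF V car_scl[OF gen(1)] gen(2)] by metis
next
  case (add x y)
  then show ?case using comm_add by (metis scl_add)
qed

lemma comm_fsum: assumes "\<And>a. a \<in> A \<Longrightarrow> f a \<in> commutator_space V" shows "fsum f A \<in> commutator_space V"
  using assms by (induction A rule: infinite_finite_induct) (auto simp: comm_zero comm_add)

lemma cycz_iff: "x \<in> cycz V \<longleftrightarrow> x \<in> car V \<and> (\<forall>n. \<exists>y\<in>commutator_space V. x - y \<in> arrow_ideal_pow V n)"
  by (simp add: adic_closure_def fun_diff_def)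

lemma cycz_car: "x \<in> cycz V \<Longrightarrow> x \<in> car V"
  by (simp add: cycz_iff)

lemma cycz_zero: "0 \<in> cycz V"
  unfolding cycz_iff using comm_zero by (auto intro!: bexI[of _ 0])

lemma cycz_add: assumes "x \<in> cycz V" "y \<in> cycz V" shows "x + y \<in> cycz V"
  unfolding cycz_iff
proof (intro conjI allI)
  show "x + y \<in> car V" using assms cycz_car by blast
  fix n
  obtain u v where "u \<in> commutator_space V" "v \<in> commutator_space V" "x - u \<in> arrow_ideal_pow V n" "y - v \<in> arrow_ideal_pow V n"
    using assms unfolding cycz_iff by blast
  moreover have "x + y - (u + v) = (x - u) + (y - v)" by simp
  ultimately show "\<exists>z\<in>commutator_space V. x + y - z \<in> arrow_ideal_pow V n"
    using comm_add pow_add by (metis (no_types, lifting))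
qed

text \<open>Approximations of \<open>x\<close> by commutators are carried to such approximations of
  \<open>T x\<close>, as \<open>T\<close> respects the filtration.\<close>

lemma cycz_map:
  assumes V: "is_quiver V" "is_quiver V'" and T: "clin V V' T" and x: "x \<in> cycz V"
    and comm: "\<And>u v. u \<in> car V \<Longrightarrow> v \<in> car V \<Longrightarrow> T (conv V u v - conv V v u) \<in> commutator_space V'"
  shows "T x \<in> cycz V'"
  unfolding cycz_iff
proof (intro conjI allI)
  show "T x \<in> car V'" using clin_car[OF T] x cycz_car by blast
  fix n
  obtain u where u: "u \<in> commutator_space V" "x - u \<in> arrow_ideal_pow V n" using x unfolding cycz_iff by blast
  have "T u \<in> commutator_space V'" using V(1) u(1)
    by (induction rule: comm_induct) (auto simp: clin_zero[OF T] comm_zero comm clin_add[OF T] comm_add)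
  moreover have "T x - T u \<in> arrow_ideal_pow V' n"
    using clin_pow[OF T u(2)] clin_diff[OF T] x u comm_car[OF V(1)] cycz_car by (metis)
  ultimately show "\<exists>z\<in>commutator_space V'. T x - z \<in> arrow_ideal_pow V' n" by blast
qed

lemma cycz_scl: assumes "is_quiver V" "x \<in> cycz V" shows "scl c x \<in> cycz V"
proof (rule cycz_map[OF assms(1,1) _ assms(2)])
  show "clin V V (scl c)" by (auto simp: clin_def scl_add scl_scl mult.commute)
qed (rule comm_scl[OF assms(1) comm_gen[OF assms(1)]])

lemma cycz_chom:
  assumes "is_quiver V" "is_quiver V'" "chom V V' h" "x \<in> cycz V" shows "h x \<in> cycz V'"
proof (rule cycz_map[OF assms(1,2) chom_clin[OF assms(3)] assms(4)])
  fix u v assume u: "u \<in> car V" and v: "v \<in> car V"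
  have "h (conv V u v - conv V v u) = conv V' (h u) (h v) - conv V' (h v) (h u)"
    using u v assms by (simp add: clin_diff[OF chom_clin[OF assms(3)]] conv_car chom_conv[OF assms(3)])
  then show "h (conv V u v - conv V v u) \<in> commutator_space V'"
    using comm_gen[OF assms(2) chom_car[OF assms(3) u] chom_car[OF assms(3) v]] by simp
qed

lemma cycz_cder:
  assumes "is_quiver V" "cder V h" "x \<in> cycz V" shows "h x \<in> cycz V"
proof (rule cycz_map[OF assms(1,1) cder_clin[OF assms(2)] assms(3)])
  fix u v assume u: "u \<in> car V" and v: "v \<in> car V"
  have "h (conv V u v - conv V v u) = (conv V (h u) v - conv V v (h u)) + (conv V u (h v) - conv V (h v) u)"
    using u v assms by (simp add: clin_diff[OF cder_clin[OF assms(2)]] conv_car cder_conv[OF assms(2)])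
  then show "h (conv V u v - conv V v u) \<in> commutator_space V"
    using comm_add[OF comm_gen[OF assms(1) cder_car[OF assms(2) u] v] comm_gen[OF assms(1) u cder_car[OF assms(2) v]]] by simp
qed

definition cyceq :: "('v, 'a) quiver \<Rightarrow> ('v, 'a) series \<Rightarrow> ('v, 'a) series \<Rightarrow> bool" where
  "cyceq V x y \<longleftrightarrow> x \<in> car V \<and> y \<in> car V \<and> x - y \<in> cycz V"

lemma cyceq_car: "cyceq V x y \<Longrightarrow> x \<in> car V" "cyceq V x y \<Longrightarrow> y \<in> car V"
  by (auto simp: cyceq_def)

lemma cyceq_refl: "x \<in> car V \<Longrightarrow> cyceq V x x"
  by (simp add: cyceq_def cycz_zero)

lemma cyceq_sym: assumes "is_quiver V" "cyceq V x y" shows "cyceq V y x"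
  using cycz_scl[OF assms(1), of "x - y" "-1"] assms(2) by (auto simp: cyceq_def scl_minus_one)

lemma cyceq_trans: assumes "cyceq V x y" "cyceq V y z" shows "cyceq V x z"
  using cycz_add[of "x - y" V "y - z"] assms by (simp add: cyceq_def)

lemma cyceq_add: assumes "cyceq V x y" "cyceq V x' y'" shows "cyceq V (x + x') (y + y')"
proof -
  have "x + x' - (y + y') = (x - y) + (x' - y')" by simp
  then show ?thesis using cycz_add[of "x - y" V "x' - y'"] assms unfolding cyceq_def by (metis car_add)
qed

lemma cyceq_chom:
  assumes "is_quiver V" "is_quiver V'" "chom V V' h" "cyceq V x y" shows "cyceq V' (h x) (h y)"
proof -
  have xy: "x \<in> car V" "y \<in> car V" "x - y \<in> cycz V" using assms(4) by (auto simp: cyceq_def)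
  have "h x - h y \<in> cycz V'"
    using cycz_chom[OF assms(1-3) xy(3)] clin_diff[OF chom_clin[OF assms(3)] xy(1,2)] by simp
  then show ?thesis using chom_car[OF assms(3)] xy by (simp add: cyceq_def)
qed

lemma cyceq_cder:
  assumes "is_quiver V" "cder V h" "cyceq V x y" shows "cyceq V (h x) (h y)"
proof -
  have xy: "x \<in> car V" "y \<in> car V" "x - y \<in> cycz V" using assms(3) by (auto simp: cyceq_def)
  have "h x - h y \<in> cycz V"
    using cycz_cder[OF assms(1-2) xy(3)] clin_diff[OF cder_clin[OF assms(2)] xy(1,2)] by simp
  then show ?thesis using cder_car[OF assms(2)] xy by (simp add: cyceq_def)
qed

lemma cyc_class_iff: assumes "x \<in> car V" shows "y \<in> cyc_class V x \<longleftrightarrow> cyceq V y x"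
proof -
  have "y \<in> cyc_class V x \<longleftrightarrow> (\<exists>h\<in>cycz V. y = h + x)"
    unfolding cyc_class_def a_r_coset_def' by simp
  also have "\<dots> \<longleftrightarrow> cyceq V y x"
  proof
    assume "\<exists>h\<in>cycz V. y = h + x"
    then obtain h where h: "h \<in> cycz V" "y = h + x" by blast
    then show "cyceq V y x" using assms cycz_car[OF h(1)] by (auto simp: cyceq_def)
  next
    assume "cyceq V y x"
    then show "\<exists>h\<in>cycz V. y = h + x" by (intro bexI[of _ "y - x"]) (simp_all add: cyceq_def)
  qed
  finally show ?thesis .
qed

lemma cyc_class_eq_iff:
  assumes "is_quiver V" "x \<in> car V" "y \<in> car V"
  shows "cyc_class V x = cyc_class V y \<longleftrightarrow> cyceq V x y"
proof
  assume "cyc_class V x = cyc_class V y"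
  then show "cyceq V x y" using cyceq_refl[OF assms(2)] cyc_class_iff[OF assms(2)] cyc_class_iff[OF assms(3)] by blast
next
  assume "cyceq V x y"
  then show "cyc_class V x = cyc_class V y"
    using cyceq_trans cyceq_sym[OF assms(1)] cyc_class_iff[OF assms(2)] cyc_class_iff[OF assms(3)] by blast
qed

subsection \<open>Cyclic sums\<close>

definition closed_word :: "('v, 'a) quiver \<Rightarrow> 'a list \<Rightarrow> bool" where
  "closed_word V w \<longleftrightarrow> w \<noteq> [] \<and> is_qpath V (head V (hd w)) w \<and> path_source V (head V (hd w)) w = head V (hd w)"

text \<open>The coefficient of \<open>w\<close> as a cyclic word, up to the order of its rotational
  symmetry: periodic words are counted with repetition, which keeps all reindexing over residues
  uniform.\<close>

definition csum :: "('v, 'a) quiver \<Rightarrow> ('v, 'a) series \<Rightarrow> 'a list \<Rightarrow> complex" where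
  "csum V x w = (\<Sum>k<length w. x (head V (hd (rotate k w)), rotate k w))"

lemma qpath_head: "is_qpath V i w \<Longrightarrow> w \<noteq> [] \<Longrightarrow> head V (hd w) = i"
  by (cases w) auto

lemma closed_wordI: "is_qpath V i w \<Longrightarrow> w \<noteq> [] \<Longrightarrow> path_source V i w = i \<Longrightarrow> closed_word V w"
  using qpath_head[of V i w] by (simp add: closed_word_def)

lemma closed_word_rotate1: assumes "is_quiver V" "closed_word V w" shows "closed_word V (rotate1 w)"
proof (cases w)
  case (Cons a u)
  show ?thesis
  proof (cases "u = []")
    case True
    then show ?thesis using assms Cons by simp
  next
    case False
    have "a \<in> arcs V" "is_qpath V (tail V a) u" "path_source V (tail V a) u = head V a" using assms Cons by (auto simp: closed_word_def)
    moreover from this have "is_qpath V (tail V a) (u @ [a])" "path_source V (tail V a) (u @ [a]) = tail V a"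
      using assms(1) by (auto simp: is_qpath_append path_source_append quiver_tail)
    ultimately show ?thesis using closed_wordI Cons by fastforce
  qed
qed (use assms in simp)

lemma closed_word_rotate: assumes "is_quiver V" "closed_word V w" shows "closed_word V (rotate k w)"
  by (induction k) (auto simp: assms closed_word_rotate1)

lemma csum_add: "csum V (x + y) w = csum V x w + csum V y w"
  and csum_diff: "csum V (x - y) w = csum V x w - csum V y w"
  and csum_scl: "csum V (scl c x) w = c * csum V x w"
  and csum_zero [simp]: "csum V 0 w = 0"
  by (simp_all add: csum_def sum.distrib sum_subtractf sum_distrib_left pointwise)

lemma csum_pow: assumes "x \<in> arrow_ideal_pow V n" "length w < n" shows "csum V x w = 0"
  unfolding csum_def using assms by (force simp: pow_iff intro!: sum.neutral)

lemma csum_rotate: "csum V x (rotate m w) = csum V x w"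
proof (cases "w = []")
  case False
  let ?n = "length w"
  from False have n: "?n > 0" by simp
  let ?g = "\<lambda>k. x (head V (hd (rotate k w)), rotate k w)"
  have *: "(\<Sum>k<?n. ?g ((k + m) mod ?n)) = (\<Sum>k<?n. ?g k)"
  proof (rule sum.reindex_bij_witness[of _ "\<lambda>k. (k + (?n - m mod ?n)) mod ?n" "\<lambda>k. (k + m) mod ?n"])
    have mn: "m mod ?n < ?n" using n by simp
    fix a assume "a \<in> {..<?n}"
    then have a: "a < ?n" by simp
    have "((a + m) mod ?n + (?n - m mod ?n)) mod ?n = (a + m mod ?n + (?n - m mod ?n)) mod ?n"
      by (metis mod_add_left_eq mod_add_right_eq)
    also have "\<dots> = a" using a mn by (simp add: add.assoc)
    finally show "((a + m) mod ?n + (?n - m mod ?n)) mod ?n = a" .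
    have "((a + (?n - m mod ?n)) mod ?n + m) mod ?n = (a + (?n - m mod ?n) + m mod ?n) mod ?n"
      by (metis mod_add_left_eq mod_add_right_eq)
    also have "\<dots> = a" using a mn by (simp add: add.assoc)
    finally show "((a + (?n - m mod ?n)) mod ?n + m) mod ?n = a" .
  qed (use n in auto)
  have "csum V x (rotate m w) = (\<Sum>k<?n. ?g ((k + m) mod ?n))"
    unfolding csum_def by (intro sum.cong) (auto simp: rotate_rotate rotate_conv_mod[of "_ + m"])
  then show ?thesis using * by (simp add: csum_def)
qed simp

text \<open>A term of the left side is a rotation \<open>k\<close> together with a cut
  \<open>j\<close>. Rotating further to the cut exchanges the two factors and gives the term
  \<open>((k + j) mod n, n - j)\<close> of the right side; this map is an involution.\<close>

lemma csum_conv_commute: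
  assumes V: "is_quiver V" and w: "closed_word V w"
  shows "csum V (conv V u v) w = csum V (conv V v u) w"
proof -
  let ?n = "length w"
  let ?r = "\<lambda>k. rotate k w"
  let ?i = "\<lambda>k. head V (hd (?r k))"
  define B where "B = (\<lambda>u v (k, j). u (?i k, take j (?r k)) * v (path_source V (?i k) (take j (?r k)), drop j (?r k)) :: complex)"
  have n: "?n > 0" using w by (auto simp: closed_word_def)
  have csum: "csum V (conv V u v) w = (\<Sum>p\<in>{..<?n}\<times>{..?n}. B u v p)" for u v
    unfolding csum_def conv_apply B_def by (simp add: sum.cartesian_product case_prod_beta)
  have key: "B v u ((k + j) mod ?n, ?n - j) = B u v (k, j)" if "k < ?n" "j \<le> ?n" for k j
  proof -
    let ?R = "?r k"
    have R: "is_qpath V (?i k) ?R" "path_source V (?i k) ?R = ?i k" "?R \<noteq> []"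
      using closed_word_rotate[OF V w, of k] by (auto simp: closed_word_def)
    have len: "length ?R = ?n" by simp
    have r': "?r ((k + j) mod ?n) = drop j ?R @ take j ?R"
    proof (cases "j = ?n")
      case True
      then show ?thesis using that by (simp add: rotate_conv_mod[of "_ + _"])
    next
      case False
      then have "j mod length ?R = j" using that by simp
      then have "rotate j ?R = drop j ?R @ take j ?R" by (simp add: rotate_drop_take)
      then show ?thesis by (simp add: rotate_rotate add.commute flip: rotate_conv_mod)
    qed
    have i': "?i ((k + j) mod ?n) = path_source V (?i k) (take j ?R)"
    proof (cases "j = ?n")
      case True
      then show ?thesis unfolding r' using R by simp
    next
      case False
      then have "drop j ?R \<noteq> []" using that by simp
      moreover have "is_qpath V (path_source V (?i k) (take j ?R)) (drop j ?R)"
        using R(1) is_qpath_take_drop[OF V] by blast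
      ultimately show ?thesis unfolding r' using qpath_head by fastforce
    qed
    have s: "path_source V (path_source V (?i k) (take j ?R)) (drop j ?R) = ?i k"
      using R(2) by (metis append_take_drop_id path_source_append)
    have "take (?n - j) (?r ((k + j) mod ?n)) = drop j ?R" "drop (?n - j) (?r ((k + j) mod ?n)) = take j ?R"
      unfolding r' using that by simp_all
    then show ?thesis unfolding B_def case_prod_conv i' using s by (simp add: mult.commute)
  qed
  have "(\<Sum>p\<in>{..<?n}\<times>{..?n}. B u v p) = (\<Sum>p\<in>{..<?n}\<times>{..?n}. B v u p)"
  proof (rule sum.reindex_bij_witness[of _ "\<lambda>(k, j). ((k + j) mod ?n, ?n - j)" "\<lambda>(k, j). ((k + j) mod ?n, ?n - j)"])
    fix a assume a: "a \<in> {..<?n}\<times>{..?n}"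
    obtain k j where kj: "a = (k, j)" "k < ?n" "j \<le> ?n" using a by auto
    have "((k + j) mod ?n + (?n - j)) mod ?n = k"
      unfolding mod_add_left_eq using kj by simp
    then show "(case (case a of (k, j) \<Rightarrow> ((k + j) mod ?n, ?n - j)) of (k, j) \<Rightarrow> ((k + j) mod ?n, ?n - j)) = a"
      using kj by simp
    then show "(case (case a of (k, j) \<Rightarrow> ((k + j) mod ?n, ?n - j)) of (k, j) \<Rightarrow> ((k + j) mod ?n, ?n - j)) = a" .
    show "(case a of (k, j) \<Rightarrow> ((k + j) mod ?n, ?n - j)) \<in> {..<?n}\<times>{..?n}" using kj n by simp
    then show "(case a of (k, j) \<Rightarrow> ((k + j) mod ?n, ?n - j)) \<in> {..<?n}\<times>{..?n}" .
    show "B v u (case a of (k, j) \<Rightarrow> ((k + j) mod ?n, ?n - j)) = B u v a" using key kj by simp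
  qed
  then show ?thesis by (simp add: csum)
qed

text \<open>A cyclic sum involves words of one length only, so it passes from commutators to their
  closure.\<close>

lemma cycz_csum:
  assumes V: "is_quiver V" and x: "x \<in> cycz V"
  shows "x (i, []) = 0" "closed_word V w \<Longrightarrow> csum V x w = 0"
proof -
  have comm: "y (i, []) = 0 \<and> (closed_word V w \<longrightarrow> csum V y w = 0)" if "y \<in> commutator_space V" for y i w
    using V that
  proof (induction rule: comm_induct)
    case (gen x y)
    have "(conv V x y - conv V y x) (i, []) = 0" by (simp add: conv_apply pointwise)
    moreover have "closed_word V w \<Longrightarrow> csum V (conv V x y - conv V y x) w = 0"
      using csum_conv_commute[OF V, of w x y] by (simp add: csum_diff)
    ultimately show ?case by blast
  next
    case zero
    then show ?case using csum_zero[of V w] by (simp add: zero_fun_def)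
  next
    case (add x y)
    then have "closed_word V w \<Longrightarrow> csum V (x + y) w = 0" "(x + y) (i, []) = 0"
      by (simp_all add: csum_add pointwise)
    then show ?case by blast
  qed
  obtain y where y: "y \<in> commutator_space V" "x - y \<in> arrow_ideal_pow V (Suc 0)" using x unfolding cycz_iff by blast
  have "(x - y) (i, []) = 0" using y(2) by (force simp: pow_iff)
  then show "x (i, []) = 0" using comm[OF y(1)] by (simp add: pointwise)
  obtain y where y: "y \<in> commutator_space V" "x - y \<in> arrow_ideal_pow V (Suc (length w))" using x unfolding cycz_iff by blast
  have "csum V (x - y) w = 0" by (rule csum_pow[OF y(2)]) simp
  then show "csum V x w = 0" if "closed_word V w" using comm[OF y(1)] that by (simp add: csum_diff)
qed

text \<open>Projection to the rotation-invariant representative of a cyclic class. It keeps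
  homogeneity and order and removes all open paths, and is used to normalise potentials.\<close>

definition cavg :: "('v, 'a) quiver \<Rightarrow> ('v, 'a) series \<Rightarrow> ('v, 'a) series" where
  "cavg V x = (\<lambda>(i, w). if closed_word V w \<and> i = head V (hd w) then csum V x w / of_nat (length w) else 0)"

lemma clin_cavg: "clin V V (cavg V)"
  unfolding clin_def
proof (intro conjI ballI allI)
  show "cavg V (x + y) = cavg V x + cavg V y" for x y
    by (auto simp: cavg_def fun_eq_iff pointwise csum_add add_divide_distrib)
  show "cavg V (scl c x) = scl c (cavg V x)" for c x
    by (auto simp: cavg_def fun_eq_iff pointwise csum_scl)
  fix n x assume x: "x \<in> arrow_ideal_pow V n"
  show "cavg V x \<in> arrow_ideal_pow V n"
    unfolding pow_iff car_iff
  proof (intro conjI allI impI)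
    fix i w assume nz: "cavg V x (i, w) \<noteq> 0"
    then show "is_qpath V i w" by (auto simp: cavg_def closed_word_def split: if_splits)
    have "csum V x w \<noteq> 0" using nz by (auto simp: cavg_def split: if_splits)
    then show "n \<le> length w" using csum_pow[OF x] by (meson not_le)
  qed
qed

lemma csum_cavg: assumes "is_quiver V" "closed_word V w" shows "csum V (cavg V x) w = csum V x w"
proof -
  have "csum V (cavg V x) w = (\<Sum>k<length w. csum V x w / of_nat (length w))"
    unfolding csum_def[of V "cavg V x"] using closed_word_rotate[OF assms]
    by (intro sum.cong) (auto simp: cavg_def csum_rotate)
  then show ?thesis using assms(2) by (simp add: closed_word_def)
qed

lemma cavg_path_elem:
  assumes V: "is_quiver V" and w: "closed_word V w"
  shows "cavg V (path_elem (head V (hd w), w)) =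
    scl (1 / of_nat (length w)) (fsum (\<lambda>k. path_elem (head V (hd (rotate k w)), rotate k w)) {..<length w})"
proof (rule ext, clarify)
  fix j v
  let ?n = "length w"
  have n: "?n > 0" using w by (auto simp: closed_word_def)
  show "cavg V (path_elem (head V (hd w), w)) (j, v) =
    scl (1 / of_nat ?n) (fsum (\<lambda>k. path_elem (head V (hd (rotate k w)), rotate k w)) {..<?n}) (j, v)"
  proof (cases "closed_word V v \<and> j = head V (hd v) \<and> length v = ?n")
    case True
    \<comment> \<open>The reduction mod \<open>n\<close> serves \<open>k = 0\<close>, where the
      inverse index has to be \<open>0\<close> instead of \<open>n\<close> to stay in range.\<close>
    have eq: "rotate k v = w \<longleftrightarrow> rotate ((?n - k) mod ?n) w = v" if "k < ?n" for k
    proof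
      assume "rotate k v = w"
      then have "rotate ((?n - k) mod ?n) w = rotate ((?n - k) + k) v" using True
        by (metis rotate_rotate rotate_conv_mod length_rotate)
      then show "rotate ((?n - k) mod ?n) w = v" using that True by simp
    next
      assume "rotate ((?n - k) mod ?n) w = v"
      then have "rotate k v = rotate (k + (?n - k)) w"
        by (metis rotate_rotate rotate_conv_mod)
      then show "rotate k v = w" using that by simp
    qed
    have "csum V (path_elem (head V (hd w), w)) v = (\<Sum>k<?n. if rotate k v = w then 1 else 0)"
      unfolding csum_def using True by (intro sum.cong) (auto simp: path_elem_apply)
    also have "\<dots> = (\<Sum>k<?n. if rotate k w = v then 1 else 0)"
    proof (rule sum.reindex_bij_witness[of _ "\<lambda>k. (?n - k) mod ?n" "\<lambda>k. (?n - k) mod ?n"])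
      fix k assume "k \<in> {..<?n}"
      then have k: "k < ?n" by simp
      show "(?n - (?n - k) mod ?n) mod ?n = k" using k by (cases "k = 0") auto
      then show "(?n - (?n - k) mod ?n) mod ?n = k" .
      show "(?n - k) mod ?n \<in> {..<?n}" using n by simp
      then show "(?n - k) mod ?n \<in> {..<?n}" .
      show "(if rotate ((?n - k) mod ?n) w = v then 1 else 0) = (if rotate k v = w then 1 else 0 :: complex)"
        by (simp only: eq[OF k])
    qed
    also have "\<dots> = (\<Sum>k<?n. path_elem (head V (hd (rotate k w)), rotate k w) (j, v))"
      using True by (intro sum.cong) (auto simp: path_elem_apply)
    finally show ?thesis using True by (simp add: cavg_def fsum_apply pointwise)
  next
    case False
    have 1: "path_elem (head V (hd (rotate k w)), rotate k w) (j, v) = 0" for k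
      using False closed_word_rotate[OF V w, of k] by (auto simp: path_elem_apply)
    have "csum V (path_elem (head V (hd w), w)) v = 0" if "length v \<noteq> ?n"
      using that by (auto simp: csum_def path_elem_apply intro!: sum.neutral)
    then show ?thesis using False by (auto simp: cavg_def fsum_apply pointwise 1)
  qed
qed

text \<open>Cyclic sums detect the closed commutator space. A closed path differs from its average
  by commutators \<open>u v - v u\<close>, one for each rotation; an open path is a commutator with
  an end idempotent; and a truncation with vanishing sums has average zero, so it equals its own
  difference to the average.\<close>

lemma cycz_iff_csum:
  assumes V: "is_quiver V" and x: "x \<in> car V"
  shows "x \<in> cycz V \<longleftrightarrow> (\<forall>i. x (i, []) = 0) \<and> (\<forall>w. closed_word V w \<longrightarrow> csum V x w = 0)"
proof
  assume "x \<in> cycz V"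
  then show "(\<forall>i. x (i, []) = 0) \<and> (\<forall>w. closed_word V w \<longrightarrow> csum V x w = 0)"
    using cycz_csum[OF V] by blast
next
  assume z: "(\<forall>i. x (i, []) = 0) \<and> (\<forall>w. closed_word V w \<longrightarrow> csum V x w = 0)"
  have T: "clin V V (\<lambda>x. x - cavg V x)" by (rule clin_diff_fun[OF clin_id clin_cavg])
  have path: "path_elem (i, w) - cavg V (path_elem (i, w)) \<in> commutator_space V" if w: "is_qpath V i w" "w \<noteq> []" for i w
  proof (cases "closed_word V w")
    case True
    let ?n = "length w"
    have i: "i = head V (hd w)" using qpath_head[OF w] by simp
    have n: "?n > 0" using w by simp
    have src: "path_source V i w = i" using True i by (auto simp: closed_word_def)
    have "path_elem (i, w) - cavg V (path_elem (i, w)) =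
      scl (1 / of_nat ?n) (fsum (\<lambda>k. path_elem (i, w) - path_elem (head V (hd (rotate k w)), rotate k w)) {..<?n})"
      unfolding i cavg_path_elem[OF V True] using n
      by (auto simp: fun_eq_iff pointwise fsum_apply pointwise sum_subtractf right_diff_distrib)
    also have "\<dots> \<in> commutator_space V"
    proof (intro comm_scl[OF V] comm_fsum)
      fix k assume "k \<in> {..<?n}"
      then have k: "k < ?n" by simp
      let ?u = "take k w" and ?v = "drop k w"
      let ?j = "path_source V i ?u"
      have p: "is_qpath V i ?u" "is_qpath V ?j ?v" using w(1) is_qpath_take_drop[OF V] by blast+
      have s: "path_source V ?j ?v = i" using src by (metis append_take_drop_id path_source_append)
      have "?v \<noteq> []" using k by simp
      then have j: "head V (hd ?v) = ?j" using qpath_head[OF p(2)] by simp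
      have rot: "rotate k w = ?v @ ?u" using k by (simp add: rotate_drop_take)
      have "path_elem (i, w) - path_elem (head V (hd (rotate k w)), rotate k w) =
        conv V (path_elem (i, ?u)) (path_elem (?j, ?v)) - conv V (path_elem (?j, ?v)) (path_elem (i, ?u))"
        using rot j s \<open>?v \<noteq> []\<close> by (simp add: conv_path_elem)
      then show "path_elem (i, w) - path_elem (head V (hd (rotate k w)), rotate k w) \<in> commutator_space V"
        using comm_gen[OF V path_elem_car[OF p(1)] path_elem_car[OF p(2)]] by simp
    qed
    finally show ?thesis .
  next
    case False
    have src: "path_source V i w \<noteq> i" using False closed_wordI[OF w] by blast
    have 0: "cavg V (path_elem (i, w)) = 0"
    proof -
      have "csum V (path_elem (i, w)) v = 0" if v: "closed_word V v" for v
      proof -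
        have "rotate k v \<noteq> w" for k using closed_word_rotate[OF V v, of k] False by auto
        then show ?thesis by (auto simp: csum_def path_elem_apply intro!: sum.neutral)
      qed
      then show ?thesis by (auto simp: cavg_def fun_eq_iff pointwise)
    qed
    have i: "i \<in> verts V" using is_qpath_verts[OF V w(1)] .
    have "path_elem (i, w) = conv V (idem i) (path_elem (i, w)) - conv V (path_elem (i, w)) (idem i)"
      using src by (simp add: conv_path_elem)
    also have "\<dots> \<in> commutator_space V" by (rule comm_gen[OF V idem_car[OF i] path_elem_car[OF w(1)]])
    finally show ?thesis using 0 by simp
  qed
  show "x \<in> cycz V"
    unfolding cycz_iff
  proof (intro conjI allI)
    fix n
    let ?y = "trunc n x"
    have y: "?y \<in> car V" by (rule trunc_car[OF x])
    have "csum V ?y w = 0" if "closed_word V w" for w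
    proof (cases "length w \<le> n")
      case True
      then have "csum V ?y w = csum V x w" by (auto simp: csum_def intro!: sum.cong)
      then show ?thesis using z that by simp
    next
      case False
      then show ?thesis by (auto simp: csum_def intro!: sum.neutral)
    qed
    then have "cavg V ?y = 0" by (auto simp: cavg_def fun_eq_iff pointwise)
    then have "?y = ?y - cavg V ?y" by simp
    also have "\<dots> = fsum (\<lambda>p. scl (x p) (path_elem p - cavg V (path_elem p))) (paths V n)"
    proof -
      have "?y - cavg V ?y = fsum (\<lambda>p. scl (x p) (path_elem p) - cavg V (scl (x p) (path_elem p))) (paths V n)"
        unfolding trunc_sum[OF V x] by (rule clin_fsum[OF T]) (auto simp: paths_def)
      also have "\<dots> = fsum (\<lambda>p. scl (x p) (path_elem p - cavg V (path_elem p))) (paths V n)"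
        unfolding fsum_def
        by (rule ext, rule sum.cong) (auto simp: paths_def clin_scl[OF clin_cavg] path_elem_car right_diff_distrib pointwise)
      finally show ?thesis .
    qed
    also have "\<dots> \<in> commutator_space V"
    proof (rule comm_fsum)
      fix p assume p: "p \<in> paths V n"
      obtain i w where iw: "p = (i, w)" "is_qpath V i w" using p by (auto simp: paths_def)
      show "scl (x p) (path_elem p - cavg V (path_elem p)) \<in> commutator_space V"
      proof (cases "w = []")
        case True
        then show ?thesis using z iw by (simp add: comm_zero)
      next
        case False
        then show ?thesis using path[OF iw(2)] iw(1) comm_scl[OF V] by blast
      qed
    qed
    finally have "?y \<in> commutator_space V" .
    moreover have "x - ?y \<in> arrow_ideal_pow V n" by (rule pow_mono[OF trunc_rest[OF x]]) simp
    ultimately show "\<exists>y\<in>commutator_space V. x - y \<in> arrow_ideal_pow V n" by blast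
  qed (rule x)
qed

lemma cyceq_iff:
  assumes "is_quiver V"
  shows "cyceq V x y \<longleftrightarrow> x \<in> car V \<and> y \<in> car V \<and> (\<forall>i. x (i, []) = y (i, [])) \<and>
    (\<forall>w. closed_word V w \<longrightarrow> csum V x w = csum V y w)"
proof (cases "x \<in> car V \<and> y \<in> car V")
  case True
  then have "x - y \<in> car V" by blast
  with True show ?thesis unfolding cyceq_def by (simp add: cycz_iff_csum[OF assms] csum_diff minus_apply)
qed (auto simp: cyceq_def)

lemma cyceq_cavg:
  assumes "is_quiver V" "x \<in> car V" "\<And>i. x (i, []) = 0" shows "cyceq V (cavg V x) x"
  using assms clin_car[OF clin_cavg assms(2)]
  by (auto simp: cyceq_iff csum_cavg) (simp add: cavg_def closed_word_def)

subsection \<open>Right-equivalences as isomorphisms of complete algebras\<close>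

definition qiso :: "('v, 'a) quiver \<Rightarrow> ('v, 'b) quiver \<Rightarrow> (('v, 'a) series \<Rightarrow> ('v, 'b) series) \<Rightarrow>
    (('v, 'b) series \<Rightarrow> ('v, 'a) series) \<Rightarrow> bool" where
  "qiso V V' \<phi> \<psi> \<longleftrightarrow> is_quiver V \<and> is_quiver V' \<and> chom V V' \<phi> \<and> chom V' V \<psi> \<and>
     (\<forall>x\<in>car V. \<psi> (\<phi> x) = x) \<and> (\<forall>y\<in>car V'. \<phi> (\<psi> y) = y)"

lemma qiso_sym: "qiso V V' \<phi> \<psi> \<Longrightarrow> qiso V' V \<psi> \<phi>"
  by (auto simp: qiso_def)

lemma qisoD:
  assumes "qiso V V' \<phi> \<psi>"
  shows "is_quiver V" "is_quiver V'" "chom V V' \<phi>" "chom V' V \<psi>"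
    "x \<in> car V \<Longrightarrow> \<psi> (\<phi> x) = x" "y \<in> car V' \<Longrightarrow> \<phi> (\<psi> y) = y"
  using assms by (auto simp: qiso_def)

lemma qisoI_arrs:
  assumes V: "is_quiver V" "is_quiver V'" and \<phi>: "chom V V' \<phi>" and \<psi>: "chom V' V \<psi>"
    and 1: "\<And>a. a \<in> arcs V \<Longrightarrow> \<psi> (\<phi> (arr V a)) = arr V a"
    and 2: "\<And>a. a \<in> arcs V' \<Longrightarrow> \<phi> (\<psi> (arr V' a)) = arr V' a"
  shows "qiso V V' \<phi> \<psi>"
  unfolding qiso_def
  using V \<phi> \<psi> chom_eqI[OF V(1) chom_comp[OF \<phi> \<psi>] chom_id _ 1] chom_eqI[OF V(2) chom_comp[OF \<psi> \<phi>] chom_id _ 2]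
  by blast

lemma qiso_comp:
  assumes "qiso V V' f f'" "qiso V' V'' g g'"
  shows "qiso V V'' (\<lambda>x. g (f x)) (\<lambda>x. f' (g' x))"
  unfolding qiso_def
proof (intro conjI ballI)
  show "chom V V'' (\<lambda>x. g (f x))" "chom V'' V (\<lambda>x. f' (g' x))"
    using assms chom_comp by (auto simp: qiso_def)
  show "f' (g' (g (f x))) = x" if "x \<in> car V" for x
    using qisoD(5)[OF assms(2) chom_car[OF qisoD(3)[OF assms(1)] that]] qisoD(5)[OF assms(1) that] by simp
  show "g (f (f' (g' x))) = x" if "x \<in> car V''" for x
    using qisoD(6)[OF assms(1) chom_car[OF qisoD(4)[OF assms(2)] that]] qisoD(6)[OF assms(2) that] by simp
qed (use assms in \<open>auto simp: qiso_def\<close>)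

lemma qiso_unipotent:
  assumes V: "is_quiver V" and T: "chom V V T"
    and uni: "\<And>n x. x \<in> arrow_ideal_pow V n \<Longrightarrow> T x - x \<in> arrow_ideal_pow V (Suc n)"
  obtains S where "qiso V V T S"
proof -
  obtain S where S: "clin V V S" "\<And>x. x \<in> car V \<Longrightarrow> S (T x) = x" "\<And>x. x \<in> car V \<Longrightarrow> T (S x) = x"
    using unipotent_inverse[OF V chom_clin[OF T] uni] by blast
  have "S (conv V x y) = conv V (S x) (S y)" if "x \<in> car V" "y \<in> car V" for x y
  proof -
    have "S (conv V x y) = S (conv V (T (S x)) (T (S y)))" using that S(3) by simp
    also have "\<dots> = S (T (conv V (S x) (S y)))"
      using that by (simp add: chom_conv[OF T] clin_car[OF S(1)])
    also have "\<dots> = conv V (S x) (S y)"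
      by (rule S(2)) (use that V in \<open>auto intro!: conv_car clin_car[OF S(1)]\<close>)
    finally show ?thesis .
  qed
  moreover have "S (idem i) = idem i" if "i \<in> verts V" for i
    using S(2)[OF idem_car[OF that]] chom_idem[OF T that] by simp
  ultimately have "chom V V S" using S(1) by (simp add: chom_def)
  then show thesis using that V T S by (auto simp: qiso_def)
qed

text \<open>Right-equivalences are given as abstract algebra isomorphisms; automatic continuity is
  applied both to the map and to its set-theoretic inverse.\<close>

lemma ring_iso_chom:
  assumes V: "is_quiver V" "is_quiver V'" and verts: "verts V' = verts V"
    and \<phi>: "\<phi> \<in> ring_iso (path_algebra V) (path_algebra V')"
    and scl: "\<forall>c. \<forall>x\<in>car V. \<phi> (\<lambda>p. c * x p) = (\<lambda>p. c * \<phi> x p)"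
    and idem: "\<forall>i\<in>verts V. \<phi> (path_elem (i, [])) = path_elem (i, [])"
  shows "qiso V V' \<phi> (inv_into (car V) \<phi>)"
proof -
  let ?\<psi> = "inv_into (car V) \<phi>"
  have hom: "\<phi> \<in> ring_hom (path_algebra V) (path_algebra V')" and bij: "bij_betw \<phi> (car V) (car V')"
    using \<phi> by (auto simp: ring_iso_def)
  have add: "\<phi> (x + y) = \<phi> x + \<phi> y" if "x \<in> car V" "y \<in> car V" for x y
    using ring_hom_add[OF hom that] by simp
  have mult: "\<phi> (conv V x y) = conv V' (\<phi> x) (\<phi> y)" if "x \<in> car V" "y \<in> car V" for x y
    using ring_hom_mult[OF hom that] by simp
  have car: "\<phi> x \<in> car V'" if "x \<in> car V" for x using bij that by (auto simp: bij_betw_def)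
  have scl: "\<phi> (scl c x) = scl c (\<phi> x)" if "x \<in> car V" for c x
    using scl that by (simp add: scl_def)
  have 1: "?\<psi> (\<phi> x) = x" if "x \<in> car V" for x using bij_betw_inv_into_left[OF bij that] .
  have 2: "\<phi> (?\<psi> x) = x" if "x \<in> car V'" for x using bij_betw_inv_into_right[OF bij that] .
  have car': "?\<psi> x \<in> car V" if "x \<in> car V'" for x
    using bij_betw_inv_into[OF bij] that by (auto simp: bij_betw_def)
  have \<phi>: "chom V V' \<phi>"
    by (rule alg_hom_continuous[OF V verts]) (use car add scl mult idem in auto)
  have eq: "?\<psi> y = x" if "x \<in> car V" "\<phi> x = y" for x y using 1 that by auto
  have "chom V' V ?\<psi>"
  proof (rule alg_hom_continuous[OF V(2,1)])
    show "verts V = verts V'" using verts by simp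
    show "?\<psi> x \<in> car V" if "x \<in> car V'" for x using car' that .
    show "?\<psi> (x + y) = ?\<psi> x + ?\<psi> y" if "x \<in> car V'" "y \<in> car V'" for x y
      by (rule eq) (use that car' in \<open>auto simp: add 2\<close>)
    show "?\<psi> (scl c x) = scl c (?\<psi> x)" if "x \<in> car V'" for c x
      by (rule eq) (use that car' in \<open>auto simp: scl 2\<close>)
    show "?\<psi> (conv V' x y) = conv V (?\<psi> x) (?\<psi> y)" if "x \<in> car V'" "y \<in> car V'" for x y
      by (rule eq) (use that car' V in \<open>auto simp: mult 2\<close>)
    show "?\<psi> (path_elem (i, [])) = path_elem (i, [])" if "i \<in> verts V'" for i
      by (rule eq) (use that idem verts in auto)
  qed
  then show ?thesis using V \<phi> 1 2 by (simp add: qiso_def)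
qed

lemma right_equivalenceD:
  assumes "right_equivalence \<phi> (V, cyc_class V x) (V', W')" "is_quiver V" "is_quiver V'" "x \<in> car V"
  obtains \<psi> where "qiso V V' \<phi> \<psi>" "\<phi> x \<in> W'"
proof -
  have "qiso V V' \<phi> (inv_into (car V) \<phi>)"
    by (rule ring_iso_chom) (use assms in \<open>auto simp: right_equivalence_def\<close>)
  moreover have "x \<in> cyc_class V x" using assms(4) by (simp add: cyc_class_iff cyceq_refl)
  then have "\<phi> x \<in> W'" using assms(1) by (auto simp: right_equivalence_def)
  ultimately show thesis using that by blast
qed

lemma right_equivalenceI:
  assumes iso: "qiso V V' \<phi> \<psi>" and x: "x \<in> car V" and eq: "cyceq V' (\<phi> x) x'"
  shows "right_equivalence \<phi> (V, cyc_class V x) (V', cyc_class V' x')"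
proof -
  note V = qisoD(1,2)[OF iso] and \<phi> = qisoD(3)[OF iso] and \<psi> = qisoD(4)[OF iso]
  have x': "x' \<in> car V'" using eq by (simp add: cyceq_def)
  have bij: "bij_betw \<phi> (car V) (car V')"
    by (rule bij_betw_byWitness[where f' = \<psi>]) (use iso chom_car[OF \<phi>] chom_car[OF \<psi>] in \<open>auto simp: qiso_def\<close>)
  have "\<phi> \<in> ring_hom (path_algebra V) (path_algebra V')"
    by (rule ring_hom_memI)
       (use chom_car[OF \<phi>] chom_conv[OF \<phi>] clin_add[OF chom_clin[OF \<phi>]] chom_one[OF V \<phi>] in auto)
  then have ring_iso: "\<phi> \<in> ring_iso (path_algebra V) (path_algebra V')"
    using bij by (simp add: ring_iso_def)
  have img: "\<phi> ` cyc_class V x = cyc_class V' x'"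
  proof (intro equalityI subsetI)
    fix z assume "z \<in> \<phi> ` cyc_class V x"
    then obtain y where y: "z = \<phi> y" "cyceq V y x" using x by (auto simp: cyc_class_iff)
    then have "cyceq V' z x'" using cyceq_trans[OF cyceq_chom[OF V \<phi> y(2)] eq] by simp
    then show "z \<in> cyc_class V' x'" using x' by (simp add: cyc_class_iff)
  next
    fix z assume "z \<in> cyc_class V' x'"
    then have z: "cyceq V' z x'" using x' by (simp add: cyc_class_iff)
    have "cyceq V' z (\<phi> x)" using cyceq_trans[OF z cyceq_sym[OF V(2) eq]] .
    then have "cyceq V (\<psi> z) (\<psi> (\<phi> x))" by (rule cyceq_chom[OF V(2,1) \<psi>])
    then have "\<psi> z \<in> cyc_class V x" using x qisoD(5)[OF iso x] by (simp add: cyc_class_iff)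
    moreover have "z = \<phi> (\<psi> z)" using qisoD(6)[OF iso cyceq_car(1)[OF z]] by simp
    ultimately show "z \<in> \<phi> ` cyc_class V x" by blast
  qed
  show ?thesis
    unfolding right_equivalence_def case_prod_conv
    using chom_verts[OF \<phi>] ring_iso img clin_scl[OF chom_clin[OF \<phi>]] chom_idem[OF \<phi>]
    by (simp add: scl_def)
qed

lemma is_qpI: "is_quiver V \<Longrightarrow> x \<in> arrow_ideal_pow V 2 \<Longrightarrow> is_qp (V, cyc_class V x)"
  by (auto simp: is_qp_def)

lemma is_qpE:
  assumes "is_qp X" obtains V x where "X = (V, cyc_class V x)" "is_quiver V" "x \<in> arrow_ideal_pow V 2"
  using assms by (cases X) (auto simp: is_qp_def)

subsection \<open>Gradings\<close>

abbreviation deg :: "('a \<Rightarrow> int) \<Rightarrow> 'a list \<Rightarrow> int" where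
  "deg d w \<equiv> sum_list (map d w)"

lemma homogeneous_iff: "x \<in> homogeneous V d n \<longleftrightarrow> x \<in> car V \<and> (\<forall>i w. x (i, w) \<noteq> 0 \<longrightarrow> deg d w = n)"
  by (simp add: homogeneous_def)

lemma homogeneous_car: "x \<in> homogeneous V d n \<Longrightarrow> x \<in> car V"
  by (simp add: homogeneous_iff)

lemma homogeneous_conv:
  assumes "is_quiver V" "x \<in> homogeneous V d m" "y \<in> homogeneous V d n"
  shows "conv V x y \<in> homogeneous V d (m + n)"
  unfolding homogeneous_iff
proof (intro conjI allI impI)
  show "conv V x y \<in> car V" using assms by (auto dest: homogeneous_car)
  fix i w assume "conv V x y (i, w) \<noteq> 0"
  then show "deg d w = m + n"
    by (rule conv_nonzero) (use assms in \<open>auto simp: homogeneous_iff\<close>)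
qed

lemma homogeneous_path_elem: "is_qpath V i w \<Longrightarrow> deg d w = n \<Longrightarrow> path_elem (i, w) \<in> homogeneous V d n"
  by (auto simp: homogeneous_iff path_elem_apply)

lemma homogeneous_zero: "0 \<in> homogeneous V d n"
  by (auto simp: homogeneous_iff pointwise)

lemma homogeneous_scl: "x \<in> homogeneous V d n \<Longrightarrow> scl c x \<in> homogeneous V d n"
  by (auto simp: homogeneous_iff pointwise)

lemma homogeneous_add: assumes "x \<in> homogeneous V d n" "y \<in> homogeneous V d n" shows "x + y \<in> homogeneous V d n"
  unfolding homogeneous_iff
proof (intro conjI allI impI)
  fix i w assume "(x + y) (i, w) \<noteq> 0"
  then have "x (i, w) \<noteq> 0 \<or> y (i, w) \<noteq> 0" by (auto simp: pointwise)
  then show "deg d w = n" using assms by (auto simp: homogeneous_iff)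
qed (use assms in \<open>auto dest: homogeneous_car\<close>)

lemma homogeneous_diff: assumes "x \<in> homogeneous V d n" "y \<in> homogeneous V d n" shows "x - y \<in> homogeneous V d n"
  using homogeneous_add[OF assms(1) homogeneous_scl[OF assms(2), of "-1"]] by (simp add: scl_minus_one)

lemma deg_rotate: "deg d (rotate k w) = deg d w"
proof (induction k)
  case (Suc k)
  have "deg d (rotate1 v) = deg d v" for v by (cases v) auto
  then show ?case using Suc by simp
qed simp

lemma homogeneous_cavg: assumes "x \<in> homogeneous V d n" shows "cavg V x \<in> homogeneous V d n"
  unfolding homogeneous_iff
proof (intro conjI allI impI)
  show "cavg V x \<in> car V" by (rule clin_car[OF clin_cavg homogeneous_car[OF assms]])
  fix i w assume "cavg V x (i, w) \<noteq> 0"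
  then have "csum V x w \<noteq> 0" by (auto simp: cavg_def split: if_splits)
  then obtain k where "x (head V (hd (rotate k w)), rotate k w) \<noteq> 0"
    unfolding csum_def by (meson sum.not_neutral_contains_not_neutral)
  then have "deg d (rotate k w) = n" using assms by (auto simp: homogeneous_iff)
  then show "deg d w = n" by (simp add: deg_rotate)
qed

definition hproj :: "('a \<Rightarrow> int) \<Rightarrow> int \<Rightarrow> ('v, 'a) series \<Rightarrow> ('v, 'a) series" where
  "hproj d n x = (\<lambda>(i, w). if deg d w = n then x (i, w) else 0)"

lemma clin_hproj: "clin V V (hproj d n)"
  unfolding clin_def
proof (intro conjI ballI allI)
  show "hproj d n (x + y) = hproj d n x + hproj d n y" for x y
    by (auto simp: hproj_def fun_eq_iff pointwise)
  show "hproj d n (scl c x) = scl c (hproj d n x)" for c x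
    by (auto simp: hproj_def fun_eq_iff pointwise)
  show "hproj d n x \<in> arrow_ideal_pow V m" if "x \<in> arrow_ideal_pow V m" for m x
    using that by (auto simp: pow_iff car_iff hproj_def)
qed

lemma hproj_homogeneous: "x \<in> car V \<Longrightarrow> hproj d n x \<in> homogeneous V d n"
  by (auto simp: homogeneous_iff hproj_def car_iff split: if_splits)

lemma hproj_eq: "x \<in> homogeneous V d n \<Longrightarrow> hproj d n x = x"
  by (auto simp: homogeneous_iff hproj_def fun_eq_iff)

lemma hproj_eq_zero: "x \<in> homogeneous V d m \<Longrightarrow> m \<noteq> n \<Longrightarrow> hproj d n x = 0"
  by (auto simp: homogeneous_iff hproj_def fun_eq_iff pointwise)

lemma chom_graded_path:
  assumes V: "is_quiver V" "is_quiver V'" and h: "chom V V' h"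
    and g: "\<And>a. a \<in> arcs V \<Longrightarrow> h (arr V a) \<in> homogeneous V' d' (d a)" and w: "is_qpath V i w"
  shows "h (path_elem (i, w)) \<in> homogeneous V' d' (deg d w)"
  using w
proof (induction w arbitrary: i)
  case Nil
  then show ?case using chom_verts[OF h] by (simp add: chom_idem[OF h] homogeneous_path_elem)
next
  case (Cons a w)
  then have 1: "arr V a \<in> car V" "path_elem (tail V a, w) \<in> car V" using V by (auto simp: arr_car)
  have "h (path_elem (i, a # w)) = conv V' (h (arr V a)) (h (path_elem (tail V a, w)))"
    unfolding path_elem_Cons[OF Cons.prems] by (rule chom_conv[OF h 1])
  also have "\<dots> \<in> homogeneous V' d' (d a + deg d w)"
    by (rule homogeneous_conv[OF V(2)]) (use Cons g in auto)
  finally show ?case by simp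
qed

lemma chom_hproj:
  assumes V: "is_quiver V" "is_quiver V'" and h: "chom V V' h"
    and g: "\<And>a. a \<in> arcs V \<Longrightarrow> h (arr V a) \<in> homogeneous V' d' (d a)" and x: "x \<in> car V"
  shows "h (hproj d n x) = hproj d' n (h x)"
proof (rule clin_eqI[OF V(1) clin_comp[OF clin_hproj chom_clin[OF h]] clin_comp[OF chom_clin[OF h] clin_hproj] x])
  fix i w assume w: "is_qpath V i w"
  have h1: "h (path_elem (i, w)) \<in> homogeneous V' d' (deg d w)" by (rule chom_graded_path[OF V h g w])
  have p1: "path_elem (i, w) \<in> homogeneous V d (deg d w)" using w by (rule homogeneous_path_elem) simp
  show "h (hproj d n (path_elem (i, w))) = hproj d' n (h (path_elem (i, w)))"
    by (cases "deg d w = n")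
      (use hproj_eq[OF h1] hproj_eq[OF p1] hproj_eq_zero[OF h1] hproj_eq_zero[OF p1] clin_zero[OF chom_clin[OF h]] in auto)
qed

lemma chom_graded:
  assumes V: "is_quiver V" "is_quiver V'" and h: "chom V V' h"
    and g: "\<And>a. a \<in> arcs V \<Longrightarrow> h (arr V a) \<in> homogeneous V' d' (d a)" and x: "x \<in> homogeneous V d n"
  shows "h x \<in> homogeneous V' d' n"
  using chom_hproj[OF V h g homogeneous_car[OF x], of n] hproj_eq[OF x]
    hproj_homogeneous[OF chom_car[OF h homogeneous_car[OF x]], of d' n] by simp

text \<open>\<open>\<phi>\<close> commutes with the projections to homogeneous parts, because it
  maps arrows to homogeneous elements; injectivity then forces the preimage of a homogeneous element
  to equal its own projection.\<close>

lemma qiso_graded_inverse: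
  assumes iso: "qiso V V' \<phi> \<psi>"
    and g: "\<And>a. a \<in> arcs V \<Longrightarrow> \<phi> (arr V a) \<in> homogeneous V' d' (d a)" and y: "y \<in> homogeneous V' d' n"
  shows "\<psi> y \<in> homogeneous V d n"
proof -
  note V = qisoD(1,2)[OF iso] and \<phi> = qisoD(3)[OF iso] and \<psi> = qisoD(4)[OF iso]
  have y': "\<psi> y \<in> car V" by (rule chom_car[OF \<psi> homogeneous_car[OF y]])
  have h: "hproj d n (\<psi> y) \<in> homogeneous V d n" by (rule hproj_homogeneous[OF y'])
  have "\<phi> (hproj d n (\<psi> y)) = y"
    using chom_hproj[OF V \<phi> g y', of n] qisoD(6)[OF iso homogeneous_car[OF y]] hproj_eq[OF y] by simp
  then have "\<psi> y = hproj d n (\<psi> y)" using qisoD(5)[OF iso homogeneous_car[OF h]] by simp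
  then show ?thesis using h by simp
qed

lemma graded_right_equivalenceI:
  assumes iso: "qiso V V' \<phi> \<psi>" and x: "x \<in> car V" and eq: "cyceq V' (\<phi> x) x'"
    and g: "\<And>a. a \<in> arcs V \<Longrightarrow> \<phi> (arr V a) \<in> homogeneous V' d' (d a)"
  shows "graded_right_equivalence \<phi> ((V, cyc_class V x), d) ((V', cyc_class V' x'), d')"
proof -
  note V = qisoD(1,2)[OF iso] and \<phi> = qisoD(3)[OF iso]
  have "\<phi> ` homogeneous V d n = homogeneous V' d' n" for n
  proof (intro equalityI subsetI)
    fix y assume y: "y \<in> homogeneous V' d' n"
    then have "\<psi> y \<in> homogeneous V d n" using qiso_graded_inverse[OF iso g] by blast
    moreover have "y = \<phi> (\<psi> y)" using qisoD(6)[OF iso homogeneous_car[OF y]] by simp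
    ultimately show "y \<in> \<phi> ` homogeneous V d n" by blast
  qed (use chom_graded[OF V \<phi> g] in blast)
  then show ?thesis
    unfolding graded_right_equivalence_def case_prod_conv
    using right_equivalenceI[OF iso x eq] by simp
qed

lemma is_graded_qpI:
  assumes "is_quiver V" "x \<in> arrow_ideal_pow V 2" "x \<in> homogeneous V d 1"
  shows "is_graded_qp ((V, cyc_class V x), d)"
  using assms by (auto simp: is_graded_qp_def is_qp_def)

text \<open>The definition supplies one representative in the square of the arrow ideal and possibly
  another that is homogeneous. Averaging the homogeneous one achieves both: only closed words
  survive, and without loops these have length at least two.\<close>

lemma is_graded_qpE:
  assumes "is_graded_qp Y"
  obtains V d x where "Y = ((V, cyc_class V x), d)" "is_quiver V" "x \<in> arrow_ideal_pow V 2" "x \<in> homogeneous V d 1"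
proof -
  obtain V W d where Y: "Y = ((V, W), d)" by (metis surj_pair)
  then obtain y x where V: "is_quiver V" and y: "W = cyc_class V y" "y \<in> arrow_ideal_pow V 2"
    and x: "W = cyc_class V x" "x \<in> homogeneous V d 1"
    using assms by (auto simp: is_graded_qp_def is_qp_def)
  let ?z = "cavg V x"
  have "cyceq V x y" using x y cyc_class_eq_iff[OF V homogeneous_car pow_car] by metis
  have x0: "x (i, []) = 0" for i using x(2) by (force simp: homogeneous_iff)
  have zh: "?z \<in> homogeneous V d 1" by (rule homogeneous_cavg[OF x(2)])
  have "?z (i, w) = 0" if len: "length w < 2" for i w
  proof (rule ccontr)
    assume "?z (i, w) \<noteq> 0"
    then have w: "closed_word V w" by (auto simp: cavg_def split: if_splits)
    then obtain a where "w = [a]" using len by (cases w) (auto simp: closed_word_def)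
    then show False using w quiver_loopfree[OF V, of a] by (auto simp: closed_word_def)
  qed
  then have "?z \<in> arrow_ideal_pow V 2"
    unfolding pow_iff using homogeneous_car[OF zh] by (meson not_le)
  moreover have "cyc_class V ?z = W"
    using cyceq_cavg[OF V homogeneous_car[OF x(2)] x0] cyc_class_eq_iff[OF V homogeneous_car[OF zh] homogeneous_car[OF x(2)]] x(1)
    by simp
  ultimately show thesis using that[of V ?z d] Y V zh by simp
qed

subsection \<open>Linear and quadratic parts\<close>

text \<open>Row \<open>a\<close> lists the linear terms of the image of \<open>a\<close>; composites
  become matrix products in the order of application.\<close>

definition lin :: "('v, 'a) quiver \<Rightarrow> ('v, 'b) quiver \<Rightarrow> (('v, 'a) series \<Rightarrow> ('v, 'b) series) \<Rightarrow> 'a \<Rightarrow> 'b \<Rightarrow> complex" where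
  "lin V V' h a b = h (arr V a) (head V' b, [b])"

lemma chom_arr_pow: "is_quiver V \<Longrightarrow> chom V V' h \<Longrightarrow> a \<in> arcs V \<Longrightarrow> h (arr V a) \<in> arrow_ideal_pow V' (Suc 0)"
  by (rule clin_pow[OF chom_clin arr_pow])

lemma chom_arr_between:
  "is_quiver V \<Longrightarrow> chom V V' h \<Longrightarrow> a \<in> arcs V \<Longrightarrow> h (arr V a) \<in> between V' (head V a) (tail V a)"
  by (rule chom_between) (auto simp: quiver_head quiver_tail arr_between)

lemma lin_parallel:
  assumes "is_quiver V" "chom V V' h" "a \<in> arcs V" "lin V V' h a b \<noteq> 0"
  shows "b \<in> arcs V'" "head V' b = head V a" "tail V' b = tail V a"
  using between_D[OF chom_arr_between[OF assms(1-3)]] assms(4) unfolding lin_def by fastforce+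

lemma sum_over_paths:
  assumes V: "is_quiver V" and x: "x \<in> arrow_ideal_pow V n"
  shows "(\<Sum>p\<in>paths V n. x p * F p) =
    (\<Sum>(i, w)\<in>{(i, w). is_qpath V i w \<and> length w = n}. x (i, w) * F (i, w))"
proof -
  have "(\<Sum>p\<in>paths V n. x p * F p) = (\<Sum>p\<in>{(i, w). is_qpath V i w \<and> length w = n}. x p * F p)"
  proof (rule sum.mono_neutral_right[OF finite_paths[OF V]])
    show "\<forall>p\<in>paths V n - {(i, w). is_qpath V i w \<and> length w = n}. x p * F p = 0"
    proof
      fix p assume p: "p \<in> paths V n - {(i, w). is_qpath V i w \<and> length w = n}"
      obtain i w where iw: "p = (i, w)" by (cases p)
      then have "length w < n" using p by (auto simp: paths_def)
      then show "x p * F p = 0" using x iw by (force simp: pow_iff)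
    qed
  qed (auto simp: paths_def)
  then show ?thesis by (simp add: case_prod_beta)
qed

lemma clin_lin_expand:
  assumes V: "is_quiver V" and h: "clin V V' h" and y: "y \<in> arrow_ideal_pow V (Suc 0)"
  shows "h y (i, [c]) = (\<Sum>a\<in>arcs V. y (head V a, [a]) * h (arr V a) (i, [c]))"
proof -
  have "h y (i, [c]) = (\<Sum>p\<in>paths V (Suc 0). y p * h (path_elem p) (i, [c]))"
    by (rule clin_expand[OF V h pow_car[OF y]]) simp
  also have "\<dots> = (\<Sum>(j, w)\<in>{(j, w). is_qpath V j w \<and> length w = Suc 0}. y (j, w) * h (path_elem (j, w)) (i, [c]))"
    by (rule sum_over_paths[OF V y])
  also have "\<dots> = (\<Sum>a\<in>arcs V. y (head V a, [a]) * h (arr V a) (i, [c]))"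
    by (rule sum.reindex_bij_witness[of _ "\<lambda>a. (head V a, [a])" "\<lambda>(j, w). hd w"])
       (auto simp: length_Suc_conv quiver_tail[OF V])
  finally show ?thesis .
qed

lemma lin_comp:
  assumes V: "is_quiver V" "is_quiver V'" and g: "chom V V' g" and h: "chom V' V'' h" and a: "a \<in> arcs V"
  shows "lin V V'' (\<lambda>x. h (g x)) a c = (\<Sum>b\<in>arcs V'. lin V V' g a b * lin V' V'' h b c)"
  unfolding lin_def by (rule clin_lin_expand[OF V(2) chom_clin[OF h] chom_arr_pow[OF V(1) g a]])

lemma lin_id: "lin V V (\<lambda>x. x) a b = (if a = b then 1 else 0)"
  by (auto simp: lin_def path_elem_apply)

lemma lin_id_on:
  assumes V: "is_quiver V" "is_quiver V'" and g: "chom V V' g" and h: "chom V' V h" and a: "a \<in> arcs V"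
    and hg: "\<And>x. x \<in> car V \<Longrightarrow> h (g x) = x"
  shows "(\<Sum>b\<in>arcs V'. lin V V' g a b * lin V' V h b c) = (if a = c then 1 else 0)"
proof -
  have "lin V V (\<lambda>x. h (g x)) a c = (if a = c then 1 else 0)"
    using hg[OF arr_car[OF V(1) a]] by (simp add: lin_def path_elem_apply)
  then show ?thesis using lin_comp[OF V g h a, of c] by simp
qed

text \<open>The symmetric matrix of the quadratic part, independent of the cyclic representative;
  only pairs of opposite arrows can have an entry.\<close>

definition quad :: "('v, 'a) quiver \<Rightarrow> ('v, 'a) series \<Rightarrow> 'a \<Rightarrow> 'a \<Rightarrow> complex" where
  "quad V x a b = (if closed_word V [a, b] then csum V x [a, b] else 0)"

lemma closed_word_2: "is_quiver V \<Longrightarrow> closed_word V [a, b] \<longleftrightarrow>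
    a \<in> arcs V \<and> b \<in> arcs V \<and> head V b = tail V a \<and> tail V b = head V a"
  by (auto simp: closed_word_def quiver_head quiver_tail)

lemma csum_2: "csum V x [a, b] = x (head V a, [a, b]) + x (head V b, [b, a])"
  by (simp add: csum_def numeral_2_eq_2)

lemma quad_sym: "is_quiver V \<Longrightarrow> quad V x a b = quad V x b a"
  by (auto simp: quad_def closed_word_2 csum_2)

lemma quad_cyceq: "is_quiver V \<Longrightarrow> cyceq V x y \<Longrightarrow> quad V x a b = quad V y a b"
  by (auto simp: quad_def cyceq_iff)

lemma quad_add: "quad V (x + y) a b = quad V x a b + quad V y a b"
  by (simp add: quad_def csum_add)

text \<open>Images of arrows have no constant term: longer paths cannot reach a two-letter word, and
  a two-letter path reaches it only with one letter from each factor.\<close>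

lemma chom_two_letter:
  assumes V: "is_quiver V" "is_quiver V'" and h: "chom V V' h" and x: "x \<in> arrow_ideal_pow V 2"
    and cl: "closed_word V' [a', b']"
  shows "h x (head V' a', [a', b']) =
    (\<Sum>a\<in>arcs V. \<Sum>b\<in>arcs V. x (head V a, [a, b]) * (lin V V' h a a' * lin V V' h b b'))"
proof -
  let ?F = "\<lambda>p. h (path_elem p) (head V' a', [a', b'])"
  have cl': "head V' b' = tail V' a'" using cl V by (simp add: closed_word_2)
  have F: "?F (head V a, [a, b]) = lin V V' h a a' * lin V V' h b b'" if "is_qpath V (head V a) [a, b]" for a b
  proof -
    have ab: "a \<in> arcs V" "b \<in> arcs V" "tail V a = head V b" using that by auto
    have "path_elem (head V a, [a, b]) = conv V (arr V a) (arr V b)"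
      using path_elem_Cons[OF that] ab by simp
    then have "h (path_elem (head V a, [a, b])) = conv V' (h (arr V a)) (h (arr V b))"
      using chom_conv[OF h arr_car[OF V(1) ab(1)] arr_car[OF V(1) ab(2)]] by simp
    moreover have "h (arr V a) (i, []) = 0" "h (arr V b) (i, []) = 0" for i
      using chom_arr_pow[OF V(1) h ab(1)] chom_arr_pow[OF V(1) h ab(2)] by (force simp: pow_iff)+
    ultimately show ?thesis
      by (simp add: conv_apply lin_def cl' numeral_2_eq_2)
  qed
  have "h x (head V' a', [a', b']) = (\<Sum>p\<in>paths V 2. x p * ?F p)"
    by (rule clin_expand[OF V(1) chom_clin[OF h] pow_car[OF x]]) simp
  also have "\<dots> = (\<Sum>(i, w)\<in>{(i, w). is_qpath V i w \<and> length w = 2}. x (i, w) * ?F (i, w))"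
    by (rule sum_over_paths[OF V(1) x])
  also have "\<dots> = (\<Sum>(a, b)\<in>{(a, b). is_qpath V (head V a) [a, b]}. x (head V a, [a, b]) * ?F (head V a, [a, b]))"
    by (rule sum.reindex_bij_witness[of _ "\<lambda>(a, b). (head V a, [a, b])" "\<lambda>(j, w). (w ! 0, w ! 1)"])
       (auto simp: length_Suc_conv numeral_2_eq_2)
  also have "\<dots> = (\<Sum>(a, b)\<in>{(a, b). is_qpath V (head V a) [a, b]}. x (head V a, [a, b]) * (lin V V' h a a' * lin V V' h b b'))"
    by (intro sum.cong refl) (clarify, simp only: F)
  also have "\<dots> = (\<Sum>(a, b)\<in>arcs V \<times> arcs V. x (head V a, [a, b]) * (lin V V' h a a' * lin V V' h b b'))"
  proof (rule sum.mono_neutral_left)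
    show "finite (arcs V \<times> arcs V)" using V by (simp add: quiver_finite_arcs)
    show "\<forall>p\<in>arcs V \<times> arcs V - {(a, b). is_qpath V (head V a) [a, b]}.
        (case p of (a, b) \<Rightarrow> x (head V a, [a, b]) * (lin V V' h a a' * lin V V' h b b')) = 0"
      using pow_car[OF x] unfolding car_iff by fastforce
  qed auto
  also have "\<dots> = (\<Sum>a\<in>arcs V. \<Sum>b\<in>arcs V. x (head V a, [a, b]) * (lin V V' h a a' * lin V V' h b b'))"
    by (simp add: sum.cartesian_product)
  finally show ?thesis .
qed

text \<open>Congruence transformation of the quadratic form by the linear part. Linear terms join
  parallel arrows only, so closed words correspond to closed words.\<close>

lemma quad_chom:
  assumes V: "is_quiver V" "is_quiver V'" and h: "chom V V' h" and x: "x \<in> arrow_ideal_pow V 2"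
    and ab': "a' \<in> arcs V'" "b' \<in> arcs V'"
  shows "quad V' (h x) a' b' = (\<Sum>a\<in>arcs V. \<Sum>b\<in>arcs V. quad V x a b * (lin V V' h a a' * lin V V' h b b'))"
proof (cases "closed_word V' [a', b']")
  case True
  let ?L = "lin V V' h"
  have True': "closed_word V' [b', a']" using True V by (simp add: closed_word_2)
  have "quad V' (h x) a' b' = h x (head V' a', [a', b']) + h x (head V' b', [b', a'])"
    using True by (simp add: quad_def csum_2)
  also have "\<dots> = (\<Sum>a\<in>arcs V. \<Sum>b\<in>arcs V. x (head V a, [a, b]) * (?L a a' * ?L b b'))
     + (\<Sum>b\<in>arcs V. \<Sum>a\<in>arcs V. x (head V b, [b, a]) * (?L b b' * ?L a a'))"
    unfolding chom_two_letter[OF V h x True] chom_two_letter[OF V h x True'] by simp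
  also have "(\<Sum>b\<in>arcs V. \<Sum>a\<in>arcs V. x (head V b, [b, a]) * (?L b b' * ?L a a')) =
     (\<Sum>a\<in>arcs V. \<Sum>b\<in>arcs V. x (head V b, [b, a]) * (?L b b' * ?L a a'))"
    by (rule sum.swap)
  also have "(\<Sum>a\<in>arcs V. \<Sum>b\<in>arcs V. x (head V a, [a, b]) * (?L a a' * ?L b b')) + \<dots>
     = (\<Sum>a\<in>arcs V. \<Sum>b\<in>arcs V. quad V x a b * (?L a a' * ?L b b'))"
    unfolding sum.distrib[symmetric]
  proof (intro sum.cong refl)
    fix a b assume ab: "a \<in> arcs V" "b \<in> arcs V"
    show "x (head V a, [a, b]) * (?L a a' * ?L b b') + x (head V b, [b, a]) * (?L b b' * ?L a a')
       = quad V x a b * (?L a a' * ?L b b')"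
    proof (cases "?L a a' = 0 \<or> ?L b b' = 0")
      case False
      then have "closed_word V [a, b]"
        using lin_parallel[OF V(1) h ab(1), of a'] lin_parallel[OF V(1) h ab(2), of b'] True ab V
        by (simp add: closed_word_2)
      then show ?thesis by (simp add: quad_def csum_2 algebra_simps)
    qed auto
  qed
  finally show ?thesis .
next
  case False
  have "quad V x a b * (lin V V' h a a' * lin V V' h b b') = 0" if ab: "a \<in> arcs V" "b \<in> arcs V" for a b
  proof (cases "lin V V' h a a' = 0 \<or> lin V V' h b b' = 0")
    case nz: False
    have "\<not> closed_word V [a, b]"
      using lin_parallel[OF V(1) h ab(1), of a'] lin_parallel[OF V(1) h ab(2), of b'] False ab' V nz
      by (simp add: closed_word_2)
    then show ?thesis by (simp add: quad_def)
  qed auto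
  then have "(\<Sum>a\<in>arcs V. \<Sum>b\<in>arcs V. quad V x a b * (lin V V' h a a' * lin V V' h b b')) = 0"
    by (intro sum.neutral ballI)
  moreover have "quad V' (h x) a' b' = 0" using False by (simp add: quad_def)
  ultimately show ?thesis by simp
qed

text \<open>The radical of the quadratic form; \<open>\<xi>\<close> is a vector indexed by the
  arrows.\<close>

definition null :: "('v, 'a) quiver \<Rightarrow> ('v, 'a) series \<Rightarrow> ('a \<Rightarrow> complex) \<Rightarrow> bool" where
  "null V x \<xi> \<longleftrightarrow> (\<forall>b\<in>arcs V. (\<Sum>a\<in>arcs V. \<xi> a * quad V x a b) = 0)"

lemma matrix_vector_assoc:
  "(\<Sum>b\<in>T. A b * (\<Sum>a\<in>S. B b a * \<xi> a)) = (\<Sum>a\<in>S. (\<Sum>b\<in>T. A b * B b a) * (\<xi> a :: complex))"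
  unfolding sum_distrib_left sum_distrib_right by (subst sum.swap) (simp add: mult.assoc)

text \<open>The data \<open>p\<close>, \<open>s\<close> exhibit \<open>(Q, w)\<close> as what remains of \<open>(V, x)\<close> after splitting off a
  trivial summand, to first order: the equation \<open>p (E x) = p (E (s w))\<close> says that \<open>x - s w\<close> is
  quadratic in the kernel of \<open>p\<close>, and the last condition that this quadratic form is nondegenerate.\<close>

definition retract :: "('v, 'q) quiver \<Rightarrow> ('v, 'q) series \<Rightarrow> ('v, 'a) quiver \<Rightarrow> ('v, 'a) series \<Rightarrow>
    (('v, 'a) series \<Rightarrow> ('v, 'q) series) \<Rightarrow> (('v, 'q) series \<Rightarrow> ('v, 'a) series) \<Rightarrow> bool" where
  "retract Q w V x p s \<longleftrightarrow> is_quiver V \<and> x \<in> arrow_ideal_pow V 2 \<and> chom V Q p \<and> chom Q V s \<and>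
     (\<forall>u\<in>car Q. p (s u) = u) \<and> cyceq Q (p x) w \<and>
     (\<forall>E. cder V E \<longrightarrow> cyceq Q (p (E x)) (p (E (s w)))) \<and>
     (\<forall>\<xi>. null V x \<xi> \<longleftrightarrow> (\<exists>\<eta>. \<forall>y\<in>arcs V. \<xi> y = (\<Sum>a\<in>arcs Q. lin V Q p y a * \<eta> a)))"

text \<open>Congruent forms have corresponding radicals; the linear part is an invertible matrix by
  \<open>lin_id_on\<close>, so the outer factor can be cancelled.\<close>

lemma null_qiso:
  assumes iso: "qiso V V' \<phi> \<psi>" and x: "x \<in> arrow_ideal_pow V 2"
  shows "null V' (\<phi> x) \<xi> \<longleftrightarrow> null V x (\<lambda>a. \<Sum>a'\<in>arcs V'. lin V V' \<phi> a a' * \<xi> a')"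
proof -
  note V = qisoD(1,2)[OF iso] and \<phi> = qisoD(3)[OF iso] and \<psi> = qisoD(4)[OF iso]
  let ?L = "lin V V' \<phi>" and ?K = "lin V' V \<psi>"
  let ?\<xi> = "\<lambda>a. \<Sum>a'\<in>arcs V'. ?L a a' * \<xi> a'"
  define N where "N = (\<lambda>b. \<Sum>a\<in>arcs V. ?\<xi> a * quad V x a b)"
  have eq: "(\<Sum>a'\<in>arcs V'. \<xi> a' * quad V' (\<phi> x) a' b') = (\<Sum>b\<in>arcs V. ?L b b' * N b)" if b': "b' \<in> arcs V'" for b'
  proof -
    have "(\<Sum>a'\<in>arcs V'. \<xi> a' * quad V' (\<phi> x) a' b') =
      (\<Sum>a'\<in>arcs V'. \<Sum>a\<in>arcs V. \<Sum>b\<in>arcs V. ?L b b' * (?L a a' * \<xi> a' * quad V x a b))"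
      by (intro sum.cong refl) (simp add: quad_chom[OF V \<phi> x _ b'] sum_distrib_left algebra_simps)
    also have "\<dots> = (\<Sum>a\<in>arcs V. \<Sum>a'\<in>arcs V'. \<Sum>b\<in>arcs V. ?L b b' * (?L a a' * \<xi> a' * quad V x a b))"
      by (rule sum.swap)
    also have "\<dots> = (\<Sum>a\<in>arcs V. \<Sum>b\<in>arcs V. \<Sum>a'\<in>arcs V'. ?L b b' * (?L a a' * \<xi> a' * quad V x a b))"
      by (intro sum.cong refl) (rule sum.swap)
    also have "\<dots> = (\<Sum>b\<in>arcs V. \<Sum>a\<in>arcs V. \<Sum>a'\<in>arcs V'. ?L b b' * (?L a a' * \<xi> a' * quad V x a b))"
      by (rule sum.swap)
    also have "\<dots> = (\<Sum>b\<in>arcs V. ?L b b' * N b)"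
      by (simp add: N_def sum_distrib_left sum_distrib_right)
    finally show ?thesis .
  qed
  have "(\<forall>b'\<in>arcs V'. (\<Sum>b\<in>arcs V. ?L b b' * N b) = 0) \<longleftrightarrow> (\<forall>b\<in>arcs V. N b = 0)"
  proof
    assume z: "\<forall>b'\<in>arcs V'. (\<Sum>b\<in>arcs V. ?L b b' * N b) = 0"
    show "\<forall>c\<in>arcs V. N c = 0"
    proof
      fix c assume c: "c \<in> arcs V"
      have "0 = (\<Sum>b'\<in>arcs V'. ?K b' c * (\<Sum>b\<in>arcs V. ?L b b' * N b))" using z by simp
      also have "\<dots> = (\<Sum>b\<in>arcs V. (\<Sum>b'\<in>arcs V'. ?K b' c * ?L b b') * N b)"
        by (rule matrix_vector_assoc)
      also have "\<dots> = (\<Sum>b\<in>arcs V. (if b = c then 1 else 0) * N b)"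
        using lin_id_on[OF V \<phi> \<psi> _ qisoD(5)[OF iso]] by (intro sum.cong refl) (simp add: mult.commute)
      also have "\<dots> = (\<Sum>b\<in>arcs V. if b = c then N b else 0)" by (intro sum.cong refl) simp
      also have "\<dots> = N c" using c by (simp add: quiver_finite_arcs[OF V(1)])
      finally show "N c = 0" by simp
    qed
  qed simp
  then show ?thesis unfolding null_def using eq by (simp add: N_def)
qed

text \<open>Transport of structure. A derivation \<open>E'\<close> of the target is conjugated to
  the derivation \<open>\<psi> E' \<phi>\<close> of the source, where the derivation identity is
  available; the condition on the radical is transported by the mutually inverse linear
  parts.\<close>

lemma retract_qiso:
  assumes Q: "is_quiver Q" and r: "retract Q w V x p s" and iso: "qiso V V' \<phi> \<psi>"
    and x': "x' \<in> arrow_ideal_pow V' 2" and eq: "cyceq V' (\<phi> x) x'"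
  shows "retract Q w V' x' (\<lambda>y. p (\<psi> y)) (\<lambda>u. \<phi> (s u))"
proof -
  note V = qisoD(1,2)[OF iso] and \<phi> = qisoD(3)[OF iso] and \<psi> = qisoD(4)[OF iso]
  from r have x: "x \<in> arrow_ideal_pow V 2" and p: "chom V Q p" and s: "chom Q V s"
    and ps: "\<And>u. u \<in> car Q \<Longrightarrow> p (s u) = u" and px: "cyceq Q (p x) w"
    and E: "\<And>E. cder V E \<Longrightarrow> cyceq Q (p (E x)) (p (E (s w)))"
    and null: "\<And>\<xi>. null V x \<xi> \<longleftrightarrow> (\<exists>\<eta>. \<forall>y\<in>arcs V. \<xi> y = (\<Sum>a\<in>arcs Q. lin V Q p y a * \<eta> a))"
    by (auto simp: retract_def)
  have w: "w \<in> car Q" using px by (rule cyceq_car)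
  have xc: "x \<in> car V" using pow_car[OF x] .
  have psi_x: "cyceq V (\<psi> x') x"
    using cyceq_chom[OF V(2,1) \<psi> cyceq_sym[OF V(2) eq]] qisoD(5)[OF iso xc] by simp
  show ?thesis unfolding retract_def
  proof (intro conjI allI ballI impI)
    show "is_quiver V'" "x' \<in> arrow_ideal_pow V' 2" by (fact V x')+
    show "chom V' Q (\<lambda>y. p (\<psi> y))" "chom Q V' (\<lambda>u. \<phi> (s u))"
      by (rule chom_comp[OF \<psi> p], rule chom_comp[OF s \<phi>])
    show "p (\<psi> (\<phi> (s u))) = u" if "u \<in> car Q" for u
      using ps[OF that] qisoD(5)[OF iso chom_car[OF s that]] by simp
    show "cyceq Q (p (\<psi> x')) w"
      using cyceq_trans[OF cyceq_chom[OF V(1) Q p psi_x] px] .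
    show "cyceq Q (p (\<psi> (E' x'))) (p (\<psi> (E' (\<phi> (s w)))))" if E': "cder V' E'" for E'
    proof -
      let ?E = "\<lambda>y. \<psi> (E' (\<phi> y))"
      have "cder V ?E"
        unfolding cder_def
      proof (intro conjI ballI)
        show "clin V V ?E"
          using clin_comp[OF clin_comp[OF chom_clin[OF \<phi>] cder_clin[OF E']] chom_clin[OF \<psi>]] .
        fix y z assume y: "y \<in> car V" and z: "z \<in> car V"
        note c = chom_car[OF \<phi> y] chom_car[OF \<phi> z]
        note c' = cder_car[OF E' c(1)] cder_car[OF E' c(2)]
        have "E' (\<phi> (conv V y z)) = conv V' (E' (\<phi> y)) (\<phi> z) + conv V' (\<phi> y) (E' (\<phi> z))"
          by (simp add: chom_conv[OF \<phi> y z] cder_conv[OF E' c])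
        then have "?E (conv V y z) = \<psi> (conv V' (E' (\<phi> y)) (\<phi> z)) + \<psi> (conv V' (\<phi> y) (E' (\<phi> z)))"
          using clin_add[OF chom_clin[OF \<psi>]] conv_car[OF V(2)] c c' by simp
        then show "?E (conv V y z) = conv V (?E y) z + conv V y (?E z)"
          using chom_conv[OF \<psi>] c c' qisoD(5)[OF iso] y z by simp
      next
        fix i assume i: "i \<in> verts V"
        then show "?E (path_elem (i, [])) = 0"
          using chom_idem[OF \<phi> i] cder_idem[OF E'] chom_verts[OF \<phi>] clin_zero[OF chom_clin[OF \<psi>]] by simp
      qed
      then have "cyceq Q (p (?E x)) (p (?E (s w)))" by (rule E)
      moreover have "cyceq Q (p (\<psi> (E' x'))) (p (?E x))"
        using cyceq_chom[OF V(1) Q p cyceq_chom[OF V(2,1) \<psi> cyceq_cder[OF V(2) E' cyceq_sym[OF V(2) eq]]]] .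
      ultimately show ?thesis using cyceq_trans by blast
    qed
    fix \<xi>'
    let ?L = "lin V V' \<phi>" and ?K = "lin V' V \<psi>" and ?P = "lin V Q p"
    have P': "lin V' Q (\<lambda>y. p (\<psi> y)) y a = (\<Sum>b\<in>arcs V. ?K y b * ?P b a)" if "y \<in> arcs V'" for y a
      by (rule lin_comp[OF V(2,1) \<psi> p that])
    have "null V' x' \<xi>' \<longleftrightarrow> null V' (\<phi> x) \<xi>'"
      unfolding null_def by (simp add: quad_cyceq[OF V(2) eq])
    also have "\<dots> \<longleftrightarrow> (\<exists>\<eta>. \<forall>y\<in>arcs V. (\<Sum>a'\<in>arcs V'. ?L y a' * \<xi>' a') = (\<Sum>a\<in>arcs Q. ?P y a * \<eta> a))"
      unfolding null_qiso[OF iso x] null ..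
    also have "\<dots> \<longleftrightarrow> (\<exists>\<eta>. \<forall>y\<in>arcs V'. \<xi>' y = (\<Sum>a\<in>arcs Q. lin V' Q (\<lambda>y. p (\<psi> y)) y a * \<eta> a))"
    proof (rule arg_cong[where f = Ex], rule ext)
      fix \<eta>
      have KP: "(\<Sum>b\<in>arcs V. ?K y b * (\<Sum>a\<in>arcs Q. ?P b a * \<eta> a)) = (\<Sum>a\<in>arcs Q. lin V' Q (\<lambda>y. p (\<psi> y)) y a * \<eta> a)"
        if "y \<in> arcs V'" for y
        unfolding matrix_vector_assoc using P'[OF that] by simp
      have KL: "(\<Sum>b\<in>arcs V. ?K y b * (\<Sum>a'\<in>arcs V'. ?L b a' * \<xi>' a')) = \<xi>' y" if y: "y \<in> arcs V'" for y
      proof -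
        have "(\<Sum>b\<in>arcs V. ?K y b * (\<Sum>a'\<in>arcs V'. ?L b a' * \<xi>' a')) = (\<Sum>a'\<in>arcs V'. if y = a' then \<xi>' a' else 0)"
          unfolding matrix_vector_assoc
          using lin_id_on[OF V(2,1) \<psi> \<phi> y qisoD(6)[OF iso]] by (intro sum.cong refl) simp
        then show ?thesis using y by (simp add: quiver_finite_arcs[OF V(2)])
      qed
      have LK: "(\<Sum>b\<in>arcs V'. ?L y b * (\<Sum>c\<in>arcs V. ?K b c * f c)) = f y" if y: "y \<in> arcs V" for y f
      proof -
        have "(\<Sum>b\<in>arcs V'. ?L y b * (\<Sum>c\<in>arcs V. ?K b c * f c)) = (\<Sum>c\<in>arcs V. if y = c then f c else 0)"
          unfolding matrix_vector_assoc
          using lin_id_on[OF V \<phi> \<psi> y qisoD(5)[OF iso]] by (intro sum.cong refl) simp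
        then show ?thesis using y by (simp add: quiver_finite_arcs[OF V(1)])
      qed
      show "(\<forall>y\<in>arcs V. (\<Sum>a'\<in>arcs V'. ?L y a' * \<xi>' a') = (\<Sum>a\<in>arcs Q. ?P y a * \<eta> a)) =
        (\<forall>y\<in>arcs V'. \<xi>' y = (\<Sum>a\<in>arcs Q. lin V' Q (\<lambda>y. p (\<psi> y)) y a * \<eta> a))"
      proof
        assume A: "\<forall>y\<in>arcs V. (\<Sum>a'\<in>arcs V'. ?L y a' * \<xi>' a') = (\<Sum>a\<in>arcs Q. ?P y a * \<eta> a)"
        show "\<forall>y\<in>arcs V'. \<xi>' y = (\<Sum>a\<in>arcs Q. lin V' Q (\<lambda>y. p (\<psi> y)) y a * \<eta> a)"
        proof
          fix y assume y: "y \<in> arcs V'"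
          have "\<xi>' y = (\<Sum>b\<in>arcs V. ?K y b * (\<Sum>a\<in>arcs Q. ?P b a * \<eta> a))"
            unfolding KL[OF y, symmetric] using A by (intro sum.cong refl) simp
          then show "\<xi>' y = (\<Sum>a\<in>arcs Q. lin V' Q (\<lambda>y. p (\<psi> y)) y a * \<eta> a)" using KP[OF y] by simp
        qed
      next
        assume B: "\<forall>y\<in>arcs V'. \<xi>' y = (\<Sum>a\<in>arcs Q. lin V' Q (\<lambda>y. p (\<psi> y)) y a * \<eta> a)"
        show "\<forall>y\<in>arcs V. (\<Sum>a'\<in>arcs V'. ?L y a' * \<xi>' a') = (\<Sum>a\<in>arcs Q. ?P y a * \<eta> a)"
        proof
          fix y assume y: "y \<in> arcs V"
          have "(\<Sum>a'\<in>arcs V'. ?L y a' * \<xi>' a') =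
              (\<Sum>a'\<in>arcs V'. ?L y a' * (\<Sum>b\<in>arcs V. ?K a' b * (\<Sum>a\<in>arcs Q. ?P b a * \<eta> a)))"
            using B KP by (intro sum.cong refl) simp
          then show "(\<Sum>a'\<in>arcs V'. ?L y a' * \<xi>' a') = (\<Sum>a\<in>arcs Q. ?P y a * \<eta> a)"
            using LK[OF y] by simp
        qed
      qed
    qed
    finally show "null V' x' \<xi>' \<longleftrightarrow> (\<exists>\<eta>. \<forall>y\<in>arcs V'. \<xi>' y = (\<Sum>a\<in>arcs Q. lin V' Q (\<lambda>y. p (\<psi> y)) y a * \<eta> a))" .
  qed
qed

subsection \<open>Subquivers and relabelling\<close>

definition subquiver :: "('v, 'a) quiver \<Rightarrow> ('v, 'a) quiver \<Rightarrow> bool" where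
  "subquiver V V' \<longleftrightarrow> is_quiver V \<and> is_quiver V' \<and> verts V' = verts V \<and> arcs V \<subseteq> arcs V' \<and>
     (\<forall>a\<in>arcs V. tail V' a = tail V a \<and> head V' a = head V a)"

lemma subquiver_source: "subquiver V V' \<Longrightarrow> set w \<subseteq> arcs V \<Longrightarrow> path_source V' i w = path_source V i w"
  by (induction w arbitrary: i) (auto simp: subquiver_def)

lemma subquiver_path: "subquiver V V' \<Longrightarrow> set w \<subseteq> arcs V \<Longrightarrow> is_qpath V' i w \<longleftrightarrow> is_qpath V i w"
  by (induction w arbitrary: i) (auto simp: subquiver_def)

lemma subquiver_path': "subquiver V V' \<Longrightarrow> is_qpath V i w \<Longrightarrow> is_qpath V' i w"
  using subquiver_path[of V V' w i] is_qpath_arcs[of V i w] by blast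

lemma subquiver_car: assumes "subquiver V V'" "x \<in> car V" shows "x \<in> car V'"
  using assms(2) subquiver_path'[OF assms(1)] unfolding car_iff by blast

text \<open>Coefficient functions are extended by zero, so the inclusion of algebras is the identity
  function; what needs checking is that \<open>path_source\<close> agrees on the words that
  occur.\<close>

lemma subquiver_chom: assumes s: "subquiver V V'" shows "chom V V' (\<lambda>x. x)"
  unfolding chom_def clin_def
proof (intro conjI ballI allI)
  show "verts V' = verts V" using s by (simp add: subquiver_def)
  show "x \<in> arrow_ideal_pow V' n" if "x \<in> arrow_ideal_pow V n" for x n
    using that subquiver_car[OF s, of x] unfolding pow_iff by blast
  fix x y assume x: "x \<in> car V" and y: "y \<in> car V"
  show "conv V x y = conv V' x y"
  proof (rule ext, clarify)
    fix i w
    have "x (i, take k w) * y (path_source V i (take k w), drop k w) =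
        x (i, take k w) * y (path_source V' i (take k w), drop k w)" for k
    proof (cases "x (i, take k w) = 0")
      case False
      then have "is_qpath V i (take k w)" using x unfolding car_iff by blast
      then have "set (take k w) \<subseteq> arcs V" by (rule is_qpath_arcs)
      then show ?thesis by (simp add: subquiver_source[OF s])
    qed simp
    then show "conv V x y (i, w) = conv V' x y (i, w)" unfolding conv_apply by (intro sum.cong refl)
  qed
qed auto

definition restr :: "('v, 'a) quiver \<Rightarrow> ('v, 'a) series \<Rightarrow> ('v, 'a) series" where
  "restr V x = (\<lambda>(i, w). if set w \<subseteq> arcs V then x (i, w) else 0)"

text \<open>The retraction that sends every other arrow to zero. It is multiplicative because a word
  avoids those arrows exactly when both pieces of a cut do.\<close>

lemma restr_chom: assumes s: "subquiver V V'" shows "chom V' V (restr V)"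
  unfolding chom_def clin_def
proof (intro conjI ballI allI)
  show "verts V = verts V'" using s by (simp add: subquiver_def)
  show "restr V x \<in> arrow_ideal_pow V n" if "x \<in> arrow_ideal_pow V' n" for x n
    unfolding pow_iff car_iff
  proof (intro conjI allI impI)
    fix i w assume nz: "restr V x (i, w) \<noteq> 0"
    then have w: "set w \<subseteq> arcs V" "x (i, w) \<noteq> 0" by (auto simp: restr_def split: if_splits)
    then have "is_qpath V' i w" "n \<le> length w" using that by (auto simp: pow_iff car_iff)
    then show "is_qpath V i w" "n \<le> length w" using subquiver_path[OF s w(1)] by auto
  qed
  show "restr V (x + y) = restr V x + restr V y" for x y
    by (auto simp: restr_def fun_eq_iff pointwise)
  show "restr V (scl c x) = scl c (restr V x)" for c x
    by (auto simp: restr_def fun_eq_iff pointwise)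
  show "restr V (path_elem (i, [])) = path_elem (i, [])" for i
    by (auto simp: restr_def fun_eq_iff path_elem_apply)
  fix x y
  show "restr V (conv V' x y) = conv V (restr V x) (restr V y)"
  proof (rule ext, clarify)
    fix i w
    show "restr V (conv V' x y) (i, w) = conv V (restr V x) (restr V y) (i, w)"
    proof (cases "set w \<subseteq> arcs V")
      case True
      then have "set (take k w) \<subseteq> arcs V" "set (drop k w) \<subseteq> arcs V" for k
        using set_take_subset set_drop_subset by fastforce+
      then show ?thesis using True
        by (simp add: restr_def conv_apply subquiver_source[OF s])
    next
      case False
      have "restr V x (i, take k w) * restr V y (j, drop k w) = 0" for k j
      proof -
        have "set w = set (take k w) \<union> set (drop k w)" by (metis append_take_drop_id set_append)
        then show ?thesis using False by (auto simp: restr_def)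
      qed
      then have "conv V (restr V x) (restr V y) (i, w) = 0" unfolding conv_apply by (intro sum.neutral ballI)
      then show ?thesis using False by (simp add: restr_def)
    qed
  qed
qed

lemma chom_fix_path:
  assumes V: "is_quiver V" and h: "chom V V' h" and S: "\<And>a. a \<in> S \<Longrightarrow> a \<in> arcs V \<and>
      h (arr V a) = arr V' a \<and> head V' a = head V a \<and> tail V' a = tail V a"
    and w: "is_qpath V i w" "set w \<subseteq> S"
  shows "h (path_elem (i, w)) = path_elem (i, w)"
  using w
proof (induction w arbitrary: i)
  case Nil
  then show ?case by (simp add: chom_idem[OF h])
next
  case (Cons a w)
  then have a: "a \<in> S" "is_qpath V (tail V a) w" "set w \<subseteq> S" "head V a = i" by auto
  have "h (path_elem (i, a # w)) = conv V' (h (arr V a)) (h (path_elem (tail V a, w)))"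
    unfolding path_elem_Cons[OF Cons.prems(1)]
    by (intro chom_conv[OF h] arr_car[OF V]) (use S[OF a(1)] a(2) in auto)
  also have "\<dots> = path_elem (i, a # w)"
    using Cons.IH[OF a(2,3)] S[OF a(1)] a(4) by (simp add: conv_path_elem)
  finally show ?case .
qed

lemma chom_fix:
  assumes V: "is_quiver V" and h: "chom V V' h" and S: "\<And>a. a \<in> S \<Longrightarrow> a \<in> arcs V \<and>
      h (arr V a) = arr V' a \<and> head V' a = head V a \<and> tail V' a = tail V a"
    and z: "z \<in> car V" "\<And>i w. z (i, w) \<noteq> 0 \<Longrightarrow> set w \<subseteq> S"
  shows "h z = z"
proof (rule ext, clarify)
  fix i w
  have "h z (i, w) = (\<Sum>p\<in>paths V (length w). z p * h (path_elem p) (i, w))"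
    by (rule clin_expand[OF V chom_clin[OF h] z(1) order_refl])
  also have "\<dots> = (\<Sum>p\<in>paths V (length w). z p * path_elem p (i, w))"
  proof (intro sum.cong refl)
    fix p assume p: "p \<in> paths V (length w)"
    obtain j v where jv: "p = (j, v)" by (cases p)
    show "z p * h (path_elem p) (i, w) = z p * path_elem p (i, w)"
    proof (cases "z p = 0")
      case False
      then have "h (path_elem p) = path_elem p"
        unfolding jv using p z(2) jv by (intro chom_fix_path[where S = S, OF V h S]) (auto simp: paths_def)
      then show ?thesis by simp
    qed simp
  qed
  also have "\<dots> = z (i, w)" by (rule clin_expand[OF V clin_id z(1) order_refl, symmetric])
  finally show "h z (i, w) = z (i, w)" .
qed

text \<open>Injective but possibly not onto, so that embeddings into quivers with adjoined arrows
  are covered along with bijective renamings.\<close>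

definition relabelling :: "('v, 'a) quiver \<Rightarrow> ('v, 'b) quiver \<Rightarrow> ('a \<Rightarrow> 'b) \<Rightarrow> bool" where
  "relabelling V V' g \<longleftrightarrow> is_quiver V \<and> is_quiver V' \<and> verts V' = verts V \<and> inj_on g (arcs V) \<and>
     (\<forall>a\<in>arcs V. g a \<in> arcs V' \<and> head V' (g a) = head V a \<and> tail V' (g a) = tail V a)"

definition relab :: "('v, 'a) quiver \<Rightarrow> ('v, 'b) quiver \<Rightarrow> ('a \<Rightarrow> 'b) \<Rightarrow> ('v, 'a) series \<Rightarrow> ('v, 'b) series" where
  "relab V V' g = subst V V' (\<lambda>a. arr V' (g a))"

lemma relabelling_substitution: "relabelling V V' g \<Longrightarrow> substitution V V' (\<lambda>a. arr V' (g a))"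
  unfolding substitution_def relabelling_def by (metis arr_between arr_pow One_nat_def)

lemma relab_chom: "relabelling V V' g \<Longrightarrow> chom V V' (relab V V' g)"
  unfolding relab_def by (rule chom_subst[OF relabelling_substitution])

lemma relab_arr: "relabelling V V' g \<Longrightarrow> a \<in> arcs V \<Longrightarrow> relab V V' g (arr V a) = arr V' (g a)"
  unfolding relab_def by (rule subst_arr[OF relabelling_substitution])

lemma relab_path_elem:
  assumes g: "relabelling V V' g" and w: "is_qpath V i w"
  shows "relab V V' g (path_elem (i, w)) = path_elem (i, map g w)"
  unfolding relab_def subst_path_elem[OF relabelling_substitution[OF g] w] using w
proof (induction w arbitrary: i)
  case (Cons a w)
  then have a: "a \<in> arcs V" "is_qpath V (tail V a) w" "head V a = i" by auto
  then show ?case using g by (simp add: Cons.IH relabelling_def conv_path_elem)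
qed simp

lemma relab_support:
  assumes g: "relabelling V V' g" and u: "u \<in> car V" and nz: "relab V V' g u (i, w') \<noteq> 0"
  obtains w where "w' = map g w" "u (i, w) \<noteq> 0"
proof -
  have V: "is_quiver V" using g by (simp add: relabelling_def)
  obtain p where p: "p \<in> paths V (length w')" "u p * relab V V' g (path_elem p) (i, w') \<noteq> 0"
    using nz unfolding clin_expand[OF V chom_clin[OF relab_chom[OF g]] u order_refl]
    by (meson sum.not_neutral_contains_not_neutral)
  obtain j v where "p = (j, v)" "is_qpath V j v" using p by (auto simp: paths_def)
  then show thesis using p that[of v] relab_path_elem[OF g] by (auto simp: path_elem_apply split: if_splits)
qed

lemma relab_apply:
  assumes g: "relabelling V V' g" and u: "u \<in> car V" and w: "set w \<subseteq> arcs V"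
  shows "relab V V' g u (i, map g w) = u (i, w)"
proof -
  have V: "is_quiver V" using g by (simp add: relabelling_def)
  have "relab V V' g u (i, map g w) = (\<Sum>p\<in>paths V (length w). u p * relab V V' g (path_elem p) (i, map g w))"
    by (rule clin_expand[OF V chom_clin[OF relab_chom[OF g]] u]) simp
  also have "\<dots> = (\<Sum>p\<in>paths V (length w). u p * path_elem p (i, w))"
  proof (intro sum.cong refl)
    fix p assume "p \<in> paths V (length w)"
    then obtain j v where p: "p = (j, v)" "is_qpath V j v" by (auto simp: paths_def)
    have "map g w = map g v \<longleftrightarrow> w = v"
      using is_qpath_arcs[OF p(2)] w g unfolding relabelling_def by (metis inj_on_map_eq_map inj_on_subset le_sup_iff)
    then show "u p * relab V V' g (path_elem p) (i, map g w) = u p * path_elem p (i, w)"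
      using p relab_path_elem[OF g] by (auto simp: path_elem_apply)
  qed
  also have "\<dots> = u (i, w)" by (rule clin_expand[OF V clin_id u order_refl, symmetric])
  finally show ?thesis .
qed

lemma relab_quad:
  assumes g: "relabelling V V' g" and u: "u \<in> car V" and a: "a \<in> arcs V" "b \<in> arcs V"
  shows "quad V' (relab V V' g u) (g a) (g b) = quad V u a b"
proof -
  have V: "is_quiver V" "is_quiver V'" and ha: "head V' (g a) = head V a" "head V' (g b) = head V b"
    using g a by (auto simp: relabelling_def)
  have cl: "closed_word V' [g a, g b] \<longleftrightarrow> closed_word V [a, b]"
    using g a unfolding closed_word_2[OF V(1)] closed_word_2[OF V(2)] relabelling_def by auto
  show ?thesis
    unfolding quad_def cl csum_2 ha
    using relab_apply[OF g u, of "[a, b]"] relab_apply[OF g u, of "[b, a]"] a by simp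
qed

lemma relab_qiso:
  assumes g: "relabelling V V' g" and surj: "g ` arcs V = arcs V'"
  shows "qiso V V' (relab V V' g) (relab V' V (inv_into (arcs V) g))"
proof -
  have inj: "inj_on g (arcs V)" and V: "is_quiver V" "is_quiver V'" using g by (auto simp: relabelling_def)
  have g': "relabelling V' V (inv_into (arcs V) g)"
    unfolding relabelling_def
  proof (intro conjI ballI)
    show "inj_on (inv_into (arcs V) g) (arcs V')" using surj by (simp add: inj_on_inv_into)
    fix b assume "b \<in> arcs V'"
    then obtain a where "a \<in> arcs V" "b = g a" using surj by blast
    then show "inv_into (arcs V) g b \<in> arcs V" "head V (inv_into (arcs V) g b) = head V' b"
      "tail V (inv_into (arcs V) g b) = tail V' b"
      using g inj by (simp_all add: relabelling_def)
  qed (use V g in \<open>auto simp: relabelling_def\<close>)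
  show ?thesis
  proof (rule qisoI_arrs[OF V relab_chom[OF g] relab_chom[OF g']])
    fix a assume a: "a \<in> arcs V"
    then have "g a \<in> arcs V'" using surj by blast
    then show "relab V' V (inv_into (arcs V) g) (relab V V' g (arr V a)) = arr V a"
      using a inj by (simp add: relab_arr[OF g] relab_arr[OF g'])
  next
    fix b assume b: "b \<in> arcs V'"
    then have "inv_into (arcs V) g b \<in> arcs V" "g (inv_into (arcs V) g b) = b"
      using surj by (auto simp: inv_into_into f_inv_into_f)
    then show "relab V V' g (relab V' V (inv_into (arcs V) g) (arr V' b)) = arr V' b"
      using b by (simp add: relab_arr[OF g] relab_arr[OF g'])
  qed
qed

subsection \<open>Nondegenerate quadratic parts\<close>

text \<open>A trivial summand seen inside the ambient quiver: quadratic in the arrows of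
  \<open>S\<close>, with zero radical there. Phrased through the matrix \<open>quad\<close>, it can
  be moved between quivers without any Jacobian algebra.\<close>

definition qpart :: "('v, 'a) quiver \<Rightarrow> 'a set \<Rightarrow> ('v, 'a) series \<Rightarrow> bool" where
  "qpart V S z \<longleftrightarrow> is_quiver V \<and> S \<subseteq> arcs V \<and> z \<in> car V \<and>
     (\<forall>i w. z (i, w) \<noteq> 0 \<longrightarrow> (\<exists>b\<in>S. \<exists>c\<in>S. w = [b, c])) \<and>
     (\<forall>\<xi>. (\<forall>b\<in>S. (\<Sum>a\<in>S. \<xi> a * quad V z a b) = 0) \<longrightarrow> (\<forall>a\<in>S. \<xi> a = 0))"

lemma qpartD:
  assumes "qpart V S z"
  shows "is_quiver V" "S \<subseteq> arcs V" "z \<in> car V" "z (i, w) \<noteq> 0 \<Longrightarrow> \<exists>b\<in>S. \<exists>c\<in>S. w = [b, c]"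
    "(\<And>b. b \<in> S \<Longrightarrow> (\<Sum>a\<in>S. \<xi> a * quad V z a b) = 0) \<Longrightarrow> a \<in> S \<Longrightarrow> \<xi> a = 0"
  using assms by (auto simp: qpart_def)

lemma qpart_pow: assumes "qpart V S z" shows "z \<in> arrow_ideal_pow V 2"
  unfolding pow_iff using qpartD(3,4)[OF assms] by fastforce

lemma qpart_quad: assumes "qpart V S z" "a \<notin> S \<or> b \<notin> S" shows "quad V z a b = 0"
proof -
  have "z (i, [a, b]) = 0" "z (i, [b, a]) = 0" for i
    using qpartD(4)[OF assms(1), of i "[a, b]"] qpartD(4)[OF assms(1), of i "[b, a]"] assms(2) by auto
  then show ?thesis by (simp add: quad_def csum_2)
qed

lemma qpart_cong:
  assumes z: "qpart V S z" and V': "is_quiver V'" and S: "S \<subseteq> arcs V'"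
    and ht: "\<And>a. a \<in> S \<Longrightarrow> head V' a = head V a \<and> tail V' a = tail V a"
  shows "qpart V' S z"
proof -
  note V = qpartD(1)[OF z]
  have "quad V' z a b = quad V z a b" if "a \<in> S" "b \<in> S" for a b
    using that qpartD(2)[OF z] S ht by (auto simp: quad_def closed_word_2[OF V] closed_word_2[OF V'] csum_2)
  moreover have "z \<in> car V'" unfolding car_iff
  proof (intro allI impI)
    fix i w assume nz: "z (i, w) \<noteq> 0"
    then obtain b c where "b \<in> S" "c \<in> S" "w = [b, c]" using qpartD(4)[OF z] by blast
    moreover have "is_qpath V i w" using nz qpartD(3)[OF z] by (simp add: car_iff)
    ultimately show "is_qpath V' i w" using ht S quiver_tail[OF V', of c] by auto
  qed
  ultimately show ?thesis
    using z V' S unfolding qpart_def by simp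
qed

lemma qpart_union:
  assumes 1: "qpart V S1 z1" and 2: "qpart V S2 z2" and disj: "S1 \<inter> S2 = {}"
  shows "qpart V (S1 \<union> S2) (z1 + z2)"
  unfolding qpart_def
proof (intro conjI allI impI ballI)
  note V = qpartD(1)[OF 1]
  show "is_quiver V" by (rule V)
  show S: "S1 \<union> S2 \<subseteq> arcs V" using qpartD(2)[OF 1] qpartD(2)[OF 2] by blast
  show "z1 + z2 \<in> car V" using qpartD(3)[OF 1] qpartD(3)[OF 2] by blast
  show "\<exists>b\<in>S1 \<union> S2. \<exists>c\<in>S1 \<union> S2. w = [b, c]" if "(z1 + z2) (i, w) \<noteq> 0" for i w
  proof -
    have "z1 (i, w) \<noteq> 0 \<or> z2 (i, w) \<noteq> 0" using that by (auto simp: pointwise)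
    then show ?thesis using qpartD(4)[OF 1, of i w] qpartD(4)[OF 2, of i w] by blast
  qed
  fix \<xi> a assume z: "\<forall>b\<in>S1 \<union> S2. (\<Sum>a\<in>S1 \<union> S2. \<xi> a * quad V (z1 + z2) a b) = 0" and a: "a \<in> S1 \<union> S2"
  have fin: "finite S1" "finite S2" using S quiver_finite_arcs[OF V] by (meson finite_subset le_sup_iff)+
  have sum: "(\<Sum>a\<in>S1 \<union> S2. \<xi> a * quad V (z1 + z2) a b) =
      (\<Sum>a\<in>S1. \<xi> a * quad V (z1 + z2) a b) + (\<Sum>a\<in>S2. \<xi> a * quad V (z1 + z2) a b)" for b
    by (rule sum.union_disjoint[OF fin disj])
  have S1: "(\<Sum>a\<in>S1. \<xi> a * quad V z1 a b) = 0" if b: "b \<in> S1" for b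
  proof -
    have b': "b \<notin> S2" using b disj by blast
    have "(\<Sum>a\<in>S1 \<union> S2. \<xi> a * quad V (z1 + z2) a b) = (\<Sum>a\<in>S1. \<xi> a * quad V z1 a b) + 0"
      unfolding sum
    proof (intro arg_cong2[where f = "(+)"])
      show "(\<Sum>a\<in>S1. \<xi> a * quad V (z1 + z2) a b) = (\<Sum>a\<in>S1. \<xi> a * quad V z1 a b)"
        using b' by (intro sum.cong refl) (simp add: quad_add qpart_quad[OF 2])
      show "(\<Sum>a\<in>S2. \<xi> a * quad V (z1 + z2) a b) = 0"
      proof (rule sum.neutral, rule ballI)
        fix a assume a: "a \<in> S2"
        then have "quad V z1 a b = 0" "quad V z2 a b = 0"
          using b' disj qpart_quad[OF 1, of a b] qpart_quad[OF 2, of a b] by auto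
        then show "\<xi> a * quad V (z1 + z2) a b = 0" by (simp add: quad_add)
      qed
    qed
    then show ?thesis using z b by simp
  qed
  have S2: "(\<Sum>a\<in>S2. \<xi> a * quad V z2 a b) = 0" if b: "b \<in> S2" for b
  proof -
    have b': "b \<notin> S1" using b disj by blast
    have "(\<Sum>a\<in>S1 \<union> S2. \<xi> a * quad V (z1 + z2) a b) = 0 + (\<Sum>a\<in>S2. \<xi> a * quad V z2 a b)"
      unfolding sum
    proof (intro arg_cong2[where f = "(+)"])
      show "(\<Sum>a\<in>S2. \<xi> a * quad V (z1 + z2) a b) = (\<Sum>a\<in>S2. \<xi> a * quad V z2 a b)"
        using b' by (intro sum.cong refl) (simp add: quad_add qpart_quad[OF 1])
      show "(\<Sum>a\<in>S1. \<xi> a * quad V (z1 + z2) a b) = 0"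
      proof (rule sum.neutral, rule ballI)
        fix a assume a: "a \<in> S1"
        then have "quad V z1 a b = 0" "quad V z2 a b = 0"
          using b' disj qpart_quad[OF 1, of a b] qpart_quad[OF 2, of a b] by auto
        then show "\<xi> a * quad V (z1 + z2) a b = 0" by (simp add: quad_add)
      qed
    qed
    then show ?thesis using z b by simp
  qed
  show "\<xi> a = 0" using a qpartD(5)[OF 1 S1] qpartD(5)[OF 2 S2] by blast
qed

lemma qpart_relab:
  assumes g: "relabelling V V' g" and z: "qpart V S z"
  shows "qpart V' (g ` S) (relab V V' g z)"
  unfolding qpart_def
proof (intro conjI allI impI ballI)
  note S = qpartD(2)[OF z] and zc = qpartD(3)[OF z]
  show "is_quiver V'" "g ` S \<subseteq> arcs V'" using g S by (auto simp: relabelling_def)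
  show "relab V V' g z \<in> car V'" by (rule chom_car[OF relab_chom[OF g] zc])
  show "\<exists>b\<in>g ` S. \<exists>c\<in>g ` S. w = [b, c]" if "relab V V' g z (i, w) \<noteq> 0" for i w
    by (rule relab_support[OF g zc that]) (use qpartD(4)[OF z] in fastforce)
  fix \<xi> a assume 0: "\<forall>b\<in>g ` S. (\<Sum>a\<in>g ` S. \<xi> a * quad V' (relab V V' g z) a b) = 0" and a: "a \<in> g ` S"
  have inj: "inj_on g S" using g S by (auto simp: relabelling_def intro: inj_on_subset)
  have "(\<Sum>a\<in>S. \<xi> (g a) * quad V z a b) = 0" if b: "b \<in> S" for b
  proof -
    have "(\<Sum>a\<in>S. \<xi> (g a) * quad V z a b) = (\<Sum>a\<in>S. \<xi> (g a) * quad V' (relab V V' g z) (g a) (g b))"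
    proof (intro sum.cong refl)
      fix a assume "a \<in> S"
      then have "quad V' (relab V V' g z) (g a) (g b) = quad V z a b"
        using S b by (intro relab_quad[OF g zc]) auto
      then show "\<xi> (g a) * quad V z a b = \<xi> (g a) * quad V' (relab V V' g z) (g a) (g b)" by simp
    qed
    also have "\<dots> = (\<Sum>a\<in>g ` S. \<xi> a * quad V' (relab V V' g z) a (g b))"
      by (simp add: sum.reindex[OF inj])
    finally show ?thesis using 0 b by simp
  qed
  then have "\<xi> (g c) = 0" if "c \<in> S" for c
    using qpartD(5)[OF z, of "\<lambda>a. \<xi> (g a)"] that by blast
  then show "\<xi> a = 0" using a by blast
qed

text \<open>The retraction sends the new arrows to zero. A derivation of the larger algebra,
  followed by restriction, is a derivation of the smaller one; and the quadratic matrix is block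
  diagonal, its new block forcing vectors of the radical to vanish on \<open>S\<close>.\<close>

lemma retract_add:
  assumes Q: "is_quiver Q" and sub: "subquiver V V'" and arcs: "arcs V' = arcs V \<union> S" and disj: "arcs V \<inter> S = {}"
    and z: "qpart V' S z" and r: "retract Q w V x p s"
  shows "retract Q w V' (x + z) (\<lambda>y. p (restr V y)) s"
proof -
  have V: "is_quiver V" "is_quiver V'" using sub by (auto simp: subquiver_def)
  from r have x: "x \<in> arrow_ideal_pow V 2" and p: "chom V Q p" and s: "chom Q V s"
    and ps: "\<And>u. u \<in> car Q \<Longrightarrow> p (s u) = u" and px: "cyceq Q (p x) w"
    and E: "\<And>E. cder V E \<Longrightarrow> cyceq Q (p (E x)) (p (E (s w)))"
    and null: "\<And>\<xi>. null V x \<xi> \<longleftrightarrow> (\<exists>\<eta>. \<forall>y\<in>arcs V. \<xi> y = (\<Sum>a\<in>arcs Q. lin V Q p y a * \<eta> a))"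
    by (auto simp: retract_def)
  have w: "w \<in> car Q" using px by (rule cyceq_car)
  note \<iota> = subquiver_chom[OF sub] and \<kappa> = restr_chom[OF sub]
  have restr_id: "restr V y = y" if "y \<in> car V" for y
    using that is_qpath_arcs[of V] by (fastforce simp: fun_eq_iff restr_def car_iff)
  have restr_S: "restr V (arr V' b) = 0" if "b \<in> S" for b
    using that disj by (auto simp: fun_eq_iff restr_def path_elem_apply pointwise)
  have xV: "x \<in> car V" by (rule pow_car[OF x])
  have xV': "x \<in> car V'" by (rule subquiver_car[OF sub xV])
  note zV' = qpartD(3)[OF z]
  have rz: "restr V z = 0"
    using qpartD(4)[OF z] disj by (fastforce simp: fun_eq_iff restr_def pointwise)
  have quad_x: "quad V' x a b = (if a \<in> arcs V \<and> b \<in> arcs V then quad V x a b else 0)" for a b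
  proof -
    have "x (i, [a, b]) = 0" if "a \<notin> arcs V \<or> b \<notin> arcs V" for i a b
      using xV that unfolding car_iff by (metis is_qpath.simps(2))
    then show ?thesis using sub by (auto simp: quad_def csum_2 closed_word_2[OF V(1)] closed_word_2[OF V(2)] subquiver_def)
  qed
  show ?thesis unfolding retract_def
  proof (intro conjI allI ballI impI)
    show "is_quiver V'" by (rule V)
    show "x + z \<in> arrow_ideal_pow V' 2"
      using clin_pow[OF chom_clin[OF \<iota>] x] qpart_pow[OF z] by blast
    show "chom V' Q (\<lambda>y. p (restr V y))" by (rule chom_comp[OF \<kappa> p])
    show "chom Q V' s" using chom_comp[OF s \<iota>] .
    show "p (restr V (s u)) = u" if "u \<in> car Q" for u
      using ps[OF that] restr_id[OF chom_car[OF s that]] by simp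
    show "cyceq Q (p (restr V (x + z))) w"
      using clin_add[OF chom_clin[OF \<kappa>] xV' zV'] restr_id[OF xV] rz px by simp
    show "cyceq Q (p (restr V (E' (x + z)))) (p (restr V (E' (s w))))" if E': "cder V' E'" for E'
    proof -
      let ?E = "\<lambda>y. restr V (E' y)"
      have "cder V ?E"
        unfolding cder_def
      proof (intro conjI ballI)
        show "clin V V ?E"
          using clin_comp[OF clin_comp[OF chom_clin[OF \<iota>] cder_clin[OF E']] chom_clin[OF \<kappa>]] .
        fix y u assume y: "y \<in> car V" and u: "u \<in> car V"
        note c = subquiver_car[OF sub y] subquiver_car[OF sub u]
        note c' = cder_car[OF E' c(1)] cder_car[OF E' c(2)]
        have "E' (conv V y u) = conv V' (E' y) u + conv V' y (E' u)"
          using chom_conv[OF \<iota> y u] cder_conv[OF E' c] by simp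
        then have "?E (conv V y u) = restr V (conv V' (E' y) u) + restr V (conv V' y (E' u))"
          using clin_add[OF chom_clin[OF \<kappa>]] conv_car[OF V(2)] c c' by simp
        then show "?E (conv V y u) = conv V (?E y) u + conv V y (?E u)"
          using chom_conv[OF \<kappa>] c c' restr_id y u by simp
      next
        fix i assume i: "i \<in> verts V"
        then show "?E (path_elem (i, [])) = 0"
          using cder_idem[OF E'] sub clin_zero[OF chom_clin[OF \<kappa>]] by (simp add: subquiver_def)
      qed
      then have 1: "cyceq Q (p (?E x)) (p (?E (s w)))" by (rule E)
      \<comment> \<open>Each term of \<open>z\<close> is a product of two arrows of
        \<open>S\<close>; in either term of the Leibniz rule one of them stays undifferentiated and
        restricts to zero.\<close>
      have "?E z = 0"
      proof (rule ext, clarify)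
        fix i v
        have "?E z (i, v) = (\<Sum>q\<in>paths V' (length v). z q * ?E (path_elem q) (i, v))"
          by (rule clin_expand[OF V(2) clin_comp[OF cder_clin[OF E'] chom_clin[OF \<kappa>]] zV' order_refl])
        also have "\<dots> = 0"
        proof (rule sum.neutral, rule ballI)
          fix q assume q: "q \<in> paths V' (length v)"
          obtain j u where ju: "q = (j, u)" by (cases q)
          show "z q * ?E (path_elem q) (i, v) = 0"
          proof (cases "z q = 0")
            case False
            then obtain b c where bc: "b \<in> S" "c \<in> S" "u = [b, c]" using qpartD(4)[OF z] ju by blast
            have path: "is_qpath V' j [b, c]" using q ju bc by (simp add: paths_def)
            have b: "arr V' b \<in> car V'" and c: "arr V' c \<in> car V'" using path arr_car[OF V(2)] by auto
            have "path_elem q = conv V' (arr V' b) (arr V' c)"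
              using path_elem_Cons[OF path] path by (simp add: ju bc)
            then have "E' (path_elem q) = conv V' (E' (arr V' b)) (arr V' c) + conv V' (arr V' b) (E' (arr V' c))"
              by (simp add: cder_conv[OF E' b c])
            then have "?E (path_elem q) = conv V (?E (arr V' b)) (restr V (arr V' c)) + conv V (restr V (arr V' b)) (?E (arr V' c))"
              using clin_add[OF chom_clin[OF \<kappa>]] chom_conv[OF \<kappa>] b c cder_car[OF E'] conv_car[OF V(2)] by simp
            then show ?thesis using restr_S bc by (simp add: pointwise)
          qed simp
        qed
        finally show "?E z (i, v) = 0 (i, v)" by (simp add: pointwise)
      qed
      moreover have "?E (x + z) = ?E x + ?E z"
        using clin_add[OF cder_clin[OF E'] xV' zV'] clin_add[OF chom_clin[OF \<kappa>]] cder_car[OF E'] xV' zV' by simp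
      ultimately show ?thesis using 1 by simp
    qed
    fix \<xi>
    have fin: "finite (arcs V)" "finite S" using quiver_finite_arcs[OF V(2)] arcs by auto
    have split: "(\<Sum>a\<in>arcs V'. f a) = (\<Sum>a\<in>arcs V. f a) + (\<Sum>a\<in>S. f a)" for f :: "_ \<Rightarrow> complex"
      unfolding arcs by (rule sum.union_disjoint[OF fin disj])
    have 1: "(\<Sum>a\<in>arcs V'. \<xi> a * quad V' (x + z) a b) = (\<Sum>a\<in>arcs V. \<xi> a * quad V x a b)" if b: "b \<in> arcs V" for b
    proof -
      have b': "b \<notin> S" using b disj by blast
      have "(\<Sum>a\<in>arcs V. \<xi> a * quad V' (x + z) a b) = (\<Sum>a\<in>arcs V. \<xi> a * quad V x a b)"
        using b b' by (intro sum.cong refl) (simp add: quad_add quad_x qpart_quad[OF z])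
      moreover have "(\<Sum>a\<in>S. \<xi> a * quad V' (x + z) a b) = 0"
      proof (rule sum.neutral, rule ballI)
        fix a assume "a \<in> S"
        then have "quad V' z a b = 0" "quad V' x a b = 0"
          using b b' disj qpart_quad[OF z, of a b] by (auto simp: quad_x)
        then show "\<xi> a * quad V' (x + z) a b = 0" by (simp add: quad_add)
      qed
      ultimately show ?thesis unfolding split by simp
    qed
    have 2: "(\<Sum>a\<in>arcs V'. \<xi> a * quad V' (x + z) a b) = (\<Sum>a\<in>S. \<xi> a * quad V' z a b)" if b: "b \<in> S" for b
    proof -
      have b': "b \<notin> arcs V" using b disj by blast
      have "(\<Sum>a\<in>S. \<xi> a * quad V' (x + z) a b) = (\<Sum>a\<in>S. \<xi> a * quad V' z a b)"
        using b b' by (intro sum.cong refl) (simp add: quad_add quad_x)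
      moreover have "(\<Sum>a\<in>arcs V. \<xi> a * quad V' (x + z) a b) = 0"
      proof (rule sum.neutral, rule ballI)
        fix a assume "a \<in> arcs V"
        then have "quad V' z a b = 0" "quad V' x a b = 0"
          using b b' disj qpart_quad[OF z, of a b] by (auto simp: quad_x)
        then show "\<xi> a * quad V' (x + z) a b = 0" by (simp add: quad_add)
      qed
      ultimately show ?thesis unfolding split by simp
    qed
    have "null V' (x + z) \<xi> \<longleftrightarrow> null V x \<xi> \<and> (\<forall>b\<in>S. (\<Sum>a\<in>S. \<xi> a * quad V' z a b) = 0)"
      unfolding null_def using 1 2 arcs by auto
    also have "\<dots> \<longleftrightarrow> null V x \<xi> \<and> (\<forall>a\<in>S. \<xi> a = 0)"
      using qpartD(5)[OF z, of \<xi>] by auto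
    also have "\<dots> \<longleftrightarrow> (\<exists>\<eta>. \<forall>y\<in>arcs V'. \<xi> y = (\<Sum>a\<in>arcs Q. lin V' Q (\<lambda>y. p (restr V y)) y a * \<eta> a))"
    proof -
      have l1: "lin V' Q (\<lambda>y. p (restr V y)) y a = lin V Q p y a" if "y \<in> arcs V" for y a
        using that sub restr_id[OF arr_car[OF V(1) that]] by (simp add: lin_def subquiver_def)
      have l2: "lin V' Q (\<lambda>y. p (restr V y)) y a = 0" if "y \<in> S" for y a
        using restr_S[OF that] clin_zero[OF chom_clin[OF p]] by (simp add: lin_def pointwise)
      show ?thesis unfolding null arcs using l1 l2 by (auto simp: ball_Un)
    qed
    finally show "null V' (x + z) \<xi> \<longleftrightarrow>
        (\<exists>\<eta>. \<forall>y\<in>arcs V'. \<xi> y = (\<Sum>a\<in>arcs Q. lin V' Q (\<lambda>y. p (restr V y)) y a * \<eta> a))" .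
  qed
qed

subsection \<open>Trivial potentials are nondegenerate\<close>

lemma ideal_path_algebraI:
  assumes V: "is_quiver V" and car: "I \<subseteq> car V" and zero: "0 \<in> I"
    and add: "\<And>x y. x \<in> I \<Longrightarrow> y \<in> I \<Longrightarrow> x + y \<in> I" and minus: "\<And>x. x \<in> I \<Longrightarrow> - x \<in> I"
    and left: "\<And>x u. x \<in> I \<Longrightarrow> u \<in> car V \<Longrightarrow> conv V u x \<in> I"
    and right: "\<And>x u. x \<in> I \<Longrightarrow> u \<in> car V \<Longrightarrow> conv V x u \<in> I"
  shows "ideal I (path_algebra V)"
proof (rule idealI[OF ring_path_algebra[OF V]])
  show "subgroup I (add_monoid (path_algebra V))"
  proof
    fix x assume x: "x \<in> I"
    have "inv\<^bsub>add_monoid (path_algebra V)\<^esub> x = - x"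
      using a_inv_path_algebra[OF V, of x] x car by (auto simp: a_inv_def)
    then show "inv\<^bsub>add_monoid (path_algebra V)\<^esub> x \<in> I" using minus[OF x] by simp
  qed (use car zero add in auto)
qed (use left right in auto)

lemma zero_in_genideal: "0 \<in> Idl\<^bsub>path_algebra V\<^esub> S"
proof -
  have "0 \<in> I" if "ideal I (path_algebra V)" for I
    using additive_subgroup.zero_closed[OF ideal.axioms(1)[OF that]] by simp
  then show ?thesis by (auto simp: genideal_def)
qed

lemma quot_surjD:
  assumes "bij_betw (\<lambda>r. J +>\<^bsub>path_algebra V\<^esub> r) R (carrier (path_algebra V Quot J))"
    and J: "0 \<in> J" and y: "y \<in> car V"
  obtains h r where "h \<in> J" "r \<in> R" "y = h + r"
proof -
  have "J +>\<^bsub>path_algebra V\<^esub> y \<in> carrier (path_algebra V Quot J)"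
    using y by (auto simp: FactRing_def A_RCOSETS_def')
  then obtain r where r: "r \<in> R" "J +>\<^bsub>path_algebra V\<^esub> y = J +>\<^bsub>path_algebra V\<^esub> r"
    using assms(1) unfolding bij_betw_def by blast
  have "y \<in> J +>\<^bsub>path_algebra V\<^esub> y" using J by (auto simp: a_r_coset_def')
  then have "y \<in> J +>\<^bsub>path_algebra V\<^esub> r" using r(2) by simp
  then obtain h where "h \<in> J" "y = h + r" by (auto simp: a_r_coset_def')
  then show thesis using that r(1) by blast
qed

text \<open>If a covector annihilates the quadratic form, then it annihilates the linear parts of the
  Jacobian ideal, which contain all arrows.\<close>

lemma trivial_qpart:
  assumes "is_trivial_qp (Z, T)"
  obtains z where "T = cyc_class Z z" "qpart Z (arcs Z) z"
proof -
  obtain z where Z: "is_quiver Z" and T: "T = cyc_class Z z" and z: "z \<in> car Z"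
    and z2: "\<And>i w. z (i, w) \<noteq> 0 \<Longrightarrow> length w = 2"
    and bij: "bij_betw (\<lambda>r. jacobian_ideal (Z, T) +>\<^bsub>path_algebra Z\<^esub> r)
       (vertex_subalgebra Z) (carrier (path_algebra Z Quot (jacobian_ideal (Z, T))))"
    using assms by (auto simp: is_trivial_qp_def is_qp_def jacobian_algebra_def)
  define G where "G = {cyc_deriv Z a x | a x. a \<in> arcs Z \<and> x \<in> T}"
  have J: "jacobian_ideal (Z, T) = adic_closure Z (Idl\<^bsub>path_algebra Z\<^esub> G)"
    by (simp add: jacobian_ideal_def G_def)
  have "\<xi> y = 0" if null: "\<And>b. b \<in> arcs Z \<Longrightarrow> (\<Sum>a\<in>arcs Z. \<xi> a * quad Z z a b) = 0" and y: "y \<in> arcs Z" for \<xi> y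
  proof -
    \<comment> \<open>Evaluates the covector on the linear terms of \<open>x\<close> that run from
      \<open>j\<close> to \<open>i\<close>. On the arrow ideal, multiplication from either side only
      scales \<open>lam\<close>, so the common kernel is an ideal.\<close>
    define lam where "lam = (\<lambda>i j (x :: ('a, 'b) series). \<Sum>a\<in>arcs Z. if head Z a = i \<and> tail Z a = j then \<xi> a * x (i, [a]) else 0)"
    define I where "I = {x \<in> arrow_ideal_pow Z (Suc 0). \<forall>i j. lam i j x = 0}"
    have lam_add: "lam i j (x + x') = lam i j x + lam i j x'" for i j x x'
      unfolding lam_def sum.distrib[symmetric] by (intro sum.cong refl) (auto simp: pointwise algebra_simps)
    have lam_minus: "lam i j (- x) = - lam i j x" for i j x
      unfolding lam_def sum_negf[symmetric] by (intro sum.cong refl) (auto simp: pointwise)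
    have nil: "x (i, []) = 0" if "x \<in> arrow_ideal_pow Z (Suc 0)" for x i
      using that by (force simp: pow_iff)
    have lam_left: "lam i j (conv Z u x) = u (i, []) * lam i j x" if "x \<in> arrow_ideal_pow Z (Suc 0)" for i j u x
      unfolding lam_def sum_distrib_left
      by (intro sum.cong refl) (auto simp: conv_apply nil[OF that])
    have lam_right: "lam i j (conv Z x u) = u (j, []) * lam i j x" if "x \<in> arrow_ideal_pow Z (Suc 0)" for i j u x
      unfolding lam_def sum_distrib_left
      by (intro sum.cong refl) (auto simp: conv_apply nil[OF that])
    have ideal: "ideal I (path_algebra Z)"
    proof (rule ideal_path_algebraI[OF Z])
      show "I \<subseteq> car Z" by (auto simp: I_def dest: pow_car)
      show "0 \<in> I" by (auto simp: I_def lam_def pointwise intro!: sum.neutral)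
      show "x + x' \<in> I" if "x \<in> I" "x' \<in> I" for x x' using that by (auto simp: I_def lam_add)
      show "- x \<in> I" if "x \<in> I" for x using that by (auto simp: I_def lam_minus)
      show "conv Z u x \<in> I" if "x \<in> I" "u \<in> car Z" for x u
        using that conv_pow[OF Z, of u 0 x "Suc 0" "Suc 0"] by (auto simp: I_def lam_left)
      show "conv Z x u \<in> I" if "x \<in> I" "u \<in> car Z" for x u
        using that conv_pow[OF Z, of x "Suc 0" u 0 "Suc 0"] by (auto simp: I_def lam_right)
    qed
    have "G \<subseteq> I"
    proof
      fix g assume "g \<in> G"
      then obtain b x where b: "b \<in> arcs Z" "x \<in> T" and g: "g = cyc_deriv Z b x" by (auto simp: G_def)
      have eq: "cyceq Z x z" using b(2) T cyc_class_iff[OF z] by simp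
      have path: "i = tail Z b \<and> is_qpath Z i u \<and> path_source Z i u = head Z b" if "g (i, u) \<noteq> 0" for i u
        using that unfolding g cyc_deriv_def by (auto split: if_splits)
      have "g \<in> arrow_ideal_pow Z (Suc 0)"
      proof (rule car_pow_one)
        show "g \<in> car Z" using path by (auto simp: car_iff)
        show "g (i, []) = 0" for i using path[of i "[]"] quiver_loopfree[OF Z b(1)] by auto
      qed
      moreover have "lam i j g = 0" for i j
      proof (cases "i = tail Z b \<and> j = head Z b")
        case True
        have "lam i j g = (\<Sum>a\<in>arcs Z. \<xi> a * quad Z z a b)"
          unfolding lam_def
        proof (intro sum.cong refl)
          fix a assume a: "a \<in> arcs Z"
          show "(if head Z a = i \<and> tail Z a = j then \<xi> a * g (i, [a]) else 0) = \<xi> a * quad Z z a b"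
          proof (cases "head Z a = i \<and> tail Z a = j")
            case ij: True
            then have "g (i, [a]) = csum Z x [b, a]"
              using True a quiver_tail[OF Z a]
              by (simp add: g cyc_deriv_def csum_2 numeral_2_eq_2 Let_def atMost_Suc)
            also have "\<dots> = quad Z x b a"
              using True ij a b by (simp add: quad_def closed_word_2[OF Z])
            also have "\<dots> = quad Z z a b" using quad_cyceq[OF Z eq] quad_sym[OF Z] by metis
            finally show ?thesis using ij by simp
          next
            case False
            then show ?thesis using True by (auto simp: quad_def closed_word_2[OF Z])
          qed
        qed
        then show ?thesis using null[OF b(1)] by simp
      next
        case False
        then have "g (i, [a]) = 0" if "tail Z a = j" for a using path[of i "[a]"] that by auto
        then show ?thesis unfolding lam_def by (intro sum.neutral) auto
      qed
      ultimately show "g \<in> I" by (simp add: I_def)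
    qed
    then have Idl: "Idl\<^bsub>path_algebra Z\<^esub> G \<subseteq> I"
      by (rule ring.genideal_minimal[OF ring_path_algebra[OF Z] ideal])
    have clos: "x \<in> jacobian_ideal (Z, T) \<longleftrightarrow> x \<in> car Z \<and>
        (\<forall>n. \<exists>u\<in>Idl\<^bsub>path_algebra Z\<^esub> G. x - u \<in> arrow_ideal_pow Z n)" for x
      unfolding J adic_closure_def fun_diff_def by simp
    have "0 \<in> jacobian_ideal (Z, T)"
      unfolding clos
    proof (intro conjI allI)
      fix n show "\<exists>u\<in>Idl\<^bsub>path_algebra Z\<^esub> G. 0 - u \<in> arrow_ideal_pow Z n"
        by (rule bexI[OF _ zero_in_genideal]) simp
    qed simp
    then obtain h r where h: "h \<in> jacobian_ideal (Z, T)" and r: "r \<in> vertex_subalgebra Z" and hr: "arr Z y = h + r"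
      using quot_surjD[OF bij _ arr_car[OF Z y]] by blast
    \<comment> \<open>Approximation up to the square of the arrow ideal is enough, as
      \<open>lam\<close> sees linear terms only.\<close>
    obtain u where u: "u \<in> Idl\<^bsub>path_algebra Z\<^esub> G" "h - u \<in> arrow_ideal_pow Z 2"
      using h unfolding clos by blast
    let ?i = "head Z y" and ?j = "tail Z y"
    have "\<xi> y = lam ?i ?j (arr Z y)"
    proof -
      have "lam ?i ?j (arr Z y) = (\<Sum>a\<in>arcs Z. if a = y then \<xi> y else 0)"
        unfolding lam_def by (intro sum.cong refl) (auto simp: path_elem_apply)
      then show ?thesis using y by (simp add: quiver_finite_arcs[OF Z])
    qed
    also have "\<dots> = lam ?i ?j u"
      unfolding lam_def
    proof (intro sum.cong refl)
      fix a
      have "(h - u) (?i, [a]) = 0" using u(2) by (force simp: pow_iff)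
      moreover have "r (?i, [a]) = 0" using r by (force simp: vertex_subalgebra_def)
      ultimately have "arr Z y (?i, [a]) = u (?i, [a])" unfolding hr by (simp add: pointwise)
      then show "(if head Z a = ?i \<and> tail Z a = ?j then \<xi> a * arr Z y (?i, [a]) else 0) =
          (if head Z a = ?i \<and> tail Z a = ?j then \<xi> a * u (?i, [a]) else 0)" by simp
    qed
    also have "\<dots> = 0" using u(1) Idl by (auto simp: I_def)
    finally show ?thesis .
  qed
  moreover have "\<exists>b\<in>arcs Z. \<exists>c\<in>arcs Z. w = [b, c]" if "z (i, w) \<noteq> 0" for i w
  proof -
    have "is_qpath Z i w" using z that by (auto simp: car_iff)
    then have "set w \<subseteq> arcs Z" by (rule is_qpath_arcs)
    then show ?thesis using z2[OF that] by (auto simp: length_Suc_conv numeral_2_eq_2)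
  qed
  ultimately have "qpart Z (arcs Z) z" using Z z by (simp add: qpart_def)
  then show thesis using that T by blast
qed

subsection \<open>Stable equivalence\<close>

text \<open>Adjoining trivial summands to \<open>(V, x)\<close> one may reach a potential which retracts onto
  \<open>(Q, w)\<close>. Arrows are taken in a sum type to keep the summands disjoint.\<close>

definition stably_retracts :: "('v, 'q) quiver \<Rightarrow> ('v, 'q) series \<Rightarrow> ('v, 'a) quiver \<Rightarrow> ('v, 'a) series \<Rightarrow> bool" where
  "stably_retracts Q w V x \<longleftrightarrow> x \<in> arrow_ideal_pow V 2 \<and>
     (\<exists>(V' :: ('v, 'a + nat) quiver) N z p s. relabelling V V' Inl \<and> arcs V' = Inl ` arcs V \<union> Inr ` N \<and>
        qpart V' (Inr ` N) z \<and> retract Q w V' (relab V V' Inl x + z) p s)"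

lemma stably_retractsI:
  fixes V :: "('v, 'a) quiver" and V' :: "('v, 'a + nat) quiver"
  assumes "x \<in> arrow_ideal_pow V 2" "relabelling V V' Inl" "arcs V' = Inl ` arcs V \<union> Inr ` N"
    "qpart V' (Inr ` N) z" "retract Q w V' (relab V V' Inl x + z) p s"
  shows "stably_retracts Q w V x"
  unfolding stably_retracts_def using assms(1)
  by (intro conjI exI[of _ V'] exI[of _ N] exI[of _ z] exI[of _ p] exI[of _ s] assms)

lemma stably_retractsE:
  fixes V :: "('v, 'a) quiver"
  assumes "stably_retracts Q w V x"
  obtains V' :: "('v, 'a + nat) quiver" and N z p s where
    "x \<in> arrow_ideal_pow V 2" "relabelling V V' Inl" "arcs V' = Inl ` arcs V \<union> Inr ` N"
    "qpart V' (Inr ` N) z" "retract Q w V' (relab V V' Inl x + z) p s"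
  using assms unfolding stably_retracts_def by (elim conjE exE) (rule that)

text \<open>\<open>\<phi>\<close> is extended by the identity on the auxiliary arrows, realised as a
  substitution.\<close>

lemma extend_chom:
  fixes V1 :: "('v, 'a) quiver" and V1' :: "('v, 'b) quiver"
  assumes V: "relabelling V1 V2 Inl" "relabelling V1' V2' Inl"
    and arcs: "arcs V2 = Inl ` arcs V1 \<union> Inr ` N" "arcs V2' = Inl ` arcs V1' \<union> Inr ` N"
    and ht: "\<And>k. k \<in> N \<Longrightarrow> head V2' (Inr k) = head V2 (Inr k) \<and> tail V2' (Inr k) = tail V2 (Inr k)"
    and \<phi>: "chom V1 V1' \<phi>"
  obtains \<phi>' where "chom V2 V2' \<phi>'" "\<And>u. u \<in> car V1 \<Longrightarrow> \<phi>' (relab V1 V2 Inl u) = relab V1' V2' Inl (\<phi> u)"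
    "\<And>k. k \<in> N \<Longrightarrow> \<phi>' (arr V2 (Inr k)) = arr V2' (Inr k)"
proof -
  have Q: "is_quiver V1" "is_quiver V2" "is_quiver V1'" "is_quiver V2'"
    and ht1: "\<And>a. a \<in> arcs V1 \<Longrightarrow> head V2 (Inl a) = head V1 a \<and> tail V2 (Inl a) = tail V1 a"
    using V by (auto simp: relabelling_def)
  define f where "f = case_sum (\<lambda>a. relab V1' V2' Inl (\<phi> (arr V1 a))) (\<lambda>k. arr V2' (Inr k))"
  have s: "substitution V2 V2' f"
    unfolding substitution_def
  proof (intro conjI ballI)
    show "verts V2' = verts V2" using V chom_verts[OF \<phi>] by (simp add: relabelling_def)
    fix e assume e: "e \<in> arcs V2"
    show "f e \<in> arrow_ideal_pow V2' 1" "f e \<in> between V2' (head V2 e) (tail V2 e)"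
    proof -
      consider a where "e = Inl a" "a \<in> arcs V1" | k where "e = Inr k" "k \<in> N" using e arcs by auto
      then have "f e \<in> arrow_ideal_pow V2' 1 \<and> f e \<in> between V2' (head V2 e) (tail V2 e)"
      proof cases
        case 1
        have c: "chom V1 V2' (\<lambda>x. relab V1' V2' Inl (\<phi> x))" by (rule chom_comp[OF \<phi> relab_chom[OF V(2)]])
        show ?thesis
          using chom_arr_pow[OF Q(1) c 1(2)] chom_arr_between[OF Q(1) c 1(2)] ht1[OF 1(2)] 1 by (simp add: f_def)
      next
        case 2
        then have "Inr k \<in> arcs V2'" using arcs by auto
        then show ?thesis
          using arr_pow[OF Q(4)] arr_between[OF Q(4)] ht[OF 2(2)] 2 by (fastforce simp: f_def)
      qed
      then show "f e \<in> arrow_ideal_pow V2' 1" "f e \<in> between V2' (head V2 e) (tail V2 e)" by auto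
    qed
  qed (use Q in auto)
  let ?\<phi> = "subst V2 V2' f"
  have c: "chom V2 V2' ?\<phi>" by (rule chom_subst[OF s])
  show thesis
  proof (rule that[OF c])
    show "?\<phi> (arr V2 (Inr k)) = arr V2' (Inr k)" if "k \<in> N" for k
      using subst_arr[OF s, of "Inr k"] that arcs by (simp add: f_def)
    show "?\<phi> (relab V1 V2 Inl u) = relab V1' V2' Inl (\<phi> u)" if u: "u \<in> car V1" for u
    proof (rule chom_eqI[OF Q(1) _ _ u])
      show "chom V1 V2' (\<lambda>u. ?\<phi> (relab V1 V2 Inl u))" by (rule chom_comp[OF relab_chom[OF V(1)] c])
      show "chom V1 V2' (\<lambda>u. relab V1' V2' Inl (\<phi> u))" by (rule chom_comp[OF \<phi> relab_chom[OF V(2)]])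
      show "?\<phi> (relab V1 V2 Inl (arr V1 a)) = relab V1' V2' Inl (\<phi> (arr V1 a))" if a: "a \<in> arcs V1" for a
        using subst_arr[OF s, of "Inl a"] a arcs by (simp add: f_def relab_arr[OF V(1) a])
    qed
  qed
qed

definition adjoin_arcs :: "('v, 'a) quiver \<Rightarrow> nat set \<Rightarrow> (nat \<Rightarrow> 'v) \<Rightarrow> (nat \<Rightarrow> 'v) \<Rightarrow> ('v, 'a + nat) quiver" where
  "adjoin_arcs V N t h = \<lparr>verts = verts V, arcs = Inl ` arcs V \<union> Inr ` N,
     tail = case_sum (tail V) t, head = case_sum (head V) h\<rparr>"

lemma adjoin_arcs_quiver:
  assumes "is_quiver V" "finite N" "\<And>k. k \<in> N \<Longrightarrow> t k \<in> verts V \<and> h k \<in> verts V \<and> t k \<noteq> h k"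
  shows "is_quiver (adjoin_arcs V N t h)"
  by (rule is_quiverI) (use assms in \<open>auto simp: adjoin_arcs_def quiver_finite_arcs quiver_finite_verts quiver_tail
      quiver_head quiver_loopfree\<close>)

lemma adjoin_arcs_relabelling:
  assumes "is_quiver V" "is_quiver (adjoin_arcs V N t h)" shows "relabelling V (adjoin_arcs V N t h) Inl"
  using assms by (auto simp: relabelling_def adjoin_arcs_def)

lemma finite_Inr: "finite (Inr ` N) \<Longrightarrow> finite N"
  by (erule finite_imageD) simp

text \<open>The auxiliary summand goes along: both quivers carry the same extra arrows, and the
  isomorphism is extended by the identity on them, hence fixes \<open>z\<close>.\<close>

lemma stably_retracts_qiso:
  fixes V V' :: "('v, 'a) quiver"
  assumes Q: "is_quiver Q" and st: "stably_retracts Q w V x" and iso: "qiso V V' \<phi> \<psi>"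
    and x': "x' \<in> arrow_ideal_pow V' 2" and eq: "cyceq V' (\<phi> x) x'"
  shows "stably_retracts Q w V' x'"
proof -
  note V = qisoD(1,2)[OF iso] and \<phi> = qisoD(3)[OF iso] and \<psi> = qisoD(4)[OF iso]
  obtain V1 :: "('v, 'a + nat) quiver" and N z p s where x: "x \<in> arrow_ideal_pow V 2"
    and rel: "relabelling V V1 Inl" and arcs: "arcs V1 = Inl ` arcs V \<union> Inr ` N"
    and z: "qpart V1 (Inr ` N) z" and r: "retract Q w V1 (relab V V1 Inl x + z) p s"
    by (rule stably_retractsE[OF st])
  have V1: "is_quiver V1" using rel by (simp add: relabelling_def)
  define V1' where "V1' = adjoin_arcs V' N (\<lambda>k. tail V1 (Inr k)) (\<lambda>k. head V1 (Inr k))"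
  have N: "finite N" by (rule finite_Inr[OF finite_subset[OF _ quiver_finite_arcs[OF V1]]]) (auto simp: arcs)
  have verts: "verts V' = verts V1" using chom_verts[OF \<phi>] rel by (simp add: relabelling_def)
  have V1': "is_quiver V1'"
    unfolding V1'_def
    by (rule adjoin_arcs_quiver[OF V(2) N])
       (use V1 arcs in \<open>auto simp: verts quiver_tail quiver_head quiver_loopfree\<close>)
  have rel': "relabelling V' V1' Inl"
    using adjoin_arcs_relabelling[OF V(2)] V1' by (simp add: V1'_def)
  have arcs': "arcs V1' = Inl ` arcs V' \<union> Inr ` N" by (simp add: V1'_def adjoin_arcs_def)
  have ht: "head V1' (Inr k) = head V1 (Inr k) \<and> tail V1' (Inr k) = tail V1 (Inr k)" for k
    by (simp add: V1'_def adjoin_arcs_def)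
  have ht': "head V1 (Inr k) = head V1' (Inr k) \<and> tail V1 (Inr k) = tail V1' (Inr k)" for k
    using ht[of k] by simp
  obtain f where f: "chom V1 V1' f" "\<And>u. u \<in> car V \<Longrightarrow> f (relab V V1 Inl u) = relab V' V1' Inl (\<phi> u)"
    "\<And>k. k \<in> N \<Longrightarrow> f (arr V1 (Inr k)) = arr V1' (Inr k)"
    by (rule extend_chom[OF rel rel' arcs arcs' ht \<phi>]) (rule that)
  obtain g where g: "chom V1' V1 g" "\<And>u. u \<in> car V' \<Longrightarrow> g (relab V' V1' Inl u) = relab V V1 Inl (\<psi> u)"
    "\<And>k. k \<in> N \<Longrightarrow> g (arr V1' (Inr k)) = arr V1 (Inr k)"
    by (rule extend_chom[OF rel' rel arcs' arcs ht' \<psi>]) (rule that)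
  have iso': "qiso V1 V1' f g"
  proof (rule qisoI_arrs[OF V1 V1' f(1) g(1)])
    fix e assume "e \<in> arcs V1"
    then consider a where "e = Inl a" "a \<in> arcs V" | k where "e = Inr k" "k \<in> N" using arcs by auto
    then show "g (f (arr V1 e)) = arr V1 e"
    proof cases
      case 1
      have c: "arr V a \<in> car V" by (rule arr_car[OF V(1) 1(2)])
      have "arr V1 e = relab V V1 Inl (arr V a)" unfolding 1(1) by (rule relab_arr[OF rel 1(2), symmetric])
      then show ?thesis
        by (simp only: f(2)[OF c] g(2)[OF chom_car[OF \<phi> c]] qisoD(5)[OF iso c])
    next
      case 2
      show ?thesis unfolding 2(1) f(3)[OF 2(2)] g(3)[OF 2(2)] ..
    qed
  next
    fix e assume "e \<in> arcs V1'"
    then consider a where "e = Inl a" "a \<in> arcs V'" | k where "e = Inr k" "k \<in> N" using arcs' by auto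
    then show "f (g (arr V1' e)) = arr V1' e"
    proof cases
      case 1
      have c: "arr V' a \<in> car V'" by (rule arr_car[OF V(2) 1(2)])
      have "arr V1' e = relab V' V1' Inl (arr V' a)" unfolding 1(1) by (rule relab_arr[OF rel' 1(2), symmetric])
      then show ?thesis
        by (simp only: g(2)[OF c] f(2)[OF chom_car[OF \<psi> c]] qisoD(6)[OF iso c])
    next
      case 2
      show ?thesis unfolding 2(1) g(3)[OF 2(2)] f(3)[OF 2(2)] ..
    qed
  qed
  have fz: "f z = z"
  proof (rule chom_fix[where S = "Inr ` N", OF V1 f(1) _ qpartD(3)[OF z]])
    fix e :: "'a + nat" assume "e \<in> Inr ` N"
    then obtain k where "e = Inr k" "k \<in> N" by blast
    then show "e \<in> arcs V1 \<and> f (arr V1 e) = arr V1' e \<and> head V1' e = head V1 e \<and> tail V1' e = tail V1 e"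
      using f(3)[of k] ht[of k] arcs by simp
  next
    fix i v assume "z (i, v) \<noteq> 0"
    then show "set v \<subseteq> Inr ` N" using qpartD(4)[OF z, of i v] by auto
  qed
  have z': "qpart V1' (Inr ` N) z"
    by (rule qpart_cong[OF z V1']) (use arcs' ht in auto)
  have xc: "relab V V1 Inl x \<in> car V1" by (rule chom_car[OF relab_chom[OF rel] pow_car[OF x]])
  have "f (relab V V1 Inl x + z) = relab V' V1' Inl (\<phi> x) + z"
    using clin_add[OF chom_clin[OF f(1)] xc qpartD(3)[OF z]] f(2)[OF pow_car[OF x]] fz by simp
  moreover have "cyceq V1' (relab V' V1' Inl (\<phi> x) + z) (relab V' V1' Inl x' + z)"
    by (rule cyceq_add[OF cyceq_chom[OF V(2) V1' relab_chom[OF rel'] eq] cyceq_refl[OF qpartD(3)[OF z']]])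
  ultimately have eq': "cyceq V1' (f (relab V V1 Inl x + z)) (relab V' V1' Inl x' + z)" by simp
  have "relab V' V1' Inl x' + z \<in> arrow_ideal_pow V1' 2"
    using clin_pow[OF chom_clin[OF relab_chom[OF rel']] x'] qpart_pow[OF z'] by blast
  from retract_qiso[OF Q r iso' this eq'] show ?thesis
    by (rule stably_retractsI[OF x' rel' arcs' z'])
qed

text \<open>Without 2-cycles the quadratic matrix is zero, so every vector lies in the radical,
  matching the full column space of the identity. The construction then only moves the arrows into
  the left half of the sum type.\<close>

lemma stably_retracts_refl:
  assumes Q: "is_quiver Q" and w: "w \<in> arrow_ideal_pow Q 2" and two: "\<And>a b. \<not> closed_word Q [a, b]"
  shows "stably_retracts Q w Q w"
proof -
  have wc: "w \<in> car Q" by (rule pow_car[OF w])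
  have null: "null Q w \<xi>" for \<xi> using two by (simp add: null_def quad_def)
  have ex: "\<exists>\<eta>. \<forall>y\<in>arcs Q. \<xi> y = (\<Sum>a\<in>arcs Q. lin Q Q (\<lambda>x. x) y a * \<eta> a)" for \<xi> :: "'b \<Rightarrow> complex"
  proof (intro exI ballI)
    fix y assume y: "y \<in> arcs Q"
    have "(\<Sum>a\<in>arcs Q. lin Q Q (\<lambda>x. x) y a * \<xi> a) = (\<Sum>a\<in>arcs Q. if y = a then \<xi> a else 0)"
      by (intro sum.cong refl) (simp add: lin_id)
    then show "\<xi> y = (\<Sum>a\<in>arcs Q. lin Q Q (\<lambda>x. x) y a * \<xi> a)" using y by (simp add: quiver_finite_arcs[OF Q])
  qed
  have r: "retract Q w Q w (\<lambda>x. x) (\<lambda>x. x)"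
    unfolding retract_def using Q w chom_id[of Q] cyceq_refl[OF wc] null ex cder_car[OF _ wc] cyceq_refl by blast
  define V' :: "('a, 'b + nat) quiver" where "V' = adjoin_arcs Q {} undefined undefined"
  have V': "is_quiver V'" unfolding V'_def by (rule adjoin_arcs_quiver[OF Q]) auto
  have rel: "relabelling Q V' Inl" using adjoin_arcs_relabelling[OF Q] V' by (simp add: V'_def)
  have arcs: "arcs V' = Inl ` arcs Q" by (simp add: V'_def adjoin_arcs_def)
  have iso: "qiso Q V' (relab Q V' Inl) (relab V' Q (inv_into (arcs Q) Inl))"
    by (rule relab_qiso[OF rel]) (simp add: arcs)
  have rw: "relab Q V' Inl w \<in> arrow_ideal_pow V' 2" by (rule clin_pow[OF chom_clin[OF relab_chom[OF rel]] w])
  have "qpart V' (Inr ` {}) 0" using V' by (simp add: qpart_def pointwise)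
  moreover have "retract Q w V' (relab Q V' Inl w + 0)
      (\<lambda>y. relab V' Q (inv_into (arcs Q) Inl) y) (\<lambda>u. relab Q V' Inl u)"
    using retract_qiso[OF Q r iso rw cyceq_refl[OF pow_car[OF rw]]] by simp
  ultimately show ?thesis
    by (intro stably_retractsI[OF w rel, where N = "{}" and z = 0]) (simp_all add: arcs)
qed

lemma relab_subquiver:
  assumes sub: "subquiver V V'" and rel: "relabelling V V1 g" "relabelling V' V1' g'" and sub': "subquiver V1 V1'"
    and g: "\<And>a. a \<in> arcs V \<Longrightarrow> g' a = g a" and x: "x \<in> car V"
  shows "relab V' V1' g' x = relab V V1 g x"
proof -
  have V: "is_quiver V" using sub by (simp add: subquiver_def)
  show ?thesis
  proof (rule chom_eqI[OF V _ _ x])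
    show "chom V V1' (\<lambda>x. relab V' V1' g' x)" using chom_comp[OF subquiver_chom[OF sub] relab_chom[OF rel(2)]] .
    show "chom V V1' (\<lambda>x. relab V V1 g x)" using chom_comp[OF relab_chom[OF rel(1)] subquiver_chom[OF sub']] .
    fix a assume a: "a \<in> arcs V"
    then have a': "a \<in> arcs V'" "arr V a = arr V' a" "g a \<in> arcs V1" using sub rel by (auto simp: subquiver_def relabelling_def)
    show "relab V' V1' g' (arr V a) = relab V V1 g (arr V a)"
      unfolding relab_arr[OF rel(1) a] unfolding a'(2) relab_arr[OF rel(2) a'(1)] g[OF a]
      using sub' a'(3) by (simp add: subquiver_def)
  qed
qed

lemma stably_retracts_adjoin:
  assumes Q: "is_quiver Q" and sub: "subquiver V V'" and arcsV: "arcs V' = arcs V \<union> S" and disj: "arcs V \<inter> S = {}"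
    and zS: "qpart V' S zS" and st: "stably_retracts Q w V x"
  shows "stably_retracts Q w V' (x + zS)"
proof -
  have V: "is_quiver V" "is_quiver V'" using sub by (auto simp: subquiver_def)
  obtain V1 :: "('a, 'c + nat) quiver" and N z p s where x: "x \<in> arrow_ideal_pow V 2"
    and rel: "relabelling V V1 Inl" and arcs: "arcs V1 = Inl ` arcs V \<union> Inr ` N"
    and z: "qpart V1 (Inr ` N) z" and r: "retract Q w V1 (relab V V1 Inl x + z) p s"
    by (rule stably_retractsE[OF st])
  have V1: "is_quiver V1" using rel by (simp add: relabelling_def)
  define V1' where "V1' = adjoin_arcs V' N (\<lambda>k. tail V1 (Inr k)) (\<lambda>k. head V1 (Inr k))"
  have N: "finite N" by (rule finite_Inr[OF finite_subset[OF _ quiver_finite_arcs[OF V1]]]) (auto simp: arcs)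
  have verts: "verts V' = verts V1" using sub rel by (simp add: relabelling_def subquiver_def)
  have V1': "is_quiver V1'"
    unfolding V1'_def
    by (rule adjoin_arcs_quiver[OF V(2) N])
       (use V1 arcs in \<open>auto simp: verts quiver_tail quiver_head quiver_loopfree\<close>)
  have rel': "relabelling V' V1' Inl"
    using adjoin_arcs_relabelling[OF V(2)] V1' by (simp add: V1'_def)
  have arcs': "arcs V1' = Inl ` arcs V' \<union> Inr ` N" by (simp add: V1'_def adjoin_arcs_def)
  have sub1: "subquiver V1 V1'"
    unfolding subquiver_def
    using V1 V1' verts arcs sub rel by (auto simp: V1'_def adjoin_arcs_def subquiver_def relabelling_def)
  have z1: "qpart V1' (Inl ` S) (relab V' V1' Inl zS)" by (rule qpart_relab[OF rel' zS])
  have r1: "retract Q w V1' (relab V V1 Inl x + z + relab V' V1' Inl zS) (\<lambda>y. p (restr V1 y)) s"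
    by (rule retract_add[OF Q sub1 _ _ z1 r]) (use arcs arcs' arcsV disj in auto)
  have xV': "x \<in> arrow_ideal_pow V' 2" by (rule clin_pow[OF chom_clin[OF subquiver_chom[OF sub]] x])
  have "relab V' V1' Inl (x + zS) = relab V V1 Inl x + relab V' V1' Inl zS"
    using clin_add[OF chom_clin[OF relab_chom[OF rel']] pow_car[OF xV'] qpartD(3)[OF zS]]
      relab_subquiver[OF sub rel rel' sub1 refl pow_car[OF x]] by simp
  then have "relab V V1 Inl x + z + relab V' V1' Inl zS = relab V' V1' Inl (x + zS) + z"
    by (simp add: algebra_simps)
  with r1 have r2: "retract Q w V1' (relab V' V1' Inl (x + zS) + z) (\<lambda>y. p (restr V1 y)) s" by simp
  have z': "qpart V1' (Inr ` N) z"
    by (rule qpart_cong[OF z V1']) (use arcs' in \<open>auto simp: V1'_def adjoin_arcs_def\<close>)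
  have "x + zS \<in> arrow_ideal_pow V' 2" using xV' qpart_pow[OF zS] by blast
  then show ?thesis by (rule stably_retractsI[OF _ rel' arcs' z' r2])
qed

lemma stably_retracts_delete:
  assumes Q: "is_quiver Q" and sub: "subquiver V V'" and arcsV: "arcs V' = arcs V \<union> S" and disj: "arcs V \<inter> S = {}"
    and zS: "qpart V' S zS" and x: "x \<in> arrow_ideal_pow V 2" and st: "stably_retracts Q w V' (x + zS)"
  shows "stably_retracts Q w V x"
proof -
  have V: "is_quiver V" "is_quiver V'" using sub by (auto simp: subquiver_def)
  obtain V1 :: "('a, 'c + nat) quiver" and N z p s where "x + zS \<in> arrow_ideal_pow V' 2" and
    rel: "relabelling V' V1 Inl" and arcs: "arcs V1 = Inl ` arcs V' \<union> Inr ` N"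
    and z: "qpart V1 (Inr ` N) z" and r: "retract Q w V1 (relab V' V1 Inl (x + zS) + z) p s"
    by (rule stably_retractsE[OF st])
  have V1: "is_quiver V1" using rel by (simp add: relabelling_def)
  have N: "finite N" by (rule finite_Inr[OF finite_subset[OF _ quiver_finite_arcs[OF V1]]]) (auto simp: arcs)
  have S: "finite S" using quiver_finite_arcs[OF V(2)] arcsV by simp
  obtain f :: "'c \<Rightarrow> nat" where f: "inj_on f S" "f ` S \<inter> N = {}"
  proof -
    obtain B where B: "B \<subseteq> - N" "finite B" "card B = card S"
      using infinite_arbitrarily_large[of "- N" "card S"] N by (auto simp: Compl_eq_Diff_UNIV)
    then obtain f where "bij_betw f S B" using finite_same_card_bij[OF S B(2)] by auto
    then show thesis using that[of f] B(1) by (auto simp: bij_betw_def)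
  qed
  define g where "g = (\<lambda>e. case e of Inl a \<Rightarrow> if a \<in> S then Inr (f a) else Inl a | Inr k \<Rightarrow> Inr k)"
  define t where "t = (\<lambda>k. if k \<in> N then tail V1 (Inr k) else tail V' (inv_into S f k))"
  define h where "h = (\<lambda>k. if k \<in> N then head V1 (Inr k) else head V' (inv_into S f k))"
  define V2 where "V2 = adjoin_arcs V (N \<union> f ` S) t h"
  have verts: "verts V = verts V1" "verts V = verts V'" using sub rel by (auto simp: relabelling_def subquiver_def)
  have th: "t k = tail V1 (Inr k) \<and> h k = head V1 (Inr k)" if "k \<in> N" for k using that by (simp add: t_def h_def)
  have thS: "t (f a) = tail V' a \<and> h (f a) = head V' a" if "a \<in> S" for a
  proof -
    have "f a \<notin> N" using f(2) that by blast
    then show ?thesis using f(1) that by (simp add: t_def h_def)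
  qed
  have V2: "is_quiver V2"
    unfolding V2_def
  proof (rule adjoin_arcs_quiver[OF V(1)])
    show "finite (N \<union> f ` S)" using N S by simp
    fix k assume "k \<in> N \<union> f ` S"
    then consider "k \<in> N" | a where "a \<in> S" "k = f a" by auto
    then show "t k \<in> verts V \<and> h k \<in> verts V \<and> t k \<noteq> h k"
    proof cases
      case 1
      then have "Inr k \<in> arcs V1" using arcs by auto
      then show ?thesis using th[OF 1] quiver_tail[OF V1] quiver_head[OF V1] quiver_loopfree[OF V1] verts by auto
    next
      case 2
      then have "a \<in> arcs V'" using arcsV by auto
      then show ?thesis using thS[OF 2(1)] 2 quiver_tail[OF V(2)] quiver_head[OF V(2)] quiver_loopfree[OF V(2)] verts by auto
    qed
  qed
  have rel2: "relabelling V V2 Inl" using adjoin_arcs_relabelling[OF V(1)] V2 by (simp add: V2_def)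
  have arcs2: "arcs V2 = Inl ` arcs V \<union> Inr ` (N \<union> f ` S)" by (simp add: V2_def adjoin_arcs_def)
  have gimg: "g ` arcs V1 = arcs V2"
  proof -
    have "g ` Inl ` arcs V = Inl ` arcs V" using disj by (force simp: g_def)
    moreover have "g ` Inl ` S = Inr ` f ` S" by (force simp: g_def)
    moreover have "g ` Inr ` N = Inr ` N" by (force simp: g_def)
    moreover have "arcs V1 = Inl ` arcs V \<union> Inl ` S \<union> Inr ` N" using arcs arcsV by auto
    ultimately show ?thesis unfolding arcs2 by (simp add: image_Un) blast
  qed
  have relg: "relabelling V1 V2 g"
    unfolding relabelling_def
  proof (intro conjI ballI)
    show "is_quiver V1" "is_quiver V2" by (fact V1 V2)+
    show "verts V2 = verts V1" using verts by (simp add: V2_def adjoin_arcs_def)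
    show "inj_on g (arcs V1)"
    proof (rule inj_onI)
      fix d e assume "d \<in> arcs V1" "e \<in> arcs V1" "g d = g e"
      moreover have "f a \<notin> N" if "a \<in> S" for a using f(2) that by blast
      ultimately show "d = e" using f(1) unfolding arcs
        by (auto simp: g_def split: if_splits dest: inj_onD)
    qed
    fix e assume e: "e \<in> arcs V1"
    show "g e \<in> arcs V2" using gimg e by blast
    consider a where "e = Inl a" "a \<in> arcs V" "a \<notin> S" | a where "e = Inl a" "a \<in> S" | k where "e = Inr k" "k \<in> N"
      using e arcs arcsV disj by auto
    then have "head V2 (g e) = head V1 e \<and> tail V2 (g e) = tail V1 e"
    proof cases
      case 1
      then have "a \<in> arcs V'" using arcsV by auto
      then show ?thesis using 1 rel sub by (simp add: g_def V2_def adjoin_arcs_def relabelling_def subquiver_def)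
    next
      case 2
      then have "a \<in> arcs V'" using arcsV by auto
      then show ?thesis using 2 rel thS[OF 2(2)] by (simp add: g_def V2_def adjoin_arcs_def relabelling_def)
    next
      case 3
      then show ?thesis using th by (simp add: g_def V2_def adjoin_arcs_def)
    qed
    then show "head V2 (g e) = head V1 e" "tail V2 (g e) = tail V1 e" by auto
  qed
  let ?r = "relab V1 V2 g"
  let ?z = "relab V' V1 Inl zS + z"
  have zz: "qpart V1 (Inl ` S \<union> Inr ` N) ?z" by (rule qpart_union[OF qpart_relab[OF rel zS] z]) auto
  have gS: "g ` (Inl ` S \<union> Inr ` N) = Inr ` (N \<union> f ` S)" by (force simp: g_def)
  have z2: "qpart V2 (Inr ` (N \<union> f ` S)) (?r ?z)" using qpart_relab[OF relg zz] gS by simp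
  have xV': "x \<in> car V'" by (rule subquiver_car[OF sub pow_car[OF x]])
  have xr: "?r (relab V' V1 Inl x) = relab V V2 Inl x"
  proof (rule chom_eqI[OF V(1) _ _ pow_car[OF x]])
    show "chom V V2 (\<lambda>x. ?r (relab V' V1 Inl x))"
      using chom_comp[OF chom_comp[OF subquiver_chom[OF sub] relab_chom[OF rel]] relab_chom[OF relg]] .
    show "chom V V2 (relab V V2 Inl)" by (rule relab_chom[OF rel2])
    fix a assume a: "a \<in> arcs V"
    then have a': "a \<in> arcs V'" "arr V a = arr V' a" "Inl a \<in> arcs V1" "a \<notin> S"
      using sub arcs disj by (auto simp: subquiver_def)
    have "?r (relab V' V1 Inl (arr V a)) = arr V2 (g (Inl a))"
      unfolding a'(2) relab_arr[OF rel a'(1)] by (rule relab_arr[OF relg a'(3)])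
    then show "?r (relab V' V1 Inl (arr V a)) = relab V V2 Inl (arr V a)"
      unfolding relab_arr[OF rel2 a] using a'(4) by (simp add: g_def)
  qed
  have c1: "relab V' V1 Inl x \<in> car V1" by (rule chom_car[OF relab_chom[OF rel] xV'])
  have split: "relab V' V1 Inl (x + zS) + z = relab V' V1 Inl x + ?z"
    using clin_add[OF chom_clin[OF relab_chom[OF rel]] xV' qpartD(3)[OF zS]] by (simp add: algebra_simps)
  have eq: "?r (relab V' V1 Inl (x + zS) + z) = relab V V2 Inl x + ?r ?z"
    unfolding split using clin_add[OF chom_clin[OF relab_chom[OF relg]] c1 qpartD(3)[OF zz]] xr by simp
  have pow: "relab V V2 Inl x + ?r ?z \<in> arrow_ideal_pow V2 2"
    using clin_pow[OF chom_clin[OF relab_chom[OF rel2]] x] qpart_pow[OF z2] by blast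
  have "cyceq V2 (?r (relab V' V1 Inl (x + zS) + z)) (relab V V2 Inl x + ?r ?z)"
    unfolding eq by (rule cyceq_refl[OF pow_car[OF pow]])
  from retract_qiso[OF Q r relab_qiso[OF relg gimg] pow this] show ?thesis
    by (rule stably_retractsI[OF x rel2 arcs2 z2])
qed

subsection \<open>Sums with trivial summands\<close>

lemma quiver_sum_sub:
  assumes "is_quiver V" "is_quiver C" "verts C = verts V" "arcs V \<inter> arcs C = {}"
  shows "is_quiver (quiver_sum V C)" "subquiver V (quiver_sum V C)" "subquiver C (quiver_sum V C)"
proof -
  show q: "is_quiver (quiver_sum V C)"
    by (rule is_quiverI) (use assms quiver_tail[OF assms(2)] quiver_head[OF assms(2)] in
        \<open>auto simp: quiver_sum_def quiver_finite_arcs quiver_finite_verts quiver_tail quiver_head quiver_loopfree\<close>)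
  show "subquiver V (quiver_sum V C)" "subquiver C (quiver_sum V C)"
    using assms q by (auto simp: subquiver_def quiver_sum_def)
qed

text \<open>The union over representatives collapses to one coset, because cyclic equivalence in a
  summand persists in the sum.\<close>

lemma qp_sum_cyc_class:
  assumes V: "is_quiver V" "is_quiver C" "verts C = verts V" "arcs V \<inter> arcs C = {}" and x: "x \<in> car V" and z: "z \<in> car C"
  shows "qp_sum (V, cyc_class V x) (C, cyc_class C z) = (quiver_sum V C, cyc_class (quiver_sum V C) (x + z))"
proof -
  let ?S = "quiver_sum V C"
  note S = quiver_sum_sub[OF V]
  have "cyc_class ?S (\<lambda>p. x' p + z' p) = cyc_class ?S (x + z)" if "x' \<in> cyc_class V x" "z' \<in> cyc_class C z" for x' z'
  proof -
    have "cyceq ?S x' x" using that(1) cyceq_chom[OF V(1) S(1) subquiver_chom[OF S(2)]] x by (simp add: cyc_class_iff)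
    moreover have "cyceq ?S z' z" using that(2) cyceq_chom[OF V(2) S(1) subquiver_chom[OF S(3)]] z by (simp add: cyc_class_iff)
    ultimately have "cyceq ?S (x' + z') (x + z)" by (rule cyceq_add)
    then have "cyc_class ?S (x' + z') = cyc_class ?S (x + z)" using cyc_class_eq_iff[OF S(1)] cyceq_car by blast
    then show ?thesis by (simp add: plus_fun_def)
  qed
  moreover have "x \<in> cyc_class V x" "z \<in> cyc_class C z" using x z by (auto simp: cyc_class_iff cyceq_refl)
  ultimately show ?thesis unfolding qp_sum_def by auto
qed

definition qp_retracts :: "('v, 'q) quiver \<Rightarrow> ('v, 'q) series \<Rightarrow> ('v, 'a) qp \<Rightarrow> bool" where
  "qp_retracts Q w X \<longleftrightarrow> (\<exists>V x. X = (V, cyc_class V x) \<and> is_quiver V \<and> stably_retracts Q w V x)"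

text \<open>Independence of the representative: two of them are related by the identity
  isomorphism.\<close>

lemma qp_retractsD:
  assumes Q: "is_quiver Q" and "qp_retracts Q w (V, cyc_class V x)" "is_quiver V" "x \<in> arrow_ideal_pow V 2"
  shows "stably_retracts Q w V x"
proof -
  obtain x' where x': "cyc_class V x = cyc_class V x'" "stably_retracts Q w V x'"
    using assms by (auto simp: qp_retracts_def)
  have "cyceq V x' x" using x' cyc_class_eq_iff[OF assms(3)] pow_car[OF assms(4)] cyceq_sym[OF assms(3)]
    by (metis pow_car stably_retracts_def)
  then show ?thesis
    using stably_retracts_qiso[OF Q x'(2), of V "\<lambda>x. x" "\<lambda>x. x" x] assms by (simp add: qiso_def chom_id)
qed

text \<open>An equivalence instead of an implication, because the stable class is generated by steps
  in both directions.\<close>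

lemma qp_retracts_step:
  assumes Q: "is_quiver Q" and "stable_step X Y"
  shows "qp_retracts Q w X \<longleftrightarrow> qp_retracts Q w Y"
  using assms(2)
proof cases
  case (right_equiv \<phi>)
  obtain V x where X: "X = (V, cyc_class V x)" "is_quiver V" "x \<in> arrow_ideal_pow V 2" using is_qpE[OF right_equiv(1)] .
  obtain V' y where Y: "Y = (V', cyc_class V' y)" "is_quiver V'" "y \<in> arrow_ideal_pow V' 2" using is_qpE[OF right_equiv(2)] .
  obtain \<psi> where iso: "qiso V V' \<phi> \<psi>" and y': "\<phi> x \<in> cyc_class V' y"
    using right_equivalenceD[of \<phi> V x V' "cyc_class V' y"] right_equiv(3) X Y pow_car by blast
  have eq: "cyceq V' (\<phi> x) y" using y' cyc_class_iff[OF pow_car[OF Y(3)]] by simp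
  have eq': "cyceq V (\<psi> y) x"
    using cyceq_chom[OF Y(2) X(2) qisoD(4)[OF iso] cyceq_sym[OF Y(2) eq]] qisoD(5)[OF iso pow_car[OF X(3)]] by simp
  show ?thesis
  proof
    assume "qp_retracts Q w X"
    then have "stably_retracts Q w V' y"
      using stably_retracts_qiso[OF Q qp_retractsD[OF Q _ X(2,3)] iso Y(3) eq] X(1) by simp
    then show "qp_retracts Q w Y" using Y by (auto simp: qp_retracts_def)
  next
    assume "qp_retracts Q w Y"
    then have "stably_retracts Q w V x"
      using stably_retracts_qiso[OF Q qp_retractsD[OF Q _ Y(2,3)] qiso_sym[OF iso] X(3) eq'] Y(1) by simp
    then show "qp_retracts Q w X" using X by (auto simp: qp_retracts_def)
  qed
next
  case (adjoin_trivial Z)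
  obtain V x where X: "X = (V, cyc_class V x)" "is_quiver V" "x \<in> arrow_ideal_pow V 2" using is_qpE[OF adjoin_trivial(2)] .
  obtain C T where Z: "Z = (C, T)" by (cases Z)
  obtain z where z: "T = cyc_class C z" "qpart C (arcs C) z" using trivial_qpart adjoin_trivial(3) Z by blast
  have C: "is_quiver C" "verts C = verts V" "arcs V \<inter> arcs C = {}"
    using qpartD(1)[OF z(2)] adjoin_trivial(4) X Z by (auto simp: summable_qp_def)
  let ?S = "quiver_sum V C"
  note S = quiver_sum_sub[OF X(2) C]
  have Y: "Y = (?S, cyc_class ?S (x + z))"
    using qp_sum_cyc_class[OF X(2) C pow_car[OF X(3)] qpartD(3)[OF z(2)]] adjoin_trivial(1) X Z z by simp
  have zS: "qpart ?S (arcs C) z"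
    by (rule qpart_cong[OF z(2) S(1)]) (use S(3) in \<open>auto simp: subquiver_def\<close>)
  have arcs: "arcs ?S = arcs V \<union> arcs C" by (simp add: quiver_sum_def)
  have pow: "x + z \<in> arrow_ideal_pow ?S 2"
    using clin_pow[OF chom_clin[OF subquiver_chom[OF S(2)]] X(3)] qpart_pow[OF zS] by blast
  show ?thesis
  proof
    assume "qp_retracts Q w X"
    then have "stably_retracts Q w ?S (x + z)"
      using stably_retracts_adjoin[OF Q S(2) arcs C(3) zS qp_retractsD[OF Q _ X(2,3)]] X(1) by simp
    then show "qp_retracts Q w Y" using Y S(1) by (auto simp: qp_retracts_def)
  next
    assume "qp_retracts Q w Y"
    then have "stably_retracts Q w V x"
      using stably_retracts_delete[OF Q S(2) arcs C(3) zS X(3) qp_retractsD[OF Q _ S(1) pow]] Y by simp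
    then show "qp_retracts Q w X" using X by (auto simp: qp_retracts_def)
  qed
qed

lemma qp_retracts_equiv:
  assumes Q: "is_quiver Q" and "equivclp stable_step X Y" "qp_retracts Q w X"
  shows "qp_retracts Q w Y"
  using assms(2,3)
proof (induction rule: equivclp_induct)
  case (step Y Z)
  then show ?case using qp_retracts_step[OF Q] by blast
qed

subsection \<open>Splitting off a pair of arrows\<close>

lemma clin_shift:
  assumes V: "is_quiver V" and T: "clin V V' T" and x: "x \<in> arrow_ideal_pow V l"
    and p: "\<And>i w. is_qpath V i w \<Longrightarrow> T (path_elem (i, w)) \<in> arrow_ideal_pow V' (length w + k)"
  shows "T x \<in> arrow_ideal_pow V' (l + k)"
  unfolding pow_iff
proof (intro conjI allI impI)
  show "T x \<in> car V'" by (rule clin_car[OF T pow_car[OF x]])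
  fix i w assume "T x (i, w) \<noteq> 0"
  then obtain q where q: "q \<in> paths V (length w)" "x q * T (path_elem q) (i, w) \<noteq> 0"
    unfolding clin_expand[OF V T pow_car[OF x] order_refl] by (meson sum.not_neutral_contains_not_neutral)
  obtain j u where ju: "q = (j, u)" "is_qpath V j u" using q(1) by (auto simp: paths_def)
  have "x (j, u) \<noteq> 0" "T (path_elem (j, u)) (i, w) \<noteq> 0" using q(2) ju(1) by auto
  then have "l \<le> length u" "length u + k \<le> length w"
    using x p[OF ju(2)] unfolding pow_iff by blast+
  then show "l + k \<le> length w" by simp
qed

text \<open>Telescoping along a path: \<open>h (b w) - b w = (h b - b) (h w) + b (h w - w)\<close>,
  so a gain of \<open>k\<close> on arrows persists for all paths.\<close>

lemma chom_shift:
  assumes V: "is_quiver V" and h: "chom V V h"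
    and a: "\<And>a. a \<in> arcs V \<Longrightarrow> h (arr V a) - arr V a \<in> arrow_ideal_pow V (Suc k)"
    and x: "x \<in> arrow_ideal_pow V l"
  shows "h x - x \<in> arrow_ideal_pow V (l + k)"
proof (rule clin_shift[OF V clin_diff_fun[OF chom_clin[OF h] clin_id] x])
  fix i w assume "is_qpath V i w"
  then show "h (path_elem (i, w)) - path_elem (i, w) \<in> arrow_ideal_pow V (length w + k)"
  proof (induction w arbitrary: i)
    case Nil
    then have "h (path_elem (i, [])) - path_elem (i, []) = (0 :: ('a, 'b) series)" by (simp add: chom_idem[OF h])
    then show ?case by (simp only: pow_zero)
  next
    case (Cons b w)
    let ?a = "arr V b" and ?w = "path_elem (tail V b, w)"
    have b: "b \<in> arcs V" "is_qpath V (tail V b) w" using Cons.prems by auto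
    note ac = arr_car[OF V b(1)] and wc = path_elem_car[OF b(2)]
    have eq: "h (path_elem (i, b # w)) - path_elem (i, b # w) = conv V (h ?a - ?a) (h ?w) + conv V ?a (h ?w - ?w)"
      unfolding path_elem_Cons[OF Cons.prems] chom_conv[OF h ac wc]
      by (simp add: conv_diff_left conv_diff_right)
    have "conv V (h ?a - ?a) (h ?w) \<in> arrow_ideal_pow V (length (b # w) + k)"
      by (rule conv_pow[OF V a[OF b(1)] clin_pow[OF chom_clin[OF h] path_elem_pow[OF b(2) order_refl]]]) simp
    moreover have "conv V ?a (h ?w - ?w) \<in> arrow_ideal_pow V (length (b # w) + k)"
      by (rule conv_pow[OF V arr_pow[OF V b(1)] Cons.IH[OF b(2)]]) simp
    ultimately show ?case unfolding eq by (rule pow_add)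
  qed
qed

lemma homogeneous_csum:
  assumes "x \<in> homogeneous V d n" "csum V x w \<noteq> 0" shows "deg d w = n"
proof -
  obtain k where "x (head V (hd (rotate k w)), rotate k w) \<noteq> 0"
    using assms(2) unfolding csum_def by (meson sum.not_neutral_contains_not_neutral)
  then have "deg d (rotate k w) = n" using assms(1) by (auto simp: homogeneous_iff)
  then show ?thesis by (simp add: deg_rotate)
qed

text \<open>A 2-cycle to be split off, with its coefficient \<open>m\<close>. A 2-cycle occurring in
  a potential of degree one has degree one itself, and this is what makes the substitutions below
  graded.\<close>

locale hyperbolic_pair =
  fixes V :: "('v, 'a) quiver" and d :: "'a \<Rightarrow> int" and b c :: 'a and m :: complex
  assumes V: "is_quiver V" and bc: "closed_word V [b, c]" and dbc: "d b + d c = 1" and m: "m \<noteq> 0"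
begin

lemma arcs_bc: "b \<in> arcs V" "c \<in> arcs V" "head V c = tail V b" "tail V c = head V b"
  using bc by (auto simp: closed_word_2[OF V])

lemma b_neq_c: "b \<noteq> c"
  using arcs_bc quiver_loopfree[OF V, of b] by auto

definition H :: "('v, 'a) series" where "H = scl m (conv V (arr V b) (arr V c))"

definition touches :: "'a list \<Rightarrow> bool" where "touches w \<longleftrightarrow> b \<in> set w \<or> c \<in> set w"

text \<open>Invariant of the splitting: below length \<open>n\<close> the arrows \<open>b\<close>,
  \<open>c\<close> occur, cyclically, only through \<open>H\<close>. The coefficient of
  \<open>[b, c]\<close> is listed separately, since for \<open>n = 2\<close> the length bound does
  not reach it.\<close>

definition good :: "nat \<Rightarrow> ('v, 'a) series \<Rightarrow> bool" where
  "good n y \<longleftrightarrow> y \<in> arrow_ideal_pow V 2 \<and> y \<in> homogeneous V d 1 \<and> csum V y [b, c] = m \<and>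
     (\<forall>w. closed_word V w \<longrightarrow> touches w \<longrightarrow> length w < n \<longrightarrow> csum V y w = csum V H w)"

lemma H_path: "H = scl m (path_elem (head V b, [b, c]))"
  using arcs_bc by (simp add: H_def conv_path_elem)

lemma bc_path: "is_qpath V (head V b) [b, c]"
  using arcs_bc quiver_head[OF V, of b] by simp

lemma H_pow: "H \<in> arrow_ideal_pow V 2"
  unfolding H_path by (intro pow_scl path_elem_pow[OF bc_path]) simp

lemma H_homogeneous: "H \<in> homogeneous V d 1"
  unfolding H_path by (intro homogeneous_scl homogeneous_path_elem[OF bc_path]) (simp add: dbc)

definition pair_word :: "'a list \<Rightarrow> bool" where "pair_word w \<longleftrightarrow> w = [b, c] \<or> w = [c, b]"

lemma pair_word_rotate: "pair_word (rotate k w) \<longleftrightarrow> pair_word w"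
proof (induction k)
  case (Suc k)
  have "pair_word (rotate1 v) \<longleftrightarrow> pair_word v" for v
    unfolding pair_word_def by (cases v rule: list.exhaust; cases "tl v") auto
  then show ?case using Suc by simp
qed simp

lemma csum_H: "\<not> pair_word w \<Longrightarrow> csum V H w = 0" "csum V H [b, c] = m"
proof -
  assume "\<not> pair_word w"
  then have "rotate k w \<noteq> [b, c]" for k using pair_word_rotate[of k w] by (auto simp: pair_word_def)
  then show "csum V H w = 0" by (auto simp: csum_def H_path path_elem_apply pointwise intro!: sum.neutral)
next
  show "csum V H [b, c] = m"
    using b_neq_c by (simp add: csum_2 H_path path_elem_apply pointwise)
qed

definition occ :: "'a list \<Rightarrow> nat" where "occ w = card {k. k < length w \<and> (w ! k = b \<or> w ! k = c)}"

lemma occ_filter: "occ w = length (filter (\<lambda>a. a = b \<or> a = c) w)"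
  by (simp add: occ_def length_filter_conv_card)

lemma occ_rotate: "occ (rotate k w) = occ w"
proof (induction k)
  case (Suc k)
  have "occ (rotate1 v) = occ v" for v by (cases v) (auto simp: occ_filter)
  then show ?case using Suc by simp
qed simp

lemma occ_pos: "touches w \<Longrightarrow> occ w > 0"
  unfolding occ_filter touches_def by (auto simp: filter_empty_conv)

text \<open>Cyclic derivative of the part of length \<open>n\<close>, weighted so that every cycle is recovered
  exactly once from its occurrences of \<open>b\<close> and \<open>c\<close>.\<close>

definition D :: "nat \<Rightarrow> ('v, 'a) series \<Rightarrow> 'a \<Rightarrow> ('v, 'a) series" where
  "D n y a = (\<lambda>(i, w). if closed_word V (a # w) \<and> i = tail V a \<and> Suc (length w) = n \<and> \<not> pair_word (a # w)
     then csum V y (a # w) / of_nat (occ (a # w)) else 0)"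

lemma D_nonzero:
  assumes "D n y a (i, w) \<noteq> 0"
  shows "closed_word V (a # w)" "i = tail V a" "Suc (length w) = n" "\<not> pair_word (a # w)" "csum V y (a # w) \<noteq> 0"
  using assms by (auto simp: D_def split: if_splits)

lemma D_between: "D n y a \<in> between V (tail V a) (head V a)"
  unfolding between_def car_iff using D_nonzero[of n y a] by (force simp: closed_word_def)

lemma D_pow: "D n y a \<in> arrow_ideal_pow V (n - 1)"
  unfolding pow_iff using between_car[OF D_between] D_nonzero[of n y a] by fastforce

lemma D_homogeneous: assumes "y \<in> homogeneous V d 1" shows "D n y a \<in> homogeneous V d (1 - d a)"
  unfolding homogeneous_iff
proof (intro conjI allI impI)
  show "D n y a \<in> car V" by (rule between_car[OF D_between])
  fix i w assume "D n y a (i, w) \<noteq> 0"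
  from homogeneous_csum[OF assms D_nonzero(5)[OF this]] show "deg d w = 1 - d a" by simp
qed

lemma csum_arr_D:
  assumes w: "closed_word V w"
  shows "csum V (conv V (arr V a) (D n y a)) w =
    (if length w = n \<and> \<not> pair_word w then csum V y w / of_nat (occ w) * of_nat (card {k. k < length w \<and> w ! k = a}) else 0)"
proof -
  have w0: "w \<noteq> []" using w by (simp add: closed_word_def)
  have "csum V (conv V (arr V a) (D n y a)) w =
    (\<Sum>k<length w. if w ! k = a then (if length w = n \<and> \<not> pair_word w then csum V y w / of_nat (occ w) else 0) else 0)"
    unfolding csum_def[of V "conv V (arr V a) (D n y a)"]
  proof (intro sum.cong refl)
    fix k assume "k \<in> {..<length w}"
    then have k: "k < length w" by simp
    let ?R = "rotate k w"
    have hd: "hd ?R = w ! k" using hd_rotate_conv_nth[OF w0, of k] k by simp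
    obtain e R where R: "?R = e # R" using w0 by (cases ?R) auto
    have len: "Suc (length R) = length w" using R by (metis length_Cons length_rotate)
    have cl: "closed_word V (e # R)" using closed_word_rotate[OF V w, of k] R by simp
    have "csum V y (e # R) = csum V y w" "occ (e # R) = occ w" "pair_word (e # R) = pair_word w"
      using csum_rotate[of V y k w] occ_rotate[of k w] pair_word_rotate[of k w] R by auto
    then show "conv V (arr V a) (D n y a) (head V (hd ?R), ?R) =
      (if w ! k = a then (if length w = n \<and> \<not> pair_word w then csum V y w / of_nat (occ w) else 0) else 0)"
      using hd R len cl by (auto simp: conv_path_elem_left D_def)
  qed
  also have "\<dots> = (\<Sum>k\<in>{k. k < length w \<and> w ! k = a}. (if length w = n \<and> \<not> pair_word w then csum V y w / of_nat (occ w) else 0))"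
    by (rule sum.mono_neutral_cong_right) auto
  finally show ?thesis by auto
qed

text \<open>Euler's identity in \<open>b\<close> and \<open>c\<close>: the positions of a cycle that
  carry one of these letters number \<open>occ w\<close>, which cancels the weight in
  \<open>D\<close>.\<close>

lemma csum_D_sum:
  assumes w: "closed_word V w" "touches w"
  shows "csum V (conv V (arr V b) (D n y b) + conv V (arr V c) (D n y c)) w =
    (if length w = n \<and> \<not> pair_word w then csum V y w else 0)"
proof -
  have "{k. k < length w \<and> (w ! k = b \<or> w ! k = c)} = {k. k < length w \<and> w ! k = b} \<union> {k. k < length w \<and> w ! k = c}"
    by auto
  then have "occ w = card {k. k < length w \<and> w ! k = b} + card {k. k < length w \<and> w ! k = c}"
    unfolding occ_def using b_neq_c by (simp add: card_Un_disjoint disjoint_iff)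
  moreover have "complex_of_nat (occ w) \<noteq> 0" using occ_pos[OF w(2)] by simp
  ultimately have "csum V y w / of_nat (occ w) * of_nat (card {k. k < length w \<and> w ! k = b}) +
     csum V y w / of_nat (occ w) * of_nat (card {k. k < length w \<and> w ! k = c}) = csum V y w"
    by (simp only: distrib_left[symmetric] of_nat_add[symmetric]) simp
  then show ?thesis unfolding csum_add csum_arr_D[OF w(1)] by auto
qed

text \<open>Completing the square. Writing \<open>u\<close> and \<open>v\<close> for the derivatives
  at \<open>b\<close> and \<open>c\<close>, the change \<open>b + t v\<close>,
  \<open>c + t u\<close> with \<open>t = - 1 / m\<close> cancels \<open>b u + c v\<close> against
  \<open>m b c\<close>, up to a commutator and a harmless remainder.\<close>

definition sub :: "nat \<Rightarrow> ('v, 'a) series \<Rightarrow> complex \<Rightarrow> 'a \<Rightarrow> ('v, 'a) series" where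
  "sub n y t a = (if a = b then arr V b + scl t (D n y c) else if a = c then arr V c + scl t (D n y b) else arr V a)"

lemma sub_substitution: assumes n: "n \<ge> 2" shows "substitution V V (sub n y t)"
  unfolding substitution_def
proof (intro conjI ballI)
  fix a assume a: "a \<in> arcs V"
  have D1: "D n y e \<in> arrow_ideal_pow V (Suc 0)" for e by (rule pow_mono[OF D_pow]) (use n in simp)
  show "sub n y t a \<in> arrow_ideal_pow V 1"
    using arr_pow[OF V a] pow_scl[OF D1, of t] pow_add by (auto simp: sub_def)
  have "D n y c \<in> between V (head V b) (tail V b)" "D n y b \<in> between V (head V c) (tail V c)"
    using D_between[of n y b] D_between[of n y c] arcs_bc by simp_all
  then have "arr V b + scl t (D n y c) \<in> between V (head V b) (tail V b)"
    "arr V c + scl t (D n y b) \<in> between V (head V c) (tail V c)"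
    using arr_between[OF V] arcs_bc(1,2) by (auto intro!: between_add between_scl)
  then show "sub n y t a \<in> between V (head V a) (tail V a)"
    using arr_between[OF V a] b_neq_c unfolding sub_def by presburger
qed (use V in auto)

lemma sub_homogeneous:
  assumes y: "y \<in> homogeneous V d 1" and a: "a \<in> arcs V" shows "sub n y t a \<in> homogeneous V d (d a)"
proof -
  have arr: "arr V a \<in> homogeneous V d (d a)" by (rule homogeneous_path_elem[OF arr_path[OF V a]]) simp
  \<comment> \<open>Removing \<open>c\<close> from a cycle of degree one leaves the degree of
    \<open>b\<close>, and conversely; so the corrections have the degrees of the arrows they are
    added to.\<close>
  have dd: "1 - d c = d b" "1 - d b = d c" using dbc by auto
  have D: "D n y c \<in> homogeneous V d (d b)" "D n y b \<in> homogeneous V d (d c)"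
    using D_homogeneous[OF y, of n b] D_homogeneous[OF y, of n c] unfolding dd by auto
  have "a = b \<Longrightarrow> arr V b + scl t (D n y c) \<in> homogeneous V d (d a)"
    "a = c \<Longrightarrow> arr V c + scl t (D n y b) \<in> homogeneous V d (d a)"
    using arr D homogeneous_scl homogeneous_add by blast+
  then show ?thesis using arr unfolding sub_def by presburger
qed

abbreviation \<theta> :: "nat \<Rightarrow> ('v, 'a) series \<Rightarrow> complex \<Rightarrow> ('v, 'a) series \<Rightarrow> ('v, 'a) series" where
  "\<theta> n y t \<equiv> subst V V (sub n y t)"

lemma \<theta>_arr: "n \<ge> 2 \<Longrightarrow> a \<in> arcs V \<Longrightarrow> \<theta> n y t (arr V a) = sub n y t a"
  by (rule subst_arr[OF sub_substitution])

lemma \<theta>_chom: "n \<ge> 2 \<Longrightarrow> chom V V (\<theta> n y t)"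
  by (rule chom_subst[OF sub_substitution])

lemma \<theta>_graded:
  "n \<ge> 2 \<Longrightarrow> y \<in> homogeneous V d 1 \<Longrightarrow> a \<in> arcs V \<Longrightarrow> \<theta> n y t (arr V a) \<in> homogeneous V d (d a)"
  by (simp add: \<theta>_arr sub_homogeneous)

lemma \<theta>_fix:
  assumes n: "n \<ge> 2" and z: "z \<in> car V" "\<And>i w. z (i, w) \<noteq> 0 \<Longrightarrow> \<not> touches w"
  shows "\<theta> n y t z = z"
proof (rule chom_fix[where S = "arcs V - {b, c}", OF V \<theta>_chom[OF n] _ z(1)])
  fix a assume "a \<in> arcs V - {b, c}"
  then show "a \<in> arcs V \<and> \<theta> n y t (arr V a) = arr V a \<and> head V a = head V a \<and> tail V a = tail V a"
    using \<theta>_arr[OF n] by (simp add: sub_def)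
next
  fix i w assume "z (i, w) \<noteq> 0"
  then have "\<not> touches w" "is_qpath V i w" using z by (auto simp: car_iff)
  then show "set w \<subseteq> arcs V - {b, c}" using is_qpath_arcs[of V i w] by (auto simp: touches_def)
qed

text \<open>The corrections have length \<open>n - 1\<close> where the arrow had length one, a gain
  of \<open>n - 2\<close>.\<close>

lemma \<theta>_shift:
  assumes n: "n \<ge> 2" and x: "x \<in> arrow_ideal_pow V l" shows "\<theta> n y t x - x \<in> arrow_ideal_pow V (l + (n - 2))"
proof (rule chom_shift[OF V \<theta>_chom[OF n] _ x])
  fix a assume a: "a \<in> arcs V"
  have "scl t (D n y e) \<in> arrow_ideal_pow V (Suc (n - 2))" for e
    using pow_scl[OF D_pow[of n y e]] n by (simp add: Suc_diff_le numeral_2_eq_2 Suc_diff_Suc)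
  then show "\<theta> n y t (arr V a) - arr V a \<in> arrow_ideal_pow V (Suc (n - 2))"
    by (simp add: \<theta>_arr[OF n a] sub_def)
qed

text \<open>At length two the words of the pair are excluded from \<open>D\<close> and loops do not
  exist, so the corrections contain neither \<open>b\<close> nor \<open>c\<close>. This makes up for
  the gain in length, which is zero for \<open>n = 2\<close>.\<close>

lemma D_two: assumes "D 2 y a (i, w) \<noteq> 0" "a = b \<or> a = c" shows "\<not> touches w"
proof -
  obtain e where e: "w = [e]" using D_nonzero(3)[OF assms(1)] by (cases w) auto
  have "closed_word V [a, e]" "\<not> pair_word [a, e]" using D_nonzero[OF assms(1)] e by auto
  moreover have "a \<noteq> e" using quiver_loopfree[OF V, of a] \<open>closed_word V [a, e]\<close> by (auto simp: closed_word_2[OF V])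
  ultimately show ?thesis using assms(2) e by (auto simp: touches_def pair_word_def)
qed

lemma csum_untouched:
  assumes "\<And>i w. z (i, w) \<noteq> 0 \<Longrightarrow> \<not> touches w" "touches w" shows "csum V z w = 0"
  unfolding csum_def
proof (rule sum.neutral, rule ballI)
  fix k
  have "touches (rotate k w)" using assms(2) by (simp add: touches_def)
  then show "z (head V (hd (rotate k w)), rotate k w) = 0" using assms(1) by blast
qed

text \<open>Cyclically \<open>y\<close> is \<open>H + S + r + r'\<close>, with
  \<open>S = b u + c v\<close> the offending terms of length \<open>n\<close>, \<open>r\<close> free
  of \<open>b\<close> and \<open>c\<close>, and \<open>r'\<close> longer than \<open>n\<close>. The
  substitution turns \<open>H + S\<close> into \<open>H\<close> plus a commutator plus
  \<open>rem\<close>, fixes \<open>r\<close> and does not shorten \<open>r'\<close>.\<close>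

lemma good_step:
  assumes n: "n \<ge> 2" and y: "good n y"
  shows "good (Suc n) (\<theta> n y (- 1 / m) y)"
proof -
  let ?t = "- 1 / m"
  let ?\<theta> = "\<theta> n y ?t" and ?b = "arr V b" and ?c = "arr V c" and ?u = "D n y b" and ?v = "D n y c"
  note \<theta> = \<theta>_chom[OF n, of y ?t]
  note lin = chom_clin[OF \<theta>]
  have ypow: "y \<in> arrow_ideal_pow V 2" and yh: "y \<in> homogeneous V d 1" and ybc: "csum V y [b, c] = m"
    and ygood: "\<And>w. closed_word V w \<Longrightarrow> touches w \<Longrightarrow> length w < n \<Longrightarrow> csum V y w = csum V H w"
    using y by (auto simp: good_def)
  note bcar = arr_car[OF V arcs_bc(1)] and ccar = arr_car[OF V arcs_bc(2)]
  have ucar: "?u \<in> car V" and vcar: "?v \<in> car V" using between_car[OF D_between] by auto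
  have Hcar: "H \<in> car V" by (rule pow_car[OF H_pow])
  note cc = conv_car[OF V]
  define S where "S = conv V ?b ?u + conv V ?c ?v"
  have Scar: "S \<in> car V" unfolding S_def using cc bcar ccar ucar vcar by blast
  \<comment> \<open>After averaging, the coefficients themselves vanish on words through the pair up
    to length \<open>n\<close>, and not just their cyclic sums; only then can words be sorted into
    \<open>r\<close> and \<open>r'\<close> one by one.\<close>
  define e where "e = cavg V (y - (H + S))"
  have dcar: "y - (H + S) \<in> car V" using pow_car[OF ypow] Hcar Scar by blast
  have ecar: "e \<in> car V" unfolding e_def by (rule clin_car[OF clin_cavg dcar])
  have nil: "(y - (H + S)) (i, []) = 0" for i
  proof -
    have "y (i, []) = 0" "H (i, []) = 0" using ypow H_pow by (force simp: pow_iff)+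
    moreover have "S (i, []) = 0" by (simp add: S_def pointwise conv_path_elem_left)
    ultimately show ?thesis by (simp add: pointwise)
  qed
  have csum_e: "csum V (y - (H + S)) w = 0" if w: "closed_word V w" "touches w" "length w \<le> n" for w
  proof (cases "pair_word w")
    case True
    then have "csum V y w = csum V H w"
      using ybc csum_H(2) csum_rotate[of V y 1 "[b, c]"] csum_rotate[of V H 1 "[b, c]"] by (auto simp: pair_word_def)
    then show ?thesis using True csum_D_sum[OF w(1,2), of n y] by (simp add: csum_diff csum_add[of V H] S_def)
  next
    case False
    then have "csum V y w = csum V H w + (if length w = n then csum V y w else 0)"
      using ygood[OF w(1,2)] w(3) csum_H(1)[OF False] by auto
    then show ?thesis using False csum_D_sum[OF w(1,2), of n y] by (simp add: csum_diff csum_add[of V H] S_def)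
  qed
  define r where "r = (\<lambda>(i, w). if touches w then 0 else e (i, w))"
  define r' where "r' = (\<lambda>(i, w). if touches w then e (i, w) else 0)"
  have e_split: "e = r + r'" by (auto simp: fun_eq_iff pointwise r_def r'_def)
  have rcar: "r \<in> car V" using ecar by (auto simp: car_iff r_def)
  have r: "\<not> touches w" if "r (i, w) \<noteq> 0" for i w using that by (auto simp: r_def split: if_splits)
  have r': "r' \<in> arrow_ideal_pow V (Suc n)"
    unfolding pow_iff
  proof (intro conjI allI impI)
    show "r' \<in> car V" using ecar by (auto simp: car_iff r'_def)
    fix i w assume "r' (i, w) \<noteq> 0"
    then have "touches w" "e (i, w) \<noteq> 0" by (auto simp: r'_def split: if_splits)
    then have "closed_word V w" "csum V (y - (H + S)) w \<noteq> 0" by (auto simp: e_def cavg_def split: if_splits)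
    then show "Suc n \<le> length w" using csum_e[of w] \<open>touches w\<close> by force
  qed
  note r'car = pow_car[OF r']
  have "cyceq V e (y - (H + S))" unfolding e_def by (rule cyceq_cavg[OF V dcar nil])
  then have "cyceq V (e + (H + S)) (y - (H + S) + (H + S))"
    by (rule cyceq_add[OF _ cyceq_refl]) (use Hcar Scar in blast)
  then have y_eq: "cyceq V (r + r' + (H + S)) y" by (simp add: e_split)
  have \<theta>b: "?\<theta> ?b = ?b + scl ?t ?v" and \<theta>c: "?\<theta> ?c = ?c + scl ?t ?u"
    using \<theta>_arr[OF n arcs_bc(1), of y ?t] \<theta>_arr[OF n arcs_bc(2), of y ?t] b_neq_c by (auto simp: sub_def)
  have \<theta>r: "?\<theta> r = r" by (rule \<theta>_fix[OF n rcar r])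
  have \<theta>u: "?\<theta> ?u \<in> car V" and \<theta>v: "?\<theta> ?v \<in> car V" using clin_car[OF lin] ucar vcar by auto
  have \<theta>H: "?\<theta> H = H - conv V ?b ?u - conv V ?v ?c - scl ?t (conv V ?v ?u)"
  proof -
    have "?\<theta> H = scl m (conv V (?b + scl ?t ?v) (?c + scl ?t ?u))"
      unfolding H_def using clin_scl[OF lin cc[OF bcar ccar]] chom_conv[OF \<theta> bcar ccar] \<theta>b \<theta>c by simp
    also have "\<dots> = H - conv V ?b ?u - conv V ?v ?c - scl ?t (conv V ?v ?u)"
      using m unfolding H_def
      by (auto simp: fun_eq_iff pointwise conv_add_left conv_add_right conv_scl_left conv_scl_right field_simps)
    finally show ?thesis .
  qed
  have \<theta>S: "?\<theta> S = conv V ?b (?\<theta> ?u) + scl ?t (conv V ?v (?\<theta> ?u)) + (conv V ?c (?\<theta> ?v) + scl ?t (conv V ?u (?\<theta> ?v)))"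
    unfolding S_def using clin_add[OF lin cc[OF bcar ucar] cc[OF ccar vcar]] chom_conv[OF \<theta>] bcar ccar ucar vcar \<theta>b \<theta>c
    by (simp add: conv_add_left conv_scl_left)
  \<comment> \<open>What the square leaves over, apart from \<open>c v - v c\<close>, which is kept
    separate because its cyclic sums vanish.\<close>
  define rem where "rem = conv V ?b (?\<theta> ?u - ?u) + conv V ?c (?\<theta> ?v - ?v)
     + (scl ?t (conv V ?v (?\<theta> ?u)) + scl ?t (conv V ?u (?\<theta> ?v)) - scl ?t (conv V ?v ?u))"
  have HS: "?\<theta> (H + S) = H + (rem + (conv V ?c ?v - conv V ?v ?c))"
    using clin_add[OF lin Hcar Scar] unfolding \<theta>H \<theta>S rem_def
    by (simp add: conv_diff_right algebra_simps)
  have \<theta>y_eq: "cyceq V (?\<theta> (r + r' + (H + S))) (?\<theta> y)" by (rule cyceq_chom[OF V V \<theta> y_eq])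
  have split: "?\<theta> (r + r' + (H + S)) = r + ?\<theta> r' + (H + (rem + (conv V ?c ?v - conv V ?v ?c)))"
    using clin_add[OF lin, of "r + r'" "H + S"] clin_add[OF lin rcar r'car] rcar r'car Hcar Scar HS \<theta>r by (simp add: car_add)
  \<comment> \<open>For \<open>n = 2\<close> the substitution fixes \<open>u\<close> and
    \<open>v\<close>, and \<open>rem\<close> is a multiple of \<open>u v\<close>, free of the pair.
    For \<open>n \<ge> 3\<close> all terms have length at least \<open>2 n - 2 > n\<close>.\<close>
  have csum_rem: "csum V rem w = 0" if w: "closed_word V w" "touches w" "length w \<le> n" for w
  proof (cases "n = 2")
    case True
    have uv: "?\<theta> ?u = ?u" "?\<theta> ?v = ?v"
      using \<theta>_fix[OF n ucar] \<theta>_fix[OF n vcar] D_two True by blast+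
    have "rem = scl ?t (conv V ?u ?v)" unfolding rem_def uv by simp
    moreover have "\<not> touches w" if "scl ?t (conv V ?u ?v) (i, w) \<noteq> 0" for i w
    proof -
      have "conv V ?u ?v (i, w) \<noteq> 0" using that by (simp add: pointwise)
      then obtain w1 w2 j where "w = w1 @ w2" "?u (i, w1) \<noteq> 0" "?v (j, w2) \<noteq> 0" by (rule conv_nonzero) blast
      then show ?thesis using D_two True by (fastforce simp: touches_def)
    qed
    ultimately show ?thesis using csum_untouched w(2) by metis
  next
    case False
    then have n3: "n \<ge> 3" using n by simp
    have up: "?u \<in> arrow_ideal_pow V (n - 1)" and vp: "?v \<in> arrow_ideal_pow V (n - 1)" by (rule D_pow)+
    have \<theta>up: "?\<theta> ?u \<in> arrow_ideal_pow V (n - 1)" and \<theta>vp: "?\<theta> ?v \<in> arrow_ideal_pow V (n - 1)"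
      using clin_pow[OF lin] up vp by auto
    have "rem \<in> arrow_ideal_pow V (Suc n)"
      unfolding rem_def
    proof (intro pow_add pow_diff pow_scl)
      show "conv V ?b (?\<theta> ?u - ?u) \<in> arrow_ideal_pow V (Suc n)"
        by (rule conv_pow[OF V arr_pow[OF V arcs_bc(1)] \<theta>_shift[OF n up]]) (use n3 in simp)
      show "conv V ?c (?\<theta> ?v - ?v) \<in> arrow_ideal_pow V (Suc n)"
        by (rule conv_pow[OF V arr_pow[OF V arcs_bc(2)] \<theta>_shift[OF n vp]]) (use n3 in simp)
      show "conv V ?v (?\<theta> ?u) \<in> arrow_ideal_pow V (Suc n)" by (rule conv_pow[OF V vp \<theta>up]) (use n3 in simp)
      show "conv V ?u (?\<theta> ?v) \<in> arrow_ideal_pow V (Suc n)" by (rule conv_pow[OF V up \<theta>vp]) (use n3 in simp)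
      show "conv V ?v ?u \<in> arrow_ideal_pow V (Suc n)" by (rule conv_pow[OF V vp up]) (use n3 in simp)
    qed
    then show ?thesis by (rule csum_pow) (use w(3) in simp)
  qed
  have csum_\<theta>y: "csum V (?\<theta> y) w = csum V H w" if w: "closed_word V w" "touches w" "length w \<le> n" for w
  proof -
    have "csum V (?\<theta> y) w = csum V (?\<theta> (r + r' + (H + S))) w" using \<theta>y_eq w(1) by (simp add: cyceq_iff[OF V])
    also have "\<dots> = csum V r w + csum V (?\<theta> r') w + (csum V H w + (csum V rem w + (csum V (conv V ?c ?v) w - csum V (conv V ?v ?c) w)))"
      unfolding split by (simp only: csum_add csum_diff)
    also have "csum V r w = 0" by (rule csum_untouched[OF r w(2)])
    also have "csum V (?\<theta> r') w = 0" by (rule csum_pow[OF clin_pow[OF lin r']]) (use w(3) in simp)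
    also have "csum V rem w = 0" by (rule csum_rem[OF w])
    also have "csum V (conv V ?c ?v) w = csum V (conv V ?v ?c) w" by (rule csum_conv_commute[OF V w(1)])
    finally show ?thesis by simp
  qed
  have "csum V (?\<theta> y) [b, c] = m" using csum_\<theta>y[OF bc] n csum_H(2) by (simp add: touches_def)
  moreover have "?\<theta> y \<in> homogeneous V d 1" by (rule chom_graded[OF V V \<theta> \<theta>_graded[OF n yh] yh])
  moreover have "?\<theta> y \<in> arrow_ideal_pow V 2" by (rule clin_pow[OF lin ypow])
  ultimately show ?thesis using csum_\<theta>y by (simp add: good_def)
qed

text \<open>This first substitution need not be unipotent, but it fixes its own corrections, so
  reversing the sign of \<open>t\<close> undoes it.\<close>

lemma \<theta>_two_iso: "qiso V V (\<theta> 2 y t) (\<theta> 2 y (- t))"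
proof -
  have *: "\<theta> 2 y t' (\<theta> 2 y (- t') (arr V a)) = arr V a" if a: "a \<in> arcs V" for a t'
  proof -
    have D: "\<theta> 2 y t' (D 2 y e) = D 2 y e" if "e = b \<or> e = c" for e
      by (rule \<theta>_fix[OF _ between_car[OF D_between]]) (use D_two that in auto)
    note lin = chom_clin[OF \<theta>_chom[of 2 y t']]
    have Dc: "D 2 y e \<in> car V" for e by (rule between_car[OF D_between])
    have "\<theta> 2 y t' (arr V a + scl (- t') (D 2 y e)) = \<theta> 2 y t' (arr V a) + scl (- t') (D 2 y e)" if "e = b \<or> e = c" for e
      using clin_add[OF lin arr_car[OF V a] car_scl[OF Dc]] clin_scl[OF lin Dc] D[OF that] by simp
    then have "\<theta> 2 y t' (sub 2 y (- t') a) = arr V a"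
      using \<theta>_arr[OF _ a, of 2 y t'] b_neq_c by (auto simp: sub_def fun_eq_iff pointwise)
    then show ?thesis by (simp add: \<theta>_arr[OF _ a])
  qed
  show ?thesis
    by (rule qisoI_arrs[OF V V \<theta>_chom \<theta>_chom]) (use *[of _ t] *[of _ "- t"] in auto)
qed

end

section \<open>The infinite composite of the substitutions\<close>

context hyperbolic_pair
begin

text \<open>The index is offset by 3: the substitution for \<open>n = 2\<close> is made beforehand,
  and from \<open>n = 3\<close> on each one is unipotent.\<close>

primrec approx :: "('v, 'a) series \<Rightarrow> nat \<Rightarrow> ('v, 'a) series" where
  "approx y 0 = y"
| "approx y (Suc k) = \<theta> (k + 3) (approx y k) (- 1 / m) (approx y k)"

text \<open>The composite automorphism on an arbitrary argument \<open>x\<close>, its substitutions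
  being dictated by the approximations of the fixed \<open>y\<close>.\<close>

primrec chain :: "('v, 'a) series \<Rightarrow> nat \<Rightarrow> ('v, 'a) series \<Rightarrow> ('v, 'a) series" where
  "chain y 0 x = x"
| "chain y (Suc k) x = \<theta> (k + 3) (approx y k) (- 1 / m) (chain y k x)"

lemma chain_approx: "chain y k y = approx y k"
  by (induction k) simp_all

lemma good_approx: "good 3 y \<Longrightarrow> good (k + 3) (approx y k)"
proof (induction k)
  case (Suc k)
  then show ?case using good_step[of "k + 3" "approx y k"] by simp
qed simp

lemma chain_chom: "chom V V (chain y k)"
proof (induction k)
  case 0
  have "chain y 0 = (\<lambda>x. x)" by (rule ext) simp
  then show ?case using chom_id[of V] by (simp only:)
next
  case (Suc k)
  have "chain y (Suc k) = (\<lambda>x. \<theta> (k + 3) (approx y k) (- 1 / m) (chain y k x))" by (rule ext) simp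
  then show ?case using chom_comp[OF Suc \<theta>_chom[of "k + 3" "approx y k" "- 1 / m"]] by (simp only:)
qed

lemma chain_step:
  assumes x: "x \<in> arrow_ideal_pow V l" shows "chain y (Suc k) x - chain y k x \<in> arrow_ideal_pow V (l + Suc k)"
  using \<theta>_shift[of "k + 3" _ _ "approx y k" "- 1 / m", OF _ clin_pow[OF chom_clin[OF chain_chom[of y k]] x]] by simp

lemma chain_unipotent:
  assumes x: "x \<in> arrow_ideal_pow V l" shows "chain y k x - x \<in> arrow_ideal_pow V (Suc l)"
proof (induction k)
  case 0
  have "chain y 0 x - x = 0" by simp
  then show ?case by (simp only: pow_zero)
next
  case (Suc k)
  have "chain y (Suc k) x - x = (chain y (Suc k) x - chain y k x) + (chain y k x - x)" by simp
  also have "\<dots> \<in> arrow_ideal_pow V (Suc l)"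
    by (rule pow_add[OF pow_mono[OF chain_step[OF x]] Suc]) simp
  finally show ?case .
qed

text \<open>Passing from \<open>k\<close> to \<open>Suc k\<close> changes only words longer than
  \<open>k\<close>, so the coefficient at \<open>w\<close> is final after \<open>length w\<close>
  steps.\<close>

definition limit :: "('v, 'a) series \<Rightarrow> ('v, 'a) series \<Rightarrow> ('v, 'a) series" where
  "limit y x = (\<lambda>(i, w). chain y (length w) x (i, w))"

lemma chain_limit:
  assumes x: "x \<in> car V" shows "length w \<le> k \<Longrightarrow> chain y k x (i, w) = limit y x (i, w)"
proof (induction k rule: dec_induct)
  case base
  then show ?case by (simp add: limit_def)
next
  case (step k)
  have "chain y (Suc k) x - chain y k x \<in> arrow_ideal_pow V (Suc k)" using chain_step[of x 0] x by simp
  then have "(chain y (Suc k) x - chain y k x) (i, w) = 0" using step(1) by (force simp: pow_iff)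
  then show ?case using step by (simp add: pointwise)
qed

lemma limit_chom: "chom V V (limit y)"
  unfolding chom_def clin_def
proof (intro conjI ballI allI)
  note lin = chom_clin[OF chain_chom]
  show "limit y (x + z) = limit y x + limit y z" if "x \<in> car V" "z \<in> car V" for x z
    by (rule ext) (auto simp: limit_def clin_add[OF lin that] pointwise)
  show "limit y (scl t x) = scl t (limit y x)" if "x \<in> car V" for t x
    by (rule ext) (auto simp: limit_def clin_scl[OF lin that] pointwise)
  show "limit y x \<in> arrow_ideal_pow V n" if "x \<in> arrow_ideal_pow V n" for n x
    using clin_pow[OF lin that] unfolding pow_iff car_iff limit_def by simp
  show "limit y (path_elem (i, [])) = path_elem (i, [])" if "i \<in> verts V" for i
    by (rule ext) (auto simp: limit_def chom_idem[OF chain_chom that])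
  fix x z assume x: "x \<in> car V" and z: "z \<in> car V"
  show "limit y (conv V x z) = conv V (limit y x) (limit y z)"
  proof (rule ext, clarify)
    fix i w
    have "limit y (conv V x z) (i, w) = conv V (chain y (length w) x) (chain y (length w) z) (i, w)"
      by (simp add: limit_def chom_conv[OF chain_chom x z])
    also have "\<dots> = conv V (limit y x) (limit y z) (i, w)"
      unfolding conv_apply by (intro sum.cong refl arg_cong2[where f = "(*)"] chain_limit x z) auto
    finally show "limit y (conv V x z) (i, w) = conv V (limit y x) (limit y z) (i, w)" .
  qed
qed simp

lemma limit_unipotent:
  assumes x: "x \<in> arrow_ideal_pow V n" shows "limit y x - x \<in> arrow_ideal_pow V (Suc n)"
proof -
  have "(limit y x - x) (i, w) = (chain y (length w) x - x) (i, w)" for i w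
    by (simp add: limit_def pointwise)
  then show ?thesis using chain_unipotent[OF x, of y] unfolding pow_iff car_iff by metis
qed

lemma chain_graded:
  assumes "good 3 y" "a \<in> arcs V" shows "chain y k (arr V a) \<in> homogeneous V d (d a)"
proof (induction k)
  case 0
  show ?case using homogeneous_path_elem[OF arr_path[OF V assms(2)]] by simp
next
  case (Suc k)
  have "approx y k \<in> homogeneous V d 1" using good_approx[OF assms(1), of k] by (simp add: good_def)
  then show ?case using chom_graded[OF V V \<theta>_chom \<theta>_graded Suc, of "k + 3"] by simp
qed

lemma limit_graded:
  assumes "good 3 y" "a \<in> arcs V" shows "limit y (arr V a) \<in> homogeneous V d (d a)"
  using chain_graded[OF assms] unfolding homogeneous_iff car_iff limit_def by simp

lemma limit_csum:
  assumes y: "good 3 y" and w: "closed_word V w" "touches w"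
  shows "csum V (limit y y) w = csum V H w"
proof -
  let ?k = "length w"
  have yc: "y \<in> car V" using y by (auto simp: good_def dest: pow_car)
  have "csum V (limit y y) w = csum V (chain y ?k y) w"
    unfolding csum_def by (intro sum.cong refl) (simp add: chain_limit[OF yc])
  also have "\<dots> = csum V H w"
    using good_approx[OF y, of ?k] w by (simp add: chain_approx good_def)
  finally show ?thesis .
qed

lemma split_pair:
  assumes y: "good 2 y"
  obtains \<phi> \<psi> x where "qiso V V \<phi> \<psi>" "\<And>a. a \<in> arcs V \<Longrightarrow> \<phi> (arr V a) \<in> homogeneous V d (d a)"
    "cyceq V (\<phi> y) (x + H)" "x \<in> arrow_ideal_pow V 2" "x \<in> homogeneous V d 1"
    "\<And>i w. x (i, w) \<noteq> 0 \<Longrightarrow> \<not> touches w"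
proof -
  let ?t = "- 1 / m"
  have yh: "y \<in> homogeneous V d 1" using y by (simp add: good_def)
  let ?y = "\<theta> 2 y ?t y"
  have y3: "good 3 ?y" using good_step[OF _ y] by simp
  obtain S where S: "qiso V V (limit ?y) S" using qiso_unipotent[OF V limit_chom limit_unipotent] .
  let ?\<phi> = "\<lambda>x. limit ?y (\<theta> 2 y ?t x)"
  have iso: "qiso V V ?\<phi> (\<lambda>x. \<theta> 2 y (- ?t) (S x))" by (rule qiso_comp[OF \<theta>_two_iso S])
  have g: "?\<phi> (arr V a) \<in> homogeneous V d (d a)" if a: "a \<in> arcs V" for a
    by (rule chom_graded[OF V V limit_chom limit_graded[OF y3] \<theta>_graded[OF _ yh a]]) simp_all
  let ?z = "?\<phi> y"
  have zpow: "?z \<in> arrow_ideal_pow V 2"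
    using clin_pow[OF chom_clin[OF qisoD(3)[OF iso]]] y by (simp add: good_def)
  have zh: "?z \<in> homogeneous V d 1" by (rule chom_graded[OF V V qisoD(3)[OF iso] g yh])
  \<comment> \<open>Unlike \<open>?z - H\<close> itself, its average has no coefficient on any word
    through the pair: these coefficients are multiples of cyclic sums, which vanish there.\<close>
  define x where "x = cavg V (?z - H)"
  have dpow: "?z - H \<in> arrow_ideal_pow V 2" using zpow H_pow by blast
  have dh: "?z - H \<in> homogeneous V d 1" by (rule homogeneous_diff[OF zh H_homogeneous])
  have "(?z - H) (i, []) = 0" for i using dpow by (force simp: pow_iff)
  then have "cyceq V x (?z - H)" unfolding x_def by (rule cyceq_cavg[OF V pow_car[OF dpow]])
  then have "cyceq V (x + H) (?z - H + H)" by (rule cyceq_add[OF _ cyceq_refl[OF pow_car[OF H_pow]]])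
  then have "cyceq V ?z (x + H)" using cyceq_sym[OF V] by simp
  moreover have "x \<in> arrow_ideal_pow V 2" unfolding x_def by (rule clin_pow[OF clin_cavg dpow])
  moreover have "x \<in> homogeneous V d 1" unfolding x_def by (rule homogeneous_cavg[OF dh])
  moreover have "\<not> touches w" if "x (i, w) \<noteq> 0" for i w
  proof
    assume t: "touches w"
    have "closed_word V w" "csum V (?z - H) w \<noteq> 0" using that by (auto simp: x_def cavg_def split: if_splits)
    then show False using limit_csum[OF y3 _ t] by (simp add: csum_diff)
  qed
  ultimately show thesis using that[OF iso g] by blast
qed

section \<open>The pair as a trivial QP of its own\<close>

definition C :: "('v, 'a) quiver" where
  "C = \<lparr>verts = verts V, arcs = {b, c}, tail = tail V, head = head V\<rparr>"

lemma C_quiver: "is_quiver C"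
  by (rule is_quiverI) (use arcs_bc in \<open>auto simp: C_def quiver_finite_verts[OF V] quiver_tail[OF V] quiver_head[OF V] quiver_loopfree[OF V]\<close>)

lemma C_sub: "subquiver C V"
  using C_quiver V arcs_bc by (auto simp: subquiver_def C_def)

lemma C_bc_path: "is_qpath C (head V b) [b, c]"
  using subquiver_path[OF C_sub, of "[b, c]"] bc_path by (simp add: C_def)

lemma H_pow_C: "H \<in> arrow_ideal_pow C 2"
  unfolding H_path by (intro pow_scl path_elem_pow[OF C_bc_path]) simp

lemma H_homogeneous_C: "H \<in> homogeneous C d 1"
  unfolding H_path by (intro homogeneous_scl homogeneous_path_elem[OF C_bc_path]) (simp add: dbc)

lemma cyc_deriv_path: "cyc_deriv W a x (i, u) \<noteq> 0 \<Longrightarrow> i = tail W a \<and> is_qpath W i u \<and> path_source W i u = head W a"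
  by (auto simp: cyc_deriv_def split: if_splits)

lemma cyc_deriv_pow: assumes "a \<in> arcs C" shows "cyc_deriv C a x \<in> arrow_ideal_pow C (Suc 0)"
proof (rule car_pow_one)
  show "cyc_deriv C a x \<in> car C"
    unfolding car_iff
  proof (intro allI impI)
    fix i u assume "cyc_deriv C a x (i, u) \<noteq> 0"
    from cyc_deriv_path[OF this] show "is_qpath C i u" by blast
  qed
  show "cyc_deriv C a x (i, []) = 0" for i
    using cyc_deriv_path[of C a x i "[]"] quiver_loopfree[OF C_quiver assms] by auto
qed

text \<open>The coefficient of the derivative at \<open>u\<close> is the cyclic sum of
  \<open>a u\<close>, and \<open>H\<close> has nonzero cyclic sums only on the two rotations of
  \<open>b c\<close>.\<close>

lemma cyc_deriv_H: assumes "a = b \<and> a' = c \<or> a = c \<and> a' = b" shows "cyc_deriv C a H = scl m (arr C a')"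
proof (rule ext, clarify)
  fix i u
  have ht: "head C = head V" "tail C = tail V" "verts C = verts V" by (simp_all add: C_def)
  have cd: "cyc_deriv C a H (i, u) =
      (if i = tail V a \<and> is_qpath C i u \<and> path_source C i u = head V a then csum V H (a # u) else 0)"
    unfolding cyc_deriv_def case_prod_conv csum_def ht Let_def
    by (intro if_cong refl sum.cong) (simp_all add: lessThan_Suc_atMost)
  have 1: "csum V H (a # u) = (if u = [a'] then m else 0)"
  proof (cases "pair_word (a # u)")
    case True
    then have "u = [a']" using assms b_neq_c by (auto simp: pair_word_def)
    moreover have "csum V H [c, b] = m" using csum_rotate[of V H 1 "[b, c]"] csum_H(2) by simp
    ultimately show ?thesis using assms csum_H(2) by auto
  next
    case False
    then have "u \<noteq> [a']" using assms by (auto simp: pair_word_def)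
    then show ?thesis using csum_H(1)[OF False] by simp
  qed
  have arcs: "a' \<in> arcs C" "a' \<in> arcs V" "tail V a' = head V a" "head V a' = tail V a"
    using assms arcs_bc by (auto simp: C_def)
  then have "is_qpath C (tail V a) [a'] \<and> path_source C (tail V a) [a'] = head V a"
    using quiver_tail[OF V arcs(2)] by (simp add: ht)
  then have "cyc_deriv C a H (i, u) = (if i = tail V a \<and> u = [a'] then m else 0)"
    unfolding cd 1 by auto
  also have "\<dots> = scl m (arr C a') (i, u)" using arcs(4) by (simp add: pointwise path_elem_apply ht)
  finally show "cyc_deriv C a H (i, u) = scl m (arr C a') (i, u)" .
qed

text \<open>The cyclic derivatives of \<open>m b c\<close> are \<open>m c\<close> and
  \<open>m b\<close>, so the ideal contains both arrows and with them, by expansion in first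
  letters, the whole arrow ideal, which is closed.\<close>

lemma jacobian_C: "jacobian_ideal (C, cyc_class C H) = arrow_ideal_pow C (Suc 0)"
proof -
  define G where "G = {cyc_deriv C a x | a x. a \<in> arcs C \<and> x \<in> cyc_class C H}"
  let ?I = "Idl\<^bsub>path_algebra C\<^esub> G"
  note ring = ring_path_algebra[OF C_quiver]
  have Gpow: "G \<subseteq> arrow_ideal_pow C (Suc 0)" using cyc_deriv_pow by (auto simp: G_def)
  have "ideal (arrow_ideal_pow C (Suc 0)) (path_algebra C)"
  proof (rule ideal_path_algebraI[OF C_quiver])
    show "arrow_ideal_pow C (Suc 0) \<subseteq> car C" by (auto dest: pow_car)
    show "conv C u x \<in> arrow_ideal_pow C (Suc 0)" if "x \<in> arrow_ideal_pow C (Suc 0)" "u \<in> car C" for x u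
      using conv_pow[OF C_quiver, of u 0 x "Suc 0"] that by simp
    show "conv C x u \<in> arrow_ideal_pow C (Suc 0)" if "x \<in> arrow_ideal_pow C (Suc 0)" "u \<in> car C" for x u
      using conv_pow[OF C_quiver, of x "Suc 0" u 0] that by simp
  qed auto
  then have I1: "?I \<subseteq> arrow_ideal_pow C (Suc 0)" using ring.genideal_minimal[OF ring _ Gpow] by blast
  have Gcar: "G \<subseteq> car C" using Gpow by (auto dest: pow_car)
  have ideal: "ideal ?I (path_algebra C)" by (rule ring.genideal_ideal[OF ring Gcar])
  have zero: "0 \<in> ?I" by (rule zero_in_genideal)
  have add: "x + y \<in> ?I" if "x \<in> ?I" "y \<in> ?I" for x y
    using additive_subgroup.a_closed[OF ideal.axioms(1)[OF ideal] that] by simp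
  have left: "conv C u x \<in> ?I" if "x \<in> ?I" "u \<in> car C" for x u using ideal.I_l_closed[OF ideal that] by simp
  have right: "conv C x u \<in> ?I" if "x \<in> ?I" "u \<in> car C" for x u using ideal.I_r_closed[OF ideal that] by simp
  have arr: "arr C a' \<in> ?I" if a': "a' \<in> arcs C" for a'
  proof -
    obtain a where a: "a = b \<and> a' = c \<or> a = c \<and> a' = b" "a \<in> arcs C" using a' by (auto simp: C_def)
    have "H \<in> cyc_class C H" using pow_car[OF H_pow_C] by (simp add: cyc_class_iff cyceq_refl)
    then have "cyc_deriv C a H \<in> G" using a(2) unfolding G_def by blast
    then have "scl m (arr C a') \<in> G" unfolding cyc_deriv_H[OF a(1)] .
    then have 1: "scl m (arr C a') \<in> ?I" using ring.genideal_self[OF ring Gcar] by blast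
    \<comment> \<open>Scaling by \<open>1 / m\<close> is multiplication by a multiple of the unit,
      so a ring ideal permits it.\<close>
    have "conv C (scl (1 / m) \<one>\<^bsub>path_algebra C\<^esub>) (scl m (arr C a')) = arr C a'"
      using m conv_one_left[OF C_quiver arr_car[OF C_quiver a']] by (simp add: conv_scl_left conv_scl_right scl_scl)
    then show ?thesis using left[OF 1 car_scl[OF one_car, of "1 / m"]] by metis
  qed
  have I2: "arrow_ideal_pow C (Suc 0) \<subseteq> ?I"
  proof
    fix x assume "x \<in> arrow_ideal_pow C (Suc 0)"
    then obtain g where g: "\<And>a. a \<in> arcs C \<Longrightarrow> g a \<in> arrow_ideal_pow C 0"
      "x = fsum (\<lambda>a. conv C (arr C a) (g a)) (arcs C)" by (rule pow_Suc_expand[OF C_quiver]) (rule that)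
    have "x = conv C (arr C b) (g b) + conv C (arr C c) (g c)"
      unfolding g(2) using b_neq_c by (simp add: C_def)
    moreover have "g b \<in> car C" "g c \<in> car C" "b \<in> arcs C" "c \<in> arcs C" using g(1) by (auto simp: C_def)
    ultimately show "x \<in> ?I" using add right arr by metis
  qed
  have "?I = arrow_ideal_pow C (Suc 0)" using I1 I2 by blast
  then have "jacobian_ideal (C, cyc_class C H) = adic_closure C (arrow_ideal_pow C (Suc 0))"
    by (simp add: jacobian_ideal_def G_def)
  also have "\<dots> = arrow_ideal_pow C (Suc 0)"
  proof (intro equalityI subsetI)
    fix x assume "x \<in> adic_closure C (arrow_ideal_pow C (Suc 0))"
    then obtain y where "y \<in> arrow_ideal_pow C (Suc 0)" "x - y \<in> arrow_ideal_pow C (Suc 0)"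
      unfolding adic_closure_def fun_diff_def by blast
    then have "(x - y) + y \<in> arrow_ideal_pow C (Suc 0)" by blast
    then show "x \<in> arrow_ideal_pow C (Suc 0)" by simp
  next
    fix x assume x: "x \<in> arrow_ideal_pow C (Suc 0)"
    have "x - x \<in> arrow_ideal_pow C n" for n by simp
    then show "x \<in> adic_closure C (arrow_ideal_pow C (Suc 0))"
      unfolding adic_closure_def fun_diff_def using x pow_car[OF x] by blast
  qed
  finally show ?thesis .
qed

lemma C_trivial: "is_trivial_qp (C, cyc_class C H)"
  unfolding is_trivial_qp_def case_prod_conv
proof (intro conjI)
  show "is_qp (C, cyc_class C H)" by (rule is_qpI[OF C_quiver H_pow_C])
  show "cyc_class C H \<in> cyc_class C ` {x \<in> car C. \<forall>i w. x (i, w) \<noteq> 0 \<longrightarrow> length w = 2}"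
  proof (intro imageI CollectI conjI allI impI)
    show "H \<in> car C" by (rule pow_car[OF H_pow_C])
    fix i w assume "H (i, w) \<noteq> 0"
    then show "length w = 2" by (auto simp: H_path pointwise path_elem_apply split: if_splits)
  qed
  let ?J = "arrow_ideal_pow C (Suc 0)"
  have coset: "y \<in> ?J +>\<^bsub>path_algebra C\<^esub> x \<longleftrightarrow> y - x \<in> ?J" for x y
  proof -
    have "y \<in> ?J +>\<^bsub>path_algebra C\<^esub> x \<longleftrightarrow> (\<exists>h\<in>?J. y = h + x)" by (simp add: a_r_coset_def')
    also have "\<dots> \<longleftrightarrow> y - x \<in> ?J" by (metis add_diff_cancel diff_add_cancel)
    finally show ?thesis .
  qed
  have "inj_on (\<lambda>r. ?J +>\<^bsub>path_algebra C\<^esub> r) (vertex_subalgebra C)"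
  proof (rule inj_onI)
    fix r s assume r: "r \<in> vertex_subalgebra C" and s: "s \<in> vertex_subalgebra C"
      and eq: "?J +>\<^bsub>path_algebra C\<^esub> r = ?J +>\<^bsub>path_algebra C\<^esub> s"
    have "r \<in> ?J +>\<^bsub>path_algebra C\<^esub> r" unfolding coset by simp
    then have rs: "r - s \<in> ?J" unfolding eq coset .
    show "r = s"
    proof (rule ext, clarify)
      fix i w
      show "r (i, w) = s (i, w)"
      proof (cases w)
        case Nil
        have "(r - s) (i, []) = 0" using rs by (force simp: pow_iff)
        then show ?thesis using Nil by (simp add: pointwise)
      next
        case Cons
        then have "r (i, w) = 0" "s (i, w) = 0" using r s unfolding vertex_subalgebra_def by fastforce+
        then show ?thesis by simp
      qed
    qed
  qed
  moreover have "(\<lambda>r. ?J +>\<^bsub>path_algebra C\<^esub> r) ` vertex_subalgebra C = carrier (path_algebra C Quot ?J)"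
  proof (intro equalityI subsetI)
    fix X assume "X \<in> carrier (path_algebra C Quot ?J)"
    then obtain x where x: "x \<in> car C" "X = ?J +>\<^bsub>path_algebra C\<^esub> x"
      by (auto simp: FactRing_def A_RCOSETS_def')
    \<comment> \<open>The constant part of \<open>x\<close> represents its coset in the vertex
      subalgebra.\<close>
    let ?r = "trunc 0 x"
    have r: "?r \<in> vertex_subalgebra C"
      using trunc_car[OF x(1), of 0] by (auto simp: vertex_subalgebra_def)
    have xr: "x - ?r \<in> ?J" by (rule trunc_rest[OF x(1)])
    have "y - x \<in> ?J \<longleftrightarrow> y - ?r \<in> ?J" for y
    proof -
      have "y - ?r = (y - x) + (x - ?r)" "y - x = (y - ?r) - (x - ?r)" by simp_all
      then show ?thesis using xr pow_add pow_diff by metis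
    qed
    then have "X = ?J +>\<^bsub>path_algebra C\<^esub> ?r" unfolding x(2) by (simp add: set_eq_iff coset)
    then show "X \<in> (\<lambda>r. ?J +>\<^bsub>path_algebra C\<^esub> r) ` vertex_subalgebra C" using r by blast
  next
    fix X assume "X \<in> (\<lambda>r. ?J +>\<^bsub>path_algebra C\<^esub> r) ` vertex_subalgebra C"
    then show "X \<in> carrier (path_algebra C Quot ?J)"
      by (auto simp: FactRing_def A_RCOSETS_def' vertex_subalgebra_def)
  qed
  ultimately show "bij_betw (\<lambda>r. jacobian_ideal (C, cyc_class C H) +>\<^bsub>path_algebra C\<^esub> r)
      (vertex_subalgebra C) (carrier (jacobian_algebra (C, cyc_class C H)))"
    unfolding jacobian_algebra_def fst_conv jacobian_C bij_betw_def by blast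
qed

section \<open>The remaining quiver, and reduction of graded QPs\<close>

definition V1 :: "('v, 'a) quiver" where
  "V1 = \<lparr>verts = verts V, arcs = arcs V - {b, c}, tail = tail V, head = head V\<rparr>"

lemma V1_quiver: "is_quiver V1"
  by (rule is_quiverI) (auto simp: V1_def quiver_finite_verts[OF V] quiver_finite_arcs[OF V] quiver_tail[OF V]
      quiver_head[OF V] quiver_loopfree[OF V])

lemma V1_sub: "subquiver V1 V"
  using V1_quiver V by (auto simp: subquiver_def V1_def)

lemma V1_sum: "quiver_sum V1 C = V"
  using arcs_bc(1,2) by (auto simp: quiver_sum_def V1_def C_def intro!: pre_digraph.equality)

lemma dilation_split:
  assumes y: "good 2 y"
  obtains x where "x \<in> arrow_ideal_pow V1 2" "x \<in> homogeneous V1 d 1"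
    "equivclp dilation_step ((V, cyc_class V y), d) ((V1, cyc_class V1 x), d)"
proof -
  obtain \<phi> \<psi> x where iso: "qiso V V \<phi> \<psi>" and g: "\<And>a. a \<in> arcs V \<Longrightarrow> \<phi> (arr V a) \<in> homogeneous V d (d a)"
    and eq: "cyceq V (\<phi> y) (x + H)" and x: "x \<in> arrow_ideal_pow V 2" "x \<in> homogeneous V d 1"
    and t: "\<And>i w. x (i, w) \<noteq> 0 \<Longrightarrow> \<not> touches w"
    using split_pair[OF y] by blast
  have y': "y \<in> arrow_ideal_pow V 2" "y \<in> homogeneous V d 1" using y by (auto simp: good_def)
  have xH: "x + H \<in> arrow_ideal_pow V 2" "x + H \<in> homogeneous V d 1"
    using x H_pow homogeneous_add[OF x(2) H_homogeneous] by blast+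
  have x1car: "x \<in> car V1"
    unfolding car_iff
  proof (intro allI impI)
    fix i w assume "x (i, w) \<noteq> 0"
    then have p: "is_qpath V i w" "\<not> touches w" using t pow_car[OF x(1)] by (auto simp: car_iff)
    then have "set w \<subseteq> arcs V1" using is_qpath_arcs[OF p(1)] by (auto simp: V1_def touches_def)
    then show "is_qpath V1 i w" using p(1) subquiver_path[OF V1_sub] by simp
  qed
  have x1: "x \<in> arrow_ideal_pow V1 2" "x \<in> homogeneous V1 d 1"
    using x x1car by (auto simp: pow_iff homogeneous_iff)
  have "dilation_step ((V, cyc_class V y), d) ((V, cyc_class V (x + H)), d)"
    by (rule graded_right_equiv[OF is_graded_qpI[OF V y'] is_graded_qpI[OF V xH]
          graded_right_equivalenceI[OF iso pow_car[OF y'(1)] eq g]])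
  \<comment> \<open>This step runs from the smaller QP to the larger one; the equivalence closure
    reverses it.\<close>
  moreover have "dilation_step ((V1, cyc_class V1 x), d) ((V, cyc_class V (x + H)), d)"
  proof -
    have s: "dilation_step ((V1, cyc_class V1 x), d) (graded_qp_sum ((V1, cyc_class V1 x), d) ((C, cyc_class C H), d))"
      by (rule adjoin_graded_trivial[OF is_graded_qpI[OF V1_quiver x1] is_graded_qpI[OF C_quiver H_pow_C H_homogeneous_C]])
         (use C_trivial in \<open>auto simp: summable_qp_def V1_def C_def\<close>)
    have "qp_sum (V1, cyc_class V1 x) (C, cyc_class C H) = (V, cyc_class V (x + H))"
      using qp_sum_cyc_class[OF V1_quiver C_quiver _ _ x1car pow_car[OF H_pow_C]] V1_sum
      by (simp add: V1_def C_def)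
    then have "graded_qp_sum ((V1, cyc_class V1 x), d) ((C, cyc_class C H), d) = ((V, cyc_class V (x + H)), d)"
      by (simp add: graded_qp_sum_def)
    then show ?thesis using s by simp
  qed
  ultimately have "equivclp dilation_step ((V, cyc_class V y), d) ((V1, cyc_class V1 x), d)"
    by (meson equivclp_trans r_into_equivclp converse_r_into_equivclp)
  then show thesis using that x1 by blast
qed

end

text \<open>Induction on the number of arrows: a nonzero entry of \<open>quad\<close> is a 2-cycle
  with nonzero coefficient, hence of degree one, and splitting it off removes two arrows.\<close>

lemma graded_reduction:
  fixes V :: "('v, 'a) quiver"
  assumes "is_quiver V" "x \<in> arrow_ideal_pow V 2" "x \<in> homogeneous V d 1"
  shows "\<exists>V' x'. is_quiver V' \<and> x' \<in> arrow_ideal_pow V' 2 \<and> x' \<in> homogeneous V' d 1 \<and>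
    (\<forall>a b. quad V' x' a b = 0) \<and>
    equivclp dilation_step ((V, cyc_class V x), d) ((V', cyc_class V' x'), d)"
  using assms
proof (induction "card (arcs V)" arbitrary: V x rule: less_induct)
  case less
  note V = less.prems(1)
  show ?case
  proof (cases "\<forall>a b. quad V x a b = 0")
    case True
    then show ?thesis using less.prems by (meson equivclp_refl)
  next
    case False
    then obtain b c where nz: "quad V x b c \<noteq> 0" by blast
    then have cl: "closed_word V [b, c]" and cs: "csum V x [b, c] \<noteq> 0" by (auto simp: quad_def split: if_splits)
    interpret hyperbolic_pair V d b c "csum V x [b, c]"
      by unfold_locales (use V cl cs homogeneous_csum[OF less.prems(3) cs] in auto)
    have "good 2 x"
      unfolding good_def
    proof (intro conjI allI impI)
      fix w assume w: "closed_word V w" "length w < 2"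
      then obtain a where a: "w = [a]" by (cases w) (auto simp: closed_word_def)
      then show "csum V x w = csum V H w" using w quiver_loopfree[OF V, of a] by (auto simp: closed_word_def)
    qed (use less.prems in auto)
    then obtain x1 where x1: "x1 \<in> arrow_ideal_pow V1 2" "x1 \<in> homogeneous V1 d 1"
      "equivclp dilation_step ((V, cyc_class V x), d) ((V1, cyc_class V1 x1), d)"
      by (rule dilation_split)
    have "arcs V1 \<subset> arcs V" using arcs_bc(1) by (auto simp: V1_def)
    then have "card (arcs V1) < card (arcs V)" by (rule psubset_card_mono[OF quiver_finite_arcs[OF V]])
    from less.hyps[OF this V1_quiver x1(1,2)] show ?thesis
      using equivclp_trans[OF x1(3)] by blast
  qed
qed

section \<open>Dilation equivalence implies stable equivalence\<close>

lemma is_graded_qp_fst: "is_graded_qp Y \<Longrightarrow> is_qp (fst Y)"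
  by (erule is_graded_qpE) (simp add: is_qpI)

lemma dilation_step_stable:
  assumes "dilation_step X Y" shows "equivclp stable_step (fst X) (fst Y)"
  using assms
proof cases
  case (vertex_gauge h)
  obtain V W d where "X = ((V, W), d)" by (metis surj_pair)
  then have "fst Y = fst X" using vertex_gauge(1) by (simp add: gauge_def)
  then show ?thesis by simp
next
  case (graded_right_equiv \<phi>)
  have "right_equivalence \<phi> (fst X) (fst Y)"
    using graded_right_equiv(3) by (cases X; cases Y) (simp add: graded_right_equivalence_def)
  then have "stable_step (fst X) (fst Y)"
    by (rule right_equiv[OF is_graded_qp_fst[OF graded_right_equiv(1)] is_graded_qp_fst[OF graded_right_equiv(2)]])
  then show ?thesis by (rule r_into_equivclp)
next
  case (adjoin_graded_trivial Z)
  have "stable_step (fst X) (qp_sum (fst X) (fst Z))"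
    by (rule adjoin_trivial[OF is_graded_qp_fst[OF adjoin_graded_trivial(2)] adjoin_graded_trivial(4,5)])
  moreover have "fst Y = qp_sum (fst X) (fst Z)"
    unfolding adjoin_graded_trivial(1) by (cases X; cases Z) (simp add: graded_qp_sum_def)
  ultimately show ?thesis by (simp add: r_into_equivclp)
qed

lemma dilation_equiv_stable:
  assumes "equivclp dilation_step X Y" shows "equivclp stable_step (fst X) (fst Y)"
  using assms
proof (induction rule: equivclp_induct)
  case base
  show ?case by simp
next
  case (step Y Z)
  from step.hyps(2) have "equivclp stable_step (fst Y) (fst Z)"
  proof
    assume "dilation_step Y Z" then show ?thesis by (rule dilation_step_stable)
  next
    assume "dilation_step Z Y"
    from equivclp_sym[OF dilation_step_stable[OF this]] show ?thesis .
  qed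
  from equivclp_trans[OF step.IH this] show ?case .
qed

subsection \<open>Plabic fences\<close>

lemma zip_snoc_right: "zip (v # us) (us @ [z]) = zip (v # us) us @ [(last (v # us), z)]"
  by (induction us arbitrary: v) auto

lemma chain_path:
  assumes Q: "is_quiver Q" and ends: "tail Q = fst" "head Q = snd"
    and "xs \<noteq> []" "hd xs \<in> verts Q" "set (zip xs (tl xs)) \<subseteq> arcs Q"
  shows "is_qpath Q (last xs) (rev (zip xs (tl xs))) \<and> path_source Q (last xs) (rev (zip xs (tl xs))) = hd xs"
  using assms(4-)
proof (induction xs)
  case (Cons v xs)
  show ?case
  proof (cases xs)
    case Nil
    then show ?thesis using Cons.prems by simp
  next
    case (Cons v' r)
    then have a: "(v, v') \<in> arcs Q" using Cons.prems by simp
    then have v': "v' \<in> verts Q" using quiver_head[OF Q] ends by fastforce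
    have "is_qpath Q (last xs) (rev (zip xs (tl xs))) \<and> path_source Q (last xs) (rev (zip xs (tl xs))) = hd xs"
      by (rule Cons.IH) (use Cons Cons.prems v' in auto)
    then show ?thesis using Cons Cons.prems a ends
      by (simp add: is_qpath_append[OF Q] path_source_append)
  qed
qed simp

locale fence =
  fixes G :: plabic_fence
  assumes fence: "is_plabic_fence G"
begin

abbreviation lv :: "real \<Rightarrow> nat" where "lv \<equiv> level G"
abbreviation Q :: "(real, real \<times> real) quiver" where "Q \<equiv> fence_quiver G"

lemma finite_edges: "finite (edges G)"
  and level_pos: "e \<in> edges G \<Longrightarrow> lv e \<ge> 1"
  using fence by (auto simp: is_plabic_fence_def)

lemma Q_simps: "verts Q = faces G" "tail Q = fst" "head Q = snd"
  by (simp_all add: fence_quiver_def)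

lemma consecutiveD:
  assumes "consecutive G d e"
  shows "d \<in> edges G" "e \<in> edges G" "lv e = lv d" "d < e" "x \<in> edges G \<Longrightarrow> lv x = lv d \<Longrightarrow> x \<le> d \<or> e \<le> x"
  using assms by (auto simp: consecutive_def next_edge_def not_less)

lemma next_edgeD:
  assumes "next_edge G k d e"
  shows "e \<in> edges G" "lv e = k" "d < e" "x \<in> edges G \<Longrightarrow> lv x = k \<Longrightarrow> x \<le> d \<or> e \<le> x"
  using assms by (auto simp: next_edge_def not_less)

lemma next_edge_unique: assumes "next_edge G k d e" "next_edge G k d e'" shows "e = e'"
  using next_edgeD(1-3)[OF assms(1)] next_edgeD(1-3)[OF assms(2)]
    next_edgeD(4)[OF assms(1), of e'] next_edgeD(4)[OF assms(2), of e] by auto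

definition lft :: "real \<Rightarrow> real" where "lft e = (SOME d. consecutive G d e)"

lemma consecutive_unique: assumes "consecutive G d e" "consecutive G d' e" shows "d = d'"
  using consecutiveD(1-4)[OF assms(1)] consecutiveD(1-4)[OF assms(2)]
    consecutiveD(5)[OF assms(1), of d'] consecutiveD(5)[OF assms(2), of d] by auto

lemma lft: "e \<in> faces G \<Longrightarrow> consecutive G (lft e) e"
  unfolding lft_def by (rule someI_ex) (simp add: faces_def)

lemma consecutive_faces: "consecutive G d e \<Longrightarrow> e \<in> faces G"
  by (auto simp: faces_def)

lemma lft_eq: "consecutive G d e \<Longrightarrow> lft e = d"
  by (rule consecutive_unique[OF lft[OF consecutive_faces]])

lemma faces_edges: "e \<in> faces G \<Longrightarrow> e \<in> edges G"
  by (rule consecutiveD(2)[OF lft])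

lemma next_edge_exists:
  assumes "x \<in> edges G" "lv x = k" "d < x"
  obtains e where "next_edge G k d e" "e \<le> x"
proof -
  let ?S = "{y \<in> edges G. lv y = k \<and> d < y}"
  have fin: "finite ?S" using finite_edges by simp
  have x: "x \<in> ?S" using assms by simp
  then have m: "Min ?S \<in> ?S" using Min_in[OF fin] by blast
  have "next_edge G k d (Min ?S)"
    unfolding next_edge_def using m Min_le[OF fin] by (auto simp: not_less) force
  then show thesis using that Min_le[OF fin x] by blast
qed

lemma face_if_preceded:
  assumes "e \<in> edges G" "x \<in> edges G" "lv x = lv e" "x < e" shows "e \<in> faces G"
proof -
  let ?S = "{y \<in> edges G. lv y = lv e \<and> y < e}"
  have fin: "finite ?S" using finite_edges by simp
  have m: "Max ?S \<in> ?S" using Max_in[OF fin] assms by blast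
  have "consecutive G (Max ?S) e"
    unfolding consecutive_def next_edge_def using m assms Max_ge[OF fin] by (auto simp: not_less)
  then show ?thesis by (auto simp: faces_def)
qed

text \<open>Arrow types (b) and (c) together. The level condition is additive in both directions,
  which avoids truncated subtraction on \<open>nat\<close>.\<close>

definition vertical :: "real \<Rightarrow> real \<Rightarrow> nat \<Rightarrow> bool" where
  "vertical e f k \<longleftrightarrow> e \<in> faces G \<and> f \<in> faces G \<and> f < e \<and> next_edge G k (lft e) f \<and> (k = lv e + 1 \<or> lv e = k + 1)"

lemma arcs_iff: "(x, y) \<in> arcs Q \<longleftrightarrow> x \<in> faces G \<and> (consecutive G x y \<or> (\<exists>k. vertical x y k))"
proof
  assume "(x, y) \<in> arcs Q"
  then consider "consecutive G x y" "x \<in> faces G"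
    | d k where "y \<in> faces G" "y < x" "consecutive G d x" "next_edge G k d y" "k = lv x + 1 \<or> k = lv x - 1"
    by (auto simp: fence_quiver_def)
  then show "x \<in> faces G \<and> (consecutive G x y \<or> (\<exists>k. vertical x y k))"
  proof cases
    case 2
    have "lft x = d" by (rule lft_eq[OF 2(3)])
    \<comment> \<open>Levels are positive, so in the case \<open>k = lv x - 1\<close> the
      subtraction is not truncated.\<close>
    moreover have "lv y \<ge> 1" "lv y = k" using level_pos next_edgeD[OF 2(4)] by auto
    ultimately have "vertical x y k" using 2 by (auto simp: vertical_def dest: consecutive_faces)
    then show ?thesis by (auto simp: vertical_def)
  qed simp
next
  assume a: "x \<in> faces G \<and> (consecutive G x y \<or> (\<exists>k. vertical x y k))"
  show "(x, y) \<in> arcs Q"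
  proof (cases "consecutive G x y")
    case True
    then show ?thesis using a by (simp add: fence_quiver_def)
  next
    case False
    then obtain k where k: "vertical x y k" using a by blast
    then have "k = lv x + 1 \<or> k = lv x - 1" by (auto simp: vertical_def)
    moreover have "consecutive G (lft x) x" using a lft by blast
    ultimately show ?thesis using k by (auto simp: fence_quiver_def vertical_def)
  qed
qed

lemma vertical_level: "vertical e f k \<Longrightarrow> lv f = k"
  by (auto simp: vertical_def next_edge_def)

lemma arcs_faces: assumes "(x, y) \<in> arcs Q" shows "x \<in> faces G" "y \<in> faces G" "x \<noteq> y"
  using assms unfolding arcs_iff by (auto simp: vertical_def dest: consecutive_faces consecutiveD(4))

lemma Q_quiver: "is_quiver Q"
proof (rule is_quiverI)
  show fin: "finite (verts Q)"
    unfolding Q_simps by (rule finite_subset[OF _ finite_edges]) (auto dest: faces_edges)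
  have "arcs Q \<subseteq> verts Q \<times> verts Q" by (auto simp: Q_simps dest: arcs_faces(1,2))
  then show "finite (arcs Q)" using fin finite_subset by blast
  show "tail Q a \<in> verts Q \<and> head Q a \<in> verts Q \<and> tail Q a \<noteq> head Q a" if "a \<in> arcs Q" for a
  proof -
    obtain x y where a: "a = (x, y)" by (cases a)
    show ?thesis using arcs_faces[of x y] that by (simp add: a Q_simps)
  qed
qed

subsection \<open>The grading by upward arrows\<close>

definition up :: "real \<times> real \<Rightarrow> int" where "up a = (if lv (snd a) = lv (fst a) + 1 then 1 else 0)"

definition bends :: "(real \<times> real) list \<Rightarrow> nat" where
  "bends w = length (filter (\<lambda>a. lv (fst a) \<noteq> lv (snd a)) w)"

lemma vertical_levels: assumes "vertical x y k" shows "lv y = k" "lv y = lv x + 1 \<or> lv x = lv y + 1"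
proof -
  show "lv y = k" by (rule vertical_level[OF assms])
  moreover have "k = lv x + 1 \<or> lv x = k + 1" using assms unfolding vertical_def by blast
  ultimately show "lv y = lv x + 1 \<or> lv x = lv y + 1" by blast
qed

lemma horizontal_arc: assumes "(x, y) \<in> arcs Q" "lv x = lv y" shows "consecutive G x y"
proof (rule ccontr)
  assume "\<not> consecutive G x y"
  then obtain k where "vertical x y k" using assms(1)[unfolded arcs_iff] by blast
  from vertical_levels(2)[OF this] show False using assms(2) by simp
qed

lemma vertical_arc: assumes "(x, y) \<in> arcs Q" "lv x \<noteq> lv y" shows "vertical x y (lv y)"
proof -
  have "\<not> consecutive G x y" using consecutiveD(3)[of x y] assms(2) by auto
  then obtain k where "vertical x y k" using assms(1)[unfolded arcs_iff] by blast
  then show ?thesis using vertical_levels(1)[of x y k] by simp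
qed

lemma arc_level: assumes "(x, y) \<in> arcs Q" shows "lv y = lv x \<or> lv y = lv x + 1 \<or> lv x = lv y + 1"
  using vertical_arc[OF assms] vertical_levels(2)[of x y "lv y"] by auto

text \<open>\<open>bends\<close> is the number of up arrows plus that of down arrows, while their
  difference is the change of level from the source to the target \<open>i\<close>.\<close>

lemma bends_deg:
  "is_qpath Q i w \<Longrightarrow> int (bends w) = 2 * deg up w - (int (lv i) - int (lv (path_source Q i w)))"
proof (induction w arbitrary: i)
  case (Cons a w)
  obtain x y where a: "a = (x, y)" by (cases a)
  have "int (bends w) = 2 * deg up w - (int (lv x) - int (lv (path_source Q x w)))"
    using Cons by (simp add: a Q_simps)
  moreover have "lv y = lv x \<or> lv y = lv x + 1 \<or> lv x = lv y + 1"
    by (rule arc_level) (use Cons.prems a in simp)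
  moreover have "y = i" "path_source Q i (a # w) = path_source Q x w" using Cons.prems by (simp_all add: a Q_simps)
  moreover have "int (bends (a # w)) = (if lv x = lv y then 0 else 1) + int (bends w)"
    "deg up (a # w) = (if lv y = lv x + 1 then 1 else 0) + deg up w"
    by (simp_all add: bends_def up_def a)
  ultimately show ?case by (elim disjE) simp_all
qed (simp add: bends_def)

text \<open>A horizontal arrow leads to the next face to the right on the same level.\<close>

lemma horizontal_path:
  assumes "is_qpath Q i w" "bends w = 0"
  shows "lv (path_source Q i w) = lv i" "path_source Q i w \<le> i" "w \<noteq> [] \<Longrightarrow> path_source Q i w < i"
proof -
  have "lv (path_source Q i w) = lv i \<and> (if w = [] then path_source Q i w = i else path_source Q i w < i)"
    using assms
  proof (induction w arbitrary: i)
    case (Cons a w)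
    obtain x y where a: "a = (x, y)" by (cases a)
    have xy: "consecutive G x i"
      using Cons.prems horizontal_arc[of x y] by (auto simp: a Q_simps bends_def split: if_splits)
    have "lv (path_source Q x w) = lv x \<and> (if w = [] then path_source Q x w = x else path_source Q x w < x)"
      using Cons.prems by (intro Cons.IH) (auto simp: a Q_simps bends_def split: if_splits)
    then show ?case using consecutiveD(3,4)[OF xy] by (auto simp: a Q_simps split: if_splits)
  qed simp
  then show "lv (path_source Q i w) = lv i" "path_source Q i w \<le> i" "w \<noteq> [] \<Longrightarrow> path_source Q i w < i"
    by (auto split: if_splits)
qed

lemma bend_path:
  assumes "is_qpath Q i w" "bends w = 1"
  obtains w1 x y w2 where "w = w1 @ (x, y) # w2" "vertical x y (lv y)" "is_qpath Q i w1" "is_qpath Q x w2"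
    "path_source Q i w1 = y" "bends w1 = 0" "bends w2 = 0" "path_source Q x w2 = path_source Q i w"
proof -
  obtain a where "filter (\<lambda>a. lv (fst a) \<noteq> lv (snd a)) w = [a]"
    using assms(2) unfolding bends_def by (auto simp: length_Suc_conv)
  then obtain w1 w2 where w: "w = w1 @ a # w2" "bends w1 = 0" "lv (fst a) \<noteq> lv (snd a)" "bends w2 = 0"
    unfolding bends_def by (auto dest!: filter_eq_ConsD)
  obtain x y where a: "a = (x, y)" by (cases a)
  have p: "is_qpath Q i w1" "is_qpath Q (path_source Q i w1) (a # w2)"
    using assms(1) unfolding w(1) is_qpath_append[OF Q_quiver] by auto
  then have "(x, y) \<in> arcs Q" "path_source Q i w1 = y" "is_qpath Q x w2" by (auto simp: a Q_simps)
  moreover from this have "vertical x y (lv y)" using vertical_arc w(3) a by simp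
  moreover have "path_source Q x w2 = path_source Q i w" by (simp add: w(1) path_source_append a Q_simps)
  ultimately show thesis using that w p a by blast
qed

text \<open>Along a horizontal detour the vertical arrows move strictly to the right, so a path parallel to
  an arrow with as few upward steps is the arrow itself.\<close>

lemma parallel_path:
  assumes a: "a \<in> arcs Q" and w: "is_qpath Q (head Q a) w" "path_source Q (head Q a) w = tail Q a"
  shows "deg up w \<ge> up a" "deg up w = up a \<Longrightarrow> w = [a]"
proof -
  obtain e f where ef: "a = (e, f)" by (cases a)
  have w: "is_qpath Q f w" "path_source Q f w = e" using w by (auto simp: ef Q_simps)
  have arc: "(e, f) \<in> arcs Q" using a ef by simp
  have b: "int (bends w) = 2 * deg up w - (int (lv f) - int (lv e))" using bends_deg[OF w(1)] w(2) by simp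
  show "deg up w \<ge> up a" using b arc_level[OF arc] by (auto simp: up_def ef)
  \<comment> \<open>By \<open>bends_deg\<close>, equality leaves no bend when \<open>a\<close> is
    horizontal and exactly one otherwise.\<close>
  assume eq: "deg up w = up a"
  show "w = [a]"
  proof (cases "lv e = lv f")
    case True
    then have cons: "consecutive G e f" using horizontal_arc[OF arc] by simp
    have b0: "bends w = 0" using b eq True by (simp add: up_def ef)
    have "w \<noteq> []" using w(2) consecutiveD(4)[OF cons] by auto
    then obtain c u where cu: "w = c # u" by (cases w) auto
    obtain x where c: "c = (x, f)" using w(1) cu by (cases c) (auto simp: Q_simps)
    have x: "(x, f) \<in> arcs Q" "is_qpath Q x u" "path_source Q x u = e" using w by (auto simp: cu c Q_simps)
    have bu: "bends u = 0" "lv x = lv f" using b0 by (auto simp: cu c bends_def split: if_splits)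
    have "x = e" using consecutive_unique[OF horizontal_arc[OF x(1)] cons] bu by simp
    then have "u = []" using horizontal_path(3)[OF x(2) bu(1)] x(3) by force
    then show ?thesis using cu c ef \<open>x = e\<close> by simp
  next
    case False
    then have v: "vertical e f (lv f)" by (rule vertical_arc[OF arc])
    then have "lv f = lv e + 1 \<or> lv e = lv f + 1" by (auto simp: vertical_def)
    then have "bends w = 1" using b eq by (auto simp: up_def ef)
    then obtain w1 x y w2 where s: "w = w1 @ (x, y) # w2" "vertical x y (lv y)" "is_qpath Q f w1" "is_qpath Q x w2"
      "path_source Q f w1 = y" "bends w1 = 0" "bends w2 = 0" "path_source Q x w2 = e"
      using bend_path[OF w(1)] w(2) by metis
    have y: "lv y = lv f" "y \<le> f" "w1 \<noteq> [] \<Longrightarrow> y < f" using horizontal_path[OF s(3,6)] s(5) by auto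
    have x: "lv e = lv x" "e \<le> x" "w2 \<noteq> [] \<Longrightarrow> e < x" using horizontal_path[OF s(4,7)] s(8) by auto
    have "f < e" using v by (simp add: vertical_def)
    \<comment> \<open>Were \<open>x\<close> strictly to the right of \<open>e\<close>, the left edge
      of \<open>F_x\<close> would lie at or beyond \<open>e\<close>, hence \<open>y\<close> beyond
      \<open>e\<close>; but \<open>y \<le> f < e\<close>.\<close>
    have xe: "x = e"
    proof (rule ccontr)
      assume "x \<noteq> e"
      then have "e < x" using x(2) by simp
      have "x \<in> faces G" "e \<in> edges G" using s(2) v faces_edges by (auto simp: vertical_def)
      then have "e \<le> lft x" using consecutiveD(3)[OF lft[of x]] consecutiveD(5)[OF lft[of x], of e] x(1) \<open>e < x\<close> by auto
      also have "lft x < y" using s(2) by (auto simp: vertical_def next_edge_def)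
      finally show False using y(2) \<open>f < e\<close> by simp
    qed
    moreover have "y = f"
    proof (rule next_edge_unique)
      show "next_edge G (lv f) (lft e) y" using s(2) unfolding vertical_def xe y(1) by blast
      show "next_edge G (lv f) (lft e) f" using v unfolding vertical_def by blast
    qed
    ultimately show ?thesis using s(1) x(3) y(3) ef by force
  qed
qed

text \<open>A horizontal arrow keeps the level and goes right, a vertical one changes the level and
  goes left; so an arrow in the reverse direction would be of the same kind and go the wrong
  way.\<close>

lemma no_two_cycle: "\<not> closed_word Q [a, b]"
proof
  assume cl: "closed_word Q [a, b]"
  then have ab: "a \<in> arcs Q" "b \<in> arcs Q" "head Q b = tail Q a" "tail Q b = head Q a"
    by (auto simp: closed_word_2[OF Q_quiver])
  obtain x y where a: "a = (x, y)" by (cases a)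
  have b: "b = (y, x)" using ab by (cases b) (auto simp: a Q_simps)
  have xy: "(x, y) \<in> arcs Q" "(y, x) \<in> arcs Q" using ab a b by auto
  show False
  proof (cases "lv x = lv y")
    case True
    then have "x < y" "y < x"
      using consecutiveD(4)[OF horizontal_arc[OF xy(1)]] consecutiveD(4)[OF horizontal_arc[OF xy(2)]] by simp_all
    then show False by simp
  next
    case False
    then have "vertical x y (lv y)" "vertical y x (lv x)" using vertical_arc xy by auto
    then have "y < x" "x < y" unfolding vertical_def by blast+
    then show False by simp
  qed
qed

subsection \<open>Pente-rows\<close>

definition row_word :: "pente_row \<Rightarrow> (real \<times> real) list" where
  "row_word = (\<lambda>(d1, d2, es, f). let vs = es @ [f, d2] in rev (zip vs (rotate1 vs)))"

text \<open>Black and white rows treated alike: \<open>p\<close> is the level of the inner edges,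
  one above or one below that of the bounding pair.\<close>

definition row_level :: "nat \<Rightarrow> pente_row \<Rightarrow> bool" where
  "row_level p \<rho> \<longleftrightarrow> is_pente_row G p \<rho> \<and> (p = lv (fst \<rho>) + 1 \<or> p + 1 = lv (fst \<rho>))"

lemma black_row_level: "\<rho> \<in> black_rows G \<Longrightarrow> row_level (lv (fst \<rho>) + 1) \<rho>"
  by (simp add: black_rows_def row_level_def)

lemma white_row_level: assumes "\<rho> \<in> white_rows G" shows "row_level (lv (fst \<rho>) - 1) \<rho>"
proof -
  obtain d1 d2 es f where \<rho>: "\<rho> = (d1, d2, es, f)" by (metis surj_pair)
  have "d1 \<in> edges G" using assms consecutiveD(1) by (auto simp: white_rows_def is_pente_row_def \<rho>)
  then show ?thesis using assms level_pos[of d1] by (simp add: white_rows_def row_level_def \<rho>)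
qed

text \<open>Puts the two vertical arrows in front; what remains is the horizontal chain through the
  inner edges to \<open>f\<close>.\<close>

lemma row_word_eq:
  assumes "es \<noteq> []"
  shows "row_word (d1, d2, es, f) = (d2, hd es) # (f, d2) # rev (zip (es @ [f]) (tl (es @ [f])))"
proof -
  obtain v us where es: "es = v # us" using assms by (cases es) auto
  let ?us = "us @ [f]"
  have "zip (v # ?us @ [d2]) ((?us @ [d2]) @ [v]) = zip (v # ?us @ [d2]) (?us @ [d2]) @ [(d2, v)]"
    using zip_snoc_right[of v "?us @ [d2]" v] by simp
  also have "zip (v # ?us @ [d2]) (?us @ [d2]) = zip (v # ?us) (?us @ [d2])"
    using zip_append1[of "v # ?us" "[d2]" "?us @ [d2]"] by simp
  also have "\<dots> = zip (v # ?us) ?us @ [(f, d2)]"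
    using zip_snoc_right[of v ?us d2] by simp
  finally show ?thesis by (simp add: row_word_def es)
qed

lemma zip_tl_split: "(x, y) \<in> set (zip xs (tl xs)) \<Longrightarrow> \<exists>us vs. xs = us @ x # y # vs"
proof (induction xs)
  case (Cons v xs)
  show ?case
  proof (cases "\<exists>vs. v = x \<and> xs = y # vs")
    case True
    then show ?thesis by (metis append_Nil)
  next
    case False
    then have "(x, y) \<in> set (zip xs (tl xs))" using Cons.prems by (cases xs) auto
    then show ?thesis using Cons.IH by (metis append_Cons)
  qed
qed simp

lemma row_facts:
  assumes r: "row_level p (d1, d2, es, f)"
  shows "es \<noteq> []" "consecutive G d1 d2" "hd es \<in> faces G" "f \<in> faces G" "d2 \<in> faces G" "lv (hd es) = p" "lv f = p"
    "hd es < f" "set (zip (es @ [f]) (tl (es @ [f]))) \<subseteq> {(x, y). consecutive G x y \<and> x \<in> faces G}"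
    "vertical f d2 (lv d2)" "vertical d2 (hd es) p"
proof -
  let ?S = "{e \<in> edges G. lv e = p \<and> d1 < e \<and> e < d2}"
  have c: "consecutive G d1 d2" and es: "es = sorted_list_of_set ?S" and ne: "es \<noteq> []" and hf: "hd es \<in> faces G"
    and nf: "next_edge G p (last es) f" and p: "p = lv d1 + 1 \<or> p + 1 = lv d1"
    using r by (auto simp: row_level_def is_pente_row_def)
  have fin: "finite ?S" using finite_edges by simp
  have set: "set es = ?S" unfolding es by (rule set_sorted_list_of_set[OF fin])
  have sorted: "sorted_wrt (<) es" unfolding es by (rule strict_sorted_list_of_set)
  have hd: "hd es \<in> ?S" and la: "last es \<in> ?S" using ne set hd_in_set last_in_set by blast+
  have hd_le: "hd es \<le> x" if "x \<in> ?S" for x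
  proof -
    obtain v us where "es = v # us" using ne by (cases es) auto
    then show ?thesis using sorted that set[symmetric] by auto
  qed
  have le_last: "x \<le> last es" if "x \<in> ?S" for x
  proof -
    obtain us v where "es = us @ [v]" using ne by (cases es rule: rev_cases) auto
    then show ?thesis using sorted that set[symmetric] by (auto simp: sorted_wrt_append)
  qed
  have d2: "lv d2 = lv d1" "d1 < d2" "d2 \<in> edges G" using consecutiveD[OF c] by auto
  note f = next_edgeD[OF nf]
  have lastf: "consecutive G (last es) f" using nf la by (simp add: consecutive_def)
  \<comment> \<open>Otherwise \<open>f\<close> would lie between \<open>d1\<close> and
    \<open>d2\<close> on level \<open>p\<close> and be an inner edge, although it comes after the
    last one.\<close>
  have d2f: "d2 < f"
  proof (rule ccontr)
    assume "\<not> d2 < f"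
    moreover have "lv f \<noteq> lv d2" unfolding f(2) d2(1) using p by linarith
    then have "f \<noteq> d2" by blast
    ultimately have "f < d2" by simp
    moreover have "d1 < f" using f(3) la by auto
    ultimately have "f \<in> ?S" using f(1,2) by simp
    then show False using le_last[of f] f(3) by simp
  qed
  show "es \<noteq> []" "consecutive G d1 d2" "hd es \<in> faces G" "lv f = p" by (fact ne c hf f(2))+
  show fF: "f \<in> faces G" and d2F: "d2 \<in> faces G" using lastf c by (auto simp: faces_def)
  show "lv (hd es) = p" using hd by simp
  show "hd es < f" using hd d2f by simp
  have cons: "consecutive G x y" if xy: "es @ [f] = us @ x # y # vs" for us x y vs
  proof (cases vs rule: rev_cases)
    case Nil
    then have "es = us @ [x]" "f = y" using xy by auto
    then show ?thesis using lastf by simp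
  next
    case (snoc vs' z)
    then have e: "es = us @ x # y # vs'" using xy by simp
    then have xy': "x \<in> ?S" "y \<in> ?S" "x < y" using set sorted by (auto simp: sorted_wrt_append)
    have "z \<le> x \<or> y \<le> z" if "z \<in> ?S" for z
    proof -
      have "z \<in> set us \<or> z = x \<or> z = y \<or> z \<in> set vs'" using that set e by auto
      then show ?thesis using sorted unfolding e by (auto simp: sorted_wrt_append)
    qed
    then have btw: "\<not> (x < z \<and> z < y)" if "z \<in> ?S" for z using that by force
    have "\<not> (x < z \<and> z < y)" if "z \<in> edges G" "lv z = lv x" for z
      using btw[of z] xy'(1,2) that by auto
    then show ?thesis unfolding consecutive_def next_edge_def using xy' by simp
  qed
  have face: "x \<in> faces G" if xy: "es @ [f] = us @ x # y # vs" for us x y vs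
  proof (cases us rule: rev_cases)
    case Nil
    then have "x = hd es" using xy ne by (cases es) auto
    then show ?thesis using hf by simp
  next
    case (snoc us' z)
    then have "consecutive G z x" using cons[of us' z x "y # vs"] xy by simp
    then show ?thesis by (auto simp: faces_def)
  qed
  show "set (zip (es @ [f]) (tl (es @ [f]))) \<subseteq> {(x, y). consecutive G x y \<and> x \<in> faces G}"
  proof (rule subsetI)
    fix q assume q: "q \<in> set (zip (es @ [f]) (tl (es @ [f])))"
    obtain x y where xy: "q = (x, y)" by (cases q)
    obtain us vs where e: "es @ [f] = us @ x # y # vs" using zip_tl_split[OF q[unfolded xy]] by blast
    show "q \<in> {(x, y). consecutive G x y \<and> x \<in> faces G}" using cons[OF e] face[OF e] xy by simp
  qed
  \<comment> \<open>No edge of the level of \<open>d2\<close> lies between \<open>d1\<close> and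
    \<open>d2\<close>, so \<open>d2\<close> is also the next one after \<open>last es\<close>, the
    left edge of \<open>F_f\<close>, as the vertical arrow out of \<open>F_f\<close>
    requires.\<close>
  have "x \<le> last es \<or> d2 \<le> x" if "x \<in> edges G" "lv x = lv d2" for x
    using consecutiveD(5)[OF c, of x] that d2(1) la by auto
  then have n2: "next_edge G (lv d2) (last es) d2"
    unfolding next_edge_def using d2 la by fastforce
  show "vertical f d2 (lv d2)"
    unfolding vertical_def lft_eq[OF lastf]
  proof (intro conjI)
    show "lv d2 = lv f + 1 \<or> lv f = lv d2 + 1" using p f(2) d2(1) by auto
  qed (fact fF d2F d2f n2)+
  have "x \<le> d1 \<or> hd es \<le> x" if "x \<in> edges G" "lv x = p" for x
    using hd_le[of x] hd that by (cases "x < d2"; cases "d1 < x") auto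
  then have n1: "next_edge G p d1 (hd es)"
    unfolding next_edge_def using hd by fastforce
  show "vertical d2 (hd es) p"
    unfolding vertical_def lft_eq[OF c]
  proof (intro conjI)
    show "p = lv d2 + 1 \<or> lv d2 = p + 1" using p d2(1) by auto
    show "hd es < d2" using hd by simp
  qed (fact d2F hf n1)+
qed

lemma row_word_path:
  assumes r: "row_level p (d1, d2, es, f)"
  shows "is_qpath Q (hd es) (row_word (d1, d2, es, f))" "path_source Q (hd es) (row_word (d1, d2, es, f)) = hd es"
proof -
  note F = row_facts[OF r]
  have "set (zip (es @ [f]) (tl (es @ [f]))) \<subseteq> arcs Q" using F(9) by (auto simp: arcs_iff)
  then have "is_qpath Q (last (es @ [f])) (rev (zip (es @ [f]) (tl (es @ [f])))) \<and>
      path_source Q (last (es @ [f])) (rev (zip (es @ [f]) (tl (es @ [f])))) = hd (es @ [f])"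
    using F(1,3) by (intro chain_path[OF Q_quiver Q_simps(2,3)]) (auto simp: Q_simps)
  moreover have "(d2, hd es) \<in> arcs Q" "(f, d2) \<in> arcs Q"
    using F(4,5,10,11) by (auto simp: arcs_iff)
  ultimately show "is_qpath Q (hd es) (row_word (d1, d2, es, f))"
    "path_source Q (hd es) (row_word (d1, d2, es, f)) = hd es"
    unfolding row_word_eq[OF F(1)] using F(1) by (auto simp: Q_simps)
qed

lemma row_word_closed: assumes "row_level p \<rho>" shows "closed_word Q (row_word \<rho>)"
proof -
  obtain d1 d2 es f where \<rho>: "\<rho> = (d1, d2, es, f)" by (metis surj_pair)
  note r = assms[unfolded \<rho>]
  show ?thesis
    unfolding \<rho> by (rule closed_wordI[OF row_word_path(1)[OF r] _ row_word_path(2)[OF r]]) (simp add: row_word_eq[OF row_facts(1)[OF r]])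
qed

lemma row_sum:
  assumes r: "row_level p (d1, d2, es, f)" and g: "\<And>x y. consecutive G x y \<Longrightarrow> x \<in> faces G \<Longrightarrow> g (x, y) = (0 :: int)"
  shows "deg g (row_word (d1, d2, es, f)) = g (d2, hd es) + g (f, d2)"
proof -
  note F = row_facts[OF r]
  have "g q = 0" if "q \<in> set (zip (es @ [f]) (tl (es @ [f])))" for q using F(9) g that by auto
  then have "map g (rev (zip (es @ [f]) (tl (es @ [f])))) = map (\<lambda>_. 0) (rev (zip (es @ [f]) (tl (es @ [f]))))"
    by (intro map_cong refl) simp
  then have "deg g (rev (zip (es @ [f]) (tl (es @ [f])))) = 0"
    by (simp only: sum_list_0)
  then show ?thesis unfolding row_word_eq[OF F(1)] by simp
qed

text \<open>Horizontal arrows count zero, and the two vertical ones join the same two levels in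
  opposite directions, so exactly one of them goes up.\<close>

lemma row_up: assumes "row_level p \<rho>" shows "deg up (row_word \<rho>) = 1"
proof -
  obtain d1 d2 es f where \<rho>: "\<rho> = (d1, d2, es, f)" by (metis surj_pair)
  note r = assms[unfolded \<rho>]
  note F = row_facts[OF r]
  have "deg up (row_word (d1, d2, es, f)) = up (d2, hd es) + up (f, d2)"
    by (rule row_sum[OF r]) (auto simp: up_def dest: consecutiveD(3))
  moreover have "p = lv d2 + 1 \<or> lv d2 = p + 1" using F(11) by (auto simp: vertical_def)
  ultimately show ?thesis unfolding \<rho> using F(6,7) by (auto simp: up_def)
qed

lemma row_monomial_eq: "row_level p \<rho> \<Longrightarrow> row_monomial \<rho> = path_elem (head Q (hd (row_word \<rho>)), row_word \<rho>)"
proof -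
  assume r: "row_level p \<rho>"
  obtain d1 d2 es f where \<rho>: "\<rho> = (d1, d2, es, f)" by (metis surj_pair)
  have ne: "es \<noteq> []" using row_facts(1) r \<rho> by blast
  have "head Q (hd (row_word \<rho>)) = hd (es @ [f, d2])"
    unfolding \<rho> row_word_eq[OF ne] using ne by (simp add: Q_simps)
  then show ?thesis by (simp add: \<rho> row_monomial_def row_word_def Let_def)
qed

end

section \<open>The fence potential as a homogeneous series\<close>

lemma homogeneous_fsum:
  "(\<And>a. a \<in> A \<Longrightarrow> f a \<in> homogeneous V d n) \<Longrightarrow> fsum f A \<in> homogeneous V d n"
  by (induction A rule: infinite_finite_induct) (auto simp: homogeneous_zero homogeneous_add)

lemma csum_fsum: "csum V (fsum f A) w = (\<Sum>a\<in>A. csum V (f a) w)"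
  unfolding csum_def fsum_apply by (rule sum.swap)

lemma csum_path_elem:
  "csum V (path_elem (head V (hd v), v)) w = of_nat (card {k. k < length w \<and> rotate k w = v})"
proof -
  have "csum V (path_elem (head V (hd v), v)) w = (\<Sum>k<length w. if rotate k w = v then 1 else 0)"
    unfolding csum_def by (intro sum.cong refl) (auto simp: path_elem_apply)
  also have "\<dots> = (\<Sum>k\<in>{k. k < length w \<and> rotate k w = v}. 1)"
    by (rule sum.mono_neutral_cong_right) auto
  finally show ?thesis by simp
qed

lemma deg_coboundary:
  "is_qpath V i w \<Longrightarrow> deg (\<lambda>a. h (head V a) - h (tail V a)) w = h i - h (path_source V i w)"
  by (induction w arbitrary: i) auto

context fence
begin

definition wpot :: "(real, real \<times> real) series" where
  "wpot = fsum row_monomial (black_rows G) - fsum row_monomial (white_rows G)"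

lemma fence_potential_eq: "fence_potential G = cyc_class Q wpot"
proof -
  have "(\<lambda>p. (\<Sum>\<rho>\<in>black_rows G. row_monomial \<rho> p) - (\<Sum>\<rho>\<in>white_rows G. row_monomial \<rho> p)) = wpot"
    by (rule ext) (simp only: wpot_def minus_apply fsum_apply)
  then show ?thesis by (simp only: fence_potential_def)
qed

lemma row_monomial_homogeneous: assumes "row_level p \<rho>"
  shows "row_monomial \<rho> \<in> arrow_ideal_pow Q 2" "row_monomial \<rho> \<in> homogeneous Q up 1"
proof -
  obtain d1 d2 es f where \<rho>: "\<rho> = (d1, d2, es, f)" by (metis surj_pair)
  have len: "2 \<le> length (row_word \<rho>)"
    using row_facts(1)[of p d1 d2 es f] assms by (simp add: \<rho> row_word_eq)
  have path: "is_qpath Q (head Q (hd (row_word \<rho>))) (row_word \<rho>)"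
    using row_word_closed[OF assms] by (simp add: closed_word_def)
  show "row_monomial \<rho> \<in> arrow_ideal_pow Q 2" "row_monomial \<rho> \<in> homogeneous Q up 1"
    unfolding row_monomial_eq[OF assms]
    by (rule path_elem_pow[OF path len], rule homogeneous_path_elem[OF path row_up[OF assms]])
qed

lemma wpot_pow: "wpot \<in> arrow_ideal_pow Q 2"
  unfolding wpot_def
  by (intro pow_diff pow_fsum row_monomial_homogeneous(1)) (erule black_row_level, erule white_row_level)

lemma wpot_homogeneous: "wpot \<in> homogeneous Q up 1"
  unfolding wpot_def
  by (intro homogeneous_diff homogeneous_fsum row_monomial_homogeneous(2)) (erule black_row_level, erule white_row_level)

lemma finite_rows: "finite (black_rows G)" "finite (white_rows G)"
proof -
  have *: "finite {\<rho>. is_pente_row G (q (lv (fst \<rho>))) \<rho>}" for q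
  proof (rule finite_subset)
    \<comment> \<open>The inner edges are determined by \<open>d1\<close>, \<open>d2\<close> and the
      level, so three edges determine a row.\<close>
    let ?F = "\<lambda>(d1, d2, f). (d1, d2, sorted_list_of_set {e \<in> edges G. lv e = q (lv d1) \<and> d1 < e \<and> e < d2}, f)"
    show "{\<rho>. is_pente_row G (q (lv (fst \<rho>))) \<rho>} \<subseteq> ?F ` (edges G \<times> edges G \<times> edges G)"
    proof
      fix \<rho> assume "\<rho> \<in> {\<rho>. is_pente_row G (q (lv (fst \<rho>))) \<rho>}"
      moreover obtain d1 d2 es f where \<rho>: "\<rho> = (d1, d2, es, f)" by (metis surj_pair)
      ultimately have c: "consecutive G d1 d2" and es: "es = sorted_list_of_set {e \<in> edges G. lv e = q (lv d1) \<and> d1 < e \<and> e < d2}"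
        and n: "next_edge G (q (lv d1)) (last es) f" by (auto simp: is_pente_row_def)
      have "\<rho> = ?F (d1, d2, f)" using \<rho> es by simp
      moreover have "(d1, d2, f) \<in> edges G \<times> edges G \<times> edges G"
        using consecutiveD(1,2)[OF c] next_edgeD(1)[OF n] by simp
      ultimately show "\<rho> \<in> ?F ` (edges G \<times> edges G \<times> edges G)" by blast
    qed
    show "finite (?F ` (edges G \<times> edges G \<times> edges G))" using finite_edges by blast
  qed
  show "finite (black_rows G)" unfolding black_rows_def by (rule *)
  show "finite (white_rows G)" unfolding white_rows_def by (rule *)
qed

lemma row_word_set:
  assumes r: "row_level p (d1, d2, es, f)" and a: "(x, y) \<in> set (row_word (d1, d2, es, f))" "lv x \<noteq> lv y"
  shows "(x, y) = (d2, hd es) \<or> (x, y) = (f, d2)"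
proof -
  note F = row_facts[OF r]
  have "(x, y) \<notin> set (zip (es @ [f]) (tl (es @ [f])))"
  proof
    assume "(x, y) \<in> set (zip (es @ [f]) (tl (es @ [f])))"
    then have "consecutive G x y" using F(9) by blast
    from consecutiveD(3)[OF this] a(2) show False by simp
  qed
  then show ?thesis using a(1) unfolding row_word_eq[OF F(1)] by auto
qed

text \<open>The vertical arrows of a black row join one lower face to two different upper faces
  \<open>hd es\<close> and \<open>f\<close>; those of a white row share a single upper face. Equal
  arrow sets would make the two upper faces coincide.\<close>

lemma black_white_disjoint:
  assumes "\<rho> \<in> black_rows G" "\<sigma> \<in> white_rows G" shows "set (row_word \<rho>) \<noteq> set (row_word \<sigma>)"
proof
  assume eq: "set (row_word \<rho>) = set (row_word \<sigma>)"
  obtain d1 d2 es f where \<rho>: "\<rho> = (d1, d2, es, f)" by (metis surj_pair)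
  obtain d1' d2' es' f' where \<sigma>: "\<sigma> = (d1', d2', es', f')" by (metis surj_pair)
  have r: "row_level (lv d1 + 1) (d1, d2, es, f)" using black_row_level[OF assms(1)] by (simp add: \<rho>)
  have s: "row_level (lv d1' - 1) (d1', d2', es', f')" using white_row_level[OF assms(2)] by (simp add: \<sigma>)
  note F = row_facts[OF r] and F' = row_facts[OF s]
  have ld: "lv d2 = lv d1" "lv d2' = lv d1'" using consecutiveD(3) F(2) F'(2) by auto
  have pos: "lv d1' \<ge> 1" using level_pos consecutiveD(1)[OF F'(2)] by blast
  have l: "lv (hd es) = lv d2 + 1" "lv f = lv d2 + 1" "lv (hd es') + 1 = lv d2'" "lv f' + 1 = lv d2'"
    using F(6,7) F'(6,7) ld pos by auto
  have m: "(d2, hd es) \<in> set (row_word \<sigma>)" "(f, d2) \<in> set (row_word \<sigma>)"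
    unfolding eq[symmetric] \<rho> row_word_eq[OF F(1)] by auto
  have "(d2, hd es) = (d2', hd es') \<or> (d2, hd es) = (f', d2')"
    using row_word_set[OF s m(1)[unfolded \<sigma>]] l(1) by simp
  then have 1: "hd es = d2'" using l(1,3) by auto
  have "(f, d2) = (d2', hd es') \<or> (f, d2) = (f', d2')"
    using row_word_set[OF s m(2)[unfolded \<sigma>]] l(2) by simp
  then have "f = d2'" using l(2,4) by auto
  then show False using 1 F(8) by simp
qed

text \<open>No cancellation: rows with the same cyclic word as \<open>\<rho>\<close> have its
  colour, by disjointness, so they enter with equal signs and the contribution of
  \<open>\<rho>\<close> survives.\<close>

lemma csum_wpot_row:
  assumes "\<rho> \<in> black_rows G \<union> white_rows G" shows "csum Q wpot (row_word \<rho>) \<noteq> 0"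
proof -
  let ?w = "row_word \<rho>"
  define c where "c = (\<lambda>\<sigma>. card {k. k < length ?w \<and> rotate k ?w = row_word \<sigma>})"
  obtain p where "row_level p \<rho>" using assms black_row_level white_row_level by blast
  then have ne: "?w \<noteq> []" using row_word_closed unfolding closed_word_def by blast
  have fin: "finite {k. k < length ?w \<and> rotate k ?w = row_word \<sigma>}" for \<sigma> by simp
  have pos: "c \<rho> > 0"
  proof -
    have "0 \<in> {k. k < length ?w \<and> rotate k ?w = ?w}" using ne by simp
    then show ?thesis unfolding c_def using fin card_gt_0_iff by blast
  qed
  have zero: "c \<sigma> = 0" if "set ?w \<noteq> set (row_word \<sigma>)" for \<sigma>
  proof -
    have "rotate k ?w \<noteq> row_word \<sigma>" for k using that by (metis set_rotate)
    then show ?thesis by (simp add: c_def)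
  qed
  have cs: "csum Q (row_monomial \<sigma>) ?w = of_nat (c \<sigma>)" if \<sigma>: "\<sigma> \<in> black_rows G \<union> white_rows G" for \<sigma>
  proof -
    obtain p where "row_level p \<sigma>" using \<sigma> black_row_level white_row_level by blast
    then show ?thesis by (simp only: row_monomial_eq csum_path_elem c_def)
  qed
  have "csum Q wpot ?w = of_nat (\<Sum>\<sigma>\<in>black_rows G. c \<sigma>) - of_nat (\<Sum>\<sigma>\<in>white_rows G. c \<sigma>)"
    unfolding wpot_def csum_diff csum_fsum of_nat_sum using cs by (intro arg_cong2[where f = "(-)"] sum.cong) auto
  moreover have "(\<Sum>\<sigma>\<in>black_rows G. c \<sigma>) \<noteq> (\<Sum>\<sigma>\<in>white_rows G. c \<sigma>)"
  proof (cases "\<rho> \<in> black_rows G")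
    case True
    have "(\<Sum>\<sigma>\<in>white_rows G. c \<sigma>) = 0" using zero black_white_disjoint[OF True] by (intro sum.neutral) auto
    moreover have "(\<Sum>\<sigma>\<in>black_rows G. c \<sigma>) > 0" using True pos finite_rows(1) by (metis sum_pos2 zero_le)
    ultimately show ?thesis by simp
  next
    case False
    then have w: "\<rho> \<in> white_rows G" using assms by blast
    have "(\<Sum>\<sigma>\<in>black_rows G. c \<sigma>) = 0" using zero black_white_disjoint[OF _ w] by (intro sum.neutral) metis
    moreover have "(\<Sum>\<sigma>\<in>white_rows G. c \<sigma>) > 0" using w pos finite_rows(2) by (metis sum_pos2 zero_le)
    ultimately show ?thesis by simp
  qed
  ultimately show ?thesis by (simp del: of_nat_sum)
qed

text \<open>Hence a cocycle which sums to zero on all rows and vanishes on horizontal arrows has, up to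
  sign, a single value on the vertical arrows between two given levels.\<close>

lemma row_exists:
  assumes v: "vertical e f k" and v': "vertical f f' (lv e)"
  obtains \<rho> p es where "\<rho> \<in> black_rows G \<union> white_rows G" "\<rho> = (lft f, f, es, e)" "row_level p \<rho>" "hd es = f'"
proof -
  have e: "e \<in> faces G" and f: "f \<in> faces G" and fe: "f < e" and k: "k = lv e + 1 \<or> lv e = k + 1"
    using v unfolding vertical_def by blast+
  have nf: "next_edge G k (lft e) f" using v unfolding vertical_def by blast
  have f': "f' \<in> faces G" "f' < f" and nf': "next_edge G (lv e) (lft f) f'" using v' unfolding vertical_def by blast+
  let ?S = "{x \<in> edges G. lv x = lv e \<and> lft f < x \<and> x < f}"
  define es where "es = sorted_list_of_set ?S"
  have fin: "finite ?S" using finite_edges by simp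
  have set: "set es = ?S" unfolding es_def by (rule set_sorted_list_of_set[OF fin])
  have sorted: "sorted_wrt (<) es" unfolding es_def by (rule strict_sorted_list_of_set)
  have f'S: "f' \<in> ?S" using next_edgeD(1-3)[OF nf'] f'(2) by simp
  then have ne: "es \<noteq> []" using set by force
  have ce: "consecutive G (lft e) e" by (rule lft[OF e])
  have cf: "consecutive G (lft f) f" by (rule lft[OF f])
  have "f' \<le> lft e" using consecutiveD(5)[OF ce, of f'] consecutiveD(3)[OF ce] f'S fe by auto
  then have laS: "lft e \<in> ?S"
    using consecutiveD(1,3)[OF ce] next_edgeD(3)[OF nf] f'S by auto
  have hd: "hd es = f'"
  proof (rule antisym)
    obtain v us where "es = v # us" using ne by (cases es) auto
    then show "hd es \<le> f'" using sorted f'S set[symmetric] by auto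
    have "hd es \<in> ?S" using ne set hd_in_set by blast
    then show "f' \<le> hd es" using next_edgeD(4)[OF nf', of "hd es"] by auto
  qed
  \<comment> \<open>As \<open>lft e\<close> is the last inner edge, \<open>e\<close>, the next edge
    of its level, is the closing edge of the row.\<close>
  have la: "last es = lft e"
  proof (rule antisym)
    obtain us v where "es = us @ [v]" using ne by (cases es rule: rev_cases) auto
    then show "lft e \<le> last es" using sorted laS set[symmetric] by (auto simp: sorted_wrt_append)
    have "last es \<in> ?S" using ne set last_in_set by blast
    then show "last es \<le> lft e" using consecutiveD(5)[OF ce, of "last es"] consecutiveD(3)[OF ce] fe by auto
  qed
  have "next_edge G (lv e) (lft e) e" using ce consecutiveD(3)[OF ce] by (simp add: consecutive_def)
  then have row: "is_pente_row G (lv e) (lft f, f, es, e)"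
    using cf ne f'(1) by (simp add: is_pente_row_def es_def[symmetric] hd la)
  have lvl: "lv (lft f) = k" using consecutiveD(3)[OF cf] vertical_level[OF v] by simp
  have "(lft f, f, es, e) \<in> black_rows G \<union> white_rows G"
    using k row lvl by (auto simp: black_rows_def white_rows_def)
  moreover have "row_level (lv e) (lft f, f, es, e)" using row k lvl by (auto simp: row_level_def)
  ultimately show thesis using that hd by blast
qed

text \<open>Two integrations. \<open>h1\<close> sums \<open>g\<close> along each level and removes
  the horizontal values; what is left is constant between adjacent levels, up to orientation, and is
  integrated by \<open>h2\<close> over the level number.\<close>

lemma coboundary:
  assumes g: "\<And>\<rho>. \<rho> \<in> black_rows G \<union> white_rows G \<Longrightarrow> deg g (row_word \<rho>) = 0"
  obtains h :: "real \<Rightarrow> int" where "\<And>x y. (x, y) \<in> arcs Q \<Longrightarrow> g (x, y) = h y - h x"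
proof -
  \<comment> \<open>The faces up to \<open>x\<close> on its level that have a left neighbour, i.e.
    the targets of the horizontal arrows leading to \<open>x\<close>.\<close>
  define L where "L = (\<lambda>x. {z \<in> faces G. lv z = lv x \<and> z \<le> x \<and> lft z \<in> faces G})"
  define h1 where "h1 = (\<lambda>x. \<Sum>z\<in>L x. g (lft z, z))"
  have "finite (faces G)" by (rule finite_subset[OF _ finite_edges]) (auto dest: faces_edges)
  then have finL: "finite (L x)" for x by (simp add: L_def)
  have h1: "h1 y = h1 x + g (x, y)" if c: "consecutive G x y" and x: "x \<in> faces G" for x y
  proof -
    have "z \<le> x" if "z \<in> faces G" "lv z = lv y" "z \<le> y" "z \<noteq> y" for z
      using consecutiveD(5)[OF c faces_edges[OF that(1)]] consecutiveD(3)[OF c] that by auto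
    moreover have "x < y" "lv y = lv x" using consecutiveD(3,4)[OF c] by simp_all
    ultimately have "z \<in> L y \<longleftrightarrow> z \<in> insert y (L x)" for z
      using lft_eq[OF c] x consecutive_faces[OF c] unfolding L_def mem_Collect_eq insert_iff by (cases "z = y") fastforce+
    then have "L y = insert y (L x)" by blast
    moreover have "y \<notin> L x" using consecutiveD(4)[OF c] by (simp add: L_def)
    ultimately show ?thesis using finL lft_eq[OF c] by (simp add: h1_def)
  qed
  define g' where "g' = (\<lambda>(x, y). g (x, y) - (h1 y - h1 x))"
  have g'_split: "deg g' w = deg g w - deg (\<lambda>a. h1 (head Q a) - h1 (tail Q a)) w" for w
    by (induction w) (auto simp: g'_def Q_simps)
  have row: "g' (d2, hd es) + g' (f, d2) = 0"
    if r: "row_level p (d1, d2, es, f)" and bw: "(d1, d2, es, f) \<in> black_rows G \<union> white_rows G" for p d1 d2 es f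
  proof -
    have "deg g' (row_word (d1, d2, es, f)) = g' (d2, hd es) + g' (f, d2)"
    proof (rule row_sum[OF r])
      fix x y assume "consecutive G x y" "x \<in> faces G"
      from h1[OF this] show "g' (x, y) = 0" by (simp add: g'_def)
    qed
    moreover have "deg g' (row_word (d1, d2, es, f)) = 0"
      unfolding g'_split deg_coboundary[OF row_word_path(1)[OF r]] row_word_path(2)[OF r] using g[OF bw] by simp
    ultimately show ?thesis by simp
  qed
  \<comment> \<open>The value in upward orientation: the two vertical arrows of a row have opposite
    \<open>g'\<close> and therefore equal \<open>sg\<close>.\<close>
  define sg where "sg = (\<lambda>e f. if lv f = lv e + 1 then g' (e, f) else - g' (e, f))"
  have sg_pred: "sg e f = sg f f'" if v: "vertical e f k" "vertical f f' (lv e)" for e f f' k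
  proof -
    obtain \<rho> p es where \<rho>: "\<rho> \<in> black_rows G \<union> white_rows G" "\<rho> = (lft f, f, es, e)" "row_level p \<rho>" "hd es = f'"
      by (rule row_exists[OF v])
    have "g' (f, f') + g' (e, f) = 0" using row[of p "lft f" f es e] \<rho> by simp
    moreover have "lv f' = lv e" by (rule vertical_level[OF v(2)])
    moreover have "lv f = lv e + 1 \<or> lv e = lv f + 1" using vertical_levels(2)[OF v(1)] .
    ultimately show ?thesis unfolding sg_def by auto
  qed
  \<comment> \<open>The vertical arrows between two adjacent levels form a zigzag running to the
    left, from \<open>e\<close> to \<open>f\<close> to \<open>f''\<close> and so on. The induction
    follows it from \<open>e\<close> until it meets \<open>e'\<close>, using \<open>sg_pred\<close>
    at each turn.\<close>
  have sg_eq: "sg e f = sg e' f'"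
    if "vertical e f k" "vertical e' f' k'" "e' \<le> e" "min (lv e) k = min (lv e') k'" for e f k e' f' k'
    using that
  proof (induction "card {x \<in> edges G. x < e}" arbitrary: e f k rule: less_induct)
    case less
    note v = less.prems(1) and v' = less.prems(2)
    have e: "e \<in> faces G" and f: "f \<in> faces G" and fe: "f < e" and nf: "next_edge G k (lft e) f"
      and k: "k = lv e + 1 \<or> lv e = k + 1" using v unfolding vertical_def by blast+
    have e': "e' \<in> faces G" and f': "f' \<in> faces G" and fe': "f' < e'" and nf': "next_edge G k' (lft e') f'"
      and k': "k' = lv e' + 1 \<or> lv e' = k' + 1" using v' unfolding vertical_def by blast+
    have lvls: "lv e' = lv e \<and> k' = k \<or> lv e' = k \<and> k' = lv e" using k k' less.prems(4) by auto
    note ce = lft[OF e] and ce' = lft[OF e'] and cf = lft[OF f]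
    have lf: "lv f = k" "lv f' = k'" using vertical_level v v' by blast+
    show ?case
    proof (cases "e' = e")
      case True
      then have "k' = k" using lvls by auto
      then have "f' = f" using next_edge_unique[OF nf'] nf True by simp
      then show ?thesis using True by simp
    next
      case False
      then have ee: "e' < e" using less.prems(3) by simp
      have df: "lft e < f" by (rule next_edgeD(3)[OF nf])
      have lde: "lv (lft e) = lv e" "lv (lft e') = lv e'" "lv (lft f) = k"
        using consecutiveD(3)[OF ce] consecutiveD(3)[OF ce'] consecutiveD(3)[OF cf] lf by auto
      \<comment> \<open>The zigzag cannot jump over \<open>e'\<close>: an arrow between these levels
        that starts left of \<open>e\<close> starts at \<open>f\<close> or further left.\<close>
      have lef: "e' \<le> f"
      proof (cases "lv e' = lv e")
        case True
        then show ?thesis using consecutiveD(5)[OF ce faces_edges[OF e']] lde ee df by auto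
      next
        case False
        then have l: "lv e' = k" "k' = lv e" using lvls by auto
        show ?thesis
        proof (rule ccontr)
          assume "\<not> e' \<le> f"
          then have "f \<le> lft e'" using consecutiveD(5)[OF ce' faces_edges[OF f]] lf l lde by auto
          then have "lft e < f'" using df next_edgeD(3)[OF nf'] by simp
          then show False using consecutiveD(5)[OF ce faces_edges[OF f']] lf l lde fe' ee by auto
        qed
      qed
      \<comment> \<open>The zigzag continues beyond \<open>f\<close>. If \<open>e' = f\<close> the
        given arrow does it; otherwise the next edge after \<open>lft f\<close> bounds a face on its
        left because the arrow at \<open>e'\<close> provides an earlier edge of its level.\<close>
      have "\<exists>f''. vertical f f'' (lv e)"
      proof (cases "e' = f")
        case True
        then have "k' = lv e" using lvls lf(1) k by (elim disjE conjE) simp_all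
        then have "vertical f f' (lv e)" using v' True by simp
        then show ?thesis by (rule exI)
      next
        case False
        then have e'f: "e' < f" using lef by simp
        have "lft f \<le> lft e"
          using next_edgeD(4)[OF nf consecutiveD(1)[OF cf]] lde consecutiveD(4)[OF cf] by auto
        moreover have "lft f \<noteq> lft e"
        proof
          assume "lft f = lft e"
          then have "k = lv e" using lde(1,3) by simp
          then show False using k by simp
        qed
        ultimately have "lft f < lft e" by simp
        then obtain f'' where n: "next_edge G (lv e) (lft f) f''" and f'': "f'' \<le> lft e"
          using next_edge_exists[OF consecutiveD(1)[OF ce] lde(1)] by blast
        have "\<exists>x\<in>edges G. lv x = lv e \<and> x \<le> lft f"
        proof (cases "lv e' = lv e")
          case True
          then have "k' = k" using lvls by auto
          then have "f' \<le> lft f"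
            using consecutiveD(5)[OF cf faces_edges[OF f']] lf lde fe' e'f by auto
          then have "lft e' \<le> lft f" using next_edgeD(3)[OF nf'] by simp
          then show ?thesis using consecutiveD(1)[OF ce'] lde(2) True by (intro bexI[of _ "lft e'"]) simp_all
        next
          case False
          then have l: "lv e' = k" "k' = lv e" using lvls by auto
          then have "e' \<le> lft f" using consecutiveD(5)[OF cf faces_edges[OF e']] lf lde e'f by auto
          then have "f' \<le> lft f" using fe' by simp
          then show ?thesis using faces_edges[OF f'] lf(2) l(2) by (intro bexI[of _ f']) simp_all
        qed
        then obtain x where x: "x \<in> edges G" "lv x = lv e" "x \<le> lft f" by blast
        have "f'' \<in> faces G"
          by (rule face_if_preceded[OF next_edgeD(1)[OF n] x(1)])
             (use x next_edgeD(2,3)[OF n] in auto)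
        moreover have "lv e = lv f + 1 \<or> lv f = lv e + 1" using k lf(1) by presburger
        moreover have "f'' < f" using f'' df by simp
        ultimately have "vertical f f'' (lv e)" unfolding vertical_def using f n by blast
        then show ?thesis by blast
      qed
      then obtain f'' where v'': "vertical f f'' (lv e)" by blast
      have "sg f f'' = sg e' f'"
      proof (rule less.hyps[OF _ v'' v' lef])
        have "{x \<in> edges G. x < f} \<subset> {x \<in> edges G. x < e}" using fe faces_edges[OF f] by auto
        then show "card {x \<in> edges G. x < f} < card {x \<in> edges G. x < e}"
          using finite_edges by (intro psubset_card_mono) auto
        show "min (lv f) (lv e) = min (lv e') k'" using less.prems(4) lf by (simp add: min.commute)
      qed
      then show ?thesis using sg_pred[OF v v''] by simp
    qed
  qed
  \<comment> \<open>The common value for the gap between levels \<open>j\<close> and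
    \<open>j + 1\<close>; the choice is arbitrary where no vertical arrow crosses that gap.\<close>
  define v where "v = (\<lambda>j. SOME s. \<exists>e f k. vertical e f k \<and> min (lv e) k = j \<and> s = sg e f)"
  have sg_v: "sg e f = v (min (lv e) k)" if vert: "vertical e f k" for e f k
  proof -
    have "\<exists>e' f' k'. vertical e' f' k' \<and> min (lv e') k' = min (lv e) k \<and> v (min (lv e) k) = sg e' f'"
      unfolding v_def by (rule someI_ex) (use vert in blast)
    then obtain e' f' k' where o: "vertical e' f' k'" "min (lv e') k' = min (lv e) k" "v (min (lv e) k) = sg e' f'" by blast
    show ?thesis
    proof (cases "e' \<le> e")
      case True
      then show ?thesis using sg_eq[OF vert o(1) True] o by simp
    next
      case False
      then show ?thesis using sg_eq[OF o(1) vert] o by simp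
    qed
  qed
  define h2 where "h2 = (\<lambda>x. \<Sum>j<lv x. v j)"
  have "g (x, y) = (h1 y + h2 y) - (h1 x + h2 x)" if xy: "(x, y) \<in> arcs Q" for x y
  proof (cases "lv x = lv y")
    case True
    then have "h2 x = h2 y" by (simp add: h2_def)
    then show ?thesis using h1[OF horizontal_arc[OF xy True] arcs_faces(1)[OF xy]] by simp
  next
    case False
    have vert: "vertical x y (lv y)" by (rule vertical_arc[OF xy False])
    have s: "sg x y = v (min (lv x) (lv y))" by (rule sg_v[OF vert])
    have "g' (x, y) = h2 y - h2 x"
    proof (cases "lv y = lv x + 1")
      case True
      then show ?thesis using s by (simp add: sg_def h2_def)
    next
      case f: False
      then have "lv x = lv y + 1" using vertical_levels(2)[OF vert] by blast
      then show ?thesis using s f by (simp add: sg_def h2_def)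
    qed
    then show ?thesis by (simp add: g'_def)
  qed
  then show thesis by (rule that)
qed

end

subsection \<open>Leading terms\<close>

text \<open>Equality of all terms of degree at most \<open>n\<close>. In use one side is homogeneous
  of degree \<open>n\<close>, so the other has nothing below \<open>n\<close> and the same leading
  part.\<close>

definition agrees :: "('a \<Rightarrow> int) \<Rightarrow> int \<Rightarrow> ('v, 'a) series \<Rightarrow> ('v, 'a) series \<Rightarrow> bool" where
  "agrees d n x y \<longleftrightarrow> (\<forall>i w. deg d w \<le> n \<longrightarrow> x (i, w) = y (i, w))"

lemma agreesD: "agrees d n x y \<Longrightarrow> deg d w \<le> n \<Longrightarrow> x (i, w) = y (i, w)"
  by (simp add: agrees_def)

lemma agrees_refl: "agrees d n x x"
  by (simp add: agrees_def)

lemma agrees_add: "agrees d n x x' \<Longrightarrow> agrees d n y y' \<Longrightarrow> agrees d n (x + y) (x' + y')"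
  by (simp add: agrees_def pointwise)

lemma agrees_csum: "agrees d n x y \<Longrightarrow> deg d w \<le> n \<Longrightarrow> csum V x w = csum V y w"
  unfolding csum_def by (intro sum.cong refl agreesD) (auto simp: deg_rotate)

text \<open>Homogeneity of \<open>x'\<close> and \<open>y'\<close> shows that \<open>x\<close> and
  \<open>y\<close> have no terms below \<open>m\<close> and \<open>n\<close>; a product term of
  degree at most \<open>m + n\<close> therefore comes from the two leading parts.\<close>

lemma agrees_conv:
  assumes x: "agrees d m x x'" "x' \<in> homogeneous V d m" and y: "agrees d n y y'" "y' \<in> homogeneous V d n"
  shows "agrees d (m + n) (conv V x y) (conv V x' y')"
  unfolding agrees_def
proof (intro allI impI)
  fix i w assume w: "deg d w \<le> m + n"
  have "x (i, take k w) * y (path_source V i (take k w), drop k w) =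
      x' (i, take k w) * y' (path_source V i (take k w), drop k w)" for k
  proof -
    have s: "deg d (take k w) + deg d (drop k w) = deg d w"
      using map_append[of d "take k w" "drop k w"] by (metis append_take_drop_id sum_list_append)
    consider "deg d (take k w) < m" | "deg d (drop k w) < n" | "deg d (take k w) = m" "deg d (drop k w) = n"
      using s w by linarith
    then show ?thesis
    proof cases
      case 1
      then have "x' (i, take k w) = 0" using x(2) by (force simp: homogeneous_iff)
      then show ?thesis using agreesD[OF x(1), of "take k w" i] 1 by simp
    next
      case 2
      then have "y' (j, drop k w) = 0" for j using y(2) by (force simp: homogeneous_iff)
      then show ?thesis using agreesD[OF y(1), of "drop k w"] 2 by simp
    next
      case 3
      then show ?thesis using agreesD[OF x(1), of "take k w" i] agreesD[OF y(1), of "drop k w"] by simp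
    qed
  qed
  then show "conv V x y (i, w) = conv V x' y' (i, w)" unfolding conv_apply by simp
qed

lemma clin_agrees:
  assumes V: "is_quiver V" and T: "clin V V' T" "clin V V' T'" and x: "x \<in> homogeneous V D n"
    and paths: "\<And>i w. is_qpath V i w \<Longrightarrow> agrees d (deg D w) (T (path_elem (i, w))) (T' (path_elem (i, w)))"
  shows "agrees d n (T x) (T' x)"
  unfolding agrees_def
proof (intro allI impI)
  fix i w assume w: "deg d w \<le> n"
  note xc = homogeneous_car[OF x]
  have "x p * T (path_elem p) (i, w) = x p * T' (path_elem p) (i, w)" for p
  proof (cases "x p = 0")
    case False
    obtain j u where p: "p = (j, u)" by (cases p)
    have "is_qpath V j u" "deg D u = n" using False x p by (auto simp: homogeneous_iff car_iff)
    then show ?thesis using agreesD[OF paths[of j u], of w i] w p by simp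
  qed simp
  then show "T x (i, w) = T' x (i, w)"
    unfolding clin_expand[OF V T(1) xc order_refl] clin_expand[OF V T(2) xc order_refl] by (simp only:)
qed

lemma chom_agrees:
  assumes V: "is_quiver V" "is_quiver V'" and h: "chom V V' h" "chom V V' h'"
    and a: "\<And>a. a \<in> arcs V \<Longrightarrow> agrees d (D a) (h (arr V a)) (h' (arr V a))"
    and hom: "\<And>a. a \<in> arcs V \<Longrightarrow> h' (arr V a) \<in> homogeneous V' d (D a)" and x: "x \<in> homogeneous V D n"
  shows "agrees d n (h x) (h' x)"
proof (rule clin_agrees[OF V(1) chom_clin[OF h(1)] chom_clin[OF h(2)] x])
  fix i w assume "is_qpath V i w"
  then show "agrees d (deg D w) (h (path_elem (i, w))) (h' (path_elem (i, w)))"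
  proof (induction w arbitrary: i)
    case Nil
    then show ?case by (simp add: chom_idem[OF h(1)] chom_idem[OF h(2)] agrees_refl)
  next
    case (Cons a w)
    then have aV: "a \<in> arcs V" and w: "is_qpath V (tail V a) w" by auto
    have c: "arr V a \<in> car V" "path_elem (tail V a, w) \<in> car V" using arr_car[OF V(1) aV] w by auto
    have "agrees d (D a + deg D w) (conv V' (h (arr V a)) (h (path_elem (tail V a, w))))
        (conv V' (h' (arr V a)) (h' (path_elem (tail V a, w))))"
      by (rule agrees_conv[OF a[OF aV] hom[OF aV] Cons.IH[OF w] chom_graded_path[OF V h(2) hom w]])
    then show ?case unfolding path_elem_Cons[OF Cons.prems] chom_conv[OF h(1) c] chom_conv[OF h(2) c] by simp
  qed
qed

lemma cder_agrees:
  assumes V: "is_quiver V" and E: "cder V E" "cder V E'"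
    and a: "\<And>a. a \<in> arcs V \<Longrightarrow> agrees d (d a) (E (arr V a)) (E' (arr V a))"
    and hom: "\<And>i w. is_qpath V i w \<Longrightarrow> E' (path_elem (i, w)) \<in> homogeneous V d (deg d w)" and x: "x \<in> homogeneous V d n"
  shows "agrees d n (E x) (E' x)"
proof (rule clin_agrees[OF V cder_clin[OF E(1)] cder_clin[OF E(2)] x])
  fix i w assume "is_qpath V i w"
  then show "agrees d (deg d w) (E (path_elem (i, w))) (E' (path_elem (i, w)))"
  proof (induction w arbitrary: i)
    case Nil
    then show ?case by (simp add: cder_idem[OF E(1)] cder_idem[OF E(2)] agrees_refl)
  next
    case (Cons a w)
    then have aV: "a \<in> arcs V" and w: "is_qpath V (tail V a) w" by auto
    have c: "arr V a \<in> car V" "path_elem (tail V a, w) \<in> car V" using arr_car[OF V aV] w by auto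
    have hp: "arr V a \<in> homogeneous V d (d a)" "path_elem (tail V a, w) \<in> homogeneous V d (deg d w)"
      by (rule homogeneous_path_elem[OF arr_path[OF V aV]], simp) (rule homogeneous_path_elem[OF w], simp)
    have ha: "E' (arr V a) \<in> homogeneous V d (d a)" using hom[OF arr_path[OF V aV]] by simp
    have "agrees d (d a + deg d w) (conv V (E (arr V a)) (path_elem (tail V a, w)) + conv V (arr V a) (E (path_elem (tail V a, w))))
        (conv V (E' (arr V a)) (path_elem (tail V a, w)) + conv V (arr V a) (E' (path_elem (tail V a, w))))"
      by (intro agrees_add agrees_conv[OF a[OF aV] ha agrees_refl hp(2)]
          agrees_conv[OF agrees_refl hp(1) Cons.IH[OF w] hom[OF w]])
    then show ?case unfolding path_elem_Cons[OF Cons.prems] cder_conv[OF E(1) c] cder_conv[OF E(2) c] by simp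
  qed
qed

section \<open>Euler derivations, diagonal on paths\<close>

definition euler :: "('a \<Rightarrow> complex) \<Rightarrow> ('v, 'a) series \<Rightarrow> ('v, 'a) series" where
  "euler \<omega> x = (\<lambda>(i, w). sum_list (map \<omega> w) * x (i, w))"

lemma euler_apply: "euler \<omega> x (i, w) = sum_list (map \<omega> w) * x (i, w)"
  by (simp add: euler_def)

lemma cder_euler: "cder V (euler \<omega>)"
  unfolding cder_def clin_def
proof (intro conjI ballI allI)
  show "euler \<omega> (x + y) = euler \<omega> x + euler \<omega> y" for x y
    by (rule ext, clarify) (simp add: euler_apply pointwise distrib_left)
  show "euler \<omega> (scl c x) = scl c (euler \<omega> x)" for c x
    by (rule ext, clarify) (simp add: euler_apply pointwise)
  show "euler \<omega> x \<in> arrow_ideal_pow V n" if "x \<in> arrow_ideal_pow V n" for n x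
    using that by (auto simp: pow_iff car_iff euler_apply)
  show "euler \<omega> (conv V x y) = conv V (euler \<omega> x) y + conv V x (euler \<omega> y)" for x y
  proof (rule ext, clarify)
    fix i w
    have s: "sum_list (map \<omega> w) = sum_list (map \<omega> (take k w)) + sum_list (map \<omega> (drop k w))" for k
      by (metis append_take_drop_id map_append sum_list_append)
    show "euler \<omega> (conv V x y) (i, w) = (conv V (euler \<omega> x) y + conv V x (euler \<omega> y)) (i, w)"
      unfolding plus_fun_apply conv_apply euler_apply sum_distrib_left sum.distrib[symmetric]
    proof (intro sum.cong refl)
      fix k
      show "sum_list (map \<omega> w) * (x (i, take k w) * y (path_source V i (take k w), drop k w)) =
          sum_list (map \<omega> (take k w)) * x (i, take k w) * y (path_source V i (take k w), drop k w) +
          x (i, take k w) * (sum_list (map \<omega> (drop k w)) * y (path_source V i (take k w), drop k w))"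
        unfolding s[of k] by (simp only: algebra_simps)
    qed
  qed
  show "euler \<omega> (idem i) = 0" for i
    by (rule ext, clarify) (simp add: euler_apply path_elem_apply pointwise)
qed

lemma euler_path_elem: "euler \<omega> (path_elem (i, w)) = scl (sum_list (map \<omega> w)) (path_elem (i, w))"
  by (rule ext, clarify) (auto simp: euler_apply path_elem_apply pointwise)

lemma csum_euler: "csum V (euler \<omega> x) w = sum_list (map \<omega> w) * csum V x w"
proof -
  have "sum_list (map \<omega> (rotate1 v)) = sum_list (map \<omega> v)" for v by (cases v) auto
  then have "sum_list (map \<omega> (rotate k w)) = sum_list (map \<omega> w)" for k by (induction k) auto
  then show ?thesis unfolding csum_def euler_apply by (simp add: sum_distrib_left)
qed

text \<open>The Leibniz rule persists because the undifferentiated factor passes through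
  \<open>s\<close> and \<open>p\<close> and returns to itself.\<close>

lemma cder_retract:
  assumes p: "chom V Q p" and s: "chom Q V s" and ps: "\<And>u. u \<in> car Q \<Longrightarrow> p (s u) = u"
    and V: "is_quiver V" and E: "cder V E"
  shows "cder Q (\<lambda>u. p (E (s u)))"
  unfolding cder_def
proof (intro conjI ballI)
  show "clin Q Q (\<lambda>u. p (E (s u)))"
    by (rule clin_comp[OF chom_clin[OF s] clin_comp[OF cder_clin[OF E] chom_clin[OF p]]])
  show "p (E (s (idem i))) = 0" if "i \<in> verts Q" for i
    using that chom_verts[OF s] by (simp add: chom_idem[OF s] cder_idem[OF E] clin_zero[OF chom_clin[OF p]])
  fix x y assume xy: "x \<in> car Q" "y \<in> car Q"
  note c = chom_car[OF s xy(1)] chom_car[OF s xy(2)]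
  note e = cder_car[OF E c(1)] cder_car[OF E c(2)]
  show "p (E (s (conv Q x y))) = conv Q (p (E (s x))) y + conv Q x (p (E (s y)))"
    unfolding chom_conv[OF s xy] cder_conv[OF E c]
    by (subst clin_add[OF chom_clin[OF p]])
       (simp_all add: conv_car[OF V] c e chom_conv[OF p] ps xy)
qed

context fence
begin

text \<open>By \<open>parallel_path\<close>, the arrow \<open>a\<close> is the only path parallel to
  it of degree at most \<open>up a\<close>.\<close>

lemma leading_term:
  assumes a: "a \<in> arcs Q" and f: "f \<in> between Q (head Q a) (tail Q a)"
  shows "agrees up (up a) f (scl (f (head Q a, [a])) (arr Q a))"
  unfolding agrees_def
proof (intro allI impI)
  fix i w assume w: "deg up w \<le> up a"
  show "f (i, w) = scl (f (head Q a, [a])) (arr Q a) (i, w)"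
  proof (cases "(i, w) = (head Q a, [a])")
    case False
    have "f (i, w) = 0"
    proof (rule ccontr)
      assume "f (i, w) \<noteq> 0"
      from between_D[OF f this] have i: "i = head Q a" and q: "is_qpath Q (head Q a) w" "path_source Q (head Q a) w = tail Q a"
        by auto
      have "w = [a]" using parallel_path[OF a q] w by (meson order_antisym)
      then show False using False i by simp
    qed
    then show ?thesis using False by (auto simp: pointwise path_elem_apply)
  qed (simp add: pointwise path_elem_apply)
qed

end

section \<open>From a reduced retract to a graded right-equivalence\<close>

lemma relab_quad_zero:
  assumes rel: "relabelling V V' g" and x: "x \<in> car V" "\<And>a b. quad V x a b = 0"
  shows "quad V' (relab V V' g x) y y' = 0"
proof (rule ccontr)
  assume nz: "quad V' (relab V V' g x) y y' \<noteq> 0"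
  have "\<exists>i w. relab V V' g x (i, w) \<noteq> 0 \<and> set w = {y, y'}"
  proof (rule ccontr)
    assume none: "\<nexists>i w. relab V V' g x (i, w) \<noteq> 0 \<and> set w = {y, y'}"
    have zero: "relab V V' g x (i, w) = 0" if "set w = {y, y'}" for i w using none that by blast
    have "relab V V' g x (i, [y, y']) = 0" for i by (rule zero) simp
    moreover have "relab V V' g x (i, [y', y]) = 0" for i by (rule zero) (simp add: insert_commute)
    ultimately show False using nz by (simp add: quad_def csum_2 split: if_splits)
  qed
  then obtain i w' where w': "relab V V' g x (i, w') \<noteq> 0" "set w' = {y, y'}" by blast
  obtain w where w: "w' = map g w" "x (i, w) \<noteq> 0" by (rule relab_support[OF rel x(1) w'(1)])
  have "is_qpath V i w" using w(2) x(1) unfolding car_iff by blast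
  from is_qpath_arcs[OF this] have sub: "set w \<subseteq> arcs V" .
  have im: "g ` set w = {y, y'}" using w'(2) unfolding w(1) by simp
  have "y \<in> g ` set w" "y' \<in> g ` set w" unfolding im by simp_all
  then obtain b b' where "b \<in> arcs V" "b' \<in> arcs V" "y = g b" "y' = g b'" using sub by blast
  then show False using nz relab_quad[OF rel x(1)] x(2) by simp
qed

text \<open>The whole quadratic part sits on the auxiliary arrows, where it is nondegenerate, so the
  radical is spanned by the arrows of \<open>A\<close>.\<close>

lemma null_reduced:
  assumes V: "is_quiver V'" and arcs: "arcs V' = Inl ` A \<union> Inr ` N" and z: "qpart V' (Inr ` N) z"
    and X: "\<And>a b. quad V' X a b = quad V' z a b"
  shows "null V' X \<xi> \<longleftrightarrow> (\<forall>k\<in>N. \<xi> (Inr k) = 0)"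
proof -
  have fin: "finite (arcs V')" by (rule quiver_finite_arcs[OF V])
  have sum: "(\<Sum>a\<in>arcs V'. \<xi> a * quad V' X a b) = (\<Sum>a\<in>Inr ` N. \<xi> a * quad V' z a b)" for b
    unfolding X
  proof (rule sum.mono_neutral_right[OF fin])
    show "Inr ` N \<subseteq> arcs V'" using arcs by blast
    show "\<forall>a\<in>arcs V' - Inr ` N. \<xi> a * quad V' z a b = 0" using qpart_quad[OF z] by simp
  qed
  show ?thesis
  proof
    assume n: "null V' X \<xi>"
    show "\<forall>k\<in>N. \<xi> (Inr k) = 0"
    proof
      fix k assume k: "k \<in> N"
      show "\<xi> (Inr k) = 0"
      proof (rule qpartD(5)[OF z])
        show "(\<Sum>a\<in>Inr ` N. \<xi> a * quad V' z a b) = 0" if "b \<in> Inr ` N" for b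
          using n that arcs unfolding null_def sum by blast
        show "Inr k \<in> Inr ` N" using k by blast
      qed
    qed
  next
    assume "\<forall>k\<in>N. \<xi> (Inr k) = 0"
    then have "(\<Sum>a\<in>Inr ` N. \<xi> a * quad V' z a b) = 0" for b by (intro sum.neutral) auto
    then show "null V' X \<xi>" unfolding null_def sum by simp
  qed
qed

lemma sum_list_of_int: "sum_list (map (\<lambda>a. of_int (d a)) w) = (of_int (deg d w) :: complex)"
  by (induction w) auto

context fence
begin

lemma parallel_arc: "a \<in> arcs Q \<Longrightarrow> head Q a = i \<Longrightarrow> tail Q a = j \<Longrightarrow> a = (j, i)"
  by (cases a) (simp add: Q_simps)

text \<open>The column space of the linear part \<open>P\<close> of \<open>p\<close> is the radical.
  Hence \<open>P\<close> vanishes on auxiliary arrows and has independent rows on the arrows of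
  \<open>V\<close>, while \<open>p (s u) = u\<close> makes every arrow of \<open>Q\<close> occur; as
  \<open>Q\<close> has no parallel arrows, \<open>P\<close> matches arrows one to one up to scalars.
  Degrees and potentials are then compared through leading terms.\<close>

lemma stably_retracts_dilation:
  fixes V :: "(real, real \<times> real) quiver"
  assumes V: "is_quiver V" and x2: "x \<in> arrow_ideal_pow V 2" and xh: "x \<in> homogeneous V d 1"
    and x0: "\<And>a b. quad V x a b = 0" and xc: "\<And>i w. x (i, w) \<noteq> 0 \<Longrightarrow> is_qpath V i w \<and> path_source V i w = i"
    and st: "stably_retracts Q wpot V x"
  shows "equivclp dilation_step ((V, cyc_class V x), d) ((Q, cyc_class Q wpot), up)"
proof -
  obtain V2 :: "(real, real \<times> real + nat) quiver" and N z p s where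
    rel: "relabelling V V2 Inl" and arcs2: "arcs V2 = Inl ` arcs V \<union> Inr ` N"
    and zq: "qpart V2 (Inr ` N) z" and r: "retract Q wpot V2 (relab V V2 Inl x + z) p s"
    by (rule stably_retractsE[OF st])
  define X where "X = relab V V2 Inl x + z"
  have V2: "is_quiver V2" and p: "chom V2 Q p" and s: "chom Q V2 s" and ps: "\<And>u. u \<in> car Q \<Longrightarrow> p (s u) = u"
    and pX: "cyceq Q (p X) wpot" and der: "\<And>E. cder V2 E \<Longrightarrow> cyceq Q (p (E X)) (p (E (s wpot)))"
    and null: "\<And>\<xi>. null V2 X \<xi> \<longleftrightarrow> (\<exists>\<eta>. \<forall>y\<in>arcs V2. \<xi> y = (\<Sum>a\<in>arcs Q. lin V2 Q p y a * \<eta> a))"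
    using r unfolding retract_def X_def[symmetric] by (elim conjE; simp only:)+
  note xcar = pow_car[OF x2] and zcar = qpartD(3)[OF zq]
  have relc: "relab V V2 Inl x \<in> car V2" by (rule chom_car[OF relab_chom[OF rel] xcar])
  let ?P = "lin V2 Q p"
  have finQ: "finite (arcs Q)" by (rule quiver_finite_arcs[OF Q_quiver])
  have quadX: "quad V2 X a b = quad V2 z a b" for a b
    unfolding X_def quad_add relab_quad_zero[OF rel xcar x0] by simp
  note nullX = null_reduced[OF V2 arcs2 zq quadX]
  have PInr: "?P (Inr k) a = 0" if k: "k \<in> N" and a: "a \<in> arcs Q" for k a
  proof -
    have "?P y a = (\<Sum>c\<in>arcs Q. ?P y c * (if c = a then 1 else 0))" for y
      using a finQ by (simp add: if_distrib cong: if_cong)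
    then have "null V2 X (\<lambda>y. ?P y a)" unfolding null by (intro exI[of _ "\<lambda>c. if c = a then 1 else 0"] ballI)
    then show ?thesis using k unfolding nullX by blast
  qed
  \<comment> \<open>\<open>Q\<close> has no parallel arrows, so the end vertices of \<open>b\<close>
    leave a single candidate for its linear image.\<close>
  define rr where "rr = (\<lambda>b. (tail V b, head V b))"
  define \<mu> where "\<mu> = (\<lambda>b. ?P (Inl b) (rr b))"
  have par: "a = rr b" if "b \<in> arcs V" "?P (Inl b) a \<noteq> 0" for a b
  proof -
    have b: "Inl b \<in> arcs V2" "head V2 (Inl b) = head V b" "tail V2 (Inl b) = tail V b"
      using rel that(1) unfolding relabelling_def by blast+
    show ?thesis
      unfolding rr_def by (rule parallel_arc) (use lin_parallel[OF V2 p b(1) that(2)] b in simp_all)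
  qed
  \<comment> \<open>The indicator of \<open>b\<close> lies in the radical and so in the column
    space. This yields \<open>\<mu> b \<noteq> 0\<close> and, for two arrows with the same image, a
    contradiction.\<close>
  have ex: "\<exists>\<eta>. \<forall>b'\<in>arcs V. (if b' = b then 1 else 0) = (\<Sum>a\<in>arcs Q. ?P (Inl b') a * \<eta> a)" for b
  proof -
    have "null V2 X (case_sum (\<lambda>b'. if b' = b then 1 else 0) (\<lambda>_. 0))" unfolding nullX by simp
    then obtain \<eta> where \<eta>: "\<And>y. y \<in> arcs V2 \<Longrightarrow>
        case_sum (\<lambda>b'. if b' = b then 1 else 0) (\<lambda>_. 0) y = (\<Sum>a\<in>arcs Q. ?P y a * \<eta> a)" unfolding null by blast
    have "(if b' = b then 1 else 0) = (\<Sum>a\<in>arcs Q. ?P (Inl b') a * \<eta> a)" if "b' \<in> arcs V" for b'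
      using \<eta>[of "Inl b'"] that arcs2 by simp
    then show ?thesis by blast
  qed
  have sumP: "(\<Sum>a\<in>arcs Q. ?P (Inl b) a * \<eta> a) = (if rr b \<in> arcs Q then \<mu> b * \<eta> (rr b) else 0)" if b: "b \<in> arcs V" for b \<eta>
  proof -
    have "(\<Sum>a\<in>arcs Q. ?P (Inl b) a * \<eta> a) = (\<Sum>a\<in>arcs Q. if a = rr b then \<mu> b * \<eta> (rr b) else 0)"
      by (intro sum.cong refl) (use par[OF b] in \<open>auto simp: \<mu>_def\<close>)
    then show ?thesis using finQ by simp
  qed
  have rrQ: "rr b \<in> arcs Q" and \<mu>0: "\<mu> b \<noteq> 0" if b: "b \<in> arcs V" for b
  proof -
    obtain \<eta> where "1 = (\<Sum>a\<in>arcs Q. ?P (Inl b) a * \<eta> a)" using ex[of b] b by fastforce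
    then show "rr b \<in> arcs Q" "\<mu> b \<noteq> 0" unfolding sumP[OF b] by (auto split: if_splits)
  qed
  have inj: "inj_on rr (arcs V)"
  proof (rule inj_onI, rule ccontr)
    fix b b' assume b: "b \<in> arcs V" "b' \<in> arcs V" "rr b = rr b'" "b \<noteq> b'"
    obtain \<eta> where \<eta>: "\<forall>c\<in>arcs V. (if c = b then 1 else 0) = (\<Sum>a\<in>arcs Q. ?P (Inl c) a * \<eta> a)" using ex[of b] by blast
    have "1 = \<mu> b * \<eta> (rr b)" "0 = \<mu> b' * \<eta> (rr b')"
      using \<eta>[rule_format, OF b(1)] \<eta>[rule_format, OF b(2)] sumP[OF b(1)] sumP[OF b(2)] rrQ[OF b(1)] rrQ[OF b(2)] b(4) by auto
    then show False using \<mu>0[OF b(2)] b(3) by auto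
  qed
  define q where "q = inv_into (arcs V) rr"
  have q_rr: "q (rr b) = b" if "b \<in> arcs V" for b unfolding q_def by (rule inv_into_f_f[OF inj that])
  have SP: "(\<Sum>y\<in>arcs V2. lin Q V2 s a y * ?P y a) = 1" if a: "a \<in> arcs Q" for a
    using lin_id_on[OF Q_quiver V2 s p a ps, of a] by simp
  have PY: "\<exists>b\<in>arcs V. y = Inl b \<and> a = rr b" if "y \<in> arcs V2" "a \<in> arcs Q" "?P y a \<noteq> 0" for y a
  proof (cases y)
    case (Inl b)
    then have b: "b \<in> arcs V" using that(1) arcs2 by auto
    have "a = rr b" by (rule par[OF b]) (use that(3) Inl in simp)
    then show ?thesis using Inl b by blast
  next
    case (Inr k)
    then have "k \<in> N" using that(1) arcs2 by auto
    from PInr[OF this that(2)] show ?thesis using that(3) Inr by simp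
  qed
  have q: "q a \<in> arcs V" "rr (q a) = a" if a: "a \<in> arcs Q" for a
  proof -
    have "\<not> (\<forall>y\<in>arcs V2. lin Q V2 s a y * ?P y a = 0)"
    proof
      assume "\<forall>y\<in>arcs V2. lin Q V2 s a y * ?P y a = 0"
      from sum.neutral[OF this] show False using SP[OF a] by simp
    qed
    then obtain y where y: "y \<in> arcs V2" "?P y a \<noteq> 0" by auto
    obtain b where b: "b \<in> arcs V" "a = rr b" using PY[OF y(1) a y(2)] by blast
    show "q a \<in> arcs V" "rr (q a) = a" unfolding b(2) q_rr[OF b(1)] using b(1) by simp_all
  qed
  have wh: "head Q (rr b) = head V b" "tail Q (rr b) = tail V b" for b by (simp_all add: rr_def Q_simps)
  \<comment> \<open>Conjugated to \<open>Q\<close>, the Euler derivation has leading coefficient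
    \<open>\<omega> (Inl (q a))\<close> on each arrow \<open>a\<close>, since only
    \<open>Inl (q a)\<close> contributes to the sum \<open>SP\<close>. In degree one it thus acts on
    \<open>wpot\<close> as a diagonal derivation.\<close>
  have key: "csum Q (p (euler \<omega> X)) w = sum_list (map (\<lambda>a. \<omega> (Inl (q a))) w) * csum Q wpot w"
    if w: "closed_word Q w" "deg up w \<le> 1" for \<omega> w
  proof -
    define \<delta> where "\<delta> = (\<lambda>u. p (euler \<omega> (s u)))"
    have \<delta>: "cder Q \<delta>" unfolding \<delta>_def by (rule cder_retract[OF p s ps V2 cder_euler])
    have "agrees up 1 (\<delta> wpot) (euler (\<lambda>a. \<omega> (Inl (q a))) wpot)"
    proof (rule cder_agrees[OF Q_quiver \<delta> cder_euler _ _ wpot_homogeneous])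
      fix a assume a: "a \<in> arcs Q"
      have sp: "euler \<omega> (s (arr Q a)) \<in> arrow_ideal_pow V2 (Suc 0)"
        by (rule clin_pow[OF cder_clin[OF cder_euler] chom_arr_pow[OF Q_quiver s a]])
      have "\<delta> (arr Q a) (head Q a, [a]) = (\<Sum>y\<in>arcs V2. euler \<omega> (s (arr Q a)) (head V2 y, [y]) * p (arr V2 y) (head Q a, [a]))"
        unfolding \<delta>_def by (rule clin_lin_expand[OF V2 chom_clin[OF p] sp])
      also have "\<dots> = (\<Sum>y\<in>arcs V2. \<omega> (Inl (q a)) * (lin Q V2 s a y * ?P y a))"
      proof (intro sum.cong refl)
        fix y assume y: "y \<in> arcs V2"
        show "euler \<omega> (s (arr Q a)) (head V2 y, [y]) * p (arr V2 y) (head Q a, [a]) = \<omega> (Inl (q a)) * (lin Q V2 s a y * ?P y a)"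
        proof (cases "?P y a = 0")
          case False
          then obtain b where b: "b \<in> arcs V" "y = Inl b" "a = rr b" using PY[OF y a] by blast
          have "q a = b" unfolding b(3) by (rule q_rr[OF b(1)])
          then show ?thesis by (simp add: lin_def euler_apply b(2))
        qed (simp add: lin_def)
      qed
      also have "\<dots> = \<omega> (Inl (q a))" unfolding sum_distrib_left[symmetric] SP[OF a] by simp
      finally have c: "\<delta> (arr Q a) (head Q a, [a]) = \<omega> (Inl (q a))" .
      have "\<delta> (arr Q a) \<in> between Q (head Q a) (tail Q a)"
        by (rule cder_between[OF Q_quiver \<delta> quiver_head[OF Q_quiver a] quiver_tail[OF Q_quiver a] arr_between[OF Q_quiver a]])
      from leading_term[OF a this] show "agrees up (up a) (\<delta> (arr Q a)) (euler (\<lambda>a. \<omega> (Inl (q a))) (arr Q a))"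
        by (simp add: c euler_path_elem)
    next
      fix i v assume v: "is_qpath Q i v"
      show "euler (\<lambda>a. \<omega> (Inl (q a))) (path_elem (i, v)) \<in> homogeneous Q up (deg up v)"
        unfolding euler_path_elem by (intro homogeneous_scl homogeneous_path_elem[OF v] refl)
    qed
    from agrees_csum[OF this w(2), of Q]
    have "csum Q (\<delta> wpot) w = sum_list (map (\<lambda>a. \<omega> (Inl (q a))) w) * csum Q wpot w"
      unfolding csum_euler .
    moreover have "csum Q (p (euler \<omega> X)) w = csum Q (\<delta> wpot) w"
      using der[OF cder_euler] w(1) unfolding \<delta>_def cyceq_iff[OF Q_quiver] by blast
    ultimately show ?thesis by simp
  qed
  have pXw: "csum Q (p X) w = csum Q wpot w" if "closed_word Q w" for w
    using pX that unfolding cyceq_iff[OF Q_quiver] by blast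
  \<comment> \<open>Every term of \<open>z\<close> has two auxiliary letters, so the weight 1/2 on
    each reproduces \<open>z\<close>.\<close>
  have eulX: "euler (case_sum c (\<lambda>_. 1 / 2)) X = euler (case_sum c (\<lambda>_. 0)) (relab V V2 Inl x) + z" for c :: "_ \<Rightarrow> complex"
  proof (rule ext, clarify)
    fix i w
    have "sum_list (map (case_sum c (\<lambda>_. 1 / 2)) w) * relab V V2 Inl x (i, w) =
        sum_list (map (case_sum c (\<lambda>_. 0)) w) * relab V V2 Inl x (i, w)"
    proof (cases "relab V V2 Inl x (i, w) = 0")
      case False
      obtain v where "w = map Inl v" by (rule relab_support[OF rel xcar False])
      then show ?thesis by (simp add: comp_def)
    qed simp
    moreover have "sum_list (map (case_sum c (\<lambda>_. 1 / 2)) w) * z (i, w) = z (i, w)"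
      using qpartD(4)[OF zq, of i w] by (cases "z (i, w) = 0") auto
    ultimately show "euler (case_sum c (\<lambda>_. 1 / 2)) X (i, w) = (euler (case_sum c (\<lambda>_. 0)) (relab V V2 Inl x) + z) (i, w)"
      unfolding X_def euler_apply plus_fun_apply distrib_left by (rule arg_cong2[where f = "(+)"])
  qed
  have "euler (case_sum (\<lambda>b. of_int (d b)) (\<lambda>_. 0)) (relab V V2 Inl x) = relab V V2 Inl x"
  proof (rule ext, clarify)
    fix i w
    show "euler (case_sum (\<lambda>b. of_int (d b)) (\<lambda>_. 0)) (relab V V2 Inl x) (i, w) = relab V V2 Inl x (i, w)"
    proof (cases "relab V V2 Inl x (i, w) = 0")
      case False
      obtain v where v: "w = map Inl v" "x (i, v) \<noteq> 0" by (rule relab_support[OF rel xcar False])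
      have "deg d v = 1" using xh v(2) unfolding homogeneous_iff by blast
      then show ?thesis unfolding euler_apply v(1) map_map comp_def sum.case sum_list_of_int by simp
    qed (simp add: euler_apply)
  qed
  then have eul1: "euler (case_sum (\<lambda>b. of_int (d b)) (\<lambda>_. 1 / 2)) X = X" unfolding eulX by (simp add: X_def)
  have zer: "sum_list (map (\<lambda>a. 0) w) = (0 :: complex)" for w :: "'q list" by (induction w) auto
  have "euler (case_sum (\<lambda>_. 0) (\<lambda>_. 0)) (relab V V2 Inl x) = 0"
  proof (rule ext, clarify)
    fix i w
    have "case_sum (\<lambda>_. 0) (\<lambda>_. 0) = (\<lambda>_ :: real \<times> real + nat. 0 :: complex)" by (rule ext) (simp split: sum.split)
    then show "euler (case_sum (\<lambda>_. 0) (\<lambda>_. 0)) (relab V V2 Inl x) (i, w) = 0 (i, w)"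
      by (simp add: euler_apply zer pointwise)
  qed
  then have eul2: "euler (case_sum (\<lambda>_. 0) (\<lambda>_. 1 / 2)) X = z" unfolding eulX by simp
  \<comment> \<open>With the weights \<open>d\<close> the potential \<open>X\<close> is its own
    Euler derivative, so \<open>key\<close> equates the cyclic sum on a row with its multiple by the
    degree of the row; that sum is nonzero.\<close>
  have degq: "deg (\<lambda>a. d (q a)) (row_word \<rho>) = 1" if \<rho>: "\<rho> \<in> black_rows G \<union> white_rows G" for \<rho>
  proof -
    obtain k where lev: "row_level k \<rho>" using \<rho> black_row_level white_row_level by blast
    note cl = row_word_closed[OF lev]
    have "csum Q wpot (row_word \<rho>) = sum_list (map (\<lambda>a. of_int (d (q a))) (row_word \<rho>)) * csum Q wpot (row_word \<rho>)"
      using key[OF cl, of "case_sum (\<lambda>b. of_int (d b)) (\<lambda>_. 1 / 2)"] row_up[OF lev] pXw[OF cl] by (simp add: eul1)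
    then have 1: "sum_list (map (\<lambda>a. of_int (d (q a))) (row_word \<rho>)) = (1 :: complex)" using csum_wpot_row[OF \<rho>] by simp
    show ?thesis using 1 unfolding sum_list_of_int of_int_eq_1_iff .
  qed
  define g where "g = (\<lambda>a. d (q a) - up a)"
  have g_row: "deg g (row_word \<rho>) = 0" if \<rho>: "\<rho> \<in> black_rows G \<union> white_rows G" for \<rho>
  proof -
    obtain k where lev: "row_level k \<rho>" using \<rho> black_row_level white_row_level by blast
    have "deg g v = deg (\<lambda>a. d (q a)) v - deg up v" for v by (induction v) (auto simp: g_def)
    then show ?thesis using degq[OF \<rho>] row_up[OF lev] by simp
  qed
  obtain h where h: "\<And>x y. (x, y) \<in> arcs Q \<Longrightarrow> g (x, y) = h y - h x" using coboundary[OF g_row] by blast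
  \<comment> \<open>Gauging by \<open>- h\<close> turns the given degrees into \<open>up\<close>
    transported along \<open>rr\<close>.\<close>
  define d' where "d' = (\<lambda>a. d a + (- h (head V a)) - (- h (tail V a)))"
  have d': "d' b = up (rr b)" if b: "b \<in> arcs V" for b
    using h[of "tail V b" "head V b"] rrQ[OF b] q_rr[OF b] by (simp add: d'_def g_def rr_def)
  have xh': "x \<in> homogeneous V d' 1"
    unfolding homogeneous_iff
  proof (intro conjI allI impI xcar)
    fix i w assume nz: "x (i, w) \<noteq> 0"
    have "deg d' w = deg d w + deg (\<lambda>a. (\<lambda>i. - h i) (head V a) - (\<lambda>i. - h i) (tail V a)) w"
      by (induction w) (auto simp: d'_def)
    also have "\<dots> = 1" using deg_coboundary[of V i w "\<lambda>i. - h i"] xc[OF nz] xh nz by (simp add: homogeneous_iff)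
    finally show "deg d' w = 1" .
  qed
  \<comment> \<open>The linear part of the retraction on the arrows of \<open>V\<close>, made into a
    homomorphism by itself.\<close>
  define R where "R = subst V Q (\<lambda>b. scl (\<mu> b) (arr Q (rr b)))"
  define R' where "R' = subst Q V (\<lambda>a. scl (1 / \<mu> (q a)) (arr V (q a)))"
  have verts: "verts Q = verts V" using chom_verts[OF p] rel by (simp add: relabelling_def)
  have sub: "substitution V Q (\<lambda>b. scl (\<mu> b) (arr Q (rr b)))"
    unfolding substitution_def
    using V Q_quiver verts pow_scl[OF arr_pow[OF Q_quiver rrQ]] between_scl[OF arr_between[OF Q_quiver rrQ]] by (simp add: wh)
  have ht: "head V (q a) = head Q a" "tail V (q a) = tail Q a" if "a \<in> arcs Q" for a
    using wh[of "q a"] q(2)[OF that] by simp_all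
  have sub': "substitution Q V (\<lambda>a. scl (1 / \<mu> (q a)) (arr V (q a)))"
    unfolding substitution_def
  proof (intro conjI ballI)
    fix a assume a: "a \<in> arcs Q"
    show "scl (1 / \<mu> (q a)) (arr V (q a)) \<in> arrow_ideal_pow V 1"
      using pow_scl[OF arr_pow[OF V q(1)[OF a]]] by simp
    show "scl (1 / \<mu> (q a)) (arr V (q a)) \<in> between V (head Q a) (tail Q a)"
      using between_scl[OF arr_between[OF V q(1)[OF a]]] ht[OF a] by simp
  qed (use V Q_quiver verts in simp_all)
  have R: "chom V Q R" and R': "chom Q V R'" unfolding R_def R'_def by (rule chom_subst[OF sub], rule chom_subst[OF sub'])
  have R_arr: "R (arr V b) = scl (\<mu> b) (arr Q (rr b))" if "b \<in> arcs V" for b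
    unfolding R_def by (rule subst_arr[OF sub that])
  have R'_arr: "R' (arr Q a) = scl (1 / \<mu> (q a)) (arr V (q a))" if "a \<in> arcs Q" for a
    unfolding R'_def by (rule subst_arr[OF sub' that])
  have iso: "qiso V Q R R'"
  proof (rule qisoI_arrs[OF V Q_quiver R R'])
    fix b assume b: "b \<in> arcs V"
    show "R' (R (arr V b)) = arr V b"
      unfolding R_arr[OF b] clin_scl[OF chom_clin[OF R'] arr_car[OF Q_quiver rrQ[OF b]]] R'_arr[OF rrQ[OF b]] q_rr[OF b] scl_scl
      using \<mu>0[OF b] by simp
  next
    fix a assume a: "a \<in> arcs Q"
    show "R (R' (arr Q a)) = arr Q a"
      unfolding R'_arr[OF a] clin_scl[OF chom_clin[OF R] arr_car[OF V q(1)[OF a]]] R_arr[OF q(1)[OF a]] q(2)[OF a] scl_scl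
      using \<mu>0[OF q(1)[OF a]] by simp
  qed
  have Rh: "R (arr V b) \<in> homogeneous Q up (d' b)" if b: "b \<in> arcs V" for b
    unfolding R_arr[OF b] d'[OF b] by (intro homogeneous_scl homogeneous_path_elem[OF arr_path[OF Q_quiver rrQ[OF b]]]) simp
  let ?\<alpha> = "\<lambda>u. p (relab V V2 Inl u)"
  have \<alpha>: "chom V Q ?\<alpha>" by (rule chom_comp[OF relab_chom[OF rel] p])
  \<comment> \<open>\<open>R\<close> sends each arrow to the leading part of its image under
    \<open>p\<close>, and \<open>x\<close> has degree one for \<open>d'\<close>.\<close>
  have agr: "agrees up 1 (?\<alpha> x) (R x)"
  proof (rule chom_agrees[OF V Q_quiver \<alpha> R _ Rh xh'])
    fix b assume b: "b \<in> arcs V"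
    have "?\<alpha> (arr V b) \<in> between Q (head Q (rr b)) (tail Q (rr b))"
      unfolding wh by (rule chom_arr_between[OF V \<alpha> b])
    from leading_term[OF rrQ[OF b] this] show "agrees up (d' b) (?\<alpha> (arr V b)) (R (arr V b))"
      unfolding R_arr[OF b] d'[OF b] relab_arr[OF rel b] \<mu>_def lin_def .
  qed
  have Rx: "R x \<in> homogeneous Q up 1" by (rule chom_graded[OF V Q_quiver R Rh xh'])
  have Rx2: "R x \<in> arrow_ideal_pow Q 2" by (rule clin_pow[OF chom_clin[OF R] x2])
  have eq: "cyceq Q (R x) wpot"
    unfolding cyceq_iff[OF Q_quiver]
  proof (intro conjI allI impI)
    show "R x \<in> car Q" "wpot \<in> car Q" by (rule pow_car[OF Rx2], rule pow_car[OF wpot_pow])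
    have nil: "y (i, []) = 0" if "y \<in> arrow_ideal_pow Q 2" for y i using that by (force simp: pow_iff)
    show "R x (i, []) = wpot (i, [])" for i using nil[OF Rx2, of i] nil[OF wpot_pow, of i] by simp
    fix w assume w: "closed_word Q w"
    show "csum Q (R x) w = csum Q wpot w"
    proof (cases "deg up w = 1")
      case True
      \<comment> \<open>The weights 0 on \<open>V\<close> and 1/2 on auxiliary arrows single out
        \<open>z\<close>; \<open>key\<close> involves only the weights at \<open>Inl (q a)\<close>,
        so it returns zero.\<close>
      have "csum Q (p z) w = 0"
        using key[OF w, of "case_sum (\<lambda>_. 0) (\<lambda>_. 1 / 2)"] True zer by (simp add: eul2)
      moreover have "p X = ?\<alpha> x + p z" unfolding X_def by (rule clin_add[OF chom_clin[OF p] relc zcar])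
      ultimately have "csum Q (?\<alpha> x) w = csum Q wpot w" using pXw[OF w] by (simp add: csum_add)
      then show ?thesis using agrees_csum[OF agr, of w Q] True by simp
    next
      case False
      then show ?thesis using homogeneous_csum[OF Rx, of w] homogeneous_csum[OF wpot_homogeneous, of w] by metis
    qed
  qed
  have "dilation_step ((V, cyc_class V x), d) (gauge (\<lambda>i. - h i) ((V, cyc_class V x), d))"
    by (rule dilation_step.vertex_gauge[OF is_graded_qpI[OF V x2 xh]])
  then have "dilation_step ((V, cyc_class V x), d) ((V, cyc_class V x), d')" by (simp add: gauge_def d'_def)
  moreover have "dilation_step ((V, cyc_class V x), d') ((Q, cyc_class Q wpot), up)"
    by (rule dilation_step.graded_right_equiv[OF is_graded_qpI[OF V x2 xh'] is_graded_qpI[OF Q_quiver wpot_pow wpot_homogeneous]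
        graded_right_equivalenceI[OF iso xcar eq Rh]])
  ultimately show ?thesis by (meson equivclp_trans r_into_equivclp)
qed

lemma dilation_unique:
  assumes Y: "is_graded_qp Y" and cls: "stable_class (fst Y) = stable_class (Q, cyc_class Q wpot)"
  shows "equivclp dilation_step Y ((Q, cyc_class Q wpot), up)"
proof -
  obtain V0 d x0 where Y0: "Y = ((V0, cyc_class V0 x0), d)" "is_quiver V0" "x0 \<in> arrow_ideal_pow V0 2" "x0 \<in> homogeneous V0 d 1"
    by (rule is_graded_qpE[OF Y])
  obtain V x' where V: "is_quiver V" and x': "x' \<in> arrow_ideal_pow V 2" "x' \<in> homogeneous V d 1" "\<And>a b. quad V x' a b = 0"
    and dil: "equivclp dilation_step Y ((V, cyc_class V x'), d)"
    using graded_reduction[OF Y0(2-4)] unfolding Y0(1) by blast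
  \<comment> \<open>Averaging removes open words, whose degrees a vertex gauge could change; the
    degree of a closed word is gauge invariant.\<close>
  define x where "x = cavg V x'"
  have x: "x \<in> arrow_ideal_pow V 2" "x \<in> homogeneous V d 1"
    unfolding x_def by (rule clin_pow[OF clin_cavg x'(1)], rule homogeneous_cavg[OF x'(2)])
  have "x' (i, []) = 0" for i using x'(1) by (force simp: pow_iff)
  then have eq: "cyceq V x x'" unfolding x_def by (rule cyceq_cavg[OF V pow_car[OF x'(1)]])
  then have cc: "cyc_class V x' = cyc_class V x" using cyc_class_eq_iff[OF V pow_car[OF x(1)] pow_car[OF x'(1)]] by simp
  have "fst Y \<in> stable_class (fst Y)" using is_graded_qp_fst[OF Y] by (simp add: stable_class_def)
  then have "equivclp stable_step (Q, cyc_class Q wpot) (fst Y)" unfolding cls by (simp add: stable_class_def)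
  moreover have "equivclp stable_step (fst Y) (V, cyc_class V x)"
    using dilation_equiv_stable[OF dil] by (simp add: cc)
  ultimately have "equivclp stable_step (Q, cyc_class Q wpot) (V, cyc_class V x)" by (rule equivclp_trans)
  moreover have "qp_retracts Q wpot (Q, cyc_class Q wpot)"
    using stably_retracts_refl[OF Q_quiver wpot_pow no_two_cycle] Q_quiver unfolding qp_retracts_def by blast
  ultimately have "qp_retracts Q wpot (V, cyc_class V x)" by (rule qp_retracts_equiv[OF Q_quiver])
  then have st: "stably_retracts Q wpot V x" by (rule qp_retractsD[OF Q_quiver _ V x(1)])
  have "equivclp dilation_step ((V, cyc_class V x), d) ((Q, cyc_class Q wpot), up)"
  proof (rule stably_retracts_dilation[OF V x _ _ st])
    show "quad V x a b = 0" for a b using quad_cyceq[OF V eq] x'(3) by simp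
    show "is_qpath V i w \<and> path_source V i w = i" if "x (i, w) \<noteq> 0" for i w
      using that by (auto simp: x_def cavg_def closed_word_def split: if_splits)
  qed
  then show ?thesis using equivclp_trans[OF dil] by (simp add: cc)
qed

end

theorem theorem4p1:
  fixes G :: plabic_fence
  assumes "is_plabic_fence G"
  shows "card (Dil (fence_quiver G, fence_potential G)) = 1"
proof -
  interpret fence G using assms by unfold_locales
  let ?X = "(Q, cyc_class Q wpot)" and ?r = "{(Y, Z). equivclp dilation_step Y Z}"
  let ?A = "{Y. is_graded_qp Y \<and> stable_class (fst Y) = stable_class ?X}"
  have "?r `` {Y} = ?r `` {(?X, up)}" if "Y \<in> ?A" for Y
  proof -
    have "equivclp dilation_step Y (?X, up)" using dilation_unique that by blast
    then show ?thesis using equivclp_trans equivclp_sym by fast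
  qed
  moreover have "(?X, up) \<in> ?A" using is_graded_qpI[OF Q_quiver wpot_pow wpot_homogeneous] by simp
  ultimately have "?A // ?r = {?r `` {(?X, up)}}" unfolding quotient_def by blast
  then show ?thesis by (simp add: Dil_def fence_potential_eq)
qed

end
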